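(* There is a canonical equivalence between the following categories: (1) the abelian category of admissible $\mathcal{H}$-modules; (2) the abelian category of graded admissible $\mathcal{C}$-modules; (3) the abelian category of graded admissible $\mathcal{E}$-modules; (4) the abelian category of $\mathbb{Q}$-vector spaces.
   Context: $\mathcal{H}$ (infinite-dimensional Heisenberg algebra): the $\mathbb{Q}$-algebra generated by $H_i$, $i\in\mathbb{Z}\setminus\{0\}$, with relations $[H_i,H_j]=i\,\delta_{i,-j}$. $\mathcal{C}$ (infinite-dimensional Clifford algebra): the $\mathbb{Q}$-algebra generated by $P_i,Q_i$, $i\in\mathbb{Z}_{>0}$, with relations $\{P_i,P_j\}=0$, $\{Q_i,Q_j\}=0$, $\{P_i,Q_j\}=\delta_{ij}$, where $\{a,b\}=ab+ba$. $\mathcal{E}$: the $\mathbb{Q}$-algebra generated by $K_1,K_{-1},E,F$ with relations $K_{-1}K_1=FE=1$, $K_{-1}E=FK_1=0$, $K_1K_{-1}+EF=1$. Graded modules: graded $\mathcal{E}$-modules are graded so that $E,F,K_{1},K_{-1}$ have degrees $1,-1,0,0$; graded $\mathcal{C}$-modules are graded so that $P_i$ has degree $1$ and $Q_i$ has degree $-1$. Morphisms preserve the grading. A $\mathbb{Z}_{\ge0}$-graded $\mathcal{E}$-module $W=\bigoplus_{i\ge0}W_i$ is admissible if $K_{-1}$ acts on $W_0$ as the identity and on $W_i$ locally nilpotently for $i>0$. A graded $\mathcal{C}$-module $W=\bigoplus_{i\ge0}W_i$ is admissible if (1) for every $x\in W$, $Q_mx=0$ for $m\gg0$, and (2) $W_0=\bigcap_{i>0}\ker(Q_i)$.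 For a sequence $\lambda=(n_1,n_2,\dots)$ of non-negative integers with $n_m=0$ for $m\gg0$ put $|\lambda|=\sum_i i\,n_i$ and $H_{-\lambda}=\prod_i H_{-i}^{n_i}$. An $\mathcal{H}$-module $W$ is admissible if for every $x\in W$ there is an integer $N>0$ with $H_{-\lambda}x=0$ for all $\lambda$ with $|\lambda|>N$. *)

theory Defs
  imports Complex_Main "HOL-Algebra.Module" "HOL-Algebra.QuotRing" "HOL-Library.FuncSet"
    "HOL-Library.Poly_Mapping"
begin

section \<open>Categories\<close>

text \<open>
  Hom-sets are indexed by source and target and need not be disjoint; accordingly composition is
  indexed by the three objects involved: for \<open>f \<in> Hom C X Y\<close> and \<open>g \<in> Hom C Y Z\<close> the composite
  ``g after f'' is \<open>Comp C X Y Z g f\<close>.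
\<close>

record ('o, 'm) category =
  Obj :: "'o set"
  Hom :: "'o \<Rightarrow> 'o \<Rightarrow> 'm set"
  Id :: "'o \<Rightarrow> 'm"
  Comp :: "'o \<Rightarrow> 'o \<Rightarrow> 'o \<Rightarrow> 'm \<Rightarrow> 'm \<Rightarrow> 'm"

definition is_category :: "('o, 'm) category \<Rightarrow> bool" where
  "is_category C \<longleftrightarrow>
     (\<forall>X\<in>Obj C. Id C X \<in> Hom C X X) \<and>
     (\<forall>X\<in>Obj C. \<forall>Y\<in>Obj C. \<forall>Z\<in>Obj C. \<forall>f\<in>Hom C X Y. \<forall>g\<in>Hom C Y Z.
        Comp C X Y Z g f \<in> Hom C X Z) \<and>
     (\<forall>X\<in>Obj C. \<forall>Y\<in>Obj C. \<forall>f\<in>Hom C X Y.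
        Comp C X X Y f (Id C X) = f \<and> Comp C X Y Y (Id C Y) f = f) \<and>
     (\<forall>X\<in>Obj C. \<forall>Y\<in>Obj C. \<forall>Z\<in>Obj C. \<forall>T\<in>Obj C.
        \<forall>f\<in>Hom C X Y. \<forall>g\<in>Hom C Y Z. \<forall>h\<in>Hom C Z T.
        Comp C X Z T h (Comp C X Y Z g f) = Comp C X Y T (Comp C Y Z T h g) f)"

definition op_category :: "('o, 'm) category \<Rightarrow> ('o, 'm) category" where
  "op_category C = \<lparr>Obj = Obj C, Hom = (\<lambda>X Y. Hom C Y X), Id = Id C,
     Comp = (\<lambda>X Y Z g f. Comp C Z Y X f g)\<rparr>"

definition is_iso :: "('o, 'm) category \<Rightarrow> 'o \<Rightarrow> 'o \<Rightarrow> 'm \<Rightarrow> bool" where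
  "is_iso C X Y f \<longleftrightarrow> f \<in> Hom C X Y \<and>
     (\<exists>g\<in>Hom C Y X. Comp C X Y X g f = Id C X \<and> Comp C Y X Y f g = Id C Y)"

subsection \<open>Abelian categories\<close>

text \<open>
  Freyd's axioms: a zero object, binary products and coproducts, kernels and cokernels; every
  monomorphism is a kernel and every epimorphism is a cokernel. The additive structure on the
  hom-sets is then uniquely determined by the category, and every equivalence respects it.
  Dual notions are obtained by passing to the opposite category.
\<close>

definition zero_object :: "('o, 'm) category \<Rightarrow> 'o \<Rightarrow> bool" where
  "zero_object C Z \<longleftrightarrow> Z \<in> Obj C \<and>
     (\<forall>X\<in>Obj C. (\<exists>!f. f \<in> Hom C X Z) \<and> (\<exists>!f. f \<in> Hom C Z X))"

definition zero_morphism :: "('o, 'm) category \<Rightarrow> 'o \<Rightarrow> 'o \<Rightarrow> 'm \<Rightarrow> bool" where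
  "zero_morphism C X Y f \<longleftrightarrow>
     (\<exists>Z. zero_object C Z \<and> (\<exists>g\<in>Hom C X Z. \<exists>h\<in>Hom C Z Y. f = Comp C X Z Y h g))"

definition is_product :: "('o, 'm) category \<Rightarrow> 'o \<Rightarrow> 'o \<Rightarrow> 'o \<Rightarrow> 'm \<Rightarrow> 'm \<Rightarrow> bool" where
  "is_product C X Y P p q \<longleftrightarrow> P \<in> Obj C \<and> p \<in> Hom C P X \<and> q \<in> Hom C P Y \<and>
     (\<forall>T\<in>Obj C. \<forall>f\<in>Hom C T X. \<forall>g\<in>Hom C T Y.
        \<exists>!u. u \<in> Hom C T P \<and> Comp C T P X p u = f \<and> Comp C T P Y q u = g)"

definition is_kernel :: "('o, 'm) category \<Rightarrow> 'o \<Rightarrow> 'o \<Rightarrow> 'm \<Rightarrow> 'o \<Rightarrow> 'm \<Rightarrow> bool" where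
  "is_kernel C X Y f K k \<longleftrightarrow> K \<in> Obj C \<and> k \<in> Hom C K X \<and>
     zero_morphism C K Y (Comp C K X Y f k) \<and>
     (\<forall>T\<in>Obj C. \<forall>t\<in>Hom C T X. zero_morphism C T Y (Comp C T X Y f t) \<longrightarrow>
        (\<exists>!u. u \<in> Hom C T K \<and> Comp C T K X k u = t))"

definition is_mono :: "('o, 'm) category \<Rightarrow> 'o \<Rightarrow> 'o \<Rightarrow> 'm \<Rightarrow> bool" where
  "is_mono C X Y f \<longleftrightarrow> f \<in> Hom C X Y \<and>
     (\<forall>T\<in>Obj C. \<forall>u\<in>Hom C T X. \<forall>v\<in>Hom C T X. Comp C T X Y f u = Comp C T X Y f v \<longrightarrow> u = v)"

definition left_abelian :: "('o, 'm) category \<Rightarrow> bool" where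
  "left_abelian C \<longleftrightarrow>
     (\<exists>Z. zero_object C Z) \<and>
     (\<forall>X\<in>Obj C. \<forall>Y\<in>Obj C. \<exists>P p q. is_product C X Y P p q) \<and>
     (\<forall>X\<in>Obj C. \<forall>Y\<in>Obj C. \<forall>f\<in>Hom C X Y. \<exists>K k. is_kernel C X Y f K k) \<and>
     (\<forall>K\<in>Obj C. \<forall>X\<in>Obj C. \<forall>k. is_mono C K X k \<longrightarrow>
        (\<exists>Y\<in>Obj C. \<exists>f\<in>Hom C X Y. is_kernel C X Y f K k))"

definition abelian_category :: "('o, 'm) category \<Rightarrow> bool" where
  "abelian_category C \<longleftrightarrow> is_category C \<and> left_abelian C \<and> left_abelian (op_category C)"

subsection \<open>Functors and equivalences\<close>

text \<open>\<open>FMor F X Y\<close> is the action of the functor on \<open>Hom C X Y\<close>.\<close>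

record ('o, 'm, 'p, 'n) functr =
  FObj :: "'o \<Rightarrow> 'p"
  FMor :: "'o \<Rightarrow> 'o \<Rightarrow> 'm \<Rightarrow> 'n"

definition is_functor ::
  "('o, 'm) category \<Rightarrow> ('p, 'n) category \<Rightarrow> ('o, 'm, 'p, 'n) functr \<Rightarrow> bool" where
  "is_functor C D F \<longleftrightarrow>
     (\<forall>X\<in>Obj C. FObj F X \<in> Obj D) \<and>
     (\<forall>X\<in>Obj C. \<forall>Y\<in>Obj C. \<forall>f\<in>Hom C X Y. FMor F X Y f \<in> Hom D (FObj F X) (FObj F Y)) \<and>
     (\<forall>X\<in>Obj C. FMor F X X (Id C X) = Id D (FObj F X)) \<and>
     (\<forall>X\<in>Obj C. \<forall>Y\<in>Obj C. \<forall>Z\<in>Obj C. \<forall>f\<in>Hom C X Y. \<forall>g\<in>Hom C Y Z.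
        FMor F X Z (Comp C X Y Z g f) =
        Comp D (FObj F X) (FObj F Y) (FObj F Z) (FMor F Y Z g) (FMor F X Y f))"

definition id_functor :: "('o, 'm, 'o, 'm) functr" where
  "id_functor = \<lparr>FObj = (\<lambda>X. X), FMor = (\<lambda>X Y f. f)\<rparr>"

definition comp_functor ::
  "('p, 'n, 'q, 'l) functr \<Rightarrow> ('o, 'm, 'p, 'n) functr \<Rightarrow> ('o, 'm, 'q, 'l) functr" where
  "comp_functor G F = \<lparr>FObj = (\<lambda>X. FObj G (FObj F X)),
     FMor = (\<lambda>X Y f. FMor G (FObj F X) (FObj F Y) (FMor F X Y f))\<rparr>"

definition natural_iso ::
  "('o, 'm) category \<Rightarrow> ('p, 'n) category \<Rightarrow>
   ('o, 'm, 'p, 'n) functr \<Rightarrow> ('o, 'm, 'p, 'n) functr \<Rightarrow> ('o \<Rightarrow> 'n) \<Rightarrow> bool" where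
  "natural_iso C D F G \<eta> \<longleftrightarrow>
     (\<forall>X\<in>Obj C. is_iso D (FObj F X) (FObj G X) (\<eta> X)) \<and>
     (\<forall>X\<in>Obj C. \<forall>Y\<in>Obj C. \<forall>f\<in>Hom C X Y.
        Comp D (FObj F X) (FObj F Y) (FObj G Y) (\<eta> Y) (FMor F X Y f) =
        Comp D (FObj F X) (FObj G X) (FObj G Y) (FMor G X Y f) (\<eta> X))"

definition is_equivalence ::
  "('o, 'm) category \<Rightarrow> ('p, 'n) category \<Rightarrow> ('o, 'm, 'p, 'n) functr \<Rightarrow> bool" where
  "is_equivalence C D F \<longleftrightarrow> is_functor C D F \<and>
     (\<exists>G. is_functor D C G \<and>
        (\<exists>\<eta>. natural_iso C C (comp_functor G F) id_functor \<eta>) \<and>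
        (\<exists>\<epsilon>. natural_iso D D (comp_functor F G) id_functor \<epsilon>))"

text \<open>
  Two categories with functors \<open>F\<close>, \<open>F'\<close> to a third one, and an equivalence between them that
  is compatible with these functors. If \<open>F\<close> and \<open>F'\<close> are themselves equivalences, then such a
  \<open>\<Phi>\<close> is unique up to natural isomorphism.
\<close>

definition equivalent_over ::
  "('q, 'l) category \<Rightarrow> ('o, 'm) category \<Rightarrow> ('o, 'm, 'q, 'l) functr \<Rightarrow>
   ('p, 'n) category \<Rightarrow> ('p, 'n, 'q, 'l) functr \<Rightarrow> bool" where
  "equivalent_over B C F C' F' \<longleftrightarrow>
     (\<exists>\<Phi>. is_equivalence C C' \<Phi> \<and> (\<exists>\<eta>. natural_iso C B (comp_functor F' \<Phi>) F \<eta>))"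


section \<open>Algebras given by generators and relations\<close>

text \<open>
  The free monoid is wrapped in a datatype, so that the convolution product of
  \<^theory>\<open>HOL-Library.Poly_Mapping\<close> makes \<open>'g word \<Rightarrow>\<^sub>0 rat\<close> the free associative unital
  algebra over the rationals on \<open>'g\<close>.
\<close>

datatype 'g word = Word "'g list"

fun letters :: "'g word \<Rightarrow> 'g list" where
  "letters (Word u) = u"

instantiation word :: (type) monoid_add
begin

definition zero_word :: "'a word" where
  "0 = Word []"

definition plus_word :: "'a word \<Rightarrow> 'a word \<Rightarrow> 'a word" where
  "u + v = Word (letters u @ letters v)"

instance
proof
  fix a b c :: "'a word"
  show "a + b + c = a + (b + c)" by (simp add: plus_word_def)
  show "0 + a = a" by (cases a) (simp add: plus_word_def zero_word_def)
  show "a + 0 = a" by (cases a) (simp add: plus_word_def zero_word_def)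
qed

end

type_synonym 'g ncpoly = "'g word \<Rightarrow>\<^sub>0 rat"

definition gen :: "'g \<Rightarrow> 'g ncpoly" where
  "gen s = Poly_Mapping.single (Word [s]) 1"

definition scalar :: "rat \<Rightarrow> 'g ncpoly" where
  "scalar q = Poly_Mapping.single 0 q"

definition free_algebra :: "'g set \<Rightarrow> 'g ncpoly ring" where
  "free_algebra S = \<lparr>carrier = {p. \<forall>w\<in>Poly_Mapping.keys p. set (letters w) \<subseteq> S},
     mult = (*), one = 1, zero = 0, add = (+)\<rparr>"

text \<open>A presentation consists of a set of generators and a set of relators.\<close>

type_synonym 'g presentation = "'g set \<times> 'g ncpoly set"

definition relation_ideal :: "'g presentation \<Rightarrow> 'g ncpoly set" where
  "relation_ideal P = Idl\<^bsub>free_algebra (fst P)\<^esub> (snd P)"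

definition presented_algebra :: "'g presentation \<Rightarrow> 'g ncpoly set ring" where
  "presented_algebra P = free_algebra (fst P) Quot relation_ideal P"

definition residue_class :: "'g presentation \<Rightarrow> 'g ncpoly \<Rightarrow> 'g ncpoly set" where
  "residue_class P p = relation_ideal P +>\<^bsub>free_algebra (fst P)\<^esub> p"

lemma letters_plus [simp]: "letters (u + v) = letters u @ letters v"
  by (simp add: plus_word_def)

lemma letters_zero [simp]: "letters 0 = []"
  by (simp add: zero_word_def)

lemma free_algebra_ring: "ring (free_algebra S)"
proof (rule ringI)
  show "abelian_group (free_algebra S)"
  proof (rule abelian_groupI)
    fix p q assume "p \<in> carrier (free_algebra S)" "q \<in> carrier (free_algebra S)"
    then show "p \<oplus>\<^bsub>free_algebra S\<^esub> q \<in> carrier (free_algebra S)"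
      using Poly_Mapping.keys_add[of p q] by (auto simp: free_algebra_def)
  next
    fix p assume "p \<in> carrier (free_algebra S)"
    then show "\<exists>y\<in>carrier (free_algebra S). y \<oplus>\<^bsub>free_algebra S\<^esub> p = \<zero>\<^bsub>free_algebra S\<^esub>"
      by (intro bexI[of _ "- p"]) (auto simp: free_algebra_def Poly_Mapping.keys.rep_eq)
  qed (auto simp: free_algebra_def add_ac)
  show "Group.monoid (free_algebra S)"
  proof (rule monoidI)
    fix p q assume "p \<in> carrier (free_algebra S)" "q \<in> carrier (free_algebra S)"
    then show "p \<otimes>\<^bsub>free_algebra S\<^esub> q \<in> carrier (free_algebra S)"
      using Poly_Mapping.keys_mult[of p q]
      by (auto simp: free_algebra_def subset_iff) (metis Un_iff letters_plus set_append)
  qed (auto simp: free_algebra_def mult.assoc)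
qed (auto simp: free_algebra_def algebra_simps)

lemma gen_in_free_algebra: "s \<in> S \<Longrightarrow> gen s \<in> carrier (free_algebra S)"
  by (auto simp: gen_def free_algebra_def)

lemma scalar_in_free_algebra: "scalar q \<in> carrier (free_algebra S)"
  by (auto simp: scalar_def free_algebra_def)

lemma one_in_free_algebra: "1 \<in> carrier (free_algebra S)"
  using ring.ring_simprules(6)[OF free_algebra_ring, of S] by (simp add: free_algebra_def)

lemma free_algebra_closed:
  assumes "p \<in> carrier (free_algebra S)" "q \<in> carrier (free_algebra S)"
  shows "p + q \<in> carrier (free_algebra S)" "p - q \<in> carrier (free_algebra S)"
    "p * q \<in> carrier (free_algebra S)"
proof -
  interpret ring "free_algebra S" by (rule free_algebra_ring)
  have "- q \<in> carrier (free_algebra S)"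
    using assms(2) by (auto simp: free_algebra_def Poly_Mapping.keys.rep_eq)
  then show "p - q \<in> carrier (free_algebra S)"
    using add.m_closed[OF assms(1), of "- q"] by (simp add: free_algebra_def)
  show "p + q \<in> carrier (free_algebra S)" "p * q \<in> carrier (free_algebra S)"
    using add.m_closed[OF assms] m_closed[OF assms] by (simp_all add: free_algebra_def)
qed

lemma presented_algebra_ring:
  assumes "snd P \<subseteq> carrier (free_algebra (fst P))"
  shows "ring (presented_algebra P)"
  unfolding presented_algebra_def relation_ideal_def
  by (intro ideal.quotient_is_ring ring.genideal_ideal free_algebra_ring assms)


section \<open>Modules\<close>

text \<open>
  The library's locale \<^locale>\<open>module\<close> requires a commutative base ring; the following is the same
  notion over an arbitrary ring. As in the library, the fields \<open>mult\<close> and \<open>one\<close> of a module record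
  are junk and play no role.
\<close>

locale left_module = R?: ring R + M?: abelian_group M
  for R :: "('r, 's) ring_scheme" (structure) and M :: "('r, 'a, 't) module_scheme" (structure) +
  assumes smult_closed:
      "\<lbrakk>a \<in> carrier R; x \<in> carrier M\<rbrakk> \<Longrightarrow> a \<odot>\<^bsub>M\<^esub> x \<in> carrier M"
    and smult_l_distr:
      "\<lbrakk>a \<in> carrier R; b \<in> carrier R; x \<in> carrier M\<rbrakk> \<Longrightarrow>
       (a \<oplus>\<^bsub>R\<^esub> b) \<odot>\<^bsub>M\<^esub> x = a \<odot>\<^bsub>M\<^esub> x \<oplus>\<^bsub>M\<^esub> b \<odot>\<^bsub>M\<^esub> x"
    and smult_r_distr:
      "\<lbrakk>a \<in> carrier R; x \<in> carrier M; y \<in> carrier M\<rbrakk> \<Longrightarrow>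
       a \<odot>\<^bsub>M\<^esub> (x \<oplus>\<^bsub>M\<^esub> y) = a \<odot>\<^bsub>M\<^esub> x \<oplus>\<^bsub>M\<^esub> a \<odot>\<^bsub>M\<^esub> y"
    and smult_assoc1:
      "\<lbrakk>a \<in> carrier R; b \<in> carrier R; x \<in> carrier M\<rbrakk> \<Longrightarrow>
       (a \<otimes>\<^bsub>R\<^esub> b) \<odot>\<^bsub>M\<^esub> x = a \<odot>\<^bsub>M\<^esub> (b \<odot>\<^bsub>M\<^esub> x)"
    and smult_one: "x \<in> carrier M \<Longrightarrow> \<one>\<^bsub>R\<^esub> \<odot>\<^bsub>M\<^esub> x = x"

lemma left_module_iff_module:
  assumes "cring R"
  shows "left_module R M \<longleftrightarrow> module R M"
proof
  assume "left_module R M"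
  then interpret left_module R M .
  show "module R M"
    by (intro moduleI assms M.abelian_group_axioms smult_closed smult_l_distr smult_r_distr
        smult_assoc1 smult_one)
next
  assume "module R M"
  then interpret module R M .
  show "left_module R M"
    by (intro left_module.intro left_module_axioms.intro R.ring_axioms M.abelian_group_axioms
        smult_closed smult_l_distr smult_r_distr smult_assoc1 smult_one)
qed

definition rat_ring :: "rat ring" where
  "rat_ring = \<lparr>carrier = UNIV, mult = (*), one = 1, zero = 0, add = (+)\<rparr>"

text \<open>
  Linear maps are taken to be extensional, so that equality of morphisms is equality on the carrier.
\<close>

definition linear_maps ::
  "('r, 's) ring_scheme \<Rightarrow> ('r, 'a) module \<Rightarrow> ('r, 'a) module \<Rightarrow> ('a \<Rightarrow> 'a) set" where
  "linear_maps R M N = {f \<in> carrier M \<rightarrow>\<^sub>E carrier N.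
     (\<forall>x\<in>carrier M. \<forall>y\<in>carrier M. f (x \<oplus>\<^bsub>M\<^esub> y) = f x \<oplus>\<^bsub>N\<^esub> f y) \<and>
     (\<forall>a\<in>carrier R. \<forall>x\<in>carrier M. f (a \<odot>\<^bsub>M\<^esub> x) = a \<odot>\<^bsub>N\<^esub> f x)}"

definition module_category ::
  "('r, 's) ring_scheme \<Rightarrow> (('r, 'a) module \<Rightarrow> bool) \<Rightarrow> (('r, 'a) module, 'a \<Rightarrow> 'a) category" where
  "module_category R adm = \<lparr>Obj = {M. left_module R M \<and> adm M},
     Hom = linear_maps R,
     Id = (\<lambda>M. \<lambda>x\<in>carrier M. x),
     Comp = (\<lambda>M N L g f. compose (carrier M) g f)\<rparr>"

text \<open>
  For an algebra with presentation \<open>P\<close>: the action of a generator on a module, and, for a subset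
  \<open>V\<close> of a module that is a rational subspace, \<open>V\<close> as a vector space over the rationals.
\<close>

definition act :: "'g presentation \<Rightarrow> ('g ncpoly set, 'a) module \<Rightarrow> 'g \<Rightarrow> 'a \<Rightarrow> 'a" where
  "act P M s x = residue_class P (gen s) \<odot>\<^bsub>M\<^esub> x"

definition rational_subspace ::
  "'g presentation \<Rightarrow> ('g ncpoly set, 'a) module \<Rightarrow> 'a set \<Rightarrow> (rat, 'a) module" where
  "rational_subspace P M V = \<lparr>carrier = V, mult = mult M, one = one M, zero = zero M, add = add M,
     smult = (\<lambda>q x. residue_class P (scalar q) \<odot>\<^bsub>M\<^esub> x)\<rparr>"

subsection \<open>Graded modules\<close>

text \<open>
  Gradings are indexed by all integers, with zero components in negative degrees; thus an operator
  of degree \<open>-1\<close> annihilates the component of degree \<open>0\<close>.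
\<close>

definition graded_module ::
  "'g presentation \<Rightarrow> ('g \<Rightarrow> int) \<Rightarrow> ('g ncpoly set, 'a) module \<Rightarrow> (int \<Rightarrow> 'a set) \<Rightarrow> bool" where
  "graded_module P deg M W \<longleftrightarrow>
     left_module (presented_algebra P) M \<and>
     (\<forall>i. submodule (W i) rat_ring (rational_subspace P M (carrier M))) \<and>
     (\<forall>x\<in>carrier M. \<exists>!c. (\<forall>i. c i \<in> W i) \<and> finite {i. c i \<noteq> \<zero>\<^bsub>M\<^esub>} \<and>
        x = finsum M c {i. c i \<noteq> \<zero>\<^bsub>M\<^esub>}) \<and>
     (\<forall>i<0. W i = {\<zero>\<^bsub>M\<^esub>}) \<and>
     (\<forall>s\<in>fst P. \<forall>i. \<forall>x\<in>W i. act P M s x \<in> W (i + deg s))"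

definition graded_module_category ::
  "'g presentation \<Rightarrow> ('g \<Rightarrow> int) \<Rightarrow> (('g ncpoly set, 'a) module \<Rightarrow> (int \<Rightarrow> 'a set) \<Rightarrow> bool) \<Rightarrow>
   (('g ncpoly set, 'a) module \<times> (int \<Rightarrow> 'a set), 'a \<Rightarrow> 'a) category" where
  "graded_module_category P deg adm = \<lparr>Obj = {(M, W). graded_module P deg M W \<and> adm M W},
     Hom = (\<lambda>(M, W) (M', W'). {f \<in> linear_maps (presented_algebra P) M M'. \<forall>i. f ` W i \<subseteq> W' i}),
     Id = (\<lambda>(M, W). \<lambda>x\<in>carrier M. x),
     Comp = (\<lambda>(M, W) N L g f. compose (carrier M) g f)\<rparr>"

text \<open>The functor taking a graded module to its component of degree \<open>0\<close>.\<close>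

definition degree_zero ::
  "'g presentation \<Rightarrow>
   (('g ncpoly set, 'a) module \<times> (int \<Rightarrow> 'a set), 'a \<Rightarrow> 'a, (rat, 'a) module, 'a \<Rightarrow> 'a) functr" where
  "degree_zero P = \<lparr>FObj = (\<lambda>(M, W). rational_subspace P M (W 0)),
     FMor = (\<lambda>(M, W) N f. restrict f (W 0))\<rparr>"


section \<open>The three algebras and their admissible modules\<close>

subsection \<open>The Heisenberg algebra\<close>

datatype heis_gen = Hgen int

definition heisenberg :: "heis_gen presentation" where
  "heisenberg = ({Hgen i | i. i \<noteq> 0},
     {gen (Hgen i) * gen (Hgen j) - gen (Hgen j) * gen (Hgen i)
        - scalar (if i = - j then of_int i else 0)
      | i j. i \<noteq> 0 \<and> j \<noteq> 0})"

lemma heisenberg_ring: "ring (presented_algebra heisenberg)"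
  by (rule presented_algebra_ring)
    (unfold heisenberg_def fst_conv snd_conv, safe,
      (intro free_algebra_closed gen_in_free_algebra scalar_in_free_algebra; simp)+)

text \<open>
  A sequence \<open>(n\<^sub>1, n\<^sub>2, \<dots>)\<close> is a function on \<open>nat\<close> whose value at \<open>0\<close> is \<open>0\<close>. The product of the
  \<open>H\<^bsub>-i\<^esub>\<close>, which commute, is taken in increasing order of \<open>i\<close>.
\<close>

definition finite_sequences :: "(nat \<Rightarrow> nat) set" where
  "finite_sequences = {n. n 0 = 0 \<and> finite {i. n i \<noteq> 0}}"

definition weight :: "(nat \<Rightarrow> nat) \<Rightarrow> nat" where
  "weight n = (\<Sum>i\<in>{i. n i \<noteq> 0}. i * n i)"

definition H_minus :: "(nat \<Rightarrow> nat) \<Rightarrow> heis_gen ncpoly set" where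
  "H_minus n = foldr
     (\<lambda>i a. residue_class heisenberg (gen (Hgen (- int i))) [^]\<^bsub>presented_algebra heisenberg\<^esub> n i
        \<otimes>\<^bsub>presented_algebra heisenberg\<^esub> a)
     (sorted_list_of_set {i. n i \<noteq> 0}) \<one>\<^bsub>presented_algebra heisenberg\<^esub>"

definition admissible_heisenberg :: "(heis_gen ncpoly set, 'a) module \<Rightarrow> bool" where
  "admissible_heisenberg M \<longleftrightarrow>
     (\<forall>x\<in>carrier M. \<exists>N>0. \<forall>n\<in>finite_sequences. weight n > N \<longrightarrow> H_minus n \<odot>\<^bsub>M\<^esub> x = \<zero>\<^bsub>M\<^esub>)"

definition heisenberg_modules ::
  "'a itself \<Rightarrow> ((heis_gen ncpoly set, 'a) module, 'a \<Rightarrow> 'a) category" where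
  "heisenberg_modules T = module_category (presented_algebra heisenberg) admissible_heisenberg"

text \<open>
  The vacuum space: on admissible modules the \<open>H\<^sub>i\<close> of negative index are the locally nilpotent
  (annihilation) operators.
\<close>

definition vacuum_space :: "(heis_gen ncpoly set, 'a) module \<Rightarrow> 'a set" where
  "vacuum_space M = {x \<in> carrier M. \<forall>i>0. act heisenberg M (Hgen (- i)) x = \<zero>\<^bsub>M\<^esub>}"

definition vacuum ::
  "((heis_gen ncpoly set, 'a) module, 'a \<Rightarrow> 'a, (rat, 'a) module, 'a \<Rightarrow> 'a) functr" where
  "vacuum = \<lparr>FObj = (\<lambda>M. rational_subspace heisenberg M (vacuum_space M)),
     FMor = (\<lambda>M N f. restrict f (vacuum_space M))\<rparr>"

subsection \<open>The Clifford algebra\<close>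

datatype cliff_gen = Pgen nat | Qgen nat

definition clifford :: "cliff_gen presentation" where
  "clifford = ({Pgen i | i. i > 0} \<union> {Qgen i | i. i > 0},
     {gen (Pgen i) * gen (Pgen j) + gen (Pgen j) * gen (Pgen i) | i j. i > 0 \<and> j > 0} \<union>
     {gen (Qgen i) * gen (Qgen j) + gen (Qgen j) * gen (Qgen i) | i j. i > 0 \<and> j > 0} \<union>
     {gen (Pgen i) * gen (Qgen j) + gen (Qgen j) * gen (Pgen i) - scalar (if i = j then 1 else 0)
      | i j. i > 0 \<and> j > 0})"

lemma clifford_ring: "ring (presented_algebra clifford)"
  by (rule presented_algebra_ring)
    (unfold clifford_def fst_conv snd_conv, safe,
      (intro free_algebra_closed gen_in_free_algebra scalar_in_free_algebra; simp)+)

fun clifford_degree :: "cliff_gen \<Rightarrow> int" where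
  "clifford_degree (Pgen i) = 1"
| "clifford_degree (Qgen i) = -1"

definition admissible_clifford ::
  "(cliff_gen ncpoly set, 'a) module \<Rightarrow> (int \<Rightarrow> 'a set) \<Rightarrow> bool" where
  "admissible_clifford M W \<longleftrightarrow>
     (\<forall>x\<in>carrier M. \<exists>m0. \<forall>m>m0. act clifford M (Qgen m) x = \<zero>\<^bsub>M\<^esub>) \<and>
     W 0 = {x \<in> carrier M. \<forall>i>0. act clifford M (Qgen i) x = \<zero>\<^bsub>M\<^esub>}"

definition clifford_modules ::
  "'a itself \<Rightarrow> ((cliff_gen ncpoly set, 'a) module \<times> (int \<Rightarrow> 'a set), 'a \<Rightarrow> 'a) category" where
  "clifford_modules T = graded_module_category clifford clifford_degree admissible_clifford"

subsection \<open>The algebra generated by \<open>K\<^sub>1\<close>, \<open>K\<^bsub>-1\<^esub>\<close>, \<open>E\<close>, \<open>F\<close>\<close>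

datatype e_gen = Kpos | Kneg | Egen | Fgen

definition e_algebra :: "e_gen presentation" where
  "e_algebra = (UNIV,
     {gen Kneg * gen Kpos - 1, gen Fgen * gen Egen - 1, gen Kneg * gen Egen, gen Fgen * gen Kpos,
      gen Kpos * gen Kneg + gen Egen * gen Fgen - 1})"

lemma e_algebra_ring: "ring (presented_algebra e_algebra)"
  by (rule presented_algebra_ring)
    (unfold e_algebra_def fst_conv snd_conv, safe,
      (intro free_algebra_closed gen_in_free_algebra one_in_free_algebra UNIV_I)+)

fun e_degree :: "e_gen \<Rightarrow> int" where
  "e_degree Egen = 1"
| "e_degree Fgen = -1"
| "e_degree Kpos = 0"
| "e_degree Kneg = 0"

definition admissible_e :: "(e_gen ncpoly set, 'a) module \<Rightarrow> (int \<Rightarrow> 'a set) \<Rightarrow> bool" where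
  "admissible_e M W \<longleftrightarrow>
     (\<forall>x\<in>W 0. act e_algebra M Kneg x = x) \<and>
     (\<forall>i>0. \<forall>x\<in>W i. \<exists>n. (act e_algebra M Kneg ^^ n) x = \<zero>\<^bsub>M\<^esub>)"

definition e_modules ::
  "'a itself \<Rightarrow> ((e_gen ncpoly set, 'a) module \<times> (int \<Rightarrow> 'a set), 'a \<Rightarrow> 'a) category" where
  "e_modules T = graded_module_category e_algebra e_degree admissible_e"

subsection \<open>Vector spaces\<close>

definition vector_spaces :: "'a itself \<Rightarrow> ((rat, 'a) module, 'a \<Rightarrow> 'a) category" where
  "vector_spaces T = module_category rat_ring (\<lambda>V. True)"

end

theory Submission
  imports "HOL-Library.Countable" "HOL-Library.Multiset" Defs
begin

text \<open>
  An admissible module is determined by its vacuum vectors. In each of the three algebras choose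
  annihilation operators \<open>a\<^sub>0, a\<^sub>1, \<dots>\<close>: the \<open>H\<^bsub>-n-1\<^esub>\<close>, the \<open>Q\<^bsub>n+1\<^esub>\<close>, and the products
  \<open>F K\<^bsub>-1\<^esub>\<^bsup>n\<^esup>\<close>. Admissibility implies that only finitely many words in the \<open>a\<^sub>n\<close> fail to kill a given
  vector. With a projection \<open>\<pi>\<close> to the space of vacuum vectors, which are the vectors killed by all
  \<open>a\<^sub>n\<close>, a vector \<open>x\<close> therefore has finitely many non-zero coordinates \<open>\<pi> (a\<^sub>l x)\<close>, one for each word
  \<open>l\<close>. The coordinates determine \<open>x\<close>, since a longest word that does not kill \<open>x\<close> takes it to
  a non-zero vacuum vector (\<open>coord_eq_zero\<close>).

  The functions that occur as coordinates are those invariant under exchange of neighbouring letters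
  for the Heisenberg algebra, those that change sign under such an exchange for the Clifford algebra,
  and all functions for the third algebra. In the first two cases the creation operators \<open>c\<^sub>n\<close> provide
  a preimage: the number operator \<open>\<Sum> c\<^sub>n a\<^sub>n\<close> multiplies functions supported on words of length \<open>N\<close>
  by \<open>N\<close>, which is invertible (\<open>coord_surj_homogeneous\<close>). In the third case a single word is reached
  from the vacuum by a product of the generators \<open>K\<^sub>1\<close> and \<open>E\<close>. So a module is the Fock space over its
  vacuum space, and in coordinates the generators act by formulas that are natural in the vacuum
  space. Hence a linear map of vacuum spaces extends uniquely to a morphism (\<open>fock_full\<close>,
  \<open>fock_faithful\<close>), and the Fock space over an arbitrary vector space is an admissible module with
  that vacuum space (\<open>realization_exists\<close>, \<open>vacuum_iso\<close>): taking vacuum vectors is fully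
  faithful and essentially surjective.

  For graded modules \<open>\<pi>\<close> is the projection to the component of degree \<open>0\<close>. A Heisenberg module comes
  without a grading; there \<open>\<pi>\<close> is locally a product of factors \<open>1 - D / k\<close>, where \<open>D\<close> is the
  number operator (\<open>ladder_proj\<close>).

  The rest is formal. Functors lift along fully faithful and essentially surjective functors
  (\<open>lift_functor\<close>); this gives quasi-inverses as well as the equivalences between the three module
  categories. The axioms of an abelian category are transferred from vector spaces
  (\<open>abelian_transfer\<close>, \<open>abelian_vector_spaces\<close>). As all modules and spaces have their elements in
  one type, direct sums and Fock spaces are embedded into that type, which is possible because a
  non-zero rational vector space is infinite.
\<close>

section \<open>Categories and equivalences\<close>

locale cat =
  fixes C :: "('o, 'm) category"
  assumes cat: "is_category C"
begin

lemma Id_in [simp]: "X \<in> Obj C \<Longrightarrow> Id C X \<in> Hom C X X"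
  using cat by (simp add: is_category_def)

lemma Comp_in [simp]:
  "\<lbrakk>X \<in> Obj C; Y \<in> Obj C; Z \<in> Obj C; f \<in> Hom C X Y; g \<in> Hom C Y Z\<rbrakk>
   \<Longrightarrow> Comp C X Y Z g f \<in> Hom C X Z"
  using cat by (simp add: is_category_def)

lemma Comp_Id [simp]:
  assumes "X \<in> Obj C" "Y \<in> Obj C" "f \<in> Hom C X Y"
  shows "Comp C X X Y f (Id C X) = f" "Comp C X Y Y (Id C Y) f = f"
  using cat assms by (simp_all add: is_category_def)

lemma Comp_assoc:
  "\<lbrakk>X \<in> Obj C; Y \<in> Obj C; Z \<in> Obj C; T \<in> Obj C; f \<in> Hom C X Y; g \<in> Hom C Y Z; h \<in> Hom C Z T\<rbrakk>
   \<Longrightarrow> Comp C X Y T (Comp C Y Z T h g) f = Comp C X Z T h (Comp C X Y Z g f)"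
  using cat by (simp add: is_category_def)

lemma Comp_cancel:
  assumes "Comp C Y Z Y g' g = Id C Y" "X \<in> Obj C" "Y \<in> Obj C" "Z \<in> Obj C"
    "f \<in> Hom C X Y" "g \<in> Hom C Y Z" "g' \<in> Hom C Z Y"
  shows "Comp C X Z Y g' (Comp C X Y Z g f) = f"
  using assms by (simp flip: Comp_assoc)

lemma iso_inverse:
  assumes "is_iso C X Y f"
  obtains g where "f \<in> Hom C X Y" "g \<in> Hom C Y X"
    "Comp C X Y X g f = Id C X" "Comp C Y X Y f g = Id C Y"
  using assms by (auto simp: is_iso_def)

lemma is_isoI:
  "\<lbrakk>f \<in> Hom C X Y; g \<in> Hom C Y X; Comp C X Y X g f = Id C X; Comp C Y X Y f g = Id C Y\<rbrakk>
   \<Longrightarrow> is_iso C X Y f"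
  by (auto simp: is_iso_def)

lemma iso_sym:
  assumes "is_iso C X Y f"
  shows "\<exists>g. is_iso C Y X g"
  using assms by (metis is_isoI iso_inverse)

lemma iso_comp:
  assumes "is_iso C X Y f" "is_iso C Y Z g" "X \<in> Obj C" "Y \<in> Obj C" "Z \<in> Obj C"
  shows "is_iso C X Z (Comp C X Y Z g f)"
proof -
  obtain f' where f': "f \<in> Hom C X Y" "f' \<in> Hom C Y X" 
    "Comp C X Y X f' f = Id C X" "Comp C Y X Y f f' = Id C Y"
    using assms(1) by (rule iso_inverse)
  obtain g' where g': "g \<in> Hom C Y Z" "g' \<in> Hom C Z Y" 
    "Comp C Y Z Y g' g = Id C Y" "Comp C Z Y Z g g' = Id C Z"
    using assms(2) by (rule iso_inverse)
  show ?thesis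
    by (rule is_isoI[where g = "Comp C Z Y X f' g'"])
      (use f' g' assms in \<open>simp_all add: Comp_assoc Comp_cancel\<close>)
qed

lemma op_cat: "is_category (op_category C)"
  unfolding is_category_def op_category_def by (simp add: Comp_assoc)

end

definition fully_faithful ::
  "('o, 'm) category \<Rightarrow> ('p, 'n) category \<Rightarrow> ('o, 'm, 'p, 'n) functr \<Rightarrow> bool" where
  "fully_faithful C D F \<longleftrightarrow>
     (\<forall>X\<in>Obj C. \<forall>Y\<in>Obj C. bij_betw (FMor F X Y) (Hom C X Y) (Hom D (FObj F X) (FObj F Y)))"

definition essentially_surjective ::
  "('o, 'm) category \<Rightarrow> ('p, 'n) category \<Rightarrow> ('o, 'm, 'p, 'n) functr \<Rightarrow> bool" where
  "essentially_surjective C D F \<longleftrightarrow> (\<forall>B\<in>Obj D. \<exists>X\<in>Obj C. \<exists>i. is_iso D (FObj F X) B i)"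

locale func = C: cat C + D: cat D
  for C :: "('o, 'm) category" and D :: "('p, 'n) category" +
  fixes F :: "('o, 'm, 'p, 'n) functr"
  assumes func: "is_functor C D F"
begin

lemma FObj_in [simp]: "X \<in> Obj C \<Longrightarrow> FObj F X \<in> Obj D"
  using func by (simp add: is_functor_def)

lemma FMor_in [simp]:
  "\<lbrakk>X \<in> Obj C; Y \<in> Obj C; f \<in> Hom C X Y\<rbrakk> \<Longrightarrow> FMor F X Y f \<in> Hom D (FObj F X) (FObj F Y)"
  using func by (simp add: is_functor_def)

lemma FMor_Id [simp]: "X \<in> Obj C \<Longrightarrow> FMor F X X (Id C X) = Id D (FObj F X)"
  using func by (simp add: is_functor_def)

lemma FMor_Comp:
  "\<lbrakk>X \<in> Obj C; Y \<in> Obj C; Z \<in> Obj C; f \<in> Hom C X Y; g \<in> Hom C Y Z\<rbrakk>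
   \<Longrightarrow> FMor F X Z (Comp C X Y Z g f) =
       Comp D (FObj F X) (FObj F Y) (FObj F Z) (FMor F Y Z g) (FMor F X Y f)"
  using func by (simp add: is_functor_def)

end

text \<open>
  This criterion is verified without choosing a quasi-inverse; the choice is made once, when functors
  are lifted.
\<close>

locale weak_equivalence = func +
  assumes ff: "fully_faithful C D F" and es: "essentially_surjective C D F"
begin

lemma inj:
  "\<lbrakk>FMor F X Y f = FMor F X Y g; X \<in> Obj C; Y \<in> Obj C; f \<in> Hom C X Y; g \<in> Hom C X Y\<rbrakk> \<Longrightarrow> f = g"
  using ff unfolding fully_faithful_def bij_betw_def inj_on_def by blast

lemma lift:
  assumes "X \<in> Obj C" "Y \<in> Obj C" "g \<in> Hom D (FObj F X) (FObj F Y)"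
  obtains f where "f \<in> Hom C X Y" "FMor F X Y f = g"
  using assms ff unfolding fully_faithful_def bij_betw_def by (metis imageE)

lemma iso_reflect:
  assumes "X \<in> Obj C" "Y \<in> Obj C" "is_iso D (FObj F X) (FObj F Y) (FMor F X Y f)" "f \<in> Hom C X Y"
  shows "is_iso C X Y f"
proof -
  obtain g' where g': "g' \<in> Hom D (FObj F Y) (FObj F X)"
    "Comp D (FObj F X) (FObj F Y) (FObj F X) g' (FMor F X Y f) = Id D (FObj F X)"
    "Comp D (FObj F Y) (FObj F X) (FObj F Y) (FMor F X Y f) g' = Id D (FObj F Y)"
    using assms by (metis D.iso_inverse)
  obtain g where g: "g \<in> Hom C Y X" "FMor F Y X g = g'"
    using lift assms g' by metis
  show ?thesis
  proof (rule C.is_isoI)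
    show "Comp C X Y X g f = Id C X" by (rule inj[of X X]) (use assms g g' in \<open>simp_all add: FMor_Comp\<close>)
    show "Comp C Y X Y f g = Id C Y" by (rule inj[of Y Y]) (use assms g g' in \<open>simp_all add: FMor_Comp\<close>)
  qed (use assms g in auto)
qed

lemma iso_lift:
  assumes "X \<in> Obj C" "Y \<in> Obj C" "is_iso D (FObj F X) (FObj F Y) i"
  obtains f where "is_iso C X Y f" "FMor F X Y f = i"
proof -
  have "i \<in> Hom D (FObj F X) (FObj F Y)" using assms by (simp add: is_iso_def)
  then show ?thesis using that assms iso_reflect by (metis lift)
qed

lemma ess_surj:
  assumes "B \<in> Obj D"
  obtains X i i' where "X \<in> Obj C" "i \<in> Hom D (FObj F X) B" "i' \<in> Hom D B (FObj F X)"
    "Comp D (FObj F X) B (FObj F X) i' i = Id D (FObj F X)" "Comp D B (FObj F X) B i i' = Id D B"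
  using es assms unfolding essentially_surjective_def by (metis D.iso_inverse)

end

text \<open>
  Lifting of functors along a weak equivalence: the source object over a given object is unique
  up to a unique compatible isomorphism, so arbitrary choices of preimages are automatically
  functorial. Both the inverse of a weak equivalence and the comparison between two
  weak equivalences with the same target are instances.
\<close>

lemma (in weak_equivalence) lift_functor:
  fixes B :: "('q, 'l) category"
  assumes "func B D H"
  obtains \<Phi> where "is_functor B C \<Phi>" "\<exists>\<eta>. natural_iso B D (comp_functor F \<Phi>) H \<eta>"
    "fully_faithful B D H \<Longrightarrow> fully_faithful B C \<Phi>"
    "essentially_surjective B D H \<Longrightarrow> essentially_surjective B C \<Phi>"
proof -
  interpret H: func B D H by fact
  have "\<forall>Z\<in>Obj B. \<exists>X i i'. X \<in> Obj C \<and> i \<in> Hom D (FObj F X) (FObj H Z)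
     \<and> i' \<in> Hom D (FObj H Z) (FObj F X)
     \<and> Comp D (FObj F X) (FObj H Z) (FObj F X) i' i = Id D (FObj F X)
     \<and> Comp D (FObj H Z) (FObj F X) (FObj H Z) i i' = Id D (FObj H Z)"
    by (metis H.FObj_in ess_surj)
  then obtain P i i' where
    P [simp]: "\<And>Z. Z \<in> Obj B \<Longrightarrow> P Z \<in> Obj C" and
    i [simp]: "\<And>Z. Z \<in> Obj B \<Longrightarrow> i Z \<in> Hom D (FObj F (P Z)) (FObj H Z)" and
    i' [simp]: "\<And>Z. Z \<in> Obj B \<Longrightarrow> i' Z \<in> Hom D (FObj H Z) (FObj F (P Z))" and
    i'i [simp]: "\<And>Z. Z \<in> Obj B \<Longrightarrow>
        Comp D (FObj F (P Z)) (FObj H Z) (FObj F (P Z)) (i' Z) (i Z) = Id D (FObj F (P Z))" and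
    ii' [simp]: "\<And>Z. Z \<in> Obj B \<Longrightarrow>
        Comp D (FObj H Z) (FObj F (P Z)) (FObj H Z) (i Z) (i' Z) = Id D (FObj H Z)"
    by metis
  \<comment> \<open>The conjugate of \<open>H f\<close>, which \<open>\<Phi> f\<close> must have as its image.\<close>
  define k where "k X Y f = Comp D (FObj F (P X)) (FObj H Y) (FObj F (P Y)) (i' Y)
       (Comp D (FObj F (P X)) (FObj H X) (FObj H Y) (FMor H X Y f) (i X))" for X Y f
  have k_in [simp]: "k X Y f \<in> Hom D (FObj F (P X)) (FObj F (P Y))"
    if "X \<in> Obj B" "Y \<in> Obj B" "f \<in> Hom B X Y" for X Y f
    using that by (simp add: k_def)
  define \<phi> where "\<phi> X Y f = (SOME f'. f' \<in> Hom C (P X) (P Y) \<and> FMor F (P X) (P Y) f' = k X Y f)"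
    for X Y f
  have \<phi>: "\<phi> X Y f \<in> Hom C (P X) (P Y) \<and> FMor F (P X) (P Y) (\<phi> X Y f) = k X Y f"
    if "X \<in> Obj B" "Y \<in> Obj B" "f \<in> Hom B X Y" for X Y f
    unfolding \<phi>_def by (rule someI_ex) (use that in \<open>metis P k_in lift\<close>)
  note [simp] = \<phi>[THEN conjunct1] \<phi>[THEN conjunct2]
  let ?\<Phi> = "\<lparr>FObj = P, FMor = \<phi>\<rparr>"
  have 1: "is_functor B C ?\<Phi>"
    unfolding is_functor_def functr.simps
  proof (intro conjI ballI)
    fix X assume X: "X \<in> Obj B"
    show "\<phi> X X (Id B X) = Id C (P X)"
      by (rule inj[of "P X" "P X"]) (use X in \<open>simp_all add: k_def\<close>)
  next
    fix X Y Z f g assume X: "X \<in> Obj B" "Y \<in> Obj B" "Z \<in> Obj B" "f \<in> Hom B X Y" "g \<in> Hom B Y Z"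
    show "\<phi> X Z (Comp B X Y Z g f) = Comp C (P X) (P Y) (P Z) (\<phi> Y Z g) (\<phi> X Y f)"
      by (rule inj[of "P X" "P Z"]) (use X in \<open>simp_all add: k_def FMor_Comp H.FMor_Comp D.Comp_assoc
        D.Comp_cancel[OF ii']\<close>)
  qed auto
  have nat: "Comp D (FObj F (P X)) (FObj F (P Y)) (FObj H Y) (i Y) (k X Y f) =
       Comp D (FObj F (P X)) (FObj H X) (FObj H Y) (FMor H X Y f) (i X)"
    if "X \<in> Obj B" "Y \<in> Obj B" "f \<in> Hom B X Y" for X Y f
    unfolding k_def using that by (simp add: D.Comp_cancel[OF ii'])
  have 2: "natural_iso B D (comp_functor F ?\<Phi>) H i"
    unfolding natural_iso_def comp_functor_def functr.simps
    by (auto simp: nat intro!: D.is_isoI i i' i'i ii')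
  have 3: "fully_faithful B C ?\<Phi>" if ffH: "fully_faithful B D H"
    unfolding fully_faithful_def functr.simps
  proof (intro ballI)
    fix X Y assume X: "X \<in> Obj B" "Y \<in> Obj B"
    have Hbij: "bij_betw (FMor H X Y) (Hom B X Y) (Hom D (FObj H X) (FObj H Y))"
      using ffH X by (simp add: fully_faithful_def)
    have kinv: "Comp D (FObj H X) (FObj F (P X)) (FObj H Y) 
        (Comp D (FObj F (P X)) (FObj F (P Y)) (FObj H Y) (i Y) (k X Y f)) (i' X) = FMor H X Y f"
      if "f \<in> Hom B X Y" for f
      using that X by (simp add: nat D.Comp_assoc)
    show "bij_betw (\<phi> X Y) (Hom B X Y) (Hom C (P X) (P Y))"
      unfolding bij_betw_def
    proof (intro conjI inj_onI subset_antisym image_subsetI subsetI)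
      fix f g assume fg: "f \<in> Hom B X Y" "g \<in> Hom B X Y" "\<phi> X Y f = \<phi> X Y g"
      then have "k X Y f = k X Y g" using \<phi> X by metis
      then have "FMor H X Y f = FMor H X Y g" using kinv fg by metis
      then show "f = g" using Hbij fg by (auto simp: bij_betw_def inj_on_def)
    next
      fix h assume h: "h \<in> Hom C (P X) (P Y)"
      let ?u = "Comp D (FObj H X) (FObj F (P X)) (FObj H Y) 
        (Comp D (FObj F (P X)) (FObj F (P Y)) (FObj H Y) (i Y) (FMor F (P X) (P Y) h)) (i' X)"
      have "?u \<in> Hom D (FObj H X) (FObj H Y)" using X h by simp
      then obtain f where f: "f \<in> Hom B X Y" "FMor H X Y f = ?u"
        using Hbij by (force simp: bij_betw_def)
      have "\<phi> X Y f = h"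
        by (rule inj[of "P X" "P Y"]) (use X h f in \<open>simp_all add: k_def D.Comp_assoc D.Comp_cancel[OF i'i]\<close>)
      then show "h \<in> \<phi> X Y ` Hom B X Y" using f by blast
    qed (use X in auto)
  qed
  have 4: "essentially_surjective B C ?\<Phi>" if esH: "essentially_surjective B D H"
    unfolding essentially_surjective_def functr.simps
  proof
    fix A assume A: "A \<in> Obj C"
    then obtain X j where X: "X \<in> Obj B" "is_iso D (FObj H X) (FObj F A) j"
      using esH FObj_in[OF A] unfolding essentially_surjective_def by blast
    have "is_iso D (FObj F (P X)) (FObj H X) (i X)"
      using X by (intro D.is_isoI[OF i i' i'i ii'])
    then have "is_iso D (FObj F (P X)) (FObj F A) (Comp D (FObj F (P X)) (FObj H X) (FObj F A) j (i X))"
      using X A by (intro D.iso_comp) auto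
    then show "\<exists>X\<in>Obj B. \<exists>i. is_iso C (P X) A i"
      using X A by (metis P iso_lift)
  qed
  show thesis using that[OF 1] 2 3 4 by blast
qed

lemma id_func: "is_category C \<Longrightarrow> func C C id_functor"
  by (simp add: func_def cat_def func_axioms_def is_functor_def id_functor_def)

text \<open>
  A quasi-inverse \<open>G\<close> is a lift of the identity functor. The isomorphism \<open>G F \<cong> 1\<close> is the preimage
  under \<open>F\<close> of the isomorphism \<open>F G \<cong> 1\<close> at the objects \<open>F X\<close>.
\<close>

lemma (in weak_equivalence) is_equivalence: "is_equivalence C D F"
proof -
  obtain G where G: "is_functor D C G" "\<exists>\<epsilon>. natural_iso D D (comp_functor F G) id_functor \<epsilon>"
    using lift_functor[OF id_func[OF D.cat]] by metis
  then obtain \<epsilon> where \<epsilon>: "natural_iso D D (comp_functor F G) id_functor \<epsilon>" by auto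
  interpret G: func D C G by unfold_locales (fact G)
  have \<epsilon>iso: "is_iso D (FObj F (FObj G B)) B (\<epsilon> B)" if "B \<in> Obj D" for B
    using \<epsilon> that by (simp add: natural_iso_def comp_functor_def id_functor_def)
  have \<epsilon>in [simp]: "\<epsilon> B \<in> Hom D (FObj F (FObj G B)) B" if "B \<in> Obj D" for B
    using \<epsilon>iso[OF that] by (simp add: is_iso_def)
  have \<epsilon>nat: "Comp D (FObj F (FObj G A)) (FObj F (FObj G B)) B (\<epsilon> B) (FMor F (FObj G A) (FObj G B) (FMor G A B f))
        = Comp D (FObj F (FObj G A)) A B f (\<epsilon> A)"
    if "A \<in> Obj D" "B \<in> Obj D" "f \<in> Hom D A B" for A B f
    using \<epsilon> that by (simp add: natural_iso_def comp_functor_def id_functor_def)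
  have "\<forall>X\<in>Obj C. \<exists>e. is_iso C (FObj G (FObj F X)) X e \<and> FMor F (FObj G (FObj F X)) X e = \<epsilon> (FObj F X)"
    using \<epsilon>iso by (metis FObj_in G.FObj_in iso_lift)
  then obtain \<eta> where \<eta>: "\<And>X. X \<in> Obj C \<Longrightarrow> is_iso C (FObj G (FObj F X)) X (\<eta> X)"
    "\<And>X. X \<in> Obj C \<Longrightarrow> FMor F (FObj G (FObj F X)) X (\<eta> X) = \<epsilon> (FObj F X)" by metis
  have \<eta>in [simp]: "\<eta> X \<in> Hom C (FObj G (FObj F X)) X" if "X \<in> Obj C" for X
    using \<eta>(1)[OF that] by (simp add: is_iso_def)
  have "natural_iso C C (comp_functor G F) id_functor \<eta>"
    unfolding natural_iso_def comp_functor_def functr.simps id_functor_def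
  proof (intro conjI ballI)
    fix X Y f assume X: "X \<in> Obj C" "Y \<in> Obj C" "f \<in> Hom C X Y"
    show "Comp C (FObj G (FObj F X)) (FObj G (FObj F Y)) Y (\<eta> Y)
             (FMor G (FObj F X) (FObj F Y) (FMor F X Y f)) =
            Comp C (FObj G (FObj F X)) X Y f (\<eta> X)"
      by (rule inj[of "FObj G (FObj F X)" Y]) (use X in \<open>simp_all add: FMor_Comp \<eta> \<epsilon>nat\<close>)
  qed (use \<eta> in auto)
  then show ?thesis unfolding is_equivalence_def using func G by blast
qed

text \<open>
  The comparison is the lift of \<open>F\<close> along \<open>F'\<close>; it inherits from \<open>F\<close> the two properties that make it
  an equivalence.
\<close>

lemma equivalent_overI:
  assumes "weak_equivalence C B F" "weak_equivalence C' B F'"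
  shows "equivalent_over B C F C' F'"
proof -
  interpret F: weak_equivalence C B F by fact
  interpret F': weak_equivalence C' B F' by fact
  obtain \<Phi> where \<Phi>: "is_functor C C' \<Phi>" "\<exists>\<eta>. natural_iso C B (comp_functor F' \<Phi>) F \<eta>"
    "fully_faithful C C' \<Phi>" "essentially_surjective C C' \<Phi>"
    using F'.lift_functor[OF F.func_axioms] F.ff F.es by metis
  then have "weak_equivalence C C' \<Phi>"
    by unfold_locales
  then show ?thesis unfolding equivalent_over_def
    using \<Phi> weak_equivalence.is_equivalence by blast
qed


subsection \<open>Transfer of Freyd's axioms\<close>

lemma zero_objectD:
  assumes "zero_object C Z"
  shows "Z \<in> Obj C" "X \<in> Obj C \<Longrightarrow> \<exists>f. f \<in> Hom C X Z" "X \<in> Obj C \<Longrightarrow> \<exists>f. f \<in> Hom C Z X"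
    "\<lbrakk>X \<in> Obj C; f \<in> Hom C X Z; g \<in> Hom C X Z\<rbrakk> \<Longrightarrow> f = g"
    "\<lbrakk>X \<in> Obj C; f \<in> Hom C Z X; g \<in> Hom C Z X\<rbrakk> \<Longrightarrow> f = g"
  using assms unfolding zero_object_def by blast+

lemma zero_objectI:
  assumes "Z \<in> Obj C"
    and "\<And>X. X \<in> Obj C \<Longrightarrow> \<exists>!f. f \<in> Hom C X Z" "\<And>X. X \<in> Obj C \<Longrightarrow> \<exists>!f. f \<in> Hom C Z X"
  shows "zero_object C Z"
  using assms by (simp add: zero_object_def)

lemma zero_morphismI:
  "\<lbrakk>zero_object C Z; g \<in> Hom C X Z; h \<in> Hom C Z Y\<rbrakk> \<Longrightarrow> zero_morphism C X Y (Comp C X Z Y h g)"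
  unfolding zero_morphism_def by blast

text \<open>
  An essentially surjective functor reaches a universal object only up to isomorphism. Therefore
  universal objects must first be known to be replaceable by isomorphic ones.
\<close>

lemma (in cat) zero_object_iso:
  assumes Z: "zero_object C Z" and i: "is_iso C A Z i" and A: "A \<in> Obj C"
  shows "zero_object C A"
proof -
  have Zo: "Z \<in> Obj C" using Z by (simp add: zero_object_def)
  obtain j where j: "i \<in> Hom C A Z" "j \<in> Hom C Z A" "Comp C A Z A j i = Id C A"
    "Comp C Z A Z i j = Id C Z"
    using i by (rule iso_inverse)
  have "\<exists>!f. f \<in> Hom C X A" "\<exists>!f. f \<in> Hom C A X" if X: "X \<in> Obj C" for X
  proof -
    obtain f g where f: "f \<in> Hom C X Z" and g: "g \<in> Hom C Z X"
      using zero_objectD(2,3)[OF Z X] by blast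
    show "\<exists>!f. f \<in> Hom C X A"
    proof (rule ex1I)
      show "Comp C X Z A j f \<in> Hom C X A" using X A Zo f j by simp
      fix f' assume f': "f' \<in> Hom C X A"
      have "Comp C X A Z i f' = f" by (rule zero_objectD(4)[OF Z X]) (use X A Zo f f' j in simp_all)
      then show "f' = Comp C X Z A j f" using Comp_cancel[OF j(3), of X f'] X A Zo f' j by simp
    qed
    show "\<exists>!f. f \<in> Hom C A X"
    proof (rule ex1I)
      show "Comp C A Z X g i \<in> Hom C A X" using X A Zo g j by simp
      fix f' assume f': "f' \<in> Hom C A X"
      have "Comp C Z A X f' j = g" by (rule zero_objectD(5)[OF Z X]) (use X A Zo g f' j in simp_all)
      then show "f' = Comp C A Z X g i" using X A Zo f' j Comp_assoc[of A Z A X i j f'] by simp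
    qed
  qed
  then show ?thesis using A by (simp add: zero_object_def)
qed

lemma (in cat) zero_morphism_factor:
  assumes Z: "zero_object C Z" and f: "zero_morphism C X Y f" and X: "X \<in> Obj C" "Y \<in> Obj C"
  obtains g h where "g \<in> Hom C X Z" "h \<in> Hom C Z Y" "f = Comp C X Z Y h g"
proof -
  obtain Z' g h where Z': "zero_object C Z'" "g \<in> Hom C X Z'" "h \<in> Hom C Z' Y" "f = Comp C X Z' Y h g"
    using f unfolding zero_morphism_def by blast
  have o: "Z \<in> Obj C" "Z' \<in> Obj C" using Z Z' by (auto simp: zero_object_def)
  obtain u where u: "u \<in> Hom C Z Z'" using zero_objectD(3)[OF Z] o by blast
  obtain v where v: "v \<in> Hom C X Z" using zero_objectD(2)[OF Z] X by blast
  have "Comp C X Z Z' u v = g"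
    by (rule zero_objectD(4)[OF Z'(1) X(1)]) (use Z' X o u v in simp_all)
  then have fe: "f = Comp C X Z Y (Comp C Z Z' Y h u) v"
    using Z' X o u v by (simp add: Comp_assoc)
  then show ?thesis using that[OF v _ fe] o u v Z' X by simp
qed

lemma (in cat) zero_morphism_comp:
  assumes "zero_morphism C X Y f" "X \<in> Obj C" "Y \<in> Obj C" "A \<in> Obj C" "B \<in> Obj C"
    "u \<in> Hom C A X" "v \<in> Hom C Y B"
  shows "zero_morphism C A Y (Comp C A X Y f u)" "zero_morphism C X B (Comp C X Y B v f)"
proof -
  obtain Z g h where Z: "zero_object C Z" "g \<in> Hom C X Z" "h \<in> Hom C Z Y" "f = Comp C X Z Y h g"
    using assms unfolding zero_morphism_def by blast
  have o: "Z \<in> Obj C" using Z by (auto simp: zero_object_def)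
  have "Comp C A X Y f u = Comp C A Z Y h (Comp C A X Z g u)"
    using assms Z o by (simp add: Comp_assoc)
  then show "zero_morphism C A Y (Comp C A X Y f u)"
    using zero_morphismI[OF Z(1)] assms Z o by simp
  have "Comp C X Y B v f = Comp C X Z B (Comp C Z Y B v h) g"
    using assms Z o by (simp add: Comp_assoc)
  then show "zero_morphism C X B (Comp C X Y B v f)"
    using zero_morphismI[OF Z(1)] assms Z o by simp
qed

lemma (in cat) product_iso:
  assumes P: "is_product C X Y P p q" and i: "is_iso C A P i" and o: "A \<in> Obj C" "X \<in> Obj C" "Y \<in> Obj C"
  shows "is_product C X Y A (Comp C A P X p i) (Comp C A P Y q i)"
proof -
  obtain j where j: "i \<in> Hom C A P" "j \<in> Hom C P A" "Comp C A P A j i = Id C A"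
    "Comp C P A P i j = Id C P"
    using i by (rule iso_inverse)
  have P': "P \<in> Obj C" "p \<in> Hom C P X" "q \<in> Hom C P Y" using P by (auto simp: is_product_def)
  have "\<exists>!u. u \<in> Hom C T A \<and> Comp C T A X (Comp C A P X p i) u = f \<and> Comp C T A Y (Comp C A P Y q i) u = g"
    if T: "T \<in> Obj C" "f \<in> Hom C T X" "g \<in> Hom C T Y" for T f g
  proof -
    obtain w where w: "w \<in> Hom C T P" "Comp C T P X p w = f" "Comp C T P Y q w = g"
      and w_uniq: "\<And>w'. \<lbrakk>w' \<in> Hom C T P; Comp C T P X p w' = f; Comp C T P Y q w' = g\<rbrakk> \<Longrightarrow> w' = w"
      using P T unfolding is_product_def by metis
    show ?thesis
    proof (rule ex1I[of _ "Comp C T P A j w"])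
      fix u assume u: "u \<in> Hom C T A \<and> Comp C T A X (Comp C A P X p i) u = f \<and> Comp C T A Y (Comp C A P Y q i) u = g"
      then have "Comp C T A P i u = w" using T o P' j by (intro w_uniq) (auto simp: Comp_assoc)
      then show "u = Comp C T P A j w" using Comp_cancel[OF j(3), of T u] u T o P' j by simp
    qed (use T o P' j w in \<open>simp add: Comp_assoc Comp_cancel[OF j(4)]\<close>)
  qed
  then show ?thesis using o P' j by (simp add: is_product_def)
qed

lemma (in cat) kernel_iso:
  assumes K: "is_kernel C X Y f K k" and i: "is_iso C A K i"
    and o: "A \<in> Obj C" "X \<in> Obj C" "Y \<in> Obj C" "f \<in> Hom C X Y"
  shows "is_kernel C X Y f A (Comp C A K X k i)"
proof -
  obtain j where j: "i \<in> Hom C A K" "j \<in> Hom C K A" "Comp C A K A j i = Id C A"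
    "Comp C K A K i j = Id C K"
    using i by (rule iso_inverse)
  have K': "K \<in> Obj C" "k \<in> Hom C K X" "zero_morphism C K Y (Comp C K X Y f k)"
    using K by (auto simp: is_kernel_def)
  have "\<exists>!u. u \<in> Hom C T A \<and> Comp C T A X (Comp C A K X k i) u = t"
    if T: "T \<in> Obj C" "t \<in> Hom C T X" "zero_morphism C T Y (Comp C T X Y f t)" for T t
  proof -
    obtain w where w: "w \<in> Hom C T K" "Comp C T K X k w = t"
      and w_uniq: "\<And>w'. \<lbrakk>w' \<in> Hom C T K; Comp C T K X k w' = t\<rbrakk> \<Longrightarrow> w' = w"
      using K T unfolding is_kernel_def by metis
    show ?thesis
    proof (rule ex1I[of _ "Comp C T K A j w"])
      fix u assume u: "u \<in> Hom C T A \<and> Comp C T A X (Comp C A K X k i) u = t"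
      then have "Comp C T A K i u = w" using T o K' j by (intro w_uniq) (auto simp: Comp_assoc)
      then show "u = Comp C T K A j w" using Comp_cancel[OF j(3), of T u] u T o K' j by simp
    qed (use T o K' j w in \<open>simp add: Comp_assoc Comp_cancel[OF j(4)]\<close>)
  qed
  moreover have "zero_morphism C A Y (Comp C A X Y f (Comp C A K X k i))"
    using zero_morphism_comp(1)[OF K'(3) K'(1) o(3,1,3) j(1) Id_in[OF o(3)]] o K' j by (simp add: Comp_assoc)
  ultimately show ?thesis using o K' j by (simp add: is_kernel_def)
qed

lemma (in cat) kernel_iso_codomain:
  assumes K: "is_kernel C X Y f K k" and i: "is_iso C Y B i"
    and o: "B \<in> Obj C" "X \<in> Obj C" "Y \<in> Obj C" "f \<in> Hom C X Y"
  shows "is_kernel C X B (Comp C X Y B i f) K k"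
proof -
  obtain j where j: "i \<in> Hom C Y B" "j \<in> Hom C B Y" "Comp C Y B Y j i = Id C Y"
    "Comp C B Y B i j = Id C B"
    using i by (rule iso_inverse)
  have zero: "zero_morphism C T B (Comp C T X B (Comp C X Y B i f) t) \<longleftrightarrow> zero_morphism C T Y (Comp C T X Y f t)"
    if T: "T \<in> Obj C" "t \<in> Hom C T X" for T t
  proof
    assume *: "zero_morphism C T B (Comp C T X B (Comp C X Y B i f) t)"
    have "Comp C T B Y j (Comp C T X B (Comp C X Y B i f) t) = Comp C T X Y f t"
      using T o j by (simp add: Comp_assoc Comp_cancel[OF j(3)])
    then show "zero_morphism C T Y (Comp C T X Y f t)"
      using zero_morphism_comp(2)[OF * T(1) o(1) T(1) o(3) Id_in[OF T(1)] j(2)] by simp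
  next
    assume *: "zero_morphism C T Y (Comp C T X Y f t)"
    show "zero_morphism C T B (Comp C T X B (Comp C X Y B i f) t)"
      using zero_morphism_comp(2)[OF * T(1) o(3) T(1) o(1) Id_in[OF T(1)] j(1)] T o j
      by (simp add: Comp_assoc)
  qed
  show ?thesis using K zero unfolding is_kernel_def by metis
qed

context weak_equivalence
begin

lemma hom_ex1_iff:
  assumes "X \<in> Obj C" "Y \<in> Obj C"
  shows "(\<exists>!f. f \<in> Hom D (FObj F X) (FObj F Y)) \<longleftrightarrow> (\<exists>!f. f \<in> Hom C X Y)"
proof -
  have b: "bij_betw (FMor F X Y) (Hom C X Y) (Hom D (FObj F X) (FObj F Y))"
    using ff assms by (auto simp: fully_faithful_def)
  then have im: "Hom D (FObj F X) (FObj F Y) = FMor F X Y ` Hom C X Y"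
    by (simp add: bij_betw_def)
  show ?thesis using inj[OF _ assms] unfolding im by blast
qed

text \<open>
  Every object of \<open>D\<close> is isomorphic to one in the image of \<open>F\<close>, and morphisms between objects of the
  image correspond to morphisms of \<open>C\<close>.
\<close>

lemma zero_object_iff:
  assumes X: "X \<in> Obj C"
  shows "zero_object C X \<longleftrightarrow> zero_object D (FObj F X)"
proof
  assume Z: "zero_object C X"
  have hom: "\<exists>!f. f \<in> Hom D (FObj F A) (FObj F X)" "\<exists>!f. f \<in> Hom D (FObj F X) (FObj F A)"
    if "A \<in> Obj C" for A
    using Z that X by (simp_all add: hom_ex1_iff zero_object_def)
  show "zero_object D (FObj F X)"
  proof (rule zero_objectI)
    fix B assume B: "B \<in> Obj D"
    obtain A i i' where A: "A \<in> Obj C" "i \<in> Hom D (FObj F A) B" "i' \<in> Hom D B (FObj F A)"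
      "Comp D (FObj F A) B (FObj F A) i' i = Id D (FObj F A)" "Comp D B (FObj F A) B i i' = Id D B"
      using B by (rule ess_surj)
    obtain f g where f: "f \<in> Hom D (FObj F A) (FObj F X)" and g: "g \<in> Hom D (FObj F X) (FObj F A)"
      using hom[OF A(1)] by blast
    show "\<exists>!f. f \<in> Hom D B (FObj F X)"
    proof (rule ex1I)
      show "Comp D B (FObj F A) (FObj F X) f i' \<in> Hom D B (FObj F X)" using A B X f by simp
      fix u assume u: "u \<in> Hom D B (FObj F X)"
      have "Comp D (FObj F A) B (FObj F X) u i \<in> Hom D (FObj F A) (FObj F X)"
        using A B X u by simp
      then have "Comp D (FObj F A) B (FObj F X) u i = f" using hom(1)[OF A(1)] f by blast
      then show "u = Comp D B (FObj F A) (FObj F X) f i'"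
        using A B X u D.Comp_assoc[of B "FObj F A" B "FObj F X" i' i u] by simp
    qed
    show "\<exists>!f. f \<in> Hom D (FObj F X) B"
    proof (rule ex1I)
      show "Comp D (FObj F X) (FObj F A) B i g \<in> Hom D (FObj F X) B" using A B X g by simp
      fix u assume u: "u \<in> Hom D (FObj F X) B"
      have "Comp D (FObj F X) B (FObj F A) i' u \<in> Hom D (FObj F X) (FObj F A)"
        using A B X u by simp
      then have "Comp D (FObj F X) B (FObj F A) i' u = g" using hom(2)[OF A(1)] g by blast
      then show "u = Comp D (FObj F X) (FObj F A) B i g"
        using A B X u D.Comp_cancel[OF A(5), of "FObj F X" u] by simp
    qed
  qed (use X in simp)
next
  assume Z: "zero_object D (FObj F X)"
  show "zero_object C X"
  proof (rule zero_objectI)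
    fix A assume A: "A \<in> Obj C"
    show "\<exists>!f. f \<in> Hom C A X" "\<exists>!f. f \<in> Hom C X A"
      using Z A X unfolding zero_object_def hom_ex1_iff[OF A X, symmetric] hom_ex1_iff[OF X A, symmetric]
      by simp_all
  qed (fact X)
qed

lemma zero_object_exists:
  assumes "zero_object D Z"
  obtains X where "zero_object C X" "X \<in> Obj C"
proof -
  have "Z \<in> Obj D" using assms by (simp add: zero_object_def)
  then obtain X i i' where X: "X \<in> Obj C" "i \<in> Hom D (FObj F X) Z" "i' \<in> Hom D Z (FObj F X)"
    "Comp D (FObj F X) Z (FObj F X) i' i = Id D (FObj F X)" "Comp D Z (FObj F X) Z i i' = Id D Z"
    by (rule ess_surj)
  then have "zero_object D (FObj F X)"
    by (intro D.zero_object_iso[OF assms D.is_isoI]) auto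
  then show ?thesis using that X zero_object_iff by auto
qed

text \<open>
  The zero object through which a zero morphism of \<open>D\<close> factors can be chosen in the image of \<open>F\<close>; then
  the factorization lifts.
\<close>

lemma zero_morphism_iff:
  assumes "X \<in> Obj C" "Y \<in> Obj C" "f \<in> Hom C X Y"
  shows "zero_morphism C X Y f \<longleftrightarrow> zero_morphism D (FObj F X) (FObj F Y) (FMor F X Y f)"
proof
  assume "zero_morphism C X Y f"
  then obtain Z g h where Z: "zero_object C Z" "g \<in> Hom C X Z" "h \<in> Hom C Z Y" "f = Comp C X Z Y h g"
    unfolding zero_morphism_def by blast
  have o: "Z \<in> Obj C" using Z by (simp add: zero_object_def)
  then have "zero_object D (FObj F Z)" using zero_object_iff Z by simp
  then have "zero_morphism D (FObj F X) (FObj F Y)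
      (Comp D (FObj F X) (FObj F Z) (FObj F Y) (FMor F Z Y h) (FMor F X Z g))"
    by (rule zero_morphismI) (use assms Z o in simp_all)
  then show "zero_morphism D (FObj F X) (FObj F Y) (FMor F X Y f)"
    using assms Z o by (simp add: FMor_Comp)
next
  assume *: "zero_morphism D (FObj F X) (FObj F Y) (FMor F X Y f)"
  then obtain Z where "zero_object D Z" unfolding zero_morphism_def by blast
  then obtain A where A: "zero_object C A" "A \<in> Obj C" by (rule zero_object_exists)
  then have "zero_object D (FObj F A)" using zero_object_iff by simp
  from D.zero_morphism_factor[OF this *] assms obtain g' h' where
    gh': "g' \<in> Hom D (FObj F X) (FObj F A)" "h' \<in> Hom D (FObj F A) (FObj F Y)"
    "FMor F X Y f = Comp D (FObj F X) (FObj F A) (FObj F Y) h' g'"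
    by auto
  obtain g where g: "g \<in> Hom C X A" "FMor F X A g = g'" using lift gh' A assms by metis
  obtain h where h: "h \<in> Hom C A Y" "FMor F A Y h = h'" using lift gh' A assms by metis
  have "f = Comp C X A Y h g"
    by (rule inj[of X Y]) (use A assms g h gh' in \<open>simp_all add: FMor_Comp\<close>)
  then show "zero_morphism C X Y f" unfolding zero_morphism_def using A g h by blast
qed

lemma product_reflect:
  assumes P: "is_product D (FObj F X) (FObj F Y) (FObj F P) (FMor F P X p) (FMor F P Y q)"
    and o: "X \<in> Obj C" "Y \<in> Obj C" "P \<in> Obj C" "p \<in> Hom C P X" "q \<in> Hom C P Y"
  shows "is_product C X Y P p q"
proof -
  have "\<exists>!u. u \<in> Hom C T P \<and> Comp C T P X p u = f \<and> Comp C T P Y q u = g"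
    if T: "T \<in> Obj C" "f \<in> Hom C T X" "g \<in> Hom C T Y" for T f g
  proof -
    have iff: "Comp C T P X p u = f \<longleftrightarrow>
          Comp D (FObj F T) (FObj F P) (FObj F X) (FMor F P X p) (FMor F T P u) = FMor F T X f"
      "Comp C T P Y q u = g \<longleftrightarrow>
          Comp D (FObj F T) (FObj F P) (FObj F Y) (FMor F P Y q) (FMor F T P u) = FMor F T Y g"
      if "u \<in> Hom C T P" for u
      using that T o FMor_Comp[of T P X u p] FMor_Comp[of T P Y u q]
        inj[of T X "Comp C T P X p u" f] inj[of T Y "Comp C T P Y q u" g] by auto
    have "\<exists>!w. w \<in> Hom D (FObj F T) (FObj F P)
        \<and> Comp D (FObj F T) (FObj F P) (FObj F X) (FMor F P X p) w = FMor F T X f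
        \<and> Comp D (FObj F T) (FObj F P) (FObj F Y) (FMor F P Y q) w = FMor F T Y g"
      using P T o unfolding is_product_def by simp
    then show ?thesis using iff lift inj FMor_in T o by (smt (verit, ccfv_threshold))
  qed
  then show ?thesis using o by (simp add: is_product_def)
qed

lemma kernel_reflect:
  assumes K: "is_kernel D (FObj F X) (FObj F Y) (FMor F X Y f) (FObj F K) (FMor F K X k)"
    and o: "X \<in> Obj C" "Y \<in> Obj C" "K \<in> Obj C" "f \<in> Hom C X Y" "k \<in> Hom C K X"
  shows "is_kernel C X Y f K k"
proof -
  have zero: "zero_morphism C T Y (Comp C T X Y f t) \<longleftrightarrow>
     zero_morphism D (FObj F T) (FObj F Y) (Comp D (FObj F T) (FObj F X) (FObj F Y) (FMor F X Y f) (FMor F T X t))"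
    if "T \<in> Obj C" "t \<in> Hom C T X" for T t
    using that o zero_morphism_iff[of T Y "Comp C T X Y f t"] by (simp add: FMor_Comp)
  have "\<exists>!u. u \<in> Hom C T K \<and> Comp C T K X k u = t"
    if T: "T \<in> Obj C" "t \<in> Hom C T X" "zero_morphism C T Y (Comp C T X Y f t)" for T t
  proof -
    have iff: "Comp C T K X k u = t \<longleftrightarrow>
          Comp D (FObj F T) (FObj F K) (FObj F X) (FMor F K X k) (FMor F T K u) = FMor F T X t"
      if "u \<in> Hom C T K" for u
      using that T o FMor_Comp[of T K X u k] inj[of T X "Comp C T K X k u" t] by auto
    have "\<exists>!w. w \<in> Hom D (FObj F T) (FObj F K)
        \<and> Comp D (FObj F T) (FObj F K) (FObj F X) (FMor F K X k) w = FMor F T X t"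
      using K T o zero unfolding is_kernel_def by simp
    then show ?thesis using iff lift inj FMor_in T o by (smt (verit, ccfv_threshold))
  qed
  then show ?thesis using o K zero by (simp add: is_kernel_def)
qed

text \<open>
  Test objects \<open>B\<close> outside the image are handled by composition with an isomorphism \<open>F A \<cong> B\<close>.
\<close>

lemma mono_preserve:
  assumes k: "is_mono C K X k" and o: "K \<in> Obj C" "X \<in> Obj C"
  shows "is_mono D (FObj F K) (FObj F X) (FMor F K X k)"
proof -
  have k': "k \<in> Hom C K X" using k by (simp add: is_mono_def)
  have "u = v" if B: "B \<in> Obj D" "u \<in> Hom D B (FObj F K)" "v \<in> Hom D B (FObj F K)"
    "Comp D B (FObj F K) (FObj F X) (FMor F K X k) u = Comp D B (FObj F K) (FObj F X) (FMor F K X k) v"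
    for B u v
  proof -
    obtain A i i' where A: "A \<in> Obj C" "i \<in> Hom D (FObj F A) B" "i' \<in> Hom D B (FObj F A)"
      "Comp D (FObj F A) B (FObj F A) i' i = Id D (FObj F A)" "Comp D B (FObj F A) B i i' = Id D B"
      using B(1) by (rule ess_surj)
    obtain u' where u': "u' \<in> Hom C A K" "FMor F A K u' = Comp D (FObj F A) B (FObj F K) u i"
      by (rule lift[of A K "Comp D (FObj F A) B (FObj F K) u i"]) (use A B o in simp_all)
    obtain v' where v': "v' \<in> Hom C A K" "FMor F A K v' = Comp D (FObj F A) B (FObj F K) v i"
      by (rule lift[of A K "Comp D (FObj F A) B (FObj F K) v i"]) (use A B o in simp_all)
    have "Comp C A K X k u' = Comp C A K X k v'"
      by (rule inj[of A X]) (use A B o k' u' v' in \<open>simp_all add: FMor_Comp flip: D.Comp_assoc\<close>)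
    then have "u' = v'" using k u' v' A unfolding is_mono_def by blast
    then have "Comp D (FObj F A) B (FObj F K) u i = Comp D (FObj F A) B (FObj F K) v i"
      using u' v' by simp
    then have "Comp D B (FObj F A) (FObj F K) (Comp D (FObj F A) B (FObj F K) u i) i' =
       Comp D B (FObj F A) (FObj F K) (Comp D (FObj F A) B (FObj F K) v i) i'" by simp
    then show ?thesis using A B o by (simp add: D.Comp_assoc)
  qed
  then show ?thesis using o k' by (simp add: is_mono_def)
qed

text \<open>
  A universal object of \<open>D\<close> is moved into the image of \<open>F\<close> along an isomorphism; since \<open>F\<close> is bijective
  on hom-sets, its preimage has the same universal property.
\<close>

lemma left_abelian_transfer:
  assumes D: "left_abelian D"
  shows "left_abelian C"
  unfolding left_abelian_def
proof (intro conjI ballI allI impI)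
  show "\<exists>Z. zero_object C Z"
    using D zero_object_exists unfolding left_abelian_def by metis
next
  fix X Y assume o: "X \<in> Obj C" "Y \<in> Obj C"
  then obtain B p q where B: "is_product D (FObj F X) (FObj F Y) B p q"
    using D FObj_in unfolding left_abelian_def by metis
  then have "B \<in> Obj D" by (simp add: is_product_def)
  then obtain P i where P: "P \<in> Obj C" "is_iso D (FObj F P) B i"
    using es unfolding essentially_surjective_def by blast
  from D.product_iso[OF B this(2)] have *: "is_product D (FObj F X) (FObj F Y) (FObj F P)
     (Comp D (FObj F P) B (FObj F X) p i) (Comp D (FObj F P) B (FObj F Y) q i)" using P o by simp
  then obtain p' q' where "p' \<in> Hom C P X" "FMor F P X p' = Comp D (FObj F P) B (FObj F X) p i"
    "q' \<in> Hom C P Y" "FMor F P Y q' = Comp D (FObj F P) B (FObj F Y) q i"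
    using P o lift unfolding is_product_def by metis
  then show "\<exists>P p q. is_product C X Y P p q" using * o P product_reflect by metis
next
  fix X Y f assume o: "X \<in> Obj C" "Y \<in> Obj C" "f \<in> Hom C X Y"
  then obtain B k where B: "is_kernel D (FObj F X) (FObj F Y) (FMor F X Y f) B k"
    using D FObj_in FMor_in unfolding left_abelian_def by metis
  then have "B \<in> Obj D" by (simp add: is_kernel_def)
  then obtain K i where K: "K \<in> Obj C" "is_iso D (FObj F K) B i"
    using es unfolding essentially_surjective_def by blast
  from D.kernel_iso[OF B this(2)] have *: "is_kernel D (FObj F X) (FObj F Y) (FMor F X Y f) (FObj F K)
     (Comp D (FObj F K) B (FObj F X) k i)" using K o by simp
  then obtain k' where "k' \<in> Hom C K X" "FMor F K X k' = Comp D (FObj F K) B (FObj F X) k i"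
    using K o lift unfolding is_kernel_def by metis
  then show "\<exists>K k. is_kernel C X Y f K k" using * o K kernel_reflect by metis
next
  fix K X k assume o: "K \<in> Obj C" "X \<in> Obj C" and k: "is_mono C K X k"
  have k': "k \<in> Hom C K X" using k by (simp add: is_mono_def)
  obtain B f where B: "B \<in> Obj D" "f \<in> Hom D (FObj F X) B"
    "is_kernel D (FObj F X) B f (FObj F K) (FMor F K X k)"
    using D mono_preserve[OF k o] o FObj_in unfolding left_abelian_def by metis
  obtain Y i where Y: "Y \<in> Obj C" "is_iso D (FObj F Y) B i"
    using es B unfolding essentially_surjective_def by blast
  obtain j where j: "is_iso D B (FObj F Y) j" using D.iso_sym Y by metis
  then have j': "j \<in> Hom D B (FObj F Y)" by (simp add: is_iso_def)
  have *: "is_kernel D (FObj F X) (FObj F Y) (Comp D (FObj F X) B (FObj F Y) j f) (FObj F K) (FMor F K X k)"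
    using D.kernel_iso_codomain[OF B(3) j] B o Y by simp
  obtain f' where "f' \<in> Hom C X Y" "FMor F X Y f' = Comp D (FObj F X) B (FObj F Y) j f"
    by (rule lift[of X Y "Comp D (FObj F X) B (FObj F Y) j f"]) (use o Y B j' in simp_all)
  then show "\<exists>Y\<in>Obj C. \<exists>f\<in>Hom C X Y. is_kernel C X Y f K k"
    using * o Y k' kernel_reflect by metis
qed

end

lemma op_simps [simp]:
  "Obj (op_category C) = Obj C" "Hom (op_category C) X Y = Hom C Y X" "Id (op_category C) = Id C"
  "Comp (op_category C) X Y Z g f = Comp C Z Y X f g"
  by (simp_all add: op_category_def)

lemma is_iso_op: "is_iso (op_category C) X Y f \<longleftrightarrow> is_iso C Y X f"
  by (auto simp: is_iso_def)

text \<open>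
  Duality reduces the axioms about coproducts, cokernels and epimorphisms to the others.
\<close>

lemma (in weak_equivalence) op:
  "weak_equivalence (op_category C) (op_category D) \<lparr>FObj = FObj F, FMor = (\<lambda>X Y. FMor F Y X)\<rparr>"
  (is "weak_equivalence ?C ?D ?F")
proof (intro weak_equivalence.intro func.intro cat.intro func_axioms.intro weak_equivalence_axioms.intro)
  show "is_functor ?C ?D ?F"
    unfolding is_functor_def op_simps functr.simps by (simp add: FMor_Comp)
  show "fully_faithful ?C ?D ?F"
    using ff unfolding fully_faithful_def op_simps functr.simps by blast
  show "essentially_surjective ?C ?D ?F"
    using es D.iso_sym unfolding essentially_surjective_def op_simps functr.simps is_iso_op by blast
qed (fact C.op_cat D.op_cat)+

lemma (in weak_equivalence) abelian_transfer:
  "abelian_category D \<Longrightarrow> abelian_category C"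
  unfolding abelian_category_def
  using left_abelian_transfer weak_equivalence.left_abelian_transfer[OF op] C.cat by blast

section \<open>Rational vector spaces\<close>

lemma rat_ring_simps [simp]:
  "carrier rat_ring = UNIV" "mult rat_ring = (*)" "one rat_ring = 1" "zero rat_ring = 0" "add rat_ring = (+)"
  by (simp_all add: rat_ring_def)

lemma rat_cring: "cring rat_ring"
proof (rule cringI)
  show "abelian_group rat_ring"
  proof (rule abelian_groupI)
    fix x :: rat
    show "\<exists>y\<in>carrier rat_ring. y \<oplus>\<^bsub>rat_ring\<^esub> x = \<zero>\<^bsub>rat_ring\<^esub>"
      by (rule bexI[of _ "- x"]) simp_all
  qed (simp_all add: ac_simps)
  show "comm_monoid rat_ring"
    by (rule comm_monoidI) (simp_all add: ac_simps)
qed (simp add: algebra_simps)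

locale qspace = module rat_ring V for V (structure)
begin

lemma scale_closed [simp]: "x \<in> carrier V \<Longrightarrow> a \<odot> x \<in> carrier V"
  using smult_closed by simp

lemma scale_add_left: "x \<in> carrier V \<Longrightarrow> (a + b) \<odot> x = a \<odot> x \<oplus> b \<odot> x"
  using smult_l_distr by simp

lemma scale_add_right: "\<lbrakk>x \<in> carrier V; y \<in> carrier V\<rbrakk> \<Longrightarrow> a \<odot> (x \<oplus> y) = a \<odot> x \<oplus> a \<odot> y"
  using smult_r_distr by simp

lemma scale_scale [simp]: "x \<in> carrier V \<Longrightarrow> a \<odot> (b \<odot> x) = (a * b) \<odot> x"
  using smult_assoc1 by simp

lemma scale_one [simp]: "x \<in> carrier V \<Longrightarrow> 1 \<odot> x = x"
  using smult_one by simp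

lemma scale_zero_left [simp]: "x \<in> carrier V \<Longrightarrow> 0 \<odot> x = \<zero>"
  using smult_l_null by simp

lemma scale_zero_right [simp]: "a \<odot> \<zero> = \<zero>"
  using smult_r_null by simp

lemma minus_scale: "x \<in> carrier V \<Longrightarrow> \<ominus> x = (- 1) \<odot> x"
  using scale_add_left[of x 1 "-1"] M.minus_equality[of "(-1) \<odot> x" x] by (simp add: M.a_comm)

lemma add_minus_one [simp]: "x \<in> carrier V \<Longrightarrow> x \<oplus> (- 1) \<odot> x = \<zero>"
  using scale_add_left[of x 1 "-1"] by simp

lemma diff_eq_zero_iff:
  "\<lbrakk>x \<in> carrier V; y \<in> carrier V\<rbrakk> \<Longrightarrow> x \<oplus> (- 1) \<odot> y = \<zero> \<longleftrightarrow> x = y"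
proof
  assume xy: "x \<in> carrier V" "y \<in> carrier V" and eq: "x \<oplus> (- 1) \<odot> y = \<zero>"
  then have "x \<oplus> ((- 1) \<odot> y \<oplus> y) = \<zero> \<oplus> y" by (simp flip: M.a_assoc)
  then show "x = y" using xy by (simp add: M.a_comm[of "(- 1) \<odot> y" y])
qed auto

lemma scale_eq_zero_iff [simp]:
  assumes "x \<in> carrier V"
  shows "a \<odot> x = \<zero> \<longleftrightarrow> a = 0 \<or> x = \<zero>"
proof
  assume "a \<odot> x = \<zero>"
  then have "inverse a \<odot> (a \<odot> x) = \<zero>" by simp
  then have "(inverse a * a) \<odot> x = \<zero>" using assms by (simp only: scale_scale)
  then show "a = 0 \<or> x = \<zero>" using assms by (cases "a = 0") simp_all
qed (use assms in auto)

end

lemma (in qspace) eq_scale_if_sum_zero: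
  assumes "x \<oplus> y = \<zero>" "x \<in> carrier V" "y \<in> carrier V"
  shows "x = (- 1) \<odot> y"
proof -
  have "(x \<oplus> y) \<oplus> (- 1) \<odot> y = (- 1) \<odot> y" using assms by simp
  then show ?thesis using assms(2,3) by (simp add: M.a_assoc)
qed

lemma (in qspace) sum_eq_if_diff_zero:
  assumes "(x \<oplus> y) \<oplus> (- 1) \<odot> z = \<zero>" "x \<in> carrier V" "y \<in> carrier V" "z \<in> carrier V"
  shows "y = z \<oplus> (- 1) \<odot> x"
proof -
  have "x \<oplus> y = z" using assms by (simp add: diff_eq_zero_iff)
  then have "z \<oplus> (- 1) \<odot> x = (y \<oplus> x) \<oplus> (- 1) \<odot> x" using assms by (simp add: M.a_comm)
  then show ?thesis using assms(2,3) by (simp add: M.a_assoc)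
qed

lemma left_module_rat_iff: "left_module rat_ring V \<longleftrightarrow> qspace V"
  by (simp add: left_module_iff_module[OF rat_cring] qspace_def)

lemma qspace_intro:
  fixes V :: "(rat, 'a) module" (structure)
  assumes "\<And>x y. \<lbrakk>x \<in> carrier V; y \<in> carrier V\<rbrakk> \<Longrightarrow> x \<oplus> y \<in> carrier V"
    and "\<zero> \<in> carrier V"
    and "\<And>a x. x \<in> carrier V \<Longrightarrow> a \<odot> x \<in> carrier V"
    and "\<And>x y z. \<lbrakk>x \<in> carrier V; y \<in> carrier V; z \<in> carrier V\<rbrakk> \<Longrightarrow> (x \<oplus> y) \<oplus> z = x \<oplus> (y \<oplus> z)"
    and "\<And>x y. \<lbrakk>x \<in> carrier V; y \<in> carrier V\<rbrakk> \<Longrightarrow> x \<oplus> y = y \<oplus> x"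
    and "\<And>x. x \<in> carrier V \<Longrightarrow> \<zero> \<oplus> x = x"
    and "\<And>x. x \<in> carrier V \<Longrightarrow> (- 1) \<odot> x \<oplus> x = \<zero>"
    and "\<And>a b x. x \<in> carrier V \<Longrightarrow> (a + b) \<odot> x = a \<odot> x \<oplus> b \<odot> x"
    and "\<And>a x y. \<lbrakk>x \<in> carrier V; y \<in> carrier V\<rbrakk> \<Longrightarrow> a \<odot> (x \<oplus> y) = a \<odot> x \<oplus> a \<odot> y"
    and "\<And>a b x. x \<in> carrier V \<Longrightarrow> (a * b) \<odot> x = a \<odot> (b \<odot> x)"
    and "\<And>x. x \<in> carrier V \<Longrightarrow> 1 \<odot> x = x"
  shows "qspace V"
proof (rule qspace.intro, rule moduleI[OF rat_cring])
  show "abelian_group V"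
  proof (rule abelian_groupI)
    fix x assume x: "x \<in> carrier V"
    show "\<exists>y\<in>carrier V. y \<oplus> x = \<zero>"
      by (rule bexI[of _ "(- 1) \<odot> x"]) (fact assms(7)[OF x] assms(3)[OF x])+
  qed (fact assms)+
qed (simp_all only: rat_ring_simps assms)

text \<open>
  In contrast to \<open>linear_maps\<close>, values outside the carrier are unconstrained, so that operators and
  their composites can be written without restrictions.
\<close>

definition qlinear :: "(rat, 'a) module \<Rightarrow> (rat, 'b) module \<Rightarrow> ('a \<Rightarrow> 'b) \<Rightarrow> bool" where
  "qlinear V W f \<longleftrightarrow> (\<forall>x\<in>carrier V. f x \<in> carrier W) \<and>
     (\<forall>x\<in>carrier V. \<forall>y\<in>carrier V. f (x \<oplus>\<^bsub>V\<^esub> y) = f x \<oplus>\<^bsub>W\<^esub> f y) \<and>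
     (\<forall>a. \<forall>x\<in>carrier V. f (a \<odot>\<^bsub>V\<^esub> x) = a \<odot>\<^bsub>W\<^esub> f x)"

lemma qlinearI:
  assumes "\<And>x. x \<in> carrier V \<Longrightarrow> f x \<in> carrier W"
    and "\<And>x y. \<lbrakk>x \<in> carrier V; y \<in> carrier V\<rbrakk> \<Longrightarrow> f (x \<oplus>\<^bsub>V\<^esub> y) = f x \<oplus>\<^bsub>W\<^esub> f y"
    and "\<And>a x. x \<in> carrier V \<Longrightarrow> f (a \<odot>\<^bsub>V\<^esub> x) = a \<odot>\<^bsub>W\<^esub> f x"
  shows "qlinear V W f"
  using assms by (simp add: qlinear_def)

lemma qlinearD:
  assumes "qlinear V W f" "x \<in> carrier V"
  shows "f x \<in> carrier W" "y \<in> carrier V \<Longrightarrow> f (x \<oplus>\<^bsub>V\<^esub> y) = f x \<oplus>\<^bsub>W\<^esub> f y"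
    "f (a \<odot>\<^bsub>V\<^esub> x) = a \<odot>\<^bsub>W\<^esub> f x"
  using assms by (simp_all add: qlinear_def)

lemma qlinear_zero:
  assumes "qlinear V W f" "qspace V" "qspace W"
  shows "f \<zero>\<^bsub>V\<^esub> = \<zero>\<^bsub>W\<^esub>"
proof -
  interpret V: qspace V by fact
  interpret W: qspace W by fact
  have "f (0 \<odot>\<^bsub>V\<^esub> \<zero>\<^bsub>V\<^esub>) = 0 \<odot>\<^bsub>W\<^esub> f \<zero>\<^bsub>V\<^esub>"
    by (rule qlinearD(3)[OF assms(1)]) simp
  then show ?thesis using qlinearD(1)[OF assms(1)] by simp
qed

lemma qlinear_comp: "qlinear V W f \<Longrightarrow> qlinear W U g \<Longrightarrow> qlinear V U (\<lambda>x. g (f x))"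
  by (simp add: qlinear_def)

lemma qlinear_finsum:
  assumes "qlinear V W f" "qspace V" "qspace W" "\<And>i. i \<in> A \<Longrightarrow> g i \<in> carrier V"
  shows "f (finsum V g A) = finsum W (\<lambda>i. f (g i)) A"
proof -
  interpret V: qspace V by fact
  interpret W: qspace W by fact
  show ?thesis
  proof (cases "finite A")
    case True
    then show ?thesis using assms(4)
    proof induction
      case empty then show ?case by (simp add: qlinear_zero[OF assms(1-3)])
    next
      case (insert i A)
      then show ?case by (simp add: Pi_def qlinearD[OF assms(1)])
    qed
  qed (simp add: qlinear_zero[OF assms(1-3)])
qed

lemma linear_maps_rat_iff:
  "f \<in> linear_maps rat_ring V W \<longleftrightarrow> qlinear V W f \<and> f \<in> extensional (carrier V)"
  by (auto simp: linear_maps_def qlinear_def PiE_iff)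

lemma qlinear_cong:
  assumes "qlinear V W f" "qspace V" "\<And>x. x \<in> carrier V \<Longrightarrow> f x = g x"
  shows "qlinear V W g"
proof -
  interpret qspace V by fact
  show ?thesis using assms by (simp add: qlinear_def)
qed

lemma qlinear_restrict:
  "qlinear V W f \<Longrightarrow> qspace V \<Longrightarrow> restrict f (carrier V) \<in> linear_maps rat_ring V W"
  by (auto simp: linear_maps_rat_iff intro: qlinear_cong)

lemma linear_maps_eqI:
  "\<lbrakk>f \<in> linear_maps R V W; g \<in> linear_maps R V W'; \<And>x. x \<in> carrier V \<Longrightarrow> f x = g x\<rbrakk> \<Longrightarrow> f = g"
  unfolding linear_maps_def by (auto simp: PiE_iff intro: extensionalityI)

lemma qspace_subspace:
  fixes V :: "(rat, 'a) module"
  assumes "qspace V" "U \<subseteq> carrier V" "\<zero>\<^bsub>V\<^esub> \<in> U"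
    "\<And>x y. x \<in> U \<Longrightarrow> y \<in> U \<Longrightarrow> x \<oplus>\<^bsub>V\<^esub> y \<in> U" "\<And>a x. x \<in> U \<Longrightarrow> a \<odot>\<^bsub>V\<^esub> x \<in> U"
  shows "qspace (V\<lparr>carrier := U\<rparr>)"
proof -
  interpret V: qspace V by fact
  note [simp] = subsetD[OF assms(2)]
  show ?thesis
    by (rule qspace_intro)
      (use assms(3-5) in \<open>simp_all add: V.scale_add_left V.scale_add_right V.M.add.m_ac\<close>)
qed

subsection \<open>Pushing the structure forward along a map\<close>

text \<open>
  A map whose fibres are the classes of a congruence carries the linear structure to its image.
  For an injective map this renames the elements of the space; for a choice of representatives of
  the cosets of a subspace this is the quotient space, without leaving the type of the elements.
\<close>

definition image_space :: "('b \<Rightarrow> 'a) \<Rightarrow> ('r, 'b) module \<Rightarrow> ('r, 'a) module" where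
  "image_space \<rho> V = \<lparr>carrier = \<rho> ` carrier V, mult = undefined, one = undefined, zero = \<rho> \<zero>\<^bsub>V\<^esub>,
     add = (\<lambda>x y. \<rho> (inv_into (carrier V) \<rho> x \<oplus>\<^bsub>V\<^esub> inv_into (carrier V) \<rho> y)),
     smult = (\<lambda>a x. \<rho> (a \<odot>\<^bsub>V\<^esub> inv_into (carrier V) \<rho> x))\<rparr>"

definition linear_congruence :: "(rat, 'b) module \<Rightarrow> ('b \<Rightarrow> 'a) \<Rightarrow> bool" where
  "linear_congruence V \<rho> \<longleftrightarrow>
     (\<forall>x\<in>carrier V. \<forall>x'\<in>carrier V. \<forall>y\<in>carrier V. \<forall>y'\<in>carrier V.
        \<rho> x = \<rho> x' \<longrightarrow> \<rho> y = \<rho> y' \<longrightarrow> \<rho> (x \<oplus>\<^bsub>V\<^esub> y) = \<rho> (x' \<oplus>\<^bsub>V\<^esub> y')) \<and>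
     (\<forall>a. \<forall>x\<in>carrier V. \<forall>x'\<in>carrier V. \<rho> x = \<rho> x' \<longrightarrow> \<rho> (a \<odot>\<^bsub>V\<^esub> x) = \<rho> (a \<odot>\<^bsub>V\<^esub> x'))"

lemma linear_congruence_inj: "inj_on \<rho> (carrier V) \<Longrightarrow> linear_congruence V \<rho>"
  unfolding linear_congruence_def by (simp add: inj_on_eq_iff)

lemma linear_congruenceD:
  assumes "linear_congruence V \<rho>"
  shows "\<lbrakk>\<rho> x = \<rho> x'; \<rho> y = \<rho> y'; x \<in> carrier V; x' \<in> carrier V; y \<in> carrier V; y' \<in> carrier V\<rbrakk>
      \<Longrightarrow> \<rho> (x \<oplus>\<^bsub>V\<^esub> y) = \<rho> (x' \<oplus>\<^bsub>V\<^esub> y')"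
    "\<lbrakk>\<rho> x = \<rho> x'; x \<in> carrier V; x' \<in> carrier V\<rbrakk> \<Longrightarrow> \<rho> (a \<odot>\<^bsub>V\<^esub> x) = \<rho> (a \<odot>\<^bsub>V\<^esub> x')"
  using assms unfolding linear_congruence_def by blast+

lemma carrier_image_space [simp]: "carrier (image_space \<rho> V) = \<rho> ` carrier V"
  by (simp add: image_space_def)

lemma image_space:
  assumes V: "qspace V" and \<rho>: "linear_congruence V \<rho>"
  shows "qspace (image_space \<rho> V)" and "qlinear V (image_space \<rho> V) \<rho>"
    and "\<zero>\<^bsub>image_space \<rho> V\<^esub> = \<rho> \<zero>\<^bsub>V\<^esub>"
proof -
  interpret V: qspace V by fact
  let ?W = "image_space \<rho> V"
  have inv: "inv_into (carrier V) \<rho> (\<rho> x) \<in> carrier V" "\<rho> (inv_into (carrier V) \<rho> (\<rho> x)) = \<rho> x"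
    if "x \<in> carrier V" for x
    using that by (simp_all add: inv_into_into f_inv_into_f)
  have add [simp]: "\<rho> x \<oplus>\<^bsub>?W\<^esub> \<rho> y = \<rho> (x \<oplus>\<^bsub>V\<^esub> y)" if "x \<in> carrier V" "y \<in> carrier V" for x y
    unfolding image_space_def module.simps ring.simps
    by (rule linear_congruenceD(1)[OF \<rho>]) (use that inv in simp_all)
  have smult [simp]: "a \<odot>\<^bsub>?W\<^esub> \<rho> x = \<rho> (a \<odot>\<^bsub>V\<^esub> x)" if "x \<in> carrier V" for x a
    unfolding image_space_def module.simps
    by (rule linear_congruenceD(2)[OF \<rho>]) (use that inv in simp_all)
  show zero [simp]: "\<zero>\<^bsub>?W\<^esub> = \<rho> \<zero>\<^bsub>V\<^esub>" by (simp add: image_space_def)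
  show "qlinear V ?W \<rho>" by (rule qlinearI) simp_all
  show "qspace ?W"
    by (rule qspace_intro)
      (auto simp: V.scale_add_left V.scale_add_right V.M.add.m_ac)
qed

subsection \<open>Room for new spaces\<close>

text \<open>
  All spaces are carried by subsets of one type, so constructions that enlarge a space need an
  injection back into that type. It exists because a non-zero rational vector space is infinite.
\<close>

lemma (in qspace) trivial_or_infinite: "carrier V = {\<zero>} \<or> infinite (carrier V)"
proof (rule disjCI)
  assume "\<not> infinite (carrier V)"
  then have fin: "finite (carrier V)" by simp
  show "carrier V = {\<zero>}"
  proof (rule ccontr)
    assume "carrier V \<noteq> {\<zero>}"
    then obtain x where x: "x \<in> carrier V" "x \<noteq> \<zero>" using M.zero_closed by blast
    have "inj (\<lambda>a. a \<odot> x)"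
    proof (rule injI)
      fix a b assume "a \<odot> x = b \<odot> x"
      then have "(a + (- b)) \<odot> x = (b + (- b)) \<odot> x"
        using x by (simp only: scale_add_left)
      then show "a = b" using x by simp
    qed
    moreover have "range (\<lambda>a. a \<odot> x) \<subseteq> carrier V" using x by auto
    ultimately show False using fin finite_imageD finite_subset infinite_UNIV_char_0 by metis
  qed
qed

lemma infinite_pairing:
  "infinite (UNIV :: 'a set) \<Longrightarrow> \<exists>p :: 'a \<times> 'a \<Rightarrow> 'a. inj p"
  using card_of_Times_same_infinite[of "UNIV :: 'a set", folded card_of_ordIso]
  by (auto simp: bij_betw_def)

lemma pair_embedding:
  fixes V W :: "(rat, 'a) module"
  assumes "qspace V" "qspace W"
  shows "\<exists>\<phi> :: 'a \<times> 'a \<Rightarrow> 'a. inj_on \<phi> (carrier V \<times> carrier W)"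
proof (cases "infinite (UNIV :: 'a set)")
  case True
  obtain p :: "'a \<times> 'a \<Rightarrow> 'a" where "inj p"
    using infinite_pairing[OF True] by blast
  then show ?thesis using inj_on_subset by blast
next
  case False
  then have "finite (carrier V)" "finite (carrier W)" using finite_subset subset_UNIV by blast+
  then have "carrier V \<times> carrier W = {(\<zero>\<^bsub>V\<^esub>, \<zero>\<^bsub>W\<^esub>)}"
    using assms[THEN qspace.trivial_or_infinite] by auto
  then show ?thesis by auto
qed

definition finite_support :: "(rat, 'a) module \<Rightarrow> ('i \<Rightarrow> 'a) set" where
  "finite_support V = {h. (\<forall>i. h i \<in> carrier V) \<and> finite {i. h i \<noteq> \<zero>\<^bsub>V\<^esub>}}"

text \<open>
  Room for Fock spaces. An infinite type has an injective pairing and hence an injective code for finite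
  lists over it; a finitely supported function is coded by a list of the points of its graph.
\<close>

lemma finite_support_embedding:
  fixes V :: "(rat, 'a) module"
  assumes "qspace V"
  shows "\<exists>\<phi> :: ('i :: countable \<Rightarrow> 'a) \<Rightarrow> 'a. inj_on \<phi> (finite_support V)"
proof -
  interpret qspace V by fact
  consider "carrier V = {\<zero>\<^bsub>V\<^esub>}" | "infinite (carrier V)" using trivial_or_infinite by blast
  then show ?thesis
  proof cases
    case 1
    then have "inj_on \<phi> (finite_support V)" for \<phi> :: "('i \<Rightarrow> 'a) \<Rightarrow> 'a"
      by (auto simp: finite_support_def inj_on_def)
    then show ?thesis by blast
  next
    case 2
    then have inf: "infinite (UNIV :: 'a set)" using finite_subset subset_UNIV by blast
    obtain e :: "nat \<Rightarrow> 'a" where e: "inj e" using infinite_countable_subset[OF inf] by blast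
    obtain p :: "'a \<times> 'a \<Rightarrow> 'a" where p: "inj p"
      using infinite_pairing[OF inf] by blast
    \<comment> \<open>A pairing on an infinite type encodes finite lists, with the length as a prefix.\<close>
    define enc where "enc = foldr (\<lambda>(i :: 'i, x) a. p (p (e (to_nat i), x), a))"
    have enc: "xs = ys" if "enc xs a = enc ys a" "length xs = length ys" for xs ys a
      using that(2,1) by (induction xs ys rule: list_induct2)
        (auto simp: enc_def inj_eq[OF p] inj_eq[OF e])
    define code where "code xs = p (e (length xs), enc xs (e 0))" for xs
    have code: "inj code"
      by (rule injI) (auto simp: code_def inj_eq[OF p] inj_eq[OF e] intro: enc)
    define gr where "gr h = (\<lambda>i. (i, h i)) ` {i. h i \<noteq> \<zero>\<^bsub>V\<^esub>}" for h :: "'i \<Rightarrow> 'a"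
    define li where "li h = (SOME xs. set xs = gr h)" for h
    have li: "set (li h) = gr h" if "h \<in> finite_support V" for h
      unfolding li_def by (rule someI_ex, rule finite_list) (use that in \<open>simp add: gr_def finite_support_def\<close>)
    have "inj_on (\<lambda>h. code (li h)) (finite_support V)"
    proof (rule inj_onI, rule ext)
      fix h h' :: "'i \<Rightarrow> 'a" and i
      assume "h \<in> finite_support V" "h' \<in> finite_support V" "code (li h) = code (li h')"
      then have "gr h = gr h'" using li injD[OF code] by metis
      then have "(i, x) \<in> gr h \<longleftrightarrow> (i, x) \<in> gr h'" for x by simp
      from this[of "h i"] this[of "h' i"] show "h i = h' i" by (auto simp: gr_def)
    qed
    then show ?thesis by blast
  qed
qed


section \<open>The abelian category of rational vector spaces\<close>

lemma module_category_simps [simp]: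
  "Obj (module_category R adm) = {M. left_module R M \<and> adm M}"
  "Hom (module_category R adm) = linear_maps R"
  "Id (module_category R adm) M = (\<lambda>x\<in>carrier M. x)"
  "Comp (module_category R adm) M N L g f = compose (carrier M) g f"
  by (simp_all add: module_category_def)

lemma linear_maps_id: "left_module R M \<Longrightarrow> (\<lambda>x\<in>carrier M. x) \<in> linear_maps R M M"
proof -
  assume "left_module R M"
  then interpret left_module R M .
  show ?thesis by (auto simp: linear_maps_def smult_closed)
qed

lemma linear_maps_compose:
  assumes "left_module R M" "f \<in> linear_maps R M N" "g \<in> linear_maps R N L"
  shows "compose (carrier M) g f \<in> linear_maps R M L"
proof -
  interpret left_module R M by fact
  show ?thesis using assms(2,3) by (auto simp: linear_maps_def compose_def smult_closed PiE_iff)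
qed

lemma linear_maps_arr [simp]:
  "f \<in> linear_maps R M N \<Longrightarrow> x \<in> carrier M \<Longrightarrow> f x \<in> carrier N"
  "f \<in> linear_maps R M N \<Longrightarrow> f \<in> extensional (carrier M)"
  by (auto simp: linear_maps_def PiE_def)

lemma compose_id:
  "f \<in> linear_maps R M N \<Longrightarrow> compose (carrier M) f (\<lambda>x\<in>carrier M. x) = f"
  "f \<in> linear_maps R M N \<Longrightarrow> compose (carrier M) (\<lambda>x\<in>carrier N. x) f = f"
  by (auto simp: compose_def intro!: extensionalityI[of _ "carrier M"])

lemma compose_assoc_linear:
  "f \<in> linear_maps R M N \<Longrightarrow>
   compose (carrier M) (compose (carrier N) h g) f = compose (carrier M) h (compose (carrier M) g f)"
  by (auto simp: compose_def)

lemma is_category_module_category: "is_category (module_category R adm)"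
  unfolding is_category_def
  by (auto simp: linear_maps_id linear_maps_compose compose_id compose_assoc_linear)

lemma vector_spaces_simps [simp]:
  "Obj (vector_spaces T) = {V. qspace V}"
  "Hom (vector_spaces T) = linear_maps rat_ring"
  "Id (vector_spaces T) V = (\<lambda>x\<in>carrier V. x)"
  "Comp (vector_spaces T) V W U g f = compose (carrier V) g f"
  by (simp_all add: vector_spaces_def left_module_rat_iff)

lemma is_category_vector_spaces: "is_category (vector_spaces T)"
  unfolding vector_spaces_def by (rule is_category_module_category)

text \<open>
  A zero space in an arbitrary type, whose only element that can be named is \<open>undefined\<close>.
\<close>

definition zero_space :: "(rat, 'a) module" where
  "zero_space = \<lparr>carrier = {undefined}, mult = undefined, one = undefined, zero = undefined,
     add = (\<lambda>x y. undefined), smult = (\<lambda>a x. undefined)\<rparr>"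

lemma qspace_zero_space: "qspace zero_space"
  by (rule qspace_intro) (simp_all add: zero_space_def)

lemma linear_maps_const_zero:
  assumes "qspace V" "qspace W"
  shows "(\<lambda>x\<in>carrier V. \<zero>\<^bsub>W\<^esub>) \<in> linear_maps rat_ring V W"
proof -
  interpret V: qspace V by fact
  interpret W: qspace W by fact
  show ?thesis by (intro qlinear_restrict qlinearI) (use assms in auto)
qed

lemma zero_object_trivial:
  assumes V: "qspace V" "carrier V = {\<zero>\<^bsub>V\<^esub>}"
  shows "zero_object (vector_spaces T) V"
proof (rule zero_objectI)
  fix W assume "W \<in> Obj (vector_spaces T)"
  then have W: "qspace W" by simp
  have *: "f x = \<zero>\<^bsub>V\<^esub>" if "f \<in> linear_maps rat_ring W V" "x \<in> carrier W" for f x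
    using linear_maps_arr(1)[OF that] unfolding V(2) by blast
  note zWV = linear_maps_const_zero[OF W V(1)] and zVW = linear_maps_const_zero[OF V(1) W]
  have "f = (\<lambda>x\<in>carrier W. \<zero>\<^bsub>V\<^esub>)" if "f \<in> linear_maps rat_ring W V" for f
    by (rule linear_maps_eqI[OF that zWV]) (simp add: *[OF that])
  then show "\<exists>!f. f \<in> Hom (vector_spaces T) W V"
    unfolding vector_spaces_simps using zWV by blast
  have **: "f x = \<zero>\<^bsub>W\<^esub>" if "f \<in> linear_maps rat_ring V W" "x \<in> carrier V" for f x
    using that(2) qlinear_zero[OF _ V(1) W, of f] that(1)
    unfolding V(2) linear_maps_rat_iff by blast
  have "f = (\<lambda>x\<in>carrier V. \<zero>\<^bsub>W\<^esub>)" if "f \<in> linear_maps rat_ring V W" for f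
    by (rule linear_maps_eqI[OF that zVW]) (simp add: **[OF that])
  then show "\<exists>!f. f \<in> Hom (vector_spaces T) V W"
    unfolding vector_spaces_simps using zVW by blast
qed (use V in simp)

lemma zero_morphism_vector_spaces:
  assumes "qspace V" "qspace W" "f \<in> linear_maps rat_ring V W"
  shows "zero_morphism (vector_spaces TYPE('a)) V W f \<longleftrightarrow> (\<forall>x\<in>carrier V. f x = \<zero>\<^bsub>W\<^esub>)"
proof
  assume "zero_morphism (vector_spaces TYPE('a)) V W f"
  then obtain Z g h where Z: "zero_object (vector_spaces TYPE('a)) Z" and
    gh: "g \<in> linear_maps rat_ring V Z" "h \<in> linear_maps rat_ring Z W" "f = compose (carrier V) h g"
    unfolding zero_morphism_def by auto
  have Zq: "qspace Z" using zero_objectD(1)[OF Z] by simp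
  have "(\<lambda>x\<in>carrier Z. x) = (\<lambda>x\<in>carrier Z. \<zero>\<^bsub>Z\<^esub>)"
    by (rule zero_objectD(4)[OF Z, of Z])
      (use Zq in \<open>simp_all add: linear_maps_const_zero linear_maps_id left_module_rat_iff\<close>)
  then have "x = \<zero>\<^bsub>Z\<^esub>" if "x \<in> carrier Z" for x using that by (metis restrict_apply')
  then have "g x = \<zero>\<^bsub>Z\<^esub>" if "x \<in> carrier V" for x
    using that gh linear_maps_arr(1) by metis
  then show "\<forall>x\<in>carrier V. f x = \<zero>\<^bsub>W\<^esub>"
    using gh qlinear_zero[OF _ Zq assms(2), of h] by (simp add: compose_def linear_maps_rat_iff)
next
  assume f: "\<forall>x\<in>carrier V. f x = \<zero>\<^bsub>W\<^esub>"
  have Z: "zero_object (vector_spaces TYPE('a)) zero_space"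
    by (rule zero_object_trivial[OF qspace_zero_space]) (simp add: zero_space_def)
  let ?g = "\<lambda>x\<in>carrier V. \<zero>\<^bsub>zero_space\<^esub>" and ?h = "\<lambda>x\<in>carrier zero_space. \<zero>\<^bsub>W\<^esub>"
  have "zero_morphism (vector_spaces TYPE('a)) V W (Comp (vector_spaces TYPE('a)) V zero_space W ?h ?g)"
    by (rule zero_morphismI[OF Z]) (use assms in \<open>simp_all add: linear_maps_const_zero qspace_zero_space\<close>)
  moreover have "Comp (vector_spaces TYPE('a)) V zero_space W ?h ?g = f"
    using f assms(3) by (auto simp: compose_def zero_space_def intro!: extensionalityI[of _ "carrier V"])
  ultimately show "zero_morphism (vector_spaces TYPE('a)) V W f" by simp
qed

lemma zero_object_op [simp]: "zero_object (op_category C) Z \<longleftrightarrow> zero_object C Z"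
  by (auto simp: zero_object_def)

lemma zero_morphism_op [simp]: "zero_morphism (op_category C) X Y f \<longleftrightarrow> zero_morphism C Y X f"
  by (auto simp: zero_morphism_def)

subsection \<open>Direct sums\<close>

definition pair_space :: "(rat, 'a) module \<Rightarrow> (rat, 'b) module \<Rightarrow> (rat, 'a \<times> 'b) module" where
  "pair_space V W = \<lparr>carrier = carrier V \<times> carrier W, mult = undefined, one = undefined,
     zero = (\<zero>\<^bsub>V\<^esub>, \<zero>\<^bsub>W\<^esub>), add = (\<lambda>x y. (fst x \<oplus>\<^bsub>V\<^esub> fst y, snd x \<oplus>\<^bsub>W\<^esub> snd y)),
     smult = (\<lambda>a x. (a \<odot>\<^bsub>V\<^esub> fst x, a \<odot>\<^bsub>W\<^esub> snd x))\<rparr>"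

lemma qspace_pair_space:
  assumes "qspace V" "qspace W"
  shows "qspace (pair_space V W)"
proof -
  interpret V: qspace V by fact
  interpret W: qspace W by fact
  show ?thesis
    by (rule qspace_intro) (auto simp: pair_space_def V.scale_add_left W.scale_add_left
      V.scale_add_right W.scale_add_right V.M.add.m_ac W.M.add.m_ac)
qed

text \<open>
  One space with both projections and injections: the equations between them imply the universal
  property of the product as well as that of the coproduct.
\<close>

lemma biproduct:
  fixes V W :: "(rat, 'a) module"
  assumes V: "qspace V" and W: "qspace W"
  obtains P and p q :: "'a \<Rightarrow> 'a" and i j where "qspace P" "qlinear P V p" "qlinear P W q" "qlinear V P i" "qlinear W P j"
    "\<And>x. x \<in> carrier V \<Longrightarrow> p (i x) = x" "\<And>x. x \<in> carrier V \<Longrightarrow> q (i x) = \<zero>\<^bsub>W\<^esub>"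
    "\<And>y. y \<in> carrier W \<Longrightarrow> p (j y) = \<zero>\<^bsub>V\<^esub>" "\<And>y. y \<in> carrier W \<Longrightarrow> q (j y) = y"
    "\<And>z. z \<in> carrier P \<Longrightarrow> z = i (p z) \<oplus>\<^bsub>P\<^esub> j (q z)"
proof -
  interpret V: qspace V by fact
  interpret W: qspace W by fact
  obtain \<phi> :: "'a \<times> 'a \<Rightarrow> 'a" where \<phi>: "inj_on \<phi> (carrier V \<times> carrier W)"
    using pair_embedding[OF V W] by blast
  let ?Q = "pair_space V W"
  have cQ: "carrier ?Q = carrier V \<times> carrier W" by (simp add: pair_space_def)
  let ?P = "image_space \<phi> ?Q"
  have Q: "qspace ?Q" using V W by (rule qspace_pair_space)
  have cong: "linear_congruence ?Q \<phi>" using \<phi> by (simp add: linear_congruence_inj cQ)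
  note P = image_space[OF Q cong]
  interpret P: qspace ?P by (rule P(1))
  define \<psi> where "\<psi> = inv_into (carrier V \<times> carrier W) \<phi>"
  have \<psi> [simp]: "\<psi> (\<phi> (x, y)) = (x, y)" if "x \<in> carrier V" "y \<in> carrier W" for x y
    using \<phi> that by (simp add: \<psi>_def)
  have P_cases: thesis' if "z \<in> carrier ?P" "\<And>x y. \<lbrakk>z = \<phi> (x, y); x \<in> carrier V; y \<in> carrier W\<rbrakk> \<Longrightarrow> thesis'"
    for z thesis' using that by (auto simp: cQ)
  have in_P [simp]: "\<phi> (x, y) \<in> carrier ?P" if "x \<in> carrier V" "y \<in> carrier W" for x y
    using that by (auto simp: cQ)
  have add [simp]: "\<phi> (x, y) \<oplus>\<^bsub>?P\<^esub> \<phi> (x', y') = \<phi> (x \<oplus>\<^bsub>V\<^esub> x', y \<oplus>\<^bsub>W\<^esub> y')"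
    if "x \<in> carrier V" "x' \<in> carrier V" "y \<in> carrier W" "y' \<in> carrier W" for x x' y y'
    using qlinearD(2)[OF P(2), of "(x, y)" "(x', y')"] that by (simp add: pair_space_def)
  have smult [simp]: "a \<odot>\<^bsub>?P\<^esub> \<phi> (x, y) = \<phi> (a \<odot>\<^bsub>V\<^esub> x, a \<odot>\<^bsub>W\<^esub> y)"
    if "x \<in> carrier V" "y \<in> carrier W" for x y a
    using qlinearD(3)[OF P(2), of "(x, y)"] that by (simp add: pair_space_def)
  show ?thesis
  proof (rule that[of ?P "\<lambda>z. fst (\<psi> z)" "\<lambda>z. snd (\<psi> z)" "\<lambda>x. \<phi> (x, \<zero>\<^bsub>W\<^esub>)" "\<lambda>y. \<phi> (\<zero>\<^bsub>V\<^esub>, y)"])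
    show "qspace ?P" by (rule P(1))
    show "qlinear ?P V (\<lambda>z. fst (\<psi> z))" "qlinear ?P W (\<lambda>z. snd (\<psi> z))"
      by (rule qlinearI; (erule P_cases)+; simp del: carrier_image_space)+
    show "qlinear V ?P (\<lambda>x. \<phi> (x, \<zero>\<^bsub>W\<^esub>))" "qlinear W ?P (\<lambda>y. \<phi> (\<zero>\<^bsub>V\<^esub>, y))"
      by (rule qlinearI; simp del: carrier_image_space)+
    show "z = \<phi> (fst (\<psi> z), \<zero>\<^bsub>W\<^esub>) \<oplus>\<^bsub>?P\<^esub> \<phi> (\<zero>\<^bsub>V\<^esub>, snd (\<psi> z))" if "z \<in> carrier ?P" for z
      using that by (elim P_cases) simp
  qed simp_all
qed


lemma direct_sum:
  fixes V W :: "(rat, 'a) module"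
  assumes V: "qspace V" and W: "qspace W"
  shows "\<exists>P p q. is_product (vector_spaces TYPE('a)) V W P p q"
    and "\<exists>P i j. is_product (op_category (vector_spaces TYPE('a))) V W P i j"
proof -
  interpret V: qspace V by fact
  interpret W: qspace W by fact
  obtain P :: "(rat, 'a) module" and p q i j where P: "qspace P" and lin: "qlinear P V p" "qlinear P W q" "qlinear V P i" "qlinear W P j"
    and pq: "\<And>x. x \<in> carrier V \<Longrightarrow> p (i x) = x" "\<And>x. x \<in> carrier V \<Longrightarrow> q (i x) = \<zero>\<^bsub>W\<^esub>"
      "\<And>y. y \<in> carrier W \<Longrightarrow> p (j y) = \<zero>\<^bsub>V\<^esub>" "\<And>y. y \<in> carrier W \<Longrightarrow> q (j y) = y"
      and ij: "\<And>z. z \<in> carrier P \<Longrightarrow> z = i (p z) \<oplus>\<^bsub>P\<^esub> j (q z)"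
  proof (rule biproduct[OF V W])
    fix P :: "(rat, 'a) module" and p q i j
    assume "qspace P" "qlinear P V p" "qlinear P W q" "qlinear V P i" "qlinear W P j"
      "\<And>x. x \<in> carrier V \<Longrightarrow> p (i x) = x" "\<And>x. x \<in> carrier V \<Longrightarrow> q (i x) = \<zero>\<^bsub>W\<^esub>"
      "\<And>y. y \<in> carrier W \<Longrightarrow> p (j y) = \<zero>\<^bsub>V\<^esub>" "\<And>y. y \<in> carrier W \<Longrightarrow> q (j y) = y"
      "\<And>z. z \<in> carrier P \<Longrightarrow> z = i (p z) \<oplus>\<^bsub>P\<^esub> j (q z)"
    then show thesis by (rule that)
  qed
  interpret P: qspace P by fact
  note lp [simp] = qlinearD[OF lin(1)] and lq [simp] = qlinearD[OF lin(2)]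
    and li [simp] = qlinearD[OF lin(3)] and lj [simp] = qlinearD[OF lin(4)] and pq [simp]
  let ?p = "restrict p (carrier P)" and ?q = "restrict q (carrier P)"
  let ?i = "restrict i (carrier V)" and ?j = "restrict j (carrier W)"
  have hom: "?p \<in> linear_maps rat_ring P V" "?q \<in> linear_maps rat_ring P W"
    "?i \<in> linear_maps rat_ring V P" "?j \<in> linear_maps rat_ring W P"
    using lin V W P by (simp_all add: qlinear_restrict)
  have "is_product (vector_spaces TYPE('a)) V W P ?p ?q"
    unfolding is_product_def vector_spaces_simps mem_Collect_eq
  proof (intro conjI ballI)
    fix T f g assume T: "T \<in> {V. qspace V}" and f: "f \<in> linear_maps rat_ring T V"
      and g: "g \<in> linear_maps rat_ring T W"
    have T: "qspace T" using T by simp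
    interpret T: qspace T by fact
    have fl: "qlinear T V f" and gl: "qlinear T W g" using f g by (simp_all add: linear_maps_rat_iff)
    note fg [simp] = qlinearD[OF fl] qlinearD[OF gl]
    let ?u = "\<lambda>x\<in>carrier T. i (f x) \<oplus>\<^bsub>P\<^esub> j (g x)"
    have u: "?u \<in> linear_maps rat_ring T P"
      by (rule qlinear_restrict[OF _ T], rule qlinearI) (simp_all add: P.scale_add_right P.M.add.m_ac)
    show "\<exists>!u. u \<in> linear_maps rat_ring T P \<and> compose (carrier T) ?p u = f \<and> compose (carrier T) ?q u = g"
    proof (rule ex1I, intro conjI)
      show "?u \<in> linear_maps rat_ring T P" by (rule u)
      show "compose (carrier T) ?p ?u = f"
        by (rule extensionalityI[of _ "carrier T"]) (use f in \<open>simp_all add: compose_def\<close>)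
      show "compose (carrier T) ?q ?u = g"
        by (rule extensionalityI[of _ "carrier T"]) (use g in \<open>simp_all add: compose_def\<close>)
      fix u' assume u': "u' \<in> linear_maps rat_ring T P \<and> compose (carrier T) ?p u' = f \<and> compose (carrier T) ?q u' = g"
      show "u' = ?u"
      proof (rule linear_maps_eqI[OF u'[THEN conjunct1] u])
        fix x assume x: "x \<in> carrier T"
        then have u'x: "u' x \<in> carrier P" using u' by auto
        have "f x = p (u' x)" "g x = q (u' x)" using u' u'x x by (auto simp: compose_def)
        then show "u' x = ?u x" using ij[OF u'x] x by simp
      qed
    qed
  qed (use P hom in auto)
  then show "\<exists>P p q. is_product (vector_spaces TYPE('a)) V W P p q" by blast
  have "is_product (op_category (vector_spaces TYPE('a))) V W P ?i ?j"
    unfolding is_product_def op_simps vector_spaces_simps mem_Collect_eq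
  proof (intro conjI ballI)
    fix T f g assume T: "T \<in> {V. qspace V}" and f: "f \<in> linear_maps rat_ring V T"
      and g: "g \<in> linear_maps rat_ring W T"
    have T: "qspace T" using T by simp
    interpret T: qspace T by fact
    have fl: "qlinear V T f" and gl: "qlinear W T g" using f g by (simp_all add: linear_maps_rat_iff)
    note fg [simp] = qlinearD[OF fl] qlinearD[OF gl]
    note [simp] = qlinear_zero[OF fl V T] qlinear_zero[OF gl W T]
    let ?u = "\<lambda>z\<in>carrier P. f (p z) \<oplus>\<^bsub>T\<^esub> g (q z)"
    have u: "?u \<in> linear_maps rat_ring P T"
      by (rule qlinear_restrict[OF _ P], rule qlinearI) (simp_all add: T.scale_add_right T.M.add.m_ac)
    show "\<exists>!u. u \<in> linear_maps rat_ring P T \<and> compose (carrier V) u ?i = f \<and> compose (carrier W) u ?j = g"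
    proof (rule ex1I, intro conjI)
      show "?u \<in> linear_maps rat_ring P T" by (rule u)
      show "compose (carrier V) ?u ?i = f"
        by (rule extensionalityI[of _ "carrier V"]) (use f in \<open>simp_all add: compose_def\<close>)
      show "compose (carrier W) ?u ?j = g"
        by (rule extensionalityI[of _ "carrier W"]) (use g in \<open>simp_all add: compose_def\<close>)
      fix u' assume u': "u' \<in> linear_maps rat_ring P T \<and> compose (carrier V) u' ?i = f \<and> compose (carrier W) u' ?j = g"
      then have u'l: "qlinear P T u'" by (simp add: linear_maps_rat_iff)
      show "u' = ?u"
      proof (rule linear_maps_eqI[OF u'[THEN conjunct1] u])
        fix z assume z: "z \<in> carrier P"
        have "f (p z) = u' (i (p z))" "g (q z) = u' (j (q z))" using u' z by (auto simp: compose_def)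
        then show "u' z = ?u z" using qlinearD(2)[OF u'l, of "i (p z)" "j (q z)"] ij[OF z] z by simp
      qed
    qed
  qed (use P hom in auto)
  then show "\<exists>P i j. is_product (op_category (vector_spaces TYPE('a))) V W P i j" by blast
qed

subsection \<open>Kernels and quotients\<close>

lemma kernel_space:
  fixes V W :: "(rat, 'a) module"
  assumes "qspace V" "qspace W" "qlinear V W f"
  shows "qspace (V\<lparr>carrier := {x \<in> carrier V. f x = \<zero>\<^bsub>W\<^esub>}\<rparr>)"
proof -
  interpret V: qspace V by fact
  interpret W: qspace W by fact
  show ?thesis
    by (rule qspace_subspace[OF assms(1)])
      (auto simp: qlinear_zero[OF assms(3,1,2)] qlinearD[OF assms(3)])
qed

text \<open>
  The map \<open>k\<close> is an arbitrary injection and not an inclusion, so that the lemma applies to the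
  kernel of a linear map and also shows that every monomorphism is the kernel of its cokernel.
\<close>

lemma is_kernelI_subspace:
  fixes V W K :: "(rat, 'a) module"
  assumes V: "qspace V" and W: "qspace W" and K: "qspace K"
    and f: "f \<in> linear_maps rat_ring V W" and k: "k \<in> linear_maps rat_ring K V"
    and inj: "inj_on k (carrier K)" and im: "k ` carrier K = {x \<in> carrier V. f x = \<zero>\<^bsub>W\<^esub>}"
  shows "is_kernel (vector_spaces TYPE('a)) V W f K k"
  unfolding is_kernel_def
proof (intro conjI ballI impI)
  have mod: "left_module rat_ring K" using K by (simp add: left_module_rat_iff)
  interpret K: qspace K by fact
  interpret V: qspace V by fact
  have kl: "qlinear K V k" using k by (simp add: linear_maps_rat_iff)
  have "compose (carrier K) f k \<in> linear_maps rat_ring K W" by (rule linear_maps_compose[OF mod k f])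
  then show "zero_morphism (vector_spaces TYPE('a)) K W (Comp (vector_spaces TYPE('a)) K V W f k)"
    using im K W by (auto simp: zero_morphism_vector_spaces compose_def)
  fix T t assume "T \<in> Obj (vector_spaces TYPE('a))" and t': "t \<in> Hom (vector_spaces TYPE('a)) T V"
    and z: "zero_morphism (vector_spaces TYPE('a)) T W (Comp (vector_spaces TYPE('a)) T V W f t)"
  then have T: "qspace T" and t: "t \<in> linear_maps rat_ring T V" by simp_all
  interpret T: qspace T by fact
  have tl: "qlinear T V t" using t by (simp add: linear_maps_rat_iff)
  have "compose (carrier T) f t \<in> linear_maps rat_ring T W"
    by (rule linear_maps_compose[OF _ t f]) (use T in \<open>simp add: left_module_rat_iff\<close>)
  then have ft: "f (t x) = \<zero>\<^bsub>W\<^esub>" if "x \<in> carrier T" for x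
    using z that zero_morphism_vector_spaces[OF T W] by (auto simp: compose_def)
  let ?k' = "inv_into (carrier K) k"
  have k': "?k' (t x) \<in> carrier K" "k (?k' (t x)) = t x" if "x \<in> carrier T" for x
  proof -
    have "t x \<in> k ` carrier K" unfolding im using that ft qlinearD(1)[OF tl] by simp
    then show "?k' (t x) \<in> carrier K" "k (?k' (t x)) = t x"
      by (rule inv_into_into, rule f_inv_into_f)
  qed
  have lin: "qlinear T K (\<lambda>x. ?k' (t x))"
  proof (rule qlinearI)
    fix x y assume xy: "x \<in> carrier T" "y \<in> carrier T"
    show "?k' (t (x \<oplus>\<^bsub>T\<^esub> y)) = ?k' (t x) \<oplus>\<^bsub>K\<^esub> ?k' (t y)"
      by (rule inj_onD[OF inj])
        (use xy k'[of x] k'[of y] k'[of "x \<oplus>\<^bsub>T\<^esub> y"] in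
          \<open>simp_all add: qlinearD(2)[OF kl] qlinearD(2)[OF tl]\<close>)
  next
    fix a x assume x: "x \<in> carrier T"
    show "?k' (t (a \<odot>\<^bsub>T\<^esub> x)) = a \<odot>\<^bsub>K\<^esub> ?k' (t x)"
      by (rule inj_onD[OF inj])
        (use x k'[of x] k'[of "a \<odot>\<^bsub>T\<^esub> x"] in
          \<open>simp_all add: qlinearD(3)[OF kl] qlinearD(3)[OF tl]\<close>)
  qed (use k' in auto)
  let ?u = "\<lambda>x\<in>carrier T. ?k' (t x)"
  have u: "?u \<in> linear_maps rat_ring T K" by (rule qlinear_restrict[OF lin T])
  show "\<exists>!u. u \<in> Hom (vector_spaces TYPE('a)) T K \<and> Comp (vector_spaces TYPE('a)) T K V k u = t"
    unfolding vector_spaces_simps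
  proof (rule ex1I, rule conjI)
    show "?u \<in> linear_maps rat_ring T K" by (rule u)
    show "compose (carrier T) k ?u = t"
      by (rule extensionalityI[of _ "carrier T"]) (use t k' in \<open>simp_all add: compose_def\<close>)
    fix v assume v: "v \<in> linear_maps rat_ring T K \<and> compose (carrier T) k v = t"
    show "v = ?u"
    proof (rule linear_maps_eqI[OF v[THEN conjunct1] u])
      fix x assume x: "x \<in> carrier T"
      have "k (v x) = t x" using v x by (auto simp: compose_def)
      have "v x \<in> carrier K" using linear_maps_arr(1)[OF v[THEN conjunct1] x] .
      then have "?k' (k (v x)) = v x" by (rule inv_into_f_f[OF inj])
      then show "v x = ?u x" using x \<open>k (v x) = t x\<close> by simp
    qed
  qed
qed (use K k in simp_all)

text \<open>
  Again \<open>k\<close> is an arbitrary surjection, to cover the quotient map as well as an epimorphism, which is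
  the cokernel of its kernel.
\<close>

lemma is_cokernelI:
  fixes V W Q :: "(rat, 'a) module"
  assumes V: "qspace V" and W: "qspace W" and Q: "qspace Q"
    and f: "f \<in> linear_maps rat_ring V W" and k: "k \<in> linear_maps rat_ring W Q"
    and surj: "k ` carrier W = carrier Q" and ker: "{x \<in> carrier W. k x = \<zero>\<^bsub>Q\<^esub>} = f ` carrier V"
  shows "is_kernel (op_category (vector_spaces TYPE('a))) W V f Q k"
  unfolding is_kernel_def op_simps zero_morphism_op
proof (intro conjI ballI impI)
  have mod: "left_module rat_ring V" "left_module rat_ring W" using V W by (simp_all add: left_module_rat_iff)
  interpret V: qspace V by fact
  interpret W: qspace W by fact
  interpret Q: qspace Q by fact
  have kl: "qlinear W Q k" using k by (simp add: linear_maps_rat_iff)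
  have fk: "compose (carrier V) k f \<in> linear_maps rat_ring V Q" by (rule linear_maps_compose[OF mod(1) f k])
  have "k (f x) = \<zero>\<^bsub>Q\<^esub>" if "x \<in> carrier V" for x using that ker by blast
  then show "zero_morphism (vector_spaces TYPE('a)) V Q (Comp (vector_spaces TYPE('a)) V W Q k f)"
    using fk V Q by (simp add: zero_morphism_vector_spaces compose_def)
  fix T t assume "T \<in> Obj (vector_spaces TYPE('a))" and t': "t \<in> Hom (vector_spaces TYPE('a)) W T"
    and z: "zero_morphism (vector_spaces TYPE('a)) V T (Comp (vector_spaces TYPE('a)) V W T t f)"
  then have T: "qspace T" and t: "t \<in> linear_maps rat_ring W T" by simp_all
  interpret T: qspace T by fact
  have tl: "qlinear W T t" using t by (simp add: linear_maps_rat_iff)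
  have "compose (carrier V) t f \<in> linear_maps rat_ring V T"
    by (rule linear_maps_compose[OF mod(1) f t])
  then have tf: "t (f x) = \<zero>\<^bsub>T\<^esub>" if "x \<in> carrier V" for x
    using z that zero_morphism_vector_spaces[OF V T] by (auto simp: compose_def)
  have t_eq: "t x = t y" if "x \<in> carrier W" "y \<in> carrier W" "k x = k y" for x y
  proof -
    have "k (x \<oplus>\<^bsub>W\<^esub> (-1) \<odot>\<^bsub>W\<^esub> y) = \<zero>\<^bsub>Q\<^esub>"
      using that qlinearD(1)[OF kl that(2)] by (simp add: qlinearD(2,3)[OF kl])
    then have "x \<oplus>\<^bsub>W\<^esub> (-1) \<odot>\<^bsub>W\<^esub> y \<in> f ` carrier V" using that ker by auto
    then have "t (x \<oplus>\<^bsub>W\<^esub> (-1) \<odot>\<^bsub>W\<^esub> y) = \<zero>\<^bsub>T\<^esub>" using tf by auto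
    then have "t x \<oplus>\<^bsub>T\<^esub> (-1) \<odot>\<^bsub>T\<^esub> t y = \<zero>\<^bsub>T\<^esub>" using that by (simp add: qlinearD(2,3)[OF tl])
    then show ?thesis using that T.diff_eq_zero_iff qlinearD(1)[OF tl] by simp
  qed
  let ?k' = "inv_into (carrier W) k"
  have k': "?k' y \<in> carrier W" "k (?k' y) = y" if "y \<in> carrier Q" for y
  proof -
    have "y \<in> k ` carrier W" unfolding surj by (rule that)
    then show "?k' y \<in> carrier W" "k (?k' y) = y"
      by (rule inv_into_into, rule f_inv_into_f)
  qed
  have lin: "qlinear Q T (\<lambda>y. t (?k' y))"
  proof (rule qlinearI)
    fix x y assume xy: "x \<in> carrier Q" "y \<in> carrier Q"
    have "t (?k' (x \<oplus>\<^bsub>Q\<^esub> y)) = t (?k' x \<oplus>\<^bsub>W\<^esub> ?k' y)"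
      by (rule t_eq) (use xy k' in \<open>simp_all add: qlinearD(2)[OF kl]\<close>)
    then show "t (?k' (x \<oplus>\<^bsub>Q\<^esub> y)) = t (?k' x) \<oplus>\<^bsub>T\<^esub> t (?k' y)"
      using xy k' by (simp add: qlinearD(2)[OF tl])
  next
    fix a x assume x: "x \<in> carrier Q"
    have "t (?k' (a \<odot>\<^bsub>Q\<^esub> x)) = t (a \<odot>\<^bsub>W\<^esub> ?k' x)"
      by (rule t_eq) (use x k' in \<open>simp_all add: qlinearD(3)[OF kl]\<close>)
    then show "t (?k' (a \<odot>\<^bsub>Q\<^esub> x)) = a \<odot>\<^bsub>T\<^esub> t (?k' x)"
      using x k' by (simp add: qlinearD(3)[OF tl])
  qed (use k' qlinearD(1)[OF tl] in auto)
  let ?u = "\<lambda>y\<in>carrier Q. t (?k' y)"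
  have u: "?u \<in> linear_maps rat_ring Q T" by (rule qlinear_restrict[OF lin Q])
  show "\<exists>!u. u \<in> Hom (vector_spaces TYPE('a)) Q T \<and> Comp (vector_spaces TYPE('a)) W Q T u k = t"
    unfolding vector_spaces_simps
  proof (rule ex1I, rule conjI)
    show "?u \<in> linear_maps rat_ring Q T" by (rule u)
    show "compose (carrier W) ?u k = t"
      by (rule extensionalityI[of _ "carrier W"])
        (use t k' qlinearD(1)[OF kl] in \<open>auto simp: compose_def intro: t_eq\<close>)
    fix v assume v: "v \<in> linear_maps rat_ring Q T \<and> compose (carrier W) v k = t"
    show "v = ?u"
    proof (rule linear_maps_eqI[OF v[THEN conjunct1] u])
      fix y assume y: "y \<in> carrier Q"
      then have "v (k (?k' y)) = t (?k' y)" using v k' by (auto simp: compose_def)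
      then show "v y = ?u y" using y k' by simp
    qed
  qed
qed (use Q k in simp_all)

text \<open>
  The quotient by the image of \<open>f\<close> is realized on a set of representatives of the cosets.
\<close>

lemma quotient_exists:
  fixes W :: "(rat, 'a) module"
  assumes V: "qspace V" and W: "qspace W" and f: "qlinear V W f"
  obtains Q k where "qspace Q" "k \<in> linear_maps rat_ring W Q" "k ` carrier W = carrier Q"
    "{x \<in> carrier W. k x = \<zero>\<^bsub>Q\<^esub>} = f ` carrier V"
proof -
  interpret V: qspace V by fact
  interpret W: qspace W by fact
  note fl = qlinearD[OF f]
  define U where "U = f ` carrier V"
  have U: "U \<subseteq> carrier W" using fl(1) by (auto simp: U_def)
  have U0: "\<zero>\<^bsub>W\<^esub> \<in> U" unfolding U_def using qlinear_zero[OF f V W] by (metis V.M.zero_closed imageI)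
  have Uadd: "x \<oplus>\<^bsub>W\<^esub> y \<in> U" if "x \<in> U" "y \<in> U" for x y
    using that unfolding U_def by (auto simp flip: fl(2))
  have Usmult: "a \<odot>\<^bsub>W\<^esub> x \<in> U" if "x \<in> U" for x a
    using that unfolding U_def by (auto simp flip: fl(3))
  define d where "d x y = x \<oplus>\<^bsub>W\<^esub> (-1) \<odot>\<^bsub>W\<^esub> y" for x y
  \<comment> \<open>The choice depends only on the coset of \<open>x\<close>, because the predicate under the choice operator does.\<close>
  define \<rho> where "\<rho> x = (SOME y. y \<in> carrier W \<and> d x y \<in> U)" for x
  have \<rho>: "\<rho> x \<in> carrier W" "d x (\<rho> x) \<in> U" if "x \<in> carrier W" for x
    unfolding atomize_conj \<rho>_def by (rule someI[of _ x]) (use that U0 in \<open>simp add: d_def\<close>)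
  have d_sum: "d x z = d x y \<oplus>\<^bsub>W\<^esub> d y z" if "x \<in> carrier W" "y \<in> carrier W" "z \<in> carrier W" for x y z
  proof -
    have "d x y \<oplus>\<^bsub>W\<^esub> d y z = x \<oplus>\<^bsub>W\<^esub> ((y \<oplus>\<^bsub>W\<^esub> (-1) \<odot>\<^bsub>W\<^esub> y) \<oplus>\<^bsub>W\<^esub> (-1) \<odot>\<^bsub>W\<^esub> z)"
      unfolding d_def using that by (simp only: W.M.add.m_ac W.scale_closed W.M.add.m_closed)
    then show ?thesis using that by (simp add: d_def)
  qed
  have d_neg: "d y x = (-1) \<odot>\<^bsub>W\<^esub> d x y" if "x \<in> carrier W" "y \<in> carrier W" for x y
    using that by (simp add: d_def W.scale_add_right W.M.a_comm)
  have \<rho>_iff: "\<rho> x = \<rho> y \<longleftrightarrow> d x y \<in> U" if xy: "x \<in> carrier W" "y \<in> carrier W" for x y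
  proof
    assume "\<rho> x = \<rho> y"
    then have "d x y = d x (\<rho> x) \<oplus>\<^bsub>W\<^esub> (-1) \<odot>\<^bsub>W\<^esub> d y (\<rho> y)"
      using xy \<rho>(1) d_sum[of x "\<rho> x" y] d_neg[of y "\<rho> x"] by simp
    then show "d x y \<in> U" using xy \<rho>(2) Uadd Usmult by simp
  next
    assume *: "d x y \<in> U"
    have "d x z \<in> U \<longleftrightarrow> d y z \<in> U" if z: "z \<in> carrier W" for z
    proof
      assume "d y z \<in> U"
      then show "d x z \<in> U" using d_sum[OF xy z] Uadd * by simp
    next
      assume "d x z \<in> U"
      then show "d y z \<in> U" using d_sum[OF xy(2,1) z] Uadd Usmult * d_neg[OF xy] by simp
    qed
    then have "(\<lambda>z. z \<in> carrier W \<and> d x z \<in> U) = (\<lambda>z. z \<in> carrier W \<and> d y z \<in> U)" by blast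
    then show "\<rho> x = \<rho> y" unfolding \<rho>_def by simp
  qed
  have cong: "linear_congruence W \<rho>"
    unfolding linear_congruence_def
  proof (intro conjI ballI allI impI)
    fix x x' y y' assume c: "x \<in> carrier W" "x' \<in> carrier W" "y \<in> carrier W" "y' \<in> carrier W"
      and "\<rho> x = \<rho> x'" "\<rho> y = \<rho> y'"
    then have "d x x' \<oplus>\<^bsub>W\<^esub> d y y' \<in> U" using \<rho>_iff Uadd by simp
    moreover have "d (x \<oplus>\<^bsub>W\<^esub> y) (x' \<oplus>\<^bsub>W\<^esub> y') = d x x' \<oplus>\<^bsub>W\<^esub> d y y'"
      using c by (simp add: d_def W.scale_add_right W.M.add.m_ac)
    ultimately show "\<rho> (x \<oplus>\<^bsub>W\<^esub> y) = \<rho> (x' \<oplus>\<^bsub>W\<^esub> y')" using c \<rho>_iff by simp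
  next
    fix a x x' assume c: "x \<in> carrier W" "x' \<in> carrier W" and "\<rho> x = \<rho> x'"
    then have "a \<odot>\<^bsub>W\<^esub> d x x' \<in> U" using \<rho>_iff Usmult by simp
    moreover have "d (a \<odot>\<^bsub>W\<^esub> x) (a \<odot>\<^bsub>W\<^esub> x') = a \<odot>\<^bsub>W\<^esub> d x x'"
      using c by (simp add: d_def W.scale_add_right)
    ultimately show "\<rho> (a \<odot>\<^bsub>W\<^esub> x) = \<rho> (a \<odot>\<^bsub>W\<^esub> x')" using c \<rho>_iff by simp
  qed
  note Q = image_space[OF W cong]
  have "restrict \<rho> (carrier W) x = \<zero>\<^bsub>image_space \<rho> W\<^esub> \<longleftrightarrow> x \<in> U" if "x \<in> carrier W" for x
    using that \<rho>_iff[OF that W.M.zero_closed] by (simp add: Q(3) d_def)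
  then show thesis
    using U by (intro that[OF Q(1) qlinear_restrict[OF Q(2) W]]) (auto simp flip: U_def)
qed


text \<open>
  The inclusion of the kernel of \<open>k\<close> and the zero map become equal after composition with \<open>k\<close>.
\<close>

lemma vector_space_mono_inj:
  assumes V: "qspace V" and W: "qspace W" and m: "is_mono (vector_spaces TYPE('a)) V W k"
  shows "inj_on k (carrier V)"
proof -
  interpret V: qspace V by fact
  interpret W: qspace W by fact
  have k: "k \<in> linear_maps rat_ring V W" using m by (simp add: is_mono_def)
  have kl: "qlinear V W k" using k by (simp add: linear_maps_rat_iff)
  let ?N = "V\<lparr>carrier := {x \<in> carrier V. k x = \<zero>\<^bsub>W\<^esub>}\<rparr>"
  have N: "qspace ?N" by (rule kernel_space[OF V W kl])
  let ?i = "\<lambda>x\<in>carrier ?N. x" and ?z = "\<lambda>x\<in>carrier ?N. \<zero>\<^bsub>V\<^esub>"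
  have i: "?i \<in> linear_maps rat_ring ?N V"
    by (rule qlinear_restrict[OF _ N]) (simp add: qlinear_def)
  have z: "?z \<in> linear_maps rat_ring ?N V" by (rule linear_maps_const_zero[OF N V])
  have "compose (carrier ?N) k ?i = compose (carrier ?N) k ?z"
    by (auto simp: compose_def fun_eq_iff qlinear_zero[OF kl V W])
  then have "?i = ?z" using m i z N unfolding is_mono_def vector_spaces_simps by blast
  then have "?i x = ?z x" for x by (rule fun_cong)
  then have zero: "x = \<zero>\<^bsub>V\<^esub>" if "x \<in> carrier V" "k x = \<zero>\<^bsub>W\<^esub>" for x
    using that by (metis (mono_tags, lifting) mem_Collect_eq partial_object.select_convs(1)
        partial_object.surjective partial_object.update_convs(1) restrict_apply')
  show ?thesis
  proof (rule inj_onI)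
    fix x y assume xy: "x \<in> carrier V" "y \<in> carrier V" "k x = k y"
    then have "k (x \<oplus>\<^bsub>V\<^esub> (-1) \<odot>\<^bsub>V\<^esub> y) = \<zero>\<^bsub>W\<^esub>"
      using qlinearD(1)[OF kl xy(2)] by (simp add: qlinearD(2,3)[OF kl])
    then have "x \<oplus>\<^bsub>V\<^esub> (-1) \<odot>\<^bsub>V\<^esub> y = \<zero>\<^bsub>V\<^esub>" using xy by (intro zero) simp_all
    then show "x = y" using xy(1,2) by (simp only: V.diff_eq_zero_iff)
  qed
qed

text \<open>
  The quotient map modulo the image of \<open>k\<close> and the zero map become equal after composition with \<open>k\<close>.
\<close>

lemma vector_space_epi_surj:
  assumes V: "qspace V" and W: "qspace W" and m: "is_mono (op_category (vector_spaces TYPE('a))) W V k"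
  shows "k ` carrier V = carrier W"
proof -
  interpret V: qspace V by fact
  interpret W: qspace W by fact
  have k: "k \<in> linear_maps rat_ring V W" using m by (simp add: is_mono_def)
  have kl: "qlinear V W k" using k by (simp add: linear_maps_rat_iff)
  obtain Q q where Q: "qspace Q" "q \<in> linear_maps rat_ring W Q" "q ` carrier W = carrier Q"
    "{x \<in> carrier W. q x = \<zero>\<^bsub>Q\<^esub>} = k ` carrier V"
    by (rule quotient_exists[OF V W kl])
  let ?z = "\<lambda>x\<in>carrier W. \<zero>\<^bsub>Q\<^esub>"
  have z: "?z \<in> linear_maps rat_ring W Q" by (rule linear_maps_const_zero[OF W Q(1)])
  have "q (k x) = \<zero>\<^bsub>Q\<^esub>" if "x \<in> carrier V" for x using that Q(4) by blast
  then have "compose (carrier V) q k = compose (carrier V) ?z k"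
    using qlinearD(1)[OF kl] by (auto simp: compose_def fun_eq_iff)
  then have "q = ?z" using m z Q unfolding is_mono_def op_simps vector_spaces_simps by blast
  then have "{x \<in> carrier W. q x = \<zero>\<^bsub>Q\<^esub>} = carrier W" by auto
  then show ?thesis using Q(4) by simp
qed

lemma abelian_vector_spaces: "abelian_category (vector_spaces TYPE('a))"
  unfolding abelian_category_def left_abelian_def op_simps zero_object_op
proof (intro conjI ballI allI impI)
  have "zero_object (vector_spaces TYPE('a)) zero_space"
    by (rule zero_object_trivial[OF qspace_zero_space]) (simp add: zero_space_def)
  then show "\<exists>Z. zero_object (vector_spaces TYPE('a)) Z" by blast
  then show "\<exists>Z. zero_object (vector_spaces TYPE('a)) Z" .
next
  fix V W :: "(rat, 'a) module" assume VW: "V \<in> Obj (vector_spaces TYPE('a))" "W \<in> Obj (vector_spaces TYPE('a))"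
  then have V: "qspace V" and W: "qspace W" by simp_all
  show "\<exists>P p q. is_product (vector_spaces TYPE('a)) V W P p q"
    and "\<exists>P p q. is_product (op_category (vector_spaces TYPE('a))) V W P p q"
    using direct_sum[OF V W] by blast+
  show "\<exists>K k. is_kernel (vector_spaces TYPE('a)) V W f K k" if "f \<in> Hom (vector_spaces TYPE('a)) V W" for f
  proof -
    have f: "f \<in> linear_maps rat_ring V W" using that by simp
    let ?N = "V\<lparr>carrier := {x \<in> carrier V. f x = \<zero>\<^bsub>W\<^esub>}\<rparr>"
    have N: "qspace ?N" by (rule kernel_space[OF V W]) (use f in \<open>simp add: linear_maps_rat_iff\<close>)
    have i: "(\<lambda>x\<in>carrier ?N. x) \<in> linear_maps rat_ring ?N V"
      by (rule qlinear_restrict[OF _ N]) (simp add: qlinear_def)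
    show ?thesis
      using is_kernelI_subspace[OF V W N f i] by (auto simp: inj_on_def)
  qed
  show "\<exists>K k. is_kernel (op_category (vector_spaces TYPE('a))) V W f K k"
    if "f \<in> Hom (vector_spaces TYPE('a)) W V" for f
  proof -
    have f: "f \<in> linear_maps rat_ring W V" using that by simp
    then have "qlinear W V f" by (simp add: linear_maps_rat_iff)
    then obtain Q q where Q: "qspace Q" "q \<in> linear_maps rat_ring V Q" "q ` carrier V = carrier Q"
      "{x \<in> carrier V. q x = \<zero>\<^bsub>Q\<^esub>} = f ` carrier W"
      by (rule quotient_exists[OF W V])
    show ?thesis using is_cokernelI[OF W V Q(1) f Q(2-4)] by blast
  qed
  show "\<exists>Y\<in>Obj (vector_spaces TYPE('a)). \<exists>f\<in>Hom (vector_spaces TYPE('a)) W Y.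
      is_kernel (vector_spaces TYPE('a)) W Y f V k"
    if m: "is_mono (vector_spaces TYPE('a)) V W k" for k
  proof -
    have k: "k \<in> linear_maps rat_ring V W" using m by (simp add: is_mono_def)
    then have kl: "qlinear V W k" by (simp add: linear_maps_rat_iff)
    obtain Q q where Q: "qspace Q" "q \<in> linear_maps rat_ring W Q" "q ` carrier W = carrier Q"
      "{x \<in> carrier W. q x = \<zero>\<^bsub>Q\<^esub>} = k ` carrier V"
      by (rule quotient_exists[OF V W kl])
    have "is_kernel (vector_spaces TYPE('a)) W Q q V k"
      by (rule is_kernelI_subspace[OF W Q(1) V Q(2) k vector_space_mono_inj[OF V W m] Q(4)[symmetric]])
    then show ?thesis using Q by auto
  qed
  show "\<exists>Y\<in>Obj (vector_spaces TYPE('a)). \<exists>f\<in>Hom (vector_spaces TYPE('a)) Y W.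
      is_kernel (op_category (vector_spaces TYPE('a))) W Y f V k"
    if m: "is_mono (op_category (vector_spaces TYPE('a))) V W k" for k
  proof -
    have k: "k \<in> linear_maps rat_ring W V" using m by (simp add: is_mono_def)
    then have kl: "qlinear W V k" by (simp add: linear_maps_rat_iff)
    let ?N = "W\<lparr>carrier := {x \<in> carrier W. k x = \<zero>\<^bsub>V\<^esub>}\<rparr>"
    have N: "qspace ?N" by (rule kernel_space[OF W V kl])
    have i: "(\<lambda>x\<in>carrier ?N. x) \<in> linear_maps rat_ring ?N W"
      by (rule qlinear_restrict[OF _ N]) (simp add: qlinear_def)
    have "is_kernel (op_category (vector_spaces TYPE('a))) W ?N (\<lambda>x\<in>carrier ?N. x) V k"
      by (rule is_cokernelI[OF N W V i k vector_space_epi_surj[OF W V m]]) auto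
    then show ?thesis using N i by auto
  qed
qed (use is_category_vector_spaces in auto)

section \<open>Modules over an algebra given by a presentation\<close>

lemma free_algebra_simps:
  "carrier (free_algebra S) = {p. \<forall>w\<in>Poly_Mapping.keys p. set (letters w) \<subseteq> S}"
  "p \<otimes>\<^bsub>free_algebra S\<^esub> q = p * q" "p \<oplus>\<^bsub>free_algebra S\<^esub> q = p + q" "\<one>\<^bsub>free_algebra S\<^esub> = 1" "\<zero>\<^bsub>free_algebra S\<^esub> = 0"
  by (simp_all add: free_algebra_def)

lemma zero_in_free_algebra: "0 \<in> carrier (free_algebra S)"
  by (simp add: free_algebra_simps)

lemma single_in_free_algebra:
  "set (letters w) \<subseteq> S \<Longrightarrow> Poly_Mapping.single w c \<in> carrier (free_algebra S)"
  by (simp add: free_algebra_simps)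

lemma single_Cons:
  "Poly_Mapping.single (Word (s # l)) c = gen s * Poly_Mapping.single (Word l) c"
  by (simp add: gen_def mult_single plus_word_def)

lemma single_Nil: "Poly_Mapping.single (Word []) c = scalar c"
  by (simp add: scalar_def zero_word_def)

lemma scalar_gen: "scalar a * gen s = gen s * scalar a"
  by (simp add: scalar_def gen_def mult_single)

lemma scalar_mult: "scalar (a * b) = scalar a * scalar b"
  by (simp add: scalar_def mult_single)

lemma scalar_add: "scalar (a + b) = scalar a + scalar b"
  by (simp add: scalar_def single_add)

lemma scalar_one: "scalar 1 = 1"
  by (simp add: scalar_def)

lemma scalar_minus_one_mult: "scalar (- 1) * p = - p"
proof -
  have "(scalar 1 + scalar (- 1)) * p = 0" unfolding scalar_add[symmetric] by (simp add: scalar_def)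
  then show ?thesis by (simp add: scalar_one algebra_simps add_eq_0_iff)
qed

lemma free_algebra_span [consumes 1, case_names zero add single]:
  assumes "p \<in> carrier (free_algebra S)"
    and zero: "R 0"
    and add: "\<And>p q. \<lbrakk>p \<in> carrier (free_algebra S); q \<in> carrier (free_algebra S); R p; R q\<rbrakk> \<Longrightarrow> R (p + q)"
    and single: "\<And>l c. set l \<subseteq> S \<Longrightarrow> R (Poly_Mapping.single (Word l) c)"
  shows "R p"
  using assms(1)
proof (induction p rule: update_induct)
  case const then show ?case using zero by simp
next
  case (update p w c)
  have eq: "Poly_Mapping.update w c p = p + Poly_Mapping.single w c"
    using update(1) by (intro poly_mapping_eqI)
      (auto simp: lookup_update lookup_add lookup_single when_def in_keys_iff)
  have "Poly_Mapping.keys (Poly_Mapping.update w c p) = insert w (Poly_Mapping.keys p)"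
    using update(1,2) by (auto simp: in_keys_iff lookup_update split: if_splits)
  then have p: "p \<in> carrier (free_algebra S)" and w: "set (letters w) \<subseteq> S"
    using update.prems by (auto simp: free_algebra_simps)
  then show ?case unfolding eq
    using add[OF p single_in_free_algebra[OF w] update.IH[OF p]] single[OF w, of c] by (cases w) simp
qed

lemma free_algebra_induct [consumes 1, case_names scalar gen add mult]:
  assumes "p \<in> carrier (free_algebra S)"
    and scalar: "\<And>c. R (scalar c)" and gen: "\<And>s. s \<in> S \<Longrightarrow> R (gen s)"
    and add: "\<And>p q. \<lbrakk>p \<in> carrier (free_algebra S); q \<in> carrier (free_algebra S); R p; R q\<rbrakk> \<Longrightarrow> R (p + q)"
    and mult: "\<And>p q. \<lbrakk>p \<in> carrier (free_algebra S); q \<in> carrier (free_algebra S); R p; R q\<rbrakk> \<Longrightarrow> R (p * q)"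
  shows "R p"
  using assms(1)
proof (induction rule: free_algebra_span)
  case zero
  then show ?case using scalar[of 0] by (simp add: scalar_def)
next
  case (single l c)
  then show ?case
  proof (induction l)
    case Nil then show ?case using scalar by (simp add: single_Nil)
  next
    case (Cons s l)
    then show ?case unfolding single_Cons
      by (intro mult gen_in_free_algebra single_in_free_algebra gen) auto
  qed
qed (use add in blast)

locale presentation =
  fixes P :: "'g presentation"
  assumes relators: "snd P \<subseteq> carrier (free_algebra (fst P))"
begin

abbreviation "F \<equiv> free_algebra (fst P)"
abbreviation "A \<equiv> presented_algebra P"
abbreviation "rc \<equiv> residue_class P"

lemma ideal_relation: "ideal (relation_ideal P) F"
  unfolding relation_ideal_def by (rule ring.genideal_ideal[OF free_algebra_ring relators])

lemma rc_closed [simp]: "p \<in> carrier F \<Longrightarrow> rc p \<in> carrier A"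
  using ring_hom_closed[OF ideal.rcos_ring_hom[OF ideal_relation]]
  by (simp add: presented_algebra_def residue_class_def)

lemma rc_add: "\<lbrakk>p \<in> carrier F; q \<in> carrier F\<rbrakk> \<Longrightarrow> rc (p + q) = rc p \<oplus>\<^bsub>A\<^esub> rc q"
  using ring_hom_add[OF ideal.rcos_ring_hom[OF ideal_relation]]
  by (simp add: presented_algebra_def residue_class_def free_algebra_simps)

lemma rc_mult: "\<lbrakk>p \<in> carrier F; q \<in> carrier F\<rbrakk> \<Longrightarrow> rc (p * q) = rc p \<otimes>\<^bsub>A\<^esub> rc q"
  using ring_hom_mult[OF ideal.rcos_ring_hom[OF ideal_relation]]
  by (simp add: presented_algebra_def residue_class_def free_algebra_simps)

lemma rc_one: "rc 1 = \<one>\<^bsub>A\<^esub>"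
  using ring_hom_one[OF ideal.rcos_ring_hom[OF ideal_relation]]
  by (simp add: presented_algebra_def residue_class_def free_algebra_simps)

lemma carrier_A: "C \<in> carrier A \<Longrightarrow> \<exists>p\<in>carrier F. C = rc p"
  by (auto simp: presented_algebra_def FactRing_def A_RCOSETS_def' residue_class_def)

lemma ring_A: "ring A"
  by (rule presented_algebra_ring[OF relators])

lemma mem_rc: "q \<in> rc p \<Longrightarrow> \<exists>i\<in>relation_ideal P. q = i + p"
  by (auto simp: residue_class_def a_r_coset_def' free_algebra_simps)

lemma self_in_rc: "p \<in> carrier F \<Longrightarrow> p \<in> rc p"
  using additive_subgroup.zero_closed[OF ideal.axioms(1)[OF ideal_relation]]
  by (force simp: residue_class_def a_r_coset_def' free_algebra_simps)

lemma rc_ideal: "i \<in> relation_ideal P \<Longrightarrow> rc i = \<zero>\<^bsub>A\<^esub>"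
proof -
  assume i: "i \<in> relation_ideal P"
  interpret I: ideal "relation_ideal P" F by (rule ideal_relation)
  have "rc i = relation_ideal P"
    unfolding residue_class_def
    by (rule I.a_coset_join2) (use i I.a_Hcarr I.a_subgroup in auto)
  then show ?thesis by (simp add: presented_algebra_def FactRing_def)
qed

lemma rc_zero: "rc 0 = \<zero>\<^bsub>A\<^esub>"
  using additive_subgroup.zero_closed[OF ideal.axioms(1)[OF ideal_relation]]
  by (intro rc_ideal) (simp add: free_algebra_simps)

lemma rc_relator: "r \<in> snd P \<Longrightarrow> rc r = \<zero>\<^bsub>A\<^esub>"
  using ring.genideal_self[OF free_algebra_ring relators]
  by (intro rc_ideal) (auto simp: relation_ideal_def)

end

subsection \<open>From modules to operators\<close>

abbreviation underlying :: "'g presentation \<Rightarrow> ('g ncpoly set, 'a) module \<Rightarrow> (rat, 'a) module" where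
  "underlying P M \<equiv> rational_subspace P M (carrier M)"

lemma rational_subspace_simps [simp]:
  "carrier (rational_subspace P M V) = V" "\<zero>\<^bsub>rational_subspace P M V\<^esub> = \<zero>\<^bsub>M\<^esub>"
  "x \<oplus>\<^bsub>rational_subspace P M V\<^esub> y = x \<oplus>\<^bsub>M\<^esub> y"
  "a \<odot>\<^bsub>rational_subspace P M V\<^esub> x = residue_class P (scalar a) \<odot>\<^bsub>M\<^esub> x"
  by (simp_all add: rational_subspace_def)

locale presented_module = presentation P + left_module "presented_algebra P" M
  for P :: "'g presentation" and M :: "('g ncpoly set, 'a) module"
begin

lemma rc_action:
  assumes "x \<in> carrier M"
  shows "p \<in> carrier F \<Longrightarrow> rc p \<odot>\<^bsub>M\<^esub> x \<in> carrier M"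
    "\<lbrakk>p \<in> carrier F; q \<in> carrier F\<rbrakk> \<Longrightarrow> rc (p + q) \<odot>\<^bsub>M\<^esub> x = rc p \<odot>\<^bsub>M\<^esub> x \<oplus>\<^bsub>M\<^esub> rc q \<odot>\<^bsub>M\<^esub> x"
    "\<lbrakk>p \<in> carrier F; q \<in> carrier F\<rbrakk> \<Longrightarrow> rc (p * q) \<odot>\<^bsub>M\<^esub> x = rc p \<odot>\<^bsub>M\<^esub> (rc q \<odot>\<^bsub>M\<^esub> x)"
    "rc 1 \<odot>\<^bsub>M\<^esub> x = x"
    "\<lbrakk>y \<in> carrier M; p \<in> carrier F\<rbrakk> \<Longrightarrow> rc p \<odot>\<^bsub>M\<^esub> (x \<oplus>\<^bsub>M\<^esub> y) = rc p \<odot>\<^bsub>M\<^esub> x \<oplus>\<^bsub>M\<^esub> rc p \<odot>\<^bsub>M\<^esub> y"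
  using assms by (simp_all add: rc_add rc_mult rc_one smult_closed smult_l_distr smult_r_distr smult_assoc1 smult_one)

lemma zero_action: "x \<in> carrier M \<Longrightarrow> \<zero>\<^bsub>A\<^esub> \<odot>\<^bsub>M\<^esub> x = \<zero>\<^bsub>M\<^esub>"
  using smult_l_distr[of "\<zero>\<^bsub>A\<^esub>" "\<zero>\<^bsub>A\<^esub>" x] smult_closed[of "\<zero>\<^bsub>A\<^esub>" x]
  by (simp add: M.add.l_cancel_one')

lemma relator_action: "\<lbrakk>r \<in> snd P; x \<in> carrier M\<rbrakk> \<Longrightarrow> rc r \<odot>\<^bsub>M\<^esub> x = \<zero>\<^bsub>M\<^esub>"
  by (simp add: rc_relator zero_action)

lemma qspace_underlying: "qspace (underlying P M)"
proof (rule qspace_intro)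
  fix x assume x: "x \<in> carrier (underlying P M)"
  have "scalar (- 1) + scalar 1 = (0 :: 'g ncpoly)" unfolding scalar_add[symmetric] by (simp add: scalar_def)
  then have "rc (scalar (- 1) + scalar 1) = \<zero>\<^bsub>A\<^esub>" by (simp only: rc_zero)
  then have "rc (scalar (- 1) + scalar 1) \<odot>\<^bsub>M\<^esub> x = \<zero>\<^bsub>M\<^esub>" using x by (simp add: zero_action)
  then show "(-1) \<odot>\<^bsub>underlying P M\<^esub> x \<oplus>\<^bsub>underlying P M\<^esub> x = \<zero>\<^bsub>underlying P M\<^esub>"
    using x by (simp add: rc_action scalar_in_free_algebra) (simp add: scalar_one rc_action)
qed (simp_all add: rc_action scalar_in_free_algebra scalar_mult scalar_add M.add.m_ac,
  simp_all add: scalar_one rc_action)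

lemma qlinear_action:
  assumes "p \<in> carrier F" "\<And>a. scalar a * p = p * scalar a"
  shows "qlinear (underlying P M) (underlying P M) (\<lambda>x. rc p \<odot>\<^bsub>M\<^esub> x)"
  using assms(1) by (intro qlinearI)
    (simp_all add: rc_action scalar_in_free_algebra flip: rc_action(3) assms(2))

lemma qlinear_act: "s \<in> fst P \<Longrightarrow> qlinear (underlying P M) (underlying P M) (act P M s)"
  unfolding act_def by (intro qlinear_action gen_in_free_algebra scalar_gen)

lemma diff_action:
  assumes "x \<in> carrier M" "p \<in> carrier F" "q \<in> carrier F"
  shows "rc (p - q) \<odot>\<^bsub>M\<^esub> x = rc p \<odot>\<^bsub>M\<^esub> x \<oplus>\<^bsub>M\<^esub> (-1) \<odot>\<^bsub>underlying P M\<^esub> (rc q \<odot>\<^bsub>M\<^esub> x)"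
proof -
  have "rc (p - q) \<odot>\<^bsub>M\<^esub> x = rc (p + scalar (- 1) * q) \<odot>\<^bsub>M\<^esub> x"
    by (simp add: scalar_minus_one_mult)
  then show ?thesis using assms by (simp add: rc_action free_algebra_closed scalar_in_free_algebra)
qed

end

lemma (in presented_module) gen_gen_action:
  "\<lbrakk>s \<in> fst P; t \<in> fst P; x \<in> carrier M\<rbrakk> \<Longrightarrow> rc (gen s * gen t) \<odot>\<^bsub>M\<^esub> x = act P M s (act P M t x)"
  by (simp add: act_def rc_action gen_in_free_algebra)

lemma (in presented_module) act_closed:
  "\<lbrakk>s \<in> fst P; x \<in> carrier M\<rbrakk> \<Longrightarrow> act P M s x \<in> carrier M"
  by (simp add: act_def rc_action gen_in_free_algebra)

text \<open>
  The elements of the free algebra that commute with \<open>f\<close> are closed under sums and products, so it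
  suffices to consider generators and scalars.
\<close>

lemma linear_maps_presented_iff:
  assumes "presented_module P M" "presented_module P N"
  shows "f \<in> linear_maps (presented_algebra P) M N \<longleftrightarrow>
     qlinear (underlying P M) (underlying P N) f \<and> f \<in> extensional (carrier M) \<and>
     (\<forall>s\<in>fst P. \<forall>x\<in>carrier M. f (act P M s x) = act P N s (f x))"
proof -
  interpret M: presented_module P M by fact
  interpret N: presented_module P N by fact
  show ?thesis
  proof
    assume f: "f \<in> linear_maps (presented_algebra P) M N"
    have "f x \<in> carrier N" "f \<in> extensional (carrier M)" if "x \<in> carrier M" for x
      using linear_maps_arr[OF f] that by auto
    moreover have "f (x \<oplus>\<^bsub>M\<^esub> y) = f x \<oplus>\<^bsub>N\<^esub> f y" if "x \<in> carrier M" "y \<in> carrier M" for x y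
      using f that unfolding linear_maps_def by blast
    moreover have "f (M.rc p \<odot>\<^bsub>M\<^esub> x) = M.rc p \<odot>\<^bsub>N\<^esub> f x" if "p \<in> carrier M.F" "x \<in> carrier M" for p x
      using f that M.rc_closed unfolding linear_maps_def by blast
    ultimately show "qlinear (underlying P M) (underlying P N) f \<and> f \<in> extensional (carrier M) \<and>
     (\<forall>s\<in>fst P. \<forall>x\<in>carrier M. f (act P M s x) = act P N s (f x))"
      using linear_maps_arr(2)[OF f]
      by (simp add: qlinear_def act_def scalar_in_free_algebra gen_in_free_algebra)
  next
    assume f: "qlinear (underlying P M) (underlying P N) f \<and> f \<in> extensional (carrier M) \<and>
     (\<forall>s\<in>fst P. \<forall>x\<in>carrier M. f (act P M s x) = act P N s (f x))"
    then have lin: "qlinear (underlying P M) (underlying P N) f"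
      and act: "\<And>s x. \<lbrakk>s \<in> fst P; x \<in> carrier M\<rbrakk> \<Longrightarrow> f (act P M s x) = act P N s (f x)" by auto
    note lin' [simp] = qlinearD[OF lin, simplified]
    have rc: "\<And>x. x \<in> carrier M \<Longrightarrow> f (M.rc p \<odot>\<^bsub>M\<^esub> x) = M.rc p \<odot>\<^bsub>N\<^esub> f x" if "p \<in> carrier M.F" for p
      using that
    proof (induction rule: free_algebra_induct)
      case (scalar c x) then show ?case by simp
    next
      case (gen s x) then show ?case using act by (simp add: act_def)
    next
      case (add p q x)
      then show ?case by (simp add: M.rc_action N.rc_action)
    next
      case (mult p q x)
      then show ?case by (simp add: M.rc_action N.rc_action)
    qed
    have "f (C \<odot>\<^bsub>M\<^esub> x) = C \<odot>\<^bsub>N\<^esub> f x" if C: "C \<in> carrier M.A" "x \<in> carrier M" for C x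
      using M.carrier_A[OF C(1)] rc C(2) by blast
    then show "f \<in> linear_maps (presented_algebra P) M N"
      using f unfolding linear_maps_def by (simp add: PiE_iff)
  qed
qed

subsection \<open>From operators to modules\<close>

locale operators = presentation P + qspace V
  for P :: "'g presentation" and V :: "(rat, 'b) module" (structure) +
  fixes T :: "'g \<Rightarrow> 'b \<Rightarrow> 'b"
  assumes T_linear: "s \<in> fst P \<Longrightarrow> qlinear V V (T s)"
begin

definition ev :: "'g ncpoly \<Rightarrow> 'b \<Rightarrow> 'b" where
  "ev p x = (\<Oplus>w\<in>Poly_Mapping.keys p. Poly_Mapping.lookup p w \<odot> foldr T (letters w) x)"

lemma qlinear_word: "set l \<subseteq> fst P \<Longrightarrow> qlinear V V (foldr T l)"
proof (induction l)
  case (Cons s l)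
  then show ?case using qlinear_comp[of V V "foldr T l" V "T s"] T_linear by (simp add: o_def)
qed (simp add: qlinear_def)

lemma word_closed [simp]: "\<lbrakk>set l \<subseteq> fst P; x \<in> carrier V\<rbrakk> \<Longrightarrow> foldr T l x \<in> carrier V"
  using qlinear_word by (rule qlinearD(1))

lemma ev_superset:
  assumes "finite B" "Poly_Mapping.keys p \<subseteq> B" "\<And>w. w \<in> B \<Longrightarrow> set (letters w) \<subseteq> fst P" "x \<in> carrier V"
  shows "ev p x = (\<Oplus>w\<in>B. Poly_Mapping.lookup p w \<odot> foldr T (letters w) x)"
  unfolding ev_def
  by (rule M.add.finprod_mono_neutral_cong_left) (use assms in \<open>auto simp: in_keys_iff\<close>)

lemma ev_closed [simp]: "\<lbrakk>p \<in> carrier F; x \<in> carrier V\<rbrakk> \<Longrightarrow> ev p x \<in> carrier V"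
  unfolding ev_def by (rule M.finsum_closed) (auto simp: free_algebra_simps)

lemma ev_zero [simp]: "ev 0 x = \<zero>"
  by (simp add: ev_def)

lemma ev_add:
  assumes "p \<in> carrier F" "q \<in> carrier F" "x \<in> carrier V"
  shows "ev (p + q) x = ev p x \<oplus> ev q x"
proof -
  let ?B = "Poly_Mapping.keys p \<union> Poly_Mapping.keys q"
  have B: "finite ?B" "set (letters w) \<subseteq> fst P" if "w \<in> ?B" for w
    using assms that by (auto simp: free_algebra_simps)
  have fin: "finite ?B" by simp
  have "ev (p + q) x = (\<Oplus>w\<in>?B. Poly_Mapping.lookup (p + q) w \<odot> foldr T (letters w) x)"
    by (rule ev_superset) (use B assms Poly_Mapping.keys_add[of p q] in auto)
  also have "\<dots> = (\<Oplus>w\<in>?B. Poly_Mapping.lookup p w \<odot> foldr T (letters w) x \<oplus> Poly_Mapping.lookup q w \<odot> foldr T (letters w) x)"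
    by (rule M.finsum_cong) (use B assms in \<open>auto simp: lookup_add scale_add_left simp_implies_def\<close>)
  also have "\<dots> = (\<Oplus>w\<in>?B. Poly_Mapping.lookup p w \<odot> foldr T (letters w) x) \<oplus> (\<Oplus>w\<in>?B. Poly_Mapping.lookup q w \<odot> foldr T (letters w) x)"
    by (rule M.finsum_addf) (use B assms in auto)
  also have "\<dots> = ev p x \<oplus> ev q x"
    using ev_superset[of ?B p x] ev_superset[of ?B q x] B assms fin by simp
  finally show ?thesis .
qed

lemma ev_single: 
  assumes "set l \<subseteq> fst P" "x \<in> carrier V"
  shows "ev (Poly_Mapping.single (Word l) c) x = c \<odot> foldr T l x"
proof -
  have "ev (Poly_Mapping.single (Word l) c) x =
      (\<Oplus>w\<in>{Word l}. Poly_Mapping.lookup (Poly_Mapping.single (Word l) c) w \<odot> foldr T (letters w) x)"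
    by (rule ev_superset) (use assms in \<open>auto\<close>)
  then show ?thesis using assms by simp
qed

lemma ev_gen: "\<lbrakk>s \<in> fst P; x \<in> carrier V\<rbrakk> \<Longrightarrow> ev (gen s) x = T s x"
  using qlinearD(1)[OF T_linear, of s x] by (simp add: gen_def ev_single)

lemma ev_scalar: "x \<in> carrier V \<Longrightarrow> ev (scalar c) x = c \<odot> x"
  using ev_single[of "[]" x c] by (simp add: single_Nil)

lemma ev_one: "x \<in> carrier V \<Longrightarrow> ev 1 x = x"
  using ev_scalar[of x 1] by (simp add: scalar_one)

lemma qlinear_ev: "p \<in> carrier F \<Longrightarrow> qlinear V V (ev p)"
proof (induction rule: free_algebra_span)
  case zero then show ?case by (simp add: qlinear_def)
next
  case (add p q)
  show ?case
    by (rule qlinearI)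
      (use add.hyps in \<open>simp_all add: ev_add qlinearD[OF add.IH(1)] qlinearD[OF add.IH(2)] scale_add_right M.add.m_ac\<close>)
next
  case (single l c)
  show ?case
    by (rule qlinearI)
      (use single in \<open>simp_all add: ev_single qlinearD(2,3)[OF qlinear_word] scale_add_right mult.commute\<close>)
qed

lemma ev_gen_mult:
  assumes "q \<in> carrier F" "s \<in> fst P" "x \<in> carrier V"
  shows "ev (gen s * q) x = T s (ev q x)"
  using assms(1)
proof (induction rule: free_algebra_span)
  case zero
  then show ?case using qlinear_zero[OF T_linear[OF assms(2)] qspace_axioms qspace_axioms] by simp
next
  case (add p q)
  then show ?case
    using assms(2,3) by (simp add: distrib_left ev_add free_algebra_closed gen_in_free_algebra qlinearD(2)[OF T_linear])
next
  case (single l c)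
  then show ?case
    using assms(2,3) unfolding single_Cons[symmetric] by (simp add: ev_single qlinearD(3)[OF T_linear])
qed

lemma ev_scalar_mult:
  assumes "q \<in> carrier F" "x \<in> carrier V"
  shows "ev (scalar c * q) x = c \<odot> ev q x"
  using assms(1)
proof (induction rule: free_algebra_span)
  case (add p q)
  then show ?case
    using assms(2) by (simp add: distrib_left ev_add free_algebra_closed scalar_in_free_algebra scale_add_right)
next
  case (single l d)
  have "scalar c * Poly_Mapping.single (Word l) d = Poly_Mapping.single (Word l) (c * d)"
    by (simp add: scalar_def mult_single)
  then show ?case using single assms(2) by (simp add: ev_single)
qed simp

lemma ev_mult:
  assumes "p \<in> carrier F" "q \<in> carrier F" "x \<in> carrier V"
  shows "ev (p * q) x = ev p (ev q x)"
  using assms(1)  assms(2,3)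
proof (induction arbitrary: q x rule: free_algebra_induct)
  case (scalar c) then show ?case by (simp add: ev_scalar_mult ev_scalar)
next
  case (gen s) then show ?case by (simp add: ev_gen_mult ev_gen)
next
  case (add p p')
  then show ?case by (simp add: distrib_right ev_add free_algebra_closed)
next
  case (mult p p')
  then show ?case by (simp add: mult.assoc free_algebra_closed)
qed

lemma ev_diff:
  assumes "p \<in> carrier F" "q \<in> carrier F" "x \<in> carrier V"
  shows "ev (p - q) x = ev p x \<oplus> (- 1) \<odot> ev q x"
proof -
  have "ev (p - q) x = ev (p + scalar (- 1) * q) x" by (simp add: scalar_minus_one_mult)
  then show ?thesis using assms by (simp add: ev_add ev_scalar_mult free_algebra_closed scalar_in_free_algebra)
qed

text \<open>
  An element of the presented algebra is a coset of polynomials. It acts through an arbitrary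
  representative; this is meaningful once all relators act by zero.
\<close>

definition op_module :: "('g ncpoly set, 'b) module" where
  "op_module = \<lparr>carrier = carrier V, mult = undefined, one = undefined, zero = \<zero>, add = add V,
     smult = (\<lambda>C x. ev (SOME p. p \<in> C) x)\<rparr>"

lemma op_module_simps [simp]:
  "carrier op_module = carrier V" "\<zero>\<^bsub>op_module\<^esub> = \<zero>" "x \<oplus>\<^bsub>op_module\<^esub> y = x \<oplus> y"
  by (simp_all add: op_module_def)

end

lemma (in operators) ev_gen_gen:
  assumes "s \<in> fst P" "t \<in> fst P" "x \<in> carrier V"
  shows "ev (gen s * gen t) x = T s (T t x)"
  using assms qlinearD(1)[OF T_linear, of t x] by (simp add: ev_mult gen_in_free_algebra ev_gen)

locale representation = operators +
  assumes relation: "\<lbrakk>r \<in> snd P; x \<in> carrier V\<rbrakk> \<Longrightarrow> ev r x = \<zero>"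
begin

text \<open>
  As the polynomials that act by zero form an ideal, they contain the whole relation ideal as soon as
  they contain the relators.
\<close>

lemma ideal_annihilator: "ideal {p \<in> carrier F. \<forall>x\<in>carrier V. ev p x = \<zero>} F"
proof (rule idealI[OF free_algebra_ring])
  interpret R: ring F by (rule free_algebra_ring)
  show "subgroup {p \<in> carrier F. \<forall>x\<in>carrier V. ev p x = \<zero>} (add_monoid F)"
  proof (rule R.add.subgroupI)
    fix p assume p: "p \<in> {p \<in> carrier F. \<forall>x\<in>carrier V. ev p x = \<zero>}"
    then have pF: "p \<in> carrier F" by simp
    have sF: "scalar (- 1) * p \<in> carrier F" by (rule free_algebra_closed(3)[OF scalar_in_free_algebra pF])
    have "\<ominus>\<^bsub>F\<^esub> p = scalar (- 1) * p"
      by (rule R.minus_equality[OF _ pF sF]) (simp add: free_algebra_simps(3,5) scalar_minus_one_mult)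
    then show "\<ominus>\<^bsub>F\<^esub> p \<in> {p \<in> carrier F. \<forall>x\<in>carrier V. ev p x = \<zero>}"
      using p by (simp add: ev_scalar_mult free_algebra_closed scalar_in_free_algebra)
  qed (auto simp: ev_add free_algebra_closed free_algebra_simps(3) zero_in_free_algebra intro: exI[of _ 0])
next
  fix p q assume pq: "p \<in> {p \<in> carrier F. \<forall>x\<in>carrier V. ev p x = \<zero>}" "q \<in> carrier F"
  have "ev q \<zero> = \<zero>" using qlinear_zero[OF qlinear_ev[OF pq(2)] qspace_axioms qspace_axioms] .
  then show "q \<otimes>\<^bsub>F\<^esub> p \<in> {p \<in> carrier F. \<forall>x\<in>carrier V. ev p x = \<zero>}"
    "p \<otimes>\<^bsub>F\<^esub> q \<in> {p \<in> carrier F. \<forall>x\<in>carrier V. ev p x = \<zero>}"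
    using pq by (simp_all add: free_algebra_simps(2) free_algebra_closed ev_mult)
qed

lemma ev_relation_ideal:
  assumes "i \<in> relation_ideal P" "x \<in> carrier V"
  shows "i \<in> carrier F" "ev i x = \<zero>"
proof -
  have "relation_ideal P \<subseteq> {p \<in> carrier F. \<forall>x\<in>carrier V. ev p x = \<zero>}"
    unfolding relation_ideal_def
    by (rule ring.genideal_minimal[OF free_algebra_ring ideal_annihilator]) (use relators relation in blast)
  then show "i \<in> carrier F" "ev i x = \<zero>" using assms by auto
qed

lemma op_module_action:
  assumes "p \<in> carrier F" "x \<in> carrier V"
  shows "rc p \<odot>\<^bsub>op_module\<^esub> x = ev p x"
proof -
  have "(SOME q. q \<in> rc p) \<in> rc p" by (rule someI) (rule self_in_rc[OF assms(1)])
  then obtain i where "i \<in> relation_ideal P" "(SOME q. q \<in> rc p) = i + p" using mem_rc by blast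
  then show ?thesis using assms ev_relation_ideal[of i x] by (simp add: op_module_def ev_add)
qed

lemma op_module_act: "\<lbrakk>s \<in> fst P; x \<in> carrier V\<rbrakk> \<Longrightarrow> act P op_module s x = T s x"
  by (simp add: act_def op_module_action gen_in_free_algebra ev_gen)

lemma op_module_scalar: "x \<in> carrier V \<Longrightarrow> rc (scalar a) \<odot>\<^bsub>op_module\<^esub> x = a \<odot> x"
  by (simp add: op_module_action scalar_in_free_algebra ev_scalar)

lemma left_module_op_module: "left_module A op_module"
proof (intro left_module.intro left_module_axioms.intro ring_A)
  show "abelian_group op_module"
    by (rule abelian_groupI) (auto simp: M.add.m_ac intro: bexI[of _ "(- 1) \<odot> _"])
  fix C x assume C: "C \<in> carrier A" and x: "x \<in> carrier op_module"
  obtain p where p: "p \<in> carrier F" "C = rc p" using carrier_A[OF C] by blast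
  show "C \<odot>\<^bsub>op_module\<^esub> x \<in> carrier op_module"
    using p x by (simp add: op_module_action)
  show "C \<odot>\<^bsub>op_module\<^esub> (x \<oplus>\<^bsub>op_module\<^esub> y) = C \<odot>\<^bsub>op_module\<^esub> x \<oplus>\<^bsub>op_module\<^esub> C \<odot>\<^bsub>op_module\<^esub> y"
    if "y \<in> carrier op_module" for y
    using p x that by (simp add: op_module_action qlinearD(2)[OF qlinear_ev])
  fix D assume D: "D \<in> carrier A"
  obtain q where q: "q \<in> carrier F" "D = rc q" using carrier_A[OF D] by blast
  show "(C \<oplus>\<^bsub>A\<^esub> D) \<odot>\<^bsub>op_module\<^esub> x = C \<odot>\<^bsub>op_module\<^esub> x \<oplus>\<^bsub>op_module\<^esub> D \<odot>\<^bsub>op_module\<^esub> x"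
    using p q x by (simp add: op_module_action ev_add free_algebra_closed flip: rc_add)
  show "(C \<otimes>\<^bsub>A\<^esub> D) \<odot>\<^bsub>op_module\<^esub> x = C \<odot>\<^bsub>op_module\<^esub> (D \<odot>\<^bsub>op_module\<^esub> x)"
    using p q x by (simp add: op_module_action ev_mult free_algebra_closed flip: rc_mult)
next
  fix x assume "x \<in> carrier op_module"
  then show "\<one>\<^bsub>A\<^esub> \<odot>\<^bsub>op_module\<^esub> x = x"
    by (simp add: op_module_action ev_one one_in_free_algebra flip: rc_one)
qed

end

text \<open>
  Renaming the elements of a module: Fock spaces consist of functions and have to be moved into the
  type that carries the modules of the category.
\<close>

lemma left_module_image:
  assumes M: "left_module R M" and inj: "inj_on \<phi> (carrier M)"
  shows "left_module R (image_space \<phi> M)"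
    and "\<lbrakk>x \<in> carrier M; y \<in> carrier M\<rbrakk> \<Longrightarrow> \<phi> x \<oplus>\<^bsub>image_space \<phi> M\<^esub> \<phi> y = \<phi> (x \<oplus>\<^bsub>M\<^esub> y)"
    and "x \<in> carrier M \<Longrightarrow> a \<odot>\<^bsub>image_space \<phi> M\<^esub> \<phi> x = \<phi> (a \<odot>\<^bsub>M\<^esub> x)"
    and "\<zero>\<^bsub>image_space \<phi> M\<^esub> = \<phi> \<zero>\<^bsub>M\<^esub>"
proof -
  interpret left_module R M by fact
  let ?N = "image_space \<phi> M"
  have inv [simp]: "inv_into (carrier M) \<phi> (\<phi> x) = x" if "x \<in> carrier M" for x
    using inj that by simp
  show add [simp]: "\<phi> x \<oplus>\<^bsub>?N\<^esub> \<phi> y = \<phi> (x \<oplus>\<^bsub>M\<^esub> y)" if "x \<in> carrier M" "y \<in> carrier M" for x y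
    using that by (simp add: image_space_def)
  show smult [simp]: "a \<odot>\<^bsub>?N\<^esub> \<phi> x = \<phi> (a \<odot>\<^bsub>M\<^esub> x)" if "x \<in> carrier M" for x a
    using that by (simp add: image_space_def)
  show zero [simp]: "\<zero>\<^bsub>?N\<^esub> = \<phi> \<zero>\<^bsub>M\<^esub>" by (simp add: image_space_def)
  show "left_module R ?N"
  proof (intro left_module.intro left_module_axioms.intro R.ring_axioms)
    show "abelian_group ?N"
    proof (rule abelian_groupI)
      fix x assume "x \<in> carrier ?N"
      then obtain y where y: "y \<in> carrier M" "x = \<phi> y" by auto
      show "\<exists>z\<in>carrier ?N. z \<oplus>\<^bsub>?N\<^esub> x = \<zero>\<^bsub>?N\<^esub>"
        by (rule bexI[of _ "\<phi> (\<ominus>\<^bsub>M\<^esub> y)"]) (use y in \<open>simp_all add: M.l_neg\<close>)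
    qed (auto simp: M.add.m_ac)
  qed (auto simp: smult_closed smult_l_distr smult_r_distr smult_assoc1 smult_one)
qed

section \<open>Gradings\<close>

text \<open>
  The part of the definition of a graded module that concerns the underlying vector space alone.
\<close>

definition is_grading :: "(rat, 'a) module \<Rightarrow> (int \<Rightarrow> 'a set) \<Rightarrow> bool" where
  "is_grading V W \<longleftrightarrow> (\<forall>i. submodule (W i) rat_ring V) \<and>
     (\<forall>x\<in>carrier V. \<exists>!c. (\<forall>i. c i \<in> W i) \<and> finite {i. c i \<noteq> \<zero>\<^bsub>V\<^esub>} \<and>
        x = finsum V c {i. c i \<noteq> \<zero>\<^bsub>V\<^esub>})"

lemma finsum_underlying: "finsum (underlying P M) f A = finsum M f A"
  by (simp add: finsum_def finprod_def rational_subspace_def)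

lemma graded_module_iff:
  "graded_module P deg M W \<longleftrightarrow>
     left_module (presented_algebra P) M \<and> is_grading (underlying P M) W \<and>
     (\<forall>i<0. W i = {\<zero>\<^bsub>M\<^esub>}) \<and> (\<forall>s\<in>fst P. \<forall>i. \<forall>x\<in>W i. act P M s x \<in> W (i + deg s))"
  unfolding graded_module_def is_grading_def by (simp add: finsum_underlying conj_assoc)

locale grading = qspace V for V :: "(rat, 'a) module" (structure) +
  fixes W :: "int \<Rightarrow> 'a set"
  assumes grading: "is_grading V W"
begin

definition component :: "int \<Rightarrow> 'a \<Rightarrow> 'a" where
  "component i x = (THE c. (\<forall>i. c i \<in> W i) \<and> finite {i. c i \<noteq> \<zero>} \<and> x = finsum V c {i. c i \<noteq> \<zero>}) i"

lemma submodule_W: "submodule (W i) rat_ring V"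
  using grading by (simp add: is_grading_def)

lemma W_closed:
  shows "x \<in> W i \<Longrightarrow> x \<in> carrier V" "\<zero> \<in> W i"
    "\<lbrakk>x \<in> W i; y \<in> W i\<rbrakk> \<Longrightarrow> x \<oplus> y \<in> W i" "x \<in> W i \<Longrightarrow> a \<odot> x \<in> W i"
proof -
  note W = submodule_W[of i]
  show "x \<in> W i \<Longrightarrow> x \<in> carrier V" using submoduleE(1)[OF W] by auto
  show "x \<in> W i \<Longrightarrow> a \<odot> x \<in> W i" for x a using submoduleE(4)[OF W] by simp
  then have "0 \<odot> x \<in> W i" if "x \<in> W i" for x using that .
  then show "\<zero> \<in> W i" using submoduleE(1,2)[OF W] by (metis equals0I scale_zero_left subsetD)
  show "\<lbrakk>x \<in> W i; y \<in> W i\<rbrakk> \<Longrightarrow> x \<oplus> y \<in> W i" using submoduleE(5)[OF W] .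
qed

lemma component_unique:
  assumes "\<And>i. c i \<in> W i" "finite {i. c i \<noteq> \<zero>}" "x = finsum V c {i. c i \<noteq> \<zero>}"
  shows "component i x = c i"
proof -
  have "x \<in> carrier V" unfolding assms(3) by (rule M.finsum_closed) (use W_closed(1) assms(1) in auto)
  then have "\<exists>!c. (\<forall>i. c i \<in> W i) \<and> finite {i. c i \<noteq> \<zero>} \<and> x = finsum V c {i. c i \<noteq> \<zero>}"
    using grading by (simp add: is_grading_def)
  from the1_equality[OF this, of c] assms show ?thesis unfolding component_def by simp
qed

lemma component:
  assumes "x \<in> carrier V"
  shows "component i x \<in> W i" "finite {i. component i x \<noteq> \<zero>}" "x = finsum V (\<lambda>i. component i x) {i. component i x \<noteq> \<zero>}"
proof -
  have "\<exists>!c. (\<forall>i. c i \<in> W i) \<and> finite {i. c i \<noteq> \<zero>} \<and> x = finsum V c {i. c i \<noteq> \<zero>}"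
    using grading assms by (simp add: is_grading_def)
  then obtain c where c: "\<And>i. c i \<in> W i" "finite {i. c i \<noteq> \<zero>}" "x = finsum V c {i. c i \<noteq> \<zero>}"
    by blast
  have "component i x = c i" for i by (rule component_unique) (rule c)+
  then show "component i x \<in> W i" "finite {i. component i x \<noteq> \<zero>}" "x = finsum V (\<lambda>i. component i x) {i. component i x \<noteq> \<zero>}"
    using c by simp_all
qed

lemma component_closed [simp]: "x \<in> carrier V \<Longrightarrow> component i x \<in> carrier V"
  using component(1) W_closed(1) by blast

lemma component_finsum:
  assumes "finite B" "\<And>i. i \<in> B \<Longrightarrow> c i \<in> W i"
  shows "component j (finsum V c B) = (if j \<in> B then c j else \<zero>)"
proof (rule component_unique[where c = "\<lambda>j. if j \<in> B then c j else \<zero>"])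
  show "finite {i. (if i \<in> B then c i else \<zero>) \<noteq> \<zero>}"
    by (rule finite_subset[OF _ assms(1)]) auto
  show "finsum V c B = finsum V (\<lambda>j. if j \<in> B then c j else \<zero>) {i. (if i \<in> B then c i else \<zero>) \<noteq> \<zero>}"
    by (rule M.add.finprod_mono_neutral_cong_right) (use assms W_closed(1) in \<open>auto split: if_splits\<close>)
qed (use assms W_closed(2) in auto)

lemma sum_comp:
  assumes "x \<in> carrier V" "finite B" "{i. component i x \<noteq> \<zero>} \<subseteq> B"
  shows "x = finsum V (\<lambda>i. component i x) B"
proof -
  have "finsum V (\<lambda>i. component i x) {i. component i x \<noteq> \<zero>} = finsum V (\<lambda>i. component i x) B"
    by (rule M.add.finprod_mono_neutral_cong_left) (use assms in auto)
  then show ?thesis using component(3)[OF assms(1)] by simp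
qed

lemma component_homogeneous: "x \<in> W i \<Longrightarrow> component j x = (if j = i then x else \<zero>)"
  using component_finsum[of "{i}" "\<lambda>_. x" j] W_closed(1) by simp

lemma component_eqI: "\<lbrakk>x \<in> carrier V; y \<in> carrier V; \<And>i. component i x = component i y\<rbrakk> \<Longrightarrow> x = y"
proof -
  assume xy: "x \<in> carrier V" "y \<in> carrier V" "\<And>i. component i x = component i y"
  have "finsum V (\<lambda>i. component i x) {i. component i x \<noteq> \<zero>} = finsum V (\<lambda>i. component i y) {i. component i y \<noteq> \<zero>}"
    by (simp only: xy(3))
  then show ?thesis using component(3)[OF xy(1)] component(3)[OF xy(2)] by (simp only:)
qed

lemma homogeneousI: "\<lbrakk>x \<in> carrier V; \<And>j. j \<noteq> i \<Longrightarrow> component j x = \<zero>\<rbrakk> \<Longrightarrow> x \<in> W i"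
proof -
  assume x: "x \<in> carrier V" "\<And>j. j \<noteq> i \<Longrightarrow> component j x = \<zero>"
  have "x = component i x"
    by (rule component_eqI) (use x component(1)[OF x(1), of i] in \<open>auto simp: component_homogeneous\<close>)
  then show ?thesis using component(1)[OF x(1), of i] by simp
qed

text \<open>
  A map of degree \<open>d\<close> takes the decomposition of \<open>x\<close> to a decomposition of \<open>f x\<close>, which is unique.
\<close>

lemma component_morphism:
  assumes "grading V' W'" and f: "qlinear V V' f" and d: "\<And>i x. x \<in> W i \<Longrightarrow> f x \<in> W' (i + d)"
    and x: "x \<in> carrier V"
  shows "grading.component V' W' (i + d) (f x) = f (component i x)"
proof -
  interpret V': grading V' W' by fact
  let ?B = "{i. component i x \<noteq> \<zero>}"
  have "f x = f (finsum V (\<lambda>i. component i x) ?B)" using component(3)[OF x] by simp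
  also have "\<dots> = finsum V' (\<lambda>i. f (component i x)) ?B"
    by (rule qlinear_finsum[OF f qspace_axioms V'.qspace_axioms]) (use x in simp)
  also have "\<dots> = finsum V' (\<lambda>j. f (component (j - d) x)) ((\<lambda>i. i + d) ` ?B)"
    by (subst V'.M.finsum_reindex) (use x qlinearD(1)[OF f] in \<open>auto simp: inj_on_def\<close>)
  finally have fx: "f x = finsum V' (\<lambda>j. f (component (j - d) x)) ((\<lambda>i. i + d) ` ?B)" .
  have "V'.component (i + d) (f x) = (if i + d \<in> (\<lambda>i. i + d) ` ?B then f (component (i + d - d) x) else \<zero>\<^bsub>V'\<^esub>)"
    unfolding fx
  proof (rule V'.component_finsum)
    fix j assume "j \<in> (\<lambda>i. i + d) ` ?B"
    show "f (component (j - d) x) \<in> W' j" using d[OF component(1)[OF x], of "j - d"] by simp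
  qed (use component(2)[OF x] in simp)
  then show ?thesis
    using qlinear_zero[OF f qspace_axioms V'.qspace_axioms] by (auto simp: image_iff)
qed

lemma qlinear_comp_i: "qlinear V V (component i)"
proof (rule qlinearI)
  fix x y assume xy: "x \<in> carrier V" "y \<in> carrier V"
  let ?B = "{i. component i x \<noteq> \<zero>} \<union> {i. component i y \<noteq> \<zero>}"
  have fin: "finite ?B" using component(2) xy by simp
  have "x \<oplus> y = finsum V (\<lambda>i. component i x) ?B \<oplus> finsum V (\<lambda>i. component i y) ?B"
    using sum_comp[of x ?B] sum_comp[of y ?B] xy fin by auto
  also have "\<dots> = finsum V (\<lambda>i. component i x \<oplus> component i y) ?B"
    by (rule M.finsum_addf[symmetric]) (use xy in auto)
  finally have "component i (x \<oplus> y) = (if i \<in> ?B then component i x \<oplus> component i y else \<zero>)"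
    using component_finsum[OF fin, of "\<lambda>i. component i x \<oplus> component i y" i] xy component(1) W_closed(3) by simp
  then show "component i (x \<oplus> y) = component i x \<oplus> component i y" by auto
next
  fix a x assume x: "x \<in> carrier V"
  have "component (i + 0) (a \<odot> x) = a \<odot> component i x"
    by (rule component_morphism[OF grading_axioms _ _ x])
      (use W_closed(4) in \<open>auto simp: qlinear_def scale_add_right mult.commute\<close>)
  then show "component i (a \<odot> x) = a \<odot> component i x" by simp
qed simp

end

text \<open>
  The sum of the projections of \<open>x\<close> has the same projections as \<open>x\<close> and therefore equals \<open>x\<close>; applying
  the projections to a decomposition shows that it is unique.
\<close>

lemma is_gradingI:
  fixes V :: "(rat, 'a) module" (structure)
  assumes "qspace V" and W: "\<And>i. submodule (W i) rat_ring V"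
    and lin: "\<And>i. qlinear V V (p i)"
    and p_in: "\<And>i x. x \<in> carrier V \<Longrightarrow> p i x \<in> W i"
    and p_W: "\<And>i j x. x \<in> W i \<Longrightarrow> p j x = (if j = i then x else \<zero>)"
    and fin: "\<And>x. x \<in> carrier V \<Longrightarrow> finite {i. p i x \<noteq> \<zero>}"
    and sep: "\<And>x. \<lbrakk>x \<in> carrier V; \<And>i. p i x = \<zero>\<rbrakk> \<Longrightarrow> x = \<zero>"
  shows "is_grading V W"
proof -
  interpret qspace V by fact
  have WV: "x \<in> carrier V" if "x \<in> W i" for x i using submoduleE(1)[OF W] that by blast
  have p_sum: "p j (finsum V c {i. c i \<noteq> \<zero>}) = c j"
    if c: "\<And>i. c i \<in> W i" "finite {i. c i \<noteq> \<zero>}" for c j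
  proof -
    have "p j (finsum V c {i. c i \<noteq> \<zero>}) = finsum V (\<lambda>i. p j (c i)) {i. c i \<noteq> \<zero>}"
      by (rule qlinear_finsum[OF lin assms(1,1)]) (use c WV in blast)
    also have "\<dots> = finsum V (\<lambda>i. if j = i then c i else \<zero>) {i. c i \<noteq> \<zero>}"
      by (rule arg_cong[where f = "\<lambda>f. finsum V f {i. c i \<noteq> \<zero>}"]) (use c p_W in auto)
    also have "\<dots> = c j"
    proof (cases "c j = \<zero>")
      case True
      then have "(\<lambda>i. if j = i then c i else \<zero>) = (\<lambda>_. \<zero>)" by auto
      then show ?thesis using True by simp
    next
      case False
      then show ?thesis by (intro M.add.finprod_singleton) (use c WV in auto)
    qed
    finally show ?thesis .
  qed
  have "\<exists>!c. (\<forall>i. c i \<in> W i) \<and> finite {i. c i \<noteq> \<zero>} \<and> x = finsum V c {i. c i \<noteq> \<zero>}"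
    if x: "x \<in> carrier V" for x
  proof (rule ex1I[of _ "\<lambda>i. p i x"])
    let ?y = "finsum V (\<lambda>i. p i x) {i. p i x \<noteq> \<zero>}"
    have y: "?y \<in> carrier V" by (rule M.finsum_closed) (use p_in[OF x] WV in auto)
    have "p j (x \<oplus> (- 1) \<odot> ?y) = \<zero>" for j
    proof -
      have "p j ?y = p j x" by (rule p_sum) (use p_in[OF x] fin[OF x] in auto)
      then show ?thesis using x y qlinearD(1)[OF lin x] by (simp add: qlinearD(2,3)[OF lin])
    qed
    then have "x \<oplus> (- 1) \<odot> ?y = \<zero>" by (rule sep[rotated]) (use x y in simp)
    then have "x = ?y" by (simp only: diff_eq_zero_iff[OF x y])
    then show "(\<forall>i. p i x \<in> W i) \<and> finite {i. p i x \<noteq> \<zero>} \<and> x = ?y"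
      using p_in[OF x] fin[OF x] by blast
  next
    fix c assume c: "(\<forall>i. c i \<in> W i) \<and> finite {i. c i \<noteq> \<zero>} \<and> x = finsum V c {i. c i \<noteq> \<zero>}"
    have "p j (finsum V c {i. c i \<noteq> \<zero>}) = c j" for j by (rule p_sum) (use c in blast)+
    then have "p j x = c j" for j using c by (simp only:)
    then show "c = (\<lambda>i. p i x)" by simp
  qed
  then show ?thesis using W by (simp add: is_grading_def)
qed

section \<open>Coordinates with respect to annihilation operators\<close>

text \<open>
  The first letter acts first. Then on coordinates, which are indexed by words, the operator \<open>A n\<close>
  is the shift \<open>\<lambda>h l. h (n # l)\<close>.
\<close>

primrec ann_word :: "(nat \<Rightarrow> 'a \<Rightarrow> 'a) \<Rightarrow> nat list \<Rightarrow> 'a \<Rightarrow> 'a" where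
  "ann_word A [] x = x"
| "ann_word A (n # l) x = ann_word A l (A n x)"

lemma ann_word_append: "ann_word A (k @ l) x = ann_word A l (ann_word A k x)"
  by (induction k arbitrary: x) simp_all

text \<open>
  The order of the letters in a word matters at this level; how letters may be exchanged depends on
  the algebra.
\<close>

locale annihilation = qspace V for V :: "(rat, 'a) module" (structure) +
  fixes A :: "nat \<Rightarrow> 'a \<Rightarrow> 'a" and \<pi> :: "'a \<Rightarrow> 'a"
  assumes A: "qlinear V V (A n)" and \<pi>: "qlinear V V \<pi>"
    and A_\<pi>: "x \<in> carrier V \<Longrightarrow> A n (\<pi> x) = \<zero>"
    and \<pi>_vac: "\<lbrakk>x \<in> carrier V; \<And>n. A n x = \<zero>\<rbrakk> \<Longrightarrow> \<pi> x = x"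
    and nilpotent: "x \<in> carrier V \<Longrightarrow> finite {l. ann_word A l x \<noteq> \<zero>}"
begin

lemma A_closed [simp]: "x \<in> carrier V \<Longrightarrow> A n x \<in> carrier V"
  and \<pi>_closed [simp]: "x \<in> carrier V \<Longrightarrow> \<pi> x \<in> carrier V"
  using A \<pi> by (auto simp: qlinear_def)

lemma word_linear: "qlinear V V (ann_word A l)"
proof (induction l)
  case (Cons n l)
  then show ?case using qlinear_comp[OF A] by simp
qed (simp add: qlinear_def)

lemma word_closed [simp]: "x \<in> carrier V \<Longrightarrow> ann_word A l x \<in> carrier V"
  using word_linear by (rule qlinearD(1))

definition vac :: "'a set" where
  "vac = {x \<in> carrier V. \<forall>n. A n x = \<zero>}"

text \<open>
  The Taylor coefficients of a vector, with words in place of multi-indices.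
\<close>

definition coord :: "'a \<Rightarrow> nat list \<Rightarrow> 'a" where
  "coord x l = \<pi> (ann_word A l x)"

lemma coord_Cons: "coord x (n # l) = coord (A n x) l"
  by (simp add: coord_def)

lemma vac_carrier: "x \<in> vac \<Longrightarrow> x \<in> carrier V"
  by (simp add: vac_def)

lemma coord_vac [simp]: "x \<in> carrier V \<Longrightarrow> coord x l \<in> vac"
  by (simp add: coord_def vac_def A_\<pi>)

lemma coord_linear: "qlinear V V (\<lambda>x. coord x l)"
  unfolding coord_def by (rule qlinear_comp[OF word_linear \<pi>])

lemma coord_of_vac:
  assumes "x \<in> vac"
  shows "coord x l = (if l = [] then x else \<zero>)"
proof (cases l)
  case Nil
  then show ?thesis using assms by (simp add: coord_def vac_def \<pi>_vac)
next
  case (Cons n k)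
  then show ?thesis using assms qlinear_zero[OF coord_linear qspace_axioms qspace_axioms]
    by (simp add: coord_Cons vac_def)
qed

lemma coord_finite_support: "x \<in> carrier V \<Longrightarrow> finite {l. coord x l \<noteq> \<zero>}"
  by (rule finite_subset[OF _ nilpotent]) (auto simp: coord_def qlinear_zero[OF \<pi> qspace_axioms qspace_axioms])

lemma coord_eq_zero:
  assumes x: "x \<in> carrier V" and "\<And>l. coord x l = \<zero>"
  shows "x = \<zero>"
proof (rule ccontr)
  assume "x \<noteq> \<zero>"
  let ?N = "{l. ann_word A l x \<noteq> \<zero>}"
  have "[] \<in> ?N" using \<open>x \<noteq> \<zero>\<close> by simp
  then have "?N \<noteq> {}" by blast
  then have "Max (length ` ?N) \<in> length ` ?N" using nilpotent[OF x] by (intro Max_in) simp_all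
  then obtain l where "l \<in> ?N" "length l = Max (length ` ?N)" by auto
  then have l: "l \<in> ?N" "\<And>k. k \<in> ?N \<Longrightarrow> length k \<le> length l" using nilpotent[OF x] by simp_all
  \<comment> \<open>A longest word that does not kill \<open>x\<close> takes it to a non-zero vacuum vector.\<close>
  have "A n (ann_word A l x) = \<zero>" for n
    using l(2)[of "l @ [n]"] by (auto simp: ann_word_append)
  then have "coord x l = ann_word A l x" using x by (simp add: coord_def \<pi>_vac)
  then show False using l assms(2) by simp
qed

lemma coord_inject:
  assumes "x \<in> carrier V" "y \<in> carrier V" "coord x = coord y"
  shows "x = y"
proof -
  have "x \<oplus> (-1) \<odot> y = \<zero>"
  proof (rule coord_eq_zero)
    fix l
    have "coord (x \<oplus> (-1) \<odot> y) l = coord x l \<oplus> (-1) \<odot> coord y l"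
      using assms(1,2) by (simp add: qlinearD(2,3)[OF coord_linear])
    then show "coord (x \<oplus> (-1) \<odot> y) l = \<zero>"
      using assms vac_carrier[OF coord_vac[OF assms(2)]] by simp
  qed (use assms in simp)
  then show ?thesis using assms by (simp add: diff_eq_zero_iff)
qed

end

section \<open>Fock spaces\<close>

text \<open>
  \<open>F x\<close> is the vector whose coordinates are the values of \<open>f\<close> at the coordinates of \<open>x\<close>. It is linear
  because vectors are determined by their coordinates, and it extends \<open>f\<close> because the only non-zero
  coordinate of a vacuum vector is the vector itself, at the empty word.
\<close>

lemma coord_extension:
  fixes V V' :: "(rat, 'a) module"
  assumes "annihilation V a \<pi>" "annihilation V' a' \<pi>'"
    and f: "\<And>v. v \<in> annihilation.vac V a \<Longrightarrow> f v \<in> annihilation.vac V' a'"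
      "\<And>v w. \<lbrakk>v \<in> annihilation.vac V a; w \<in> annihilation.vac V a\<rbrakk> \<Longrightarrow> f (v \<oplus>\<^bsub>V\<^esub> w) = f v \<oplus>\<^bsub>V'\<^esub> f w"
      "\<And>v q. v \<in> annihilation.vac V a \<Longrightarrow> f (q \<odot>\<^bsub>V\<^esub> v) = q \<odot>\<^bsub>V'\<^esub> f v"
    and surj: "\<And>x. x \<in> carrier V \<Longrightarrow>
       \<exists>y\<in>carrier V'. annihilation.coord a' \<pi>' y = (\<lambda>l. f (annihilation.coord a \<pi> x l))"
  obtains F where "qlinear V V' F"
    "\<And>x. x \<in> carrier V \<Longrightarrow> annihilation.coord a' \<pi>' (F x) = (\<lambda>l. f (annihilation.coord a \<pi> x l))"
    "\<And>v. v \<in> annihilation.vac V a \<Longrightarrow> F v = f v"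
proof -
  interpret V: annihilation V a \<pi> by fact
  interpret V': annihilation V' a' \<pi>' by fact
  define F where "F x = (SOME y. y \<in> carrier V' \<and> V'.coord y = (\<lambda>l. f (V.coord x l)))" for x
  have F: "F x \<in> carrier V'" "V'.coord (F x) = (\<lambda>l. f (V.coord x l))" if "x \<in> carrier V" for x
    unfolding atomize_conj F_def by (rule someI_ex) (use surj[OF that] in blast)
  have lin: "qlinear V V' F"
  proof (rule qlinearI)
    fix x y assume xy: "x \<in> carrier V" "y \<in> carrier V"
    show "F (x \<oplus>\<^bsub>V\<^esub> y) = F x \<oplus>\<^bsub>V'\<^esub> F y"
    proof (rule V'.coord_inject)
      have "V'.coord (F x \<oplus>\<^bsub>V'\<^esub> F y) l = V'.coord (F x) l \<oplus>\<^bsub>V'\<^esub> V'.coord (F y) l" for l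
        by (rule qlinearD(2)[OF V'.coord_linear]) (use F(1) xy in auto)
      moreover have "V.coord (x \<oplus>\<^bsub>V\<^esub> y) l = V.coord x l \<oplus>\<^bsub>V\<^esub> V.coord y l" for l
        by (rule qlinearD(2)[OF V.coord_linear]) (use xy in auto)
      ultimately show "V'.coord (F (x \<oplus>\<^bsub>V\<^esub> y)) = V'.coord (F x \<oplus>\<^bsub>V'\<^esub> F y)"
        using xy f(2)[OF V.coord_vac V.coord_vac] by (auto simp: F(2))
    qed (use F(1) xy in auto)
  next
    fix q x assume x: "x \<in> carrier V"
    show "F (q \<odot>\<^bsub>V\<^esub> x) = q \<odot>\<^bsub>V'\<^esub> F x"
    proof (rule V'.coord_inject)
      have "V'.coord (q \<odot>\<^bsub>V'\<^esub> F x) l = q \<odot>\<^bsub>V'\<^esub> V'.coord (F x) l" for l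
        by (rule qlinearD(3)[OF V'.coord_linear]) (use F(1) x in auto)
      moreover have "V.coord (q \<odot>\<^bsub>V\<^esub> x) l = q \<odot>\<^bsub>V\<^esub> V.coord x l" for l
        by (rule qlinearD(3)[OF V.coord_linear]) (use x in auto)
      ultimately show "V'.coord (F (q \<odot>\<^bsub>V\<^esub> x)) = V'.coord (q \<odot>\<^bsub>V'\<^esub> F x)"
        using x f(3)[OF V.coord_vac] by (auto simp: F(2))
    qed (use F(1) x in auto)
  qed (use F in auto)
  have "F v = f v" if v: "v \<in> V.vac" for v
  proof (rule V'.coord_inject)
    have "\<zero>\<^bsub>V\<^esub> \<in> V.vac" using V.coord_vac[of v "[0]"] V.coord_of_vac[OF v, of "[0]"] V.vac_carrier[OF v] by simp
    then have "f \<zero>\<^bsub>V\<^esub> = \<zero>\<^bsub>V'\<^esub>"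
      using f(3)[of "\<zero>\<^bsub>V\<^esub>" 0] f(1)[of "\<zero>\<^bsub>V\<^esub>"] V'.vac_carrier by simp
    then show "V'.coord (F v) = V'.coord (f v)"
      using v f(1) by (auto simp: F(2) V.vac_carrier V.coord_of_vac V'.coord_of_vac)
  qed (use v F V.vac_carrier V'.vac_carrier f(1) in auto)
  then show ?thesis using that lin F(2) by blast
qed

text \<open>
  The predicate \<open>ok\<close> selects the functions that are coordinates of vectors: the symmetric ones, the
  alternating ones, or all.
\<close>

definition fock :: "((rat, 'a) module \<Rightarrow> (nat list \<Rightarrow> 'a) \<Rightarrow> bool) \<Rightarrow> (rat, 'a) module \<Rightarrow> (rat, nat list \<Rightarrow> 'a) module" where
  "fock ok V = \<lparr>carrier = {h \<in> finite_support V. ok V h}, mult = undefined, one = undefined,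
     zero = (\<lambda>_. \<zero>\<^bsub>V\<^esub>), add = (\<lambda>h k l. h l \<oplus>\<^bsub>V\<^esub> k l), smult = (\<lambda>q h l. q \<odot>\<^bsub>V\<^esub> h l)\<rparr>"

lemma fock_simps [simp]:
  "carrier (fock ok V) = {h \<in> finite_support V. ok V h}" "\<zero>\<^bsub>fock ok V\<^esub> = (\<lambda>_. \<zero>\<^bsub>V\<^esub>)"
  "h \<oplus>\<^bsub>fock ok V\<^esub> k = (\<lambda>l. h l \<oplus>\<^bsub>V\<^esub> k l)" "q \<odot>\<^bsub>fock ok V\<^esub> h = (\<lambda>l. q \<odot>\<^bsub>V\<^esub> h l)"
  by (simp_all add: fock_def)

lemma finite_supportD:
  assumes "h \<in> finite_support V"
  shows "h i \<in> carrier V" "finite {i. h i \<noteq> \<zero>\<^bsub>V\<^esub>}"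
  using assms by (auto simp: finite_support_def)

lemma finite_supportI:
  "\<lbrakk>\<And>i. h i \<in> carrier V; {i. h i \<noteq> \<zero>\<^bsub>V\<^esub>} \<subseteq> B; finite B\<rbrakk> \<Longrightarrow> h \<in> finite_support V"
  by (auto simp: finite_support_def intro: finite_subset)

lemma finite_support_add:
  assumes "qspace V" "h \<in> finite_support V" "k \<in> finite_support V"
  shows "(\<lambda>l. h l \<oplus>\<^bsub>V\<^esub> k l) \<in> finite_support V"
proof -
  interpret qspace V by fact
  show ?thesis
    by (rule finite_supportI[of _ _ "{i. h i \<noteq> \<zero>\<^bsub>V\<^esub>} \<union> {i. k i \<noteq> \<zero>\<^bsub>V\<^esub>}"])
      (use finite_supportD[OF assms(2)] finite_supportD[OF assms(3)] in auto)
qed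

lemma finite_support_linear:
  assumes "qspace V" "qspace V'" "qlinear V V' f" "h \<in> finite_support V"
  shows "(\<lambda>l. f (h l)) \<in> finite_support V'"
  by (rule finite_supportI[of _ _ "{i. h i \<noteq> \<zero>\<^bsub>V\<^esub>}"])
    (use finite_supportD[OF assms(4)] qlinearD(1)[OF assms(3)] qlinear_zero[OF assms(3,1,2)] in auto)

lemma qlinear_scale: "qspace V \<Longrightarrow> qlinear V V (\<lambda>x. q \<odot>\<^bsub>V\<^esub> x)"
proof -
  assume "qspace V"
  then interpret qspace V .
  show ?thesis by (rule qlinearI) (simp_all add: scale_add_right mult.commute)
qed

lemma qspace_fock:
  fixes V :: "(rat, 'a) module" (structure)
  assumes V: "qspace V"
    and ok_zero: "ok V (\<lambda>_. \<zero>\<^bsub>V\<^esub>)"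
    and ok_add: "\<And>h k. \<lbrakk>h \<in> finite_support V; k \<in> finite_support V; ok V h; ok V k\<rbrakk> \<Longrightarrow> ok V (\<lambda>l. h l \<oplus>\<^bsub>V\<^esub> k l)"
    and ok_smult: "\<And>q h. \<lbrakk>h \<in> finite_support V; ok V h\<rbrakk> \<Longrightarrow> ok V (\<lambda>l. q \<odot>\<^bsub>V\<^esub> h l)"
  shows "qspace (fock ok V)"
proof -
  interpret qspace V by fact
  have smult: "(\<lambda>l. q \<odot> h l) \<in> finite_support V" if "h \<in> finite_support V" for h :: "nat list \<Rightarrow> 'a" and q
    by (rule finite_support_linear[OF V V qlinear_scale[OF V] that])
  show ?thesis
  proof (rule qspace_intro)
    show "\<zero>\<^bsub>fock ok V\<^esub> \<in> carrier (fock ok V)" using ok_zero by (simp add: finite_support_def)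
  next
    fix h k assume "h \<in> carrier (fock ok V)" "k \<in> carrier (fock ok V)"
    then show "h \<oplus>\<^bsub>fock ok V\<^esub> k \<in> carrier (fock ok V)"
      using finite_support_add[OF V] ok_add unfolding fock_simps by blast
  next
    fix q h assume "h \<in> carrier (fock ok V)"
    then show "q \<odot>\<^bsub>fock ok V\<^esub> h \<in> carrier (fock ok V)"
      using smult ok_smult unfolding fock_simps by blast
  qed (simp_all add: finite_support_def scale_add_left scale_add_right M.add.m_ac)
qed

lemma rational_subspace_qspace:
  assumes "presented_module P M" "U \<subseteq> carrier M" "\<zero>\<^bsub>M\<^esub> \<in> U"
    "\<And>x y. x \<in> U \<Longrightarrow> y \<in> U \<Longrightarrow> x \<oplus>\<^bsub>M\<^esub> y \<in> U"
    "\<And>a x. x \<in> U \<Longrightarrow> a \<odot>\<^bsub>underlying P M\<^esub> x \<in> U"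
  shows "qspace (rational_subspace P M U)"
proof -
  have "rational_subspace P M U = (underlying P M)\<lparr>carrier := U\<rparr>" by (simp add: rational_subspace_def)
  then show ?thesis
    using qspace_subspace[OF presented_module.qspace_underlying[OF assms(1)], of U] assms by simp
qed

text \<open>
  A Fock model describes, for each vacuum space \<open>V\<close>, the admissible module with that vacuum space as
  a space of finitely supported functions on words, naturally in \<open>V\<close>.
\<close>

locale fock_model = presentation P
  for P :: "'g presentation" +
  fixes ok :: "(rat, 'a) module \<Rightarrow> (nat list \<Rightarrow> 'a) \<Rightarrow> bool"
    and G :: "(rat, 'a) module \<Rightarrow> 'g \<Rightarrow> (nat list \<Rightarrow> 'a) \<Rightarrow> (nat list \<Rightarrow> 'a)"
  assumes rep: "qspace V \<Longrightarrow> representation P (fock ok V) (G V)"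
    and ok_vac: "\<lbrakk>qspace V; v \<in> carrier V\<rbrakk> \<Longrightarrow> ok V (\<lambda>l. if l = [] then v else \<zero>\<^bsub>V\<^esub>)"
    and ok_trunc: "\<lbrakk>qspace V; ok V h\<rbrakk> \<Longrightarrow> ok V (\<lambda>l. if int (length l) = i then h l else \<zero>\<^bsub>V\<^esub>)"
    and ok_natural: "\<lbrakk>qspace V; qspace V'; qlinear V V' f; h \<in> finite_support V; ok V h\<rbrakk> \<Longrightarrow> ok V' (\<lambda>l. f (h l))"
    and G_natural: "\<lbrakk>qspace V; qspace V'; qlinear V V' f; h \<in> finite_support V; ok V h; s \<in> fst P\<rbrakk>
        \<Longrightarrow> G V' s (\<lambda>l. f (h l)) = (\<lambda>l. f (G V s h l))"

subsection \<open>The module of a vacuum space\<close>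

text \<open>
  The elements of the Fock space over \<open>V\<close> are functions; \<open>\<phi>\<close> renames them to elements of the type
  that carries \<open>V\<close>.
\<close>

locale fock_realization = fock_model P ok G + V: qspace V + presented_module P M
  for P :: "'g presentation" and ok G and V :: "(rat, 'a) module" and M :: "('g ncpoly set, 'a) module"
    and \<phi> :: "(nat list \<Rightarrow> 'a) \<Rightarrow> 'a" +
  assumes inj: "inj_on \<phi> {h \<in> finite_support V. ok V h}"
    and carrier_M: "carrier M = \<phi> ` {h \<in> finite_support V. ok V h}"
    and add_M: "\<lbrakk>h \<in> finite_support V; ok V h; k \<in> finite_support V; ok V k\<rbrakk> \<Longrightarrow> \<phi> h \<oplus>\<^bsub>M\<^esub> \<phi> k = \<phi> (\<lambda>l. h l \<oplus>\<^bsub>V\<^esub> k l)"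
    and scalar_M: "\<lbrakk>h \<in> finite_support V; ok V h\<rbrakk> \<Longrightarrow> rc (scalar q) \<odot>\<^bsub>M\<^esub> \<phi> h = \<phi> (\<lambda>l. q \<odot>\<^bsub>V\<^esub> h l)"
    and zero_M: "\<zero>\<^bsub>M\<^esub> = \<phi> (\<lambda>_. \<zero>\<^bsub>V\<^esub>)"
    and act_M: "\<lbrakk>s \<in> fst P; h \<in> finite_support V; ok V h\<rbrakk> \<Longrightarrow> act P M s (\<phi> h) = \<phi> (G V s h)"

lemma (in fock_model) realization_exists:
  assumes V: "qspace V"
  obtains M \<phi> where "fock_realization P ok G V M \<phi>"
proof -
  interpret V: qspace V by fact
  interpret R: representation P "fock ok V" "G V" by (rule rep[OF V])
  obtain \<phi> :: "(nat list \<Rightarrow> 'a) \<Rightarrow> 'a" where "inj_on \<phi> (finite_support V)"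
    using finite_support_embedding[OF V] by blast
  then have inj: "inj_on \<phi> {h \<in> finite_support V. ok V h}" by (rule inj_on_subset) auto
  let ?M = "image_space \<phi> R.op_module"
  have inj': "inj_on \<phi> (carrier R.op_module)" using inj by simp
  note im = left_module_image[OF R.left_module_op_module inj']
  have "fock_realization P ok G V ?M \<phi>"
  proof (intro fock_realization.intro fock_model_axioms V presented_module.intro presentation_axioms im(1)
      fock_realization_axioms.intro inj)
    show "\<zero>\<^bsub>?M\<^esub> = \<phi> (\<lambda>_. \<zero>\<^bsub>V\<^esub>)" using im(4) by simp
    fix h :: "nat list \<Rightarrow> 'a" assume h: "h \<in> finite_support V" "ok V h"
    then have h': "h \<in> carrier R.op_module" by simp
    show "rc (scalar q) \<odot>\<^bsub>?M\<^esub> \<phi> h = \<phi> (\<lambda>l. q \<odot>\<^bsub>V\<^esub> h l)" for q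
      using im(3)[OF h'] R.op_module_scalar[of h q] h by simp
    show "act P ?M s (\<phi> h) = \<phi> (G V s h)" if "s \<in> fst P" for s
      using im(3)[OF h'] R.op_module_act[OF that, of h] h by (simp add: act_def)
    fix k assume k: "k \<in> finite_support V" "ok V k"
    then have k': "k \<in> carrier R.op_module" by simp
    show "\<phi> h \<oplus>\<^bsub>?M\<^esub> \<phi> k = \<phi> (\<lambda>l. h l \<oplus>\<^bsub>V\<^esub> k l)" using im(2)[OF h' k'] by simp
  qed simp
  then show ?thesis using that by blast
qed

context fock_realization
begin

lemma fock_closed:
  assumes "h \<in> finite_support V" "ok V h"
  shows "k \<in> finite_support V \<Longrightarrow> ok V k \<Longrightarrow> (\<lambda>l. h l \<oplus>\<^bsub>V\<^esub> k l) \<in> finite_support V \<and> ok V (\<lambda>l. h l \<oplus>\<^bsub>V\<^esub> k l)"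
    "(\<lambda>l. q \<odot>\<^bsub>V\<^esub> h l) \<in> finite_support V \<and> ok V (\<lambda>l. q \<odot>\<^bsub>V\<^esub> h l)"
    "s \<in> fst P \<Longrightarrow> G V s h \<in> finite_support V \<and> ok V (G V s h)"
proof -
  interpret R: representation P "fock ok V" "G V" by (rule rep[OF V.qspace_axioms])
  show "(\<lambda>l. h l \<oplus>\<^bsub>V\<^esub> k l) \<in> finite_support V \<and> ok V (\<lambda>l. h l \<oplus>\<^bsub>V\<^esub> k l)" if "k \<in> finite_support V" "ok V k"
    using R.M.add.m_closed[of h k] assms that by simp
  show "(\<lambda>l. q \<odot>\<^bsub>V\<^esub> h l) \<in> finite_support V \<and> ok V (\<lambda>l. q \<odot>\<^bsub>V\<^esub> h l)"
    using R.scale_closed[of h q] assms by simp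
  show "G V s h \<in> finite_support V \<and> ok V (G V s h)" if "s \<in> fst P"
    using qlinearD(1)[OF R.T_linear[OF that], of h] assms by simp
qed

lemma zero_fock: "(\<lambda>_ :: nat list. \<zero>\<^bsub>V\<^esub>) \<in> finite_support V" "ok V (\<lambda>_. \<zero>\<^bsub>V\<^esub>)"
proof -
  interpret R: representation P "fock ok V" "G V" by (rule rep[OF V.qspace_axioms])
  show "(\<lambda>_ :: nat list. \<zero>\<^bsub>V\<^esub>) \<in> finite_support V" "ok V (\<lambda>_. \<zero>\<^bsub>V\<^esub>)" using R.M.zero_closed by simp_all
qed

lemma phi_eq_iff: "\<lbrakk>h \<in> finite_support V; ok V h; k \<in> finite_support V; ok V k\<rbrakk> \<Longrightarrow> \<phi> h = \<phi> k \<longleftrightarrow> h = k"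
  using inj by (auto simp: inj_on_def)

lemma phi_zero_iff: "\<lbrakk>h \<in> finite_support V; ok V h\<rbrakk> \<Longrightarrow> \<phi> h = \<zero>\<^bsub>M\<^esub> \<longleftrightarrow> (\<forall>l. h l = \<zero>\<^bsub>V\<^esub>)"
  using phi_eq_iff[OF _ _ zero_fock] by (auto simp: zero_M fun_eq_iff)

text \<open>
  Word length is the grading for which annihilation operators have degree \<open>-1\<close>.
\<close>

definition level :: "int \<Rightarrow> 'a set" where
  "level i = \<phi> ` {h \<in> finite_support V. ok V h \<and> (\<forall>l. h l \<noteq> \<zero>\<^bsub>V\<^esub> \<longrightarrow> int (length l) = i)}"

lemma levelE:
  assumes "x \<in> level i"
  obtains h where "h \<in> finite_support V" "ok V h" "\<forall>l. h l \<noteq> \<zero>\<^bsub>V\<^esub> \<longrightarrow> int (length l) = i" "x = \<phi> h"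
  using assms unfolding level_def by blast

lemma levelI:
  "\<lbrakk>h \<in> finite_support V; ok V h; \<And>l. h l \<noteq> \<zero>\<^bsub>V\<^esub> \<Longrightarrow> int (length l) = i\<rbrakk> \<Longrightarrow> \<phi> h \<in> level i"
  unfolding level_def by blast

lemma level_negative: "i < 0 \<Longrightarrow> level i = {\<zero>\<^bsub>M\<^esub>}"
proof -
  assume "i < 0"
  then have "{h \<in> finite_support V. ok V h \<and> (\<forall>l. h l \<noteq> \<zero>\<^bsub>V\<^esub> \<longrightarrow> int (length l) = i)} = {\<lambda>_. \<zero>\<^bsub>V\<^esub>}"
    using zero_fock by (auto simp: fun_eq_iff) 
  then show ?thesis by (simp add: level_def zero_M)
qed

lemma submodule_level: "submodule (level i) rat_ring (underlying P M)"
proof -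
  interpret U: qspace "underlying P M" by (rule qspace_underlying)
  have smult: "q \<odot>\<^bsub>underlying P M\<^esub> x \<in> level i" if "x \<in> level i" for q x
  proof -
    obtain h where h: "h \<in> finite_support V" "ok V h" "\<forall>l. h l \<noteq> \<zero>\<^bsub>V\<^esub> \<longrightarrow> int (length l) = i" "x = \<phi> h"
      using \<open>x \<in> level i\<close> by (rule levelE)
    have "q \<odot>\<^bsub>V\<^esub> h l \<noteq> \<zero>\<^bsub>V\<^esub> \<Longrightarrow> int (length l) = i" for l
      using h(3)[rule_format, of l] finite_supportD(1)[OF h(1), of l] by auto
    then have "\<phi> (\<lambda>l. q \<odot>\<^bsub>V\<^esub> h l) \<in> level i" using fock_closed(2)[OF h(1,2), of q] by (intro levelI) auto
    then show ?thesis using h(4) scalar_M[OF h(1,2), of q] by simp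
  qed
  show ?thesis
  proof (rule U.submoduleI)
    show sub: "level i \<subseteq> carrier (underlying P M)" by (auto simp: level_def carrier_M)
    show "\<zero>\<^bsub>underlying P M\<^esub> \<in> level i" using zero_fock by (auto simp: level_def zero_M)
    show "\<ominus>\<^bsub>underlying P M\<^esub> x \<in> level i" if x: "x \<in> level i" for x
      using U.minus_scale[of x] smult[OF x, of "- 1"] sub x by auto
    show "x \<oplus>\<^bsub>underlying P M\<^esub> y \<in> level i" if "x \<in> level i" "y \<in> level i" for x y
    proof -
      obtain h where h: "h \<in> finite_support V" "ok V h" "\<forall>l. h l \<noteq> \<zero>\<^bsub>V\<^esub> \<longrightarrow> int (length l) = i" "x = \<phi> h"
        using \<open>x \<in> level i\<close> by (rule levelE)
      obtain k where k: "k \<in> finite_support V" "ok V k" "\<forall>l. k l \<noteq> \<zero>\<^bsub>V\<^esub> \<longrightarrow> int (length l) = i" "y = \<phi> k"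
        using \<open>y \<in> level i\<close> by (rule levelE)
      have "h l \<oplus>\<^bsub>V\<^esub> k l \<noteq> \<zero>\<^bsub>V\<^esub> \<Longrightarrow> int (length l) = i" for l
        using h(3)[rule_format, of l] k(3)[rule_format, of l] finite_supportD(1)[OF k(1), of l]
        by (cases "h l = \<zero>\<^bsub>V\<^esub>") auto
      then have "\<phi> (\<lambda>l. h l \<oplus>\<^bsub>V\<^esub> k l) \<in> level i"
        using fock_closed(1)[OF h(1,2) k(1,2)] by (intro levelI) auto
      then show ?thesis using h(4) k(4) add_M[OF h(1,2) k(1,2)] by simp
    qed
  qed (use smult in auto)
qed

lemma trunc_fock:
  assumes "h \<in> finite_support V" "ok V h"
  shows "(\<lambda>l. if int (length l) = i then h l else \<zero>\<^bsub>V\<^esub>) \<in> finite_support V"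
    "ok V (\<lambda>l. if int (length l) = i then h l else \<zero>\<^bsub>V\<^esub>)"
  by (rule finite_supportI[OF _ _ finite_supportD(2)[OF assms(1)]])
    (use finite_supportD(1)[OF assms(1)] ok_trunc[OF V.qspace_axioms assms(2)] in auto)

lemma is_grading_level: "is_grading (underlying P M) level"
proof -
  define \<psi> where "\<psi> = inv_into {h \<in> finite_support V. ok V h} \<phi>"
  have \<psi> [simp]: "\<psi> (\<phi> h) = h" if "h \<in> finite_support V" "ok V h" for h
    using inj that by (simp add: \<psi>_def)
  define tr where "tr i h = (\<lambda>l. if int (length l) = i then h l else \<zero>\<^bsub>V\<^esub>)" for i and h :: "nat list \<Rightarrow> 'a"
  have tr [simp]: "tr i h \<in> finite_support V" "ok V (tr i h)" if "h \<in> finite_support V" "ok V h" for i h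
    unfolding tr_def by (fact trunc_fock[OF that])+
  define p where "p i x = \<phi> (tr i (\<psi> x))" for i x
  have p [simp]: "p i (\<phi> h) = \<phi> (tr i h)" if "h \<in> finite_support V" "ok V h" for i h
    using that by (simp add: p_def)
  note vals = finite_supportD(1)
  show ?thesis
  proof (rule is_gradingI[of _ _ p])
    show "qlinear (underlying P M) (underlying P M) (p i)" for i
    proof (rule qlinearI)
      fix x y assume "x \<in> carrier (underlying P M)" "y \<in> carrier (underlying P M)"
      then obtain h k where h: "h \<in> finite_support V" "ok V h" "x = \<phi> h" and k: "k \<in> finite_support V" "ok V k" "y = \<phi> k"
        by (auto simp: carrier_M)
      have "tr i (\<lambda>l. h l \<oplus>\<^bsub>V\<^esub> k l) = (\<lambda>l. tr i h l \<oplus>\<^bsub>V\<^esub> tr i k l)" by (auto simp: tr_def)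
      then show "p i (x \<oplus>\<^bsub>underlying P M\<^esub> y) = p i x \<oplus>\<^bsub>underlying P M\<^esub> p i y"
        using h k fock_closed(1)[OF h(1,2) k(1,2)] by (simp add: add_M)
    next
      fix q x assume "x \<in> carrier (underlying P M)"
      then obtain h where h: "h \<in> finite_support V" "ok V h" "x = \<phi> h" by (auto simp: carrier_M)
      have "tr i (\<lambda>l. q \<odot>\<^bsub>V\<^esub> h l) = (\<lambda>l. q \<odot>\<^bsub>V\<^esub> tr i h l)" by (auto simp: tr_def)
      then show "p i (q \<odot>\<^bsub>underlying P M\<^esub> x) = q \<odot>\<^bsub>underlying P M\<^esub> p i x"
        using h fock_closed(2)[OF h(1,2)] by (simp add: scalar_M)
    qed (auto simp: carrier_M)
    show "p i x \<in> level i" if "x \<in> carrier (underlying P M)" for i x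
    proof -
      obtain h where h: "h \<in> finite_support V" "ok V h" "x = \<phi> h"
        using \<open>x \<in> carrier (underlying P M)\<close> by (auto simp: carrier_M)
      have "tr i h l \<noteq> \<zero>\<^bsub>V\<^esub> \<Longrightarrow> int (length l) = i" for l by (simp add: tr_def split: if_splits)
      then have "\<phi> (tr i h) \<in> level i" using h by (intro levelI) simp_all
      then show ?thesis using h by simp
    qed
    show "p j x = (if j = i then x else \<zero>\<^bsub>underlying P M\<^esub>)" if "x \<in> level i" for i j x
    proof -
      obtain h where h: "h \<in> finite_support V" "ok V h" "\<forall>l. h l \<noteq> \<zero>\<^bsub>V\<^esub> \<longrightarrow> int (length l) = i" "x = \<phi> h"
        using \<open>x \<in> level i\<close> by (rule levelE)
      have "tr j h = (if j = i then h else (\<lambda>_. \<zero>\<^bsub>V\<^esub>))" using h(3) by (force simp: tr_def fun_eq_iff)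
      then show ?thesis using h by (simp add: zero_M)
    qed
    show "finite {i. p i x \<noteq> \<zero>\<^bsub>underlying P M\<^esub>}" if "x \<in> carrier (underlying P M)" for x
    proof -
      obtain h where h: "h \<in> finite_support V" "ok V h" "x = \<phi> h"
        using \<open>x \<in> carrier (underlying P M)\<close> by (auto simp: carrier_M)
      have "{i. p i x \<noteq> \<zero>\<^bsub>M\<^esub>} \<subseteq> (\<lambda>l. int (length l)) ` {l. h l \<noteq> \<zero>\<^bsub>V\<^esub>}"
      proof
        fix i assume "i \<in> {i. p i x \<noteq> \<zero>\<^bsub>M\<^esub>}"
        then obtain l where "tr i h l \<noteq> \<zero>\<^bsub>V\<^esub>" using h by (auto simp: phi_zero_iff)
        then show "i \<in> (\<lambda>l. int (length l)) ` {l. h l \<noteq> \<zero>\<^bsub>V\<^esub>}" by (auto simp: tr_def split: if_splits)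
      qed
      then show ?thesis using finite_supportD(2)[OF h(1)] by (simp add: finite_subset)
    qed
    show "x = \<zero>\<^bsub>underlying P M\<^esub>" if "x \<in> carrier (underlying P M)" and z: "\<And>i. p i x = \<zero>\<^bsub>underlying P M\<^esub>" for x
    proof -
      obtain h where h: "h \<in> finite_support V" "ok V h" "x = \<phi> h"
        using \<open>x \<in> carrier (underlying P M)\<close> by (auto simp: carrier_M)
      have "h l = \<zero>\<^bsub>V\<^esub>" for l
      proof -
        have "tr (int (length l)) h l = \<zero>\<^bsub>V\<^esub>" using z[of "int (length l)"] h by (simp add: phi_zero_iff)
        then show ?thesis by (simp add: tr_def)
      qed
      then show ?thesis using h by (simp add: phi_zero_iff)
    qed
  qed (use qspace_underlying submodule_level in auto)
qed

lemma graded_module_level: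
  assumes shift: "\<And>s h i l. \<lbrakk>s \<in> fst P; h \<in> finite_support V; ok V h; \<And>l. h l \<noteq> \<zero>\<^bsub>V\<^esub> \<Longrightarrow> int (length l) = i;
      G V s h l \<noteq> \<zero>\<^bsub>V\<^esub>\<rbrakk> \<Longrightarrow> int (length l) = i + deg s"
  shows "graded_module P deg M level"
  unfolding graded_module_iff
proof (intro conjI allI ballI impI)
  fix s i x assume s: "s \<in> fst P" and x: "x \<in> level i"
  obtain h where h: "h \<in> finite_support V" "ok V h" "\<forall>l. h l \<noteq> \<zero>\<^bsub>V\<^esub> \<longrightarrow> int (length l) = i" "x = \<phi> h"
    using x by (rule levelE)
  have "\<phi> (G V s h) \<in> level (i + deg s)"
    by (rule levelI) (use fock_closed(3)[OF h(1,2) s] shift[OF s h(1,2) h(3)[rule_format]] in auto)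
  then show "act P M s x \<in> level (i + deg s)" using h s by (simp add: act_M)
qed (use level_negative is_grading_level left_module_axioms in auto)

text \<open>
  A function supported at the empty word is its value there, an arbitrary element of \<open>V\<close>.
\<close>

lemma vacuum_iso: "\<exists>i. is_iso (vector_spaces TYPE('a)) (rational_subspace P M (level 0)) V i"
proof -
  let ?U = "rational_subspace P M (level 0)"
  interpret g: grading "underlying P M" level
    by (intro grading.intro grading_axioms.intro qspace_underlying is_grading_level)
  have U: "qspace ?U"
    by (rule rational_subspace_qspace[OF presented_module_axioms])
      (use g.W_closed[where i = 0] in auto)
  have V: "qspace V" by (rule V.qspace_axioms)
  define d where "d v = (\<lambda>l :: nat list. if l = [] then v else \<zero>\<^bsub>V\<^esub>)" for v
  have d: "d v \<in> finite_support V" "ok V (d v)" if "v \<in> carrier V" for v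
    by (rule finite_supportI[of _ _ "{[]}"]) (use that ok_vac[OF V that] in \<open>auto simp: d_def\<close>)
  have in_level: "\<phi> (d v) \<in> level 0" if "v \<in> carrier V" for v
    by (rule levelI) (use d[OF that] in \<open>auto simp: d_def split: if_splits\<close>)
  have level0: "\<exists>v\<in>carrier V. x = \<phi> (d v)" if "x \<in> level 0" for x
  proof -
    obtain h where h: "h \<in> finite_support V" "ok V h" "\<forall>l. h l \<noteq> \<zero>\<^bsub>V\<^esub> \<longrightarrow> int (length l) = 0" "x = \<phi> h"
      using \<open>x \<in> level 0\<close> by (rule levelE)
    have "h = d (h [])" using h(3) by (auto simp: d_def fun_eq_iff)
    then show ?thesis using h finite_supportD(1)[OF h(1)] by metis
  qed
  have lin: "qlinear V ?U (\<lambda>v. \<phi> (d v))"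
  proof (rule qlinearI)
    fix v w assume vw: "v \<in> carrier V" "w \<in> carrier V"
    have "d (v \<oplus>\<^bsub>V\<^esub> w) = (\<lambda>l. d v l \<oplus>\<^bsub>V\<^esub> d w l)" by (auto simp: d_def)
    then show "\<phi> (d (v \<oplus>\<^bsub>V\<^esub> w)) = \<phi> (d v) \<oplus>\<^bsub>?U\<^esub> \<phi> (d w)" using vw d by (simp add: add_M)
  next
    fix q v assume v: "v \<in> carrier V"
    have "d (q \<odot>\<^bsub>V\<^esub> v) = (\<lambda>l. q \<odot>\<^bsub>V\<^esub> d v l)" by (auto simp: d_def)
    then show "\<phi> (d (q \<odot>\<^bsub>V\<^esub> v)) = q \<odot>\<^bsub>?U\<^esub> \<phi> (d v)" using v d by (simp add: scalar_M)
  qed (use in_level in simp)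
  have inj_d: "v = w" if "v \<in> carrier V" "w \<in> carrier V" "\<phi> (d v) = \<phi> (d w)" for v w
  proof -
    have "d v [] = d w []" using that d phi_eq_iff by simp
    then show ?thesis by (simp add: d_def)
  qed
  then have bij: "bij_betw (\<lambda>v. \<phi> (d v)) (carrier V) (carrier ?U)"
    using in_level by (auto simp: bij_betw_def inj_on_def dest!: level0)
  let ?inv = "inv_into (carrier V) (\<lambda>v. \<phi> (d v))"
  have inv1 [simp]: "?inv (\<phi> (d v)) = v" if "v \<in> carrier V" for v
    using bij_betw_inv_into_left[OF bij that] .
  have lin': "qlinear ?U V ?inv"
  proof (rule qlinearI)
    fix x assume "x \<in> carrier ?U"
    then obtain v where v: "v \<in> carrier V" "x = \<phi> (d v)" using level0 by auto
    then show "?inv x \<in> carrier V" by simp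
    show "?inv (q \<odot>\<^bsub>?U\<^esub> x) = q \<odot>\<^bsub>V\<^esub> ?inv x" for q
      using v by (simp only: qlinearD(3)[OF lin, symmetric] inv1 V.scale_closed)
    fix y assume "y \<in> carrier ?U"
    then obtain w where w: "w \<in> carrier V" "y = \<phi> (d w)" using level0 by auto
    show "?inv (x \<oplus>\<^bsub>?U\<^esub> y) = ?inv x \<oplus>\<^bsub>V\<^esub> ?inv y"
      using v w by (simp only: qlinearD(2)[OF lin, symmetric] inv1 V.M.add.m_closed)
  qed
  have "is_iso (vector_spaces TYPE('a)) ?U V (restrict ?inv (carrier ?U))"
    unfolding is_iso_def vector_spaces_simps
  proof (intro conjI bexI)
    show "restrict ?inv (carrier ?U) \<in> linear_maps rat_ring ?U V" by (rule qlinear_restrict[OF lin' U])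
    show "restrict (\<lambda>v. \<phi> (d v)) (carrier V) \<in> linear_maps rat_ring V ?U" by (rule qlinear_restrict[OF lin V])
    show "compose (carrier ?U) (restrict (\<lambda>v. \<phi> (d v)) (carrier V)) (restrict ?inv (carrier ?U)) = (\<lambda>x\<in>carrier ?U. x)"
      using bij_betw_inv_into_right[OF bij] qlinearD(1)[OF lin'] by (auto simp: compose_def fun_eq_iff)
    show "compose (carrier V) (restrict ?inv (carrier ?U)) (restrict (\<lambda>v. \<phi> (d v)) (carrier V)) = (\<lambda>x\<in>carrier V. x)"
      using qlinearD(1)[OF lin] by (auto simp: compose_def fun_eq_iff in_level)
  qed
  then show ?thesis by blast
qed

end

lemma (in fock_realization) level_zero_iff:
  assumes "h \<in> finite_support V" "ok V h"
  shows "\<phi> h \<in> level 0 \<longleftrightarrow> (\<forall>n l. h (n # l) = \<zero>\<^bsub>V\<^esub>)"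
proof
  assume "\<phi> h \<in> level 0"
  then obtain k where k: "k \<in> finite_support V" "ok V k"
    "\<forall>l. k l \<noteq> \<zero>\<^bsub>V\<^esub> \<longrightarrow> int (length l) = 0" "\<phi> h = \<phi> k" by (rule levelE)
  then have "h = k" using assms phi_eq_iff by blast
  then show "\<forall>n l. h (n # l) = \<zero>\<^bsub>V\<^esub>" using k(3) by force
next
  assume *: "\<forall>n l. h (n # l) = \<zero>\<^bsub>V\<^esub>"
  show "\<phi> h \<in> level 0"
  proof (rule levelI[OF assms])
    fix l assume "h l \<noteq> \<zero>\<^bsub>V\<^esub>"
    then show "int (length l) = 0" using * by (cases l) auto
  qed
qed

subsection \<open>Modules in Fock coordinates\<close>

text \<open>
  The coordinates identify such a module with the Fock space over its own vacuum space.
\<close>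

locale fock_module = fock_model P ok G + presented_module P M + ann: annihilation "underlying P M" a \<pi>
  for P :: "'g presentation" and ok G and M :: "('g ncpoly set, 'a) module" and a \<pi> +
  assumes coord_ok: "x \<in> carrier M \<Longrightarrow> ok (rational_subspace P M ann.vac) (ann.coord x)"
    and coord_surj: "\<lbrakk>h \<in> finite_support (rational_subspace P M ann.vac); ok (rational_subspace P M ann.vac) h\<rbrakk>
        \<Longrightarrow> \<exists>x\<in>carrier M. ann.coord x = h"
    and coord_act: "\<lbrakk>s \<in> fst P; x \<in> carrier M\<rbrakk>
        \<Longrightarrow> ann.coord (act P M s x) = G (rational_subspace P M ann.vac) s (ann.coord x)"
begin

abbreviation "Vac \<equiv> rational_subspace P M ann.vac"

lemma qspace_Vac: "qspace Vac"
proof -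
  have z: "a n \<zero>\<^bsub>underlying P M\<^esub> = \<zero>\<^bsub>underlying P M\<^esub>" for n
    by (rule qlinear_zero[OF ann.A ann.qspace_axioms ann.qspace_axioms])
  show ?thesis
    by (rule rational_subspace_qspace[OF presented_module_axioms])
      (use z ann.scale_closed in \<open>auto simp: ann.vac_def qlinearD(2,3)[OF ann.A, simplified]
        rc_action scalar_in_free_algebra qlinear_zero[OF qlinear_scale[OF ann.qspace_axioms] ann.qspace_axioms ann.qspace_axioms, simplified]\<close>)
qed

lemma coord_fock: "x \<in> carrier M \<Longrightarrow> ann.coord x \<in> finite_support Vac"
  using ann.coord_finite_support by (auto simp: finite_support_def)

end

text \<open>
  Applying \<open>f\<close> to all coordinates commutes with the generators, because in coordinates these act by
  operators that are natural in the vacuum space.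
\<close>

lemma fock_full:
  assumes "fock_module P ok G M a \<pi>" "fock_module P ok G N b \<rho>"
    and f: "qlinear (rational_subspace P M (annihilation.vac (underlying P M) a))
      (rational_subspace P N (annihilation.vac (underlying P N) b)) f"
  obtains F where "F \<in> linear_maps (presented_algebra P) M N"
    "\<And>x. x \<in> carrier M \<Longrightarrow> annihilation.coord b \<rho> (F x) = (\<lambda>l. f (annihilation.coord a \<pi> x l))"
    "\<And>v. v \<in> annihilation.vac (underlying P M) a \<Longrightarrow> F v = f v"
proof -
  interpret M: fock_module P ok G M a \<pi> by fact
  interpret N: fock_module P ok G N b \<rho> by fact
  have fc: "\<exists>y\<in>carrier (underlying P N). N.ann.coord y = (\<lambda>l. f (M.ann.coord x l))" if "x \<in> carrier M" for x
  proof -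
    have "(\<lambda>l. f (M.ann.coord x l)) \<in> finite_support N.Vac"
      by (rule finite_support_linear[OF M.qspace_Vac N.qspace_Vac f M.coord_fock[OF that]])
    moreover have "ok N.Vac (\<lambda>l. f (M.ann.coord x l))"
      by (rule M.ok_natural[OF M.qspace_Vac N.qspace_Vac f M.coord_fock[OF that] M.coord_ok[OF that]])
    ultimately show ?thesis using N.coord_surj by simp
  qed
  obtain F where F: "qlinear (underlying P M) (underlying P N) F"
    "\<And>x. x \<in> carrier M \<Longrightarrow> N.ann.coord (F x) = (\<lambda>l. f (M.ann.coord x l))"
    "\<And>v. v \<in> M.ann.vac \<Longrightarrow> F v = f v"
    by (rule coord_extension[OF M.ann.annihilation_axioms N.ann.annihilation_axioms, of f])
      (use qlinearD[OF f] fc in auto)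
  have act: "F (act P M s x) = act P N s (F x)" if "s \<in> fst P" "x \<in> carrier M" for s x
  proof (rule N.ann.coord_inject)
    have sx: "act P M s x \<in> carrier M" using qlinearD(1)[OF M.qlinear_act[OF that(1)]] that by simp
    have Fx: "F x \<in> carrier N" using qlinearD(1)[OF F(1)] that by simp
    show "F (act P M s x) \<in> carrier (underlying P N)" using qlinearD(1)[OF F(1)] sx by simp
    show "act P N s (F x) \<in> carrier (underlying P N)" using qlinearD(1)[OF N.qlinear_act[OF that(1)]] Fx by simp
    have "N.ann.coord (F (act P M s x)) = (\<lambda>l. f (G M.Vac s (M.ann.coord x) l))"
      using F(2)[OF sx] M.coord_act[OF that] by simp
    also have "\<dots> = G N.Vac s (\<lambda>l. f (M.ann.coord x l))"
      using M.G_natural[OF M.qspace_Vac N.qspace_Vac f M.coord_fock[OF that(2)] M.coord_ok[OF that(2)] that(1)] by simp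
    also have "\<dots> = N.ann.coord (act P N s (F x))"
      using F(2)[OF that(2)] N.coord_act[OF that(1) Fx] by simp
    finally show "N.ann.coord (F (act P M s x)) = N.ann.coord (act P N s (F x))" .
  qed
  let ?F = "restrict F (carrier M)"
  have "?F \<in> linear_maps (presented_algebra P) M N"
    unfolding linear_maps_presented_iff[OF M.presented_module_axioms N.presented_module_axioms]
  proof (intro conjI ballI)
    show "qlinear (underlying P M) (underlying P N) ?F"
      by (rule qlinear_cong[OF F(1) M.qspace_underlying]) simp
    show "?F (act P M s x) = act P N s (?F x)" if "s \<in> fst P" "x \<in> carrier M" for s x
      using act[OF that] qlinearD(1)[OF M.qlinear_act[OF that(1)]] that by simp
  qed simp
  moreover have "v \<in> carrier M" if "v \<in> M.ann.vac" for v using M.ann.vac_carrier[OF that] by simp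
  ultimately show ?thesis using that[of ?F] F by simp
qed

text \<open>
  A map that commutes with annihilation operators and with the projections acts on coordinates through
  its restriction to vacuum vectors.
\<close>

lemma fock_faithful:
  assumes "fock_module P ok G M a \<pi>" "fock_module P ok G N b \<rho>"
    and g: "\<And>x n. x \<in> carrier M \<Longrightarrow> g (a n x) = b n (g x)" "\<And>x. x \<in> carrier M \<Longrightarrow> g (\<pi> x) = \<rho> (g x)"
      "\<And>x. x \<in> carrier M \<Longrightarrow> g x \<in> carrier N"
    and h: "\<And>x n. x \<in> carrier M \<Longrightarrow> h (a n x) = b n (h x)" "\<And>x. x \<in> carrier M \<Longrightarrow> h (\<pi> x) = \<rho> (h x)"
      "\<And>x. x \<in> carrier M \<Longrightarrow> h x \<in> carrier N"
    and eq: "\<And>v. v \<in> annihilation.vac (underlying P M) a \<Longrightarrow> g v = h v"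
    and x: "x \<in> carrier M"
  shows "g x = h x"
proof -
  interpret M: fock_module P ok G M a \<pi> by fact
  interpret N: fock_module P ok G N b \<rho> by fact
  have ac: "a n x \<in> carrier M" if "x \<in> carrier M" for x n using M.ann.A_closed that by simp
  have "N.ann.coord (k x) l = k (M.ann.coord x l)"
    if k: "\<And>x n. x \<in> carrier M \<Longrightarrow> k (a n x) = b n (k x)" "\<And>x. x \<in> carrier M \<Longrightarrow> k (\<pi> x) = \<rho> (k x)"
      and "x \<in> carrier M" for k x l
    using that(3)
  proof (induction l arbitrary: x)
    case Nil then show ?case using k(2) by (simp add: N.ann.coord_def M.ann.coord_def)
  next
    case (Cons n l)
    then show ?case using Cons.IH[OF ac[OF Cons.prems], of n] k(1)
      by (simp add: N.ann.coord_Cons M.ann.coord_Cons)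
  qed
  from this[of g, OF g(1,2) x] this[of h, OF h(1,2) x] have "N.ann.coord (g x) = N.ann.coord (h x)"
    using eq[OF M.ann.coord_vac] x by (auto simp: fun_eq_iff)
  then show ?thesis by (rule N.ann.coord_inject[rotated 2]) (use g(3) h(3) x in auto)
qed

section \<open>Bosonic and fermionic Fock spaces\<close>

lemma finite_subset_lessThan: "finite S \<Longrightarrow> \<exists>m :: nat. S \<subseteq> {..<m}"
  by (auto simp: finite_nat_set_iff_bounded)

definition ann :: "nat \<Rightarrow> (nat list \<Rightarrow> 'a) \<Rightarrow> nat list \<Rightarrow> 'a" where
  "ann n h l = h (n # l)"

text \<open>
  The recursion is the relation \<open>a\<^sub>j c\<^sub>n = \<delta>\<^sub>j\<^sub>n + \<epsilon> c\<^sub>n a\<^sub>j\<close> evaluated on coordinates; the value at the empty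
  word is zero because created vectors have no vacuum component.
\<close>

fun cre :: "rat \<Rightarrow> (rat, 'a) module \<Rightarrow> nat \<Rightarrow> (nat list \<Rightarrow> 'a) \<Rightarrow> nat list \<Rightarrow> 'a" where
  "cre \<epsilon> V n h [] = \<zero>\<^bsub>V\<^esub>"
| "cre \<epsilon> V n h (j # l) = (if j = n then h l else \<zero>\<^bsub>V\<^esub>) \<oplus>\<^bsub>V\<^esub> \<epsilon> \<odot>\<^bsub>V\<^esub> cre \<epsilon> V n (ann j h) l"

text \<open>
  The coordinates of vectors have this property if the annihilation operators satisfy
  \<open>a\<^sub>i a\<^sub>j = \<epsilon> a\<^sub>j a\<^sub>i\<close>.
\<close>

definition twisted :: "rat \<Rightarrow> (rat, 'a) module \<Rightarrow> (nat list \<Rightarrow> 'a) \<Rightarrow> bool" where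
  "twisted \<epsilon> V h \<longleftrightarrow> (\<forall>p i j q. h (p @ i # j # q) = \<epsilon> \<odot>\<^bsub>V\<^esub> h (p @ j # i # q))"

lemma twistedD: "twisted \<epsilon> V h \<Longrightarrow> h (p @ i # j # q) = \<epsilon> \<odot>\<^bsub>V\<^esub> h (p @ j # i # q)"
  unfolding twisted_def by blast

lemma twisted_ann: "twisted \<epsilon> V h \<Longrightarrow> twisted \<epsilon> V (ann n h)"
  unfolding twisted_def ann_def by (metis append_Cons)

lemma ann_ann: "twisted \<epsilon> V h \<Longrightarrow> ann i (ann j h) = (\<lambda>l. \<epsilon> \<odot>\<^bsub>V\<^esub> ann j (ann i h) l)"
  unfolding ann_def fun_eq_iff using twistedD[of \<epsilon> V h "[]"] by (metis append_Nil)

lemma ann_closed: "\<forall>l. h l \<in> carrier V \<Longrightarrow> \<forall>l. ann n h l \<in> carrier V"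
  by (simp add: ann_def)

lemma ann_linear:
  "ann n (\<lambda>l. h l \<oplus>\<^bsub>V\<^esub> k l) = (\<lambda>l. ann n h l \<oplus>\<^bsub>V\<^esub> ann n k l)"
  "ann n (\<lambda>l. f (h l)) = (\<lambda>l. f (ann n h l))"
  by (simp_all add: ann_def fun_eq_iff)

lemma ann_finite_support: "h \<in> finite_support V \<Longrightarrow> ann n h \<in> finite_support V"
proof -
  assume h: "h \<in> finite_support V"
  have "finite ((\<lambda>l. n # l) -` {l. h l \<noteq> \<zero>\<^bsub>V\<^esub>})"
    by (rule finite_vimageI[OF finite_supportD(2)[OF h]]) simp
  then show ?thesis
    by (rule finite_supportI[rotated 2]) (use finite_supportD(1)[OF h] in \<open>auto simp: ann_def\<close>)
qed

text \<open>
  Creation inserts the letter \<open>n\<close> into the words of the support. This keeps supports finite and raises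
  the degree by one.
\<close>

lemma cre_nonzero:
  assumes "qspace V" "cre \<epsilon> V n h l \<noteq> \<zero>\<^bsub>V\<^esub>"
  shows "\<exists>k. h k \<noteq> \<zero>\<^bsub>V\<^esub> \<and> length l = Suc (length k) \<and> set l \<subseteq> insert n (set k)"
  using assms(2)
proof (induction l arbitrary: h)
  case (Cons j l)
  interpret qspace V by fact
  show ?case
  proof (cases "j = n \<and> h l \<noteq> \<zero>\<^bsub>V\<^esub>")
    case True
    then show ?thesis by (intro exI[of _ l]) auto
  next
    case False
    then have "cre \<epsilon> V n (ann j h) l \<noteq> \<zero>\<^bsub>V\<^esub>" using Cons.prems by (auto split: if_splits)
    from Cons.IH[OF this] obtain k where "h (j # k) \<noteq> \<zero>\<^bsub>V\<^esub>" "length l = Suc (length k)" "set l \<subseteq> insert n (set k)"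
      by (auto simp: ann_def)
    then show ?thesis by (intro exI[of _ "j # k"]) auto
  qed
qed simp

lemma cre_natural:
  assumes "qspace V" "qspace V'" "qlinear V V' f" "\<forall>l. h l \<in> carrier V"
  shows "cre \<epsilon> V' n (\<lambda>l. f (h l)) l = f (cre \<epsilon> V n h l)" and "cre \<epsilon> V n h l \<in> carrier V"
proof -
  interpret V: qspace V by fact
  have c: "cre \<epsilon> V n h l \<in> carrier V" if "\<forall>l. h l \<in> carrier V" for h l
    using that
  proof (induction l arbitrary: h)
    case (Cons j l)
    then show ?case using Cons.IH[OF ann_closed[OF Cons.prems]] by simp
  qed simp
  then show "cre \<epsilon> V n h l \<in> carrier V" using assms(4) .
  show "cre \<epsilon> V' n (\<lambda>l. f (h l)) l = f (cre \<epsilon> V n h l)"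
    using assms(4)
  proof (induction l arbitrary: h)
    case Nil
    then show ?case by (simp add: qlinear_zero[OF assms(3,1,2)])
  next
    case (Cons j l)
    note IH = Cons.IH[OF ann_closed[OF Cons.prems, of j]] and c' = c[OF ann_closed[OF Cons.prems, of j]]
    show ?case
      using Cons.prems IH c' by (simp add: ann_linear(2) qlinearD(2,3)[OF assms(3)] qlinear_zero[OF assms(3,1,2)])
  qed
qed

text \<open>
  Bosons for \<open>\<epsilon> = 1\<close>, fermions for \<open>\<epsilon> = -1\<close>.
\<close>

locale statistics = qspace V for V :: "(rat, 'a) module" (structure) +
  fixes \<epsilon> :: rat
  assumes \<epsilon>: "\<epsilon> * \<epsilon> = 1"
begin

text \<open>
  The shape in which the contributions of two letters appear when neighbouring letters of a word, or
  two creation operators, are exchanged.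
\<close>

lemma swap_sign:
  "\<lbrakk>x \<in> carrier V; y \<in> carrier V; z \<in> carrier V\<rbrakk> \<Longrightarrow>
   x \<oplus> \<epsilon> \<odot> (y \<oplus> \<epsilon> \<odot> (\<epsilon> \<odot> z)) = \<epsilon> \<odot> (y \<oplus> \<epsilon> \<odot> (x \<oplus> \<epsilon> \<odot> z))"
  by (simp add: scale_add_right \<epsilon> M.add.m_ac flip: mult.assoc)

lemma cre_closed: "\<forall>l. h l \<in> carrier V \<Longrightarrow> cre \<epsilon> V n h l \<in> carrier V"
  by (rule cre_natural(2)[OF qspace_axioms qspace_axioms, of "\<lambda>x. x"]) (simp_all add: qlinear_def)

lemma cre_smult: "\<forall>l. h l \<in> carrier V \<Longrightarrow> cre \<epsilon> V n (\<lambda>l. q \<odot> h l) l = q \<odot> cre \<epsilon> V n h l"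
  by (rule cre_natural(1)[OF qspace_axioms qspace_axioms qlinear_scale[OF qspace_axioms]])

lemma cre_add:
  "\<lbrakk>\<forall>l. h l \<in> carrier V; \<forall>l. k l \<in> carrier V\<rbrakk> \<Longrightarrow>
   cre \<epsilon> V n (\<lambda>l. h l \<oplus> k l) l = cre \<epsilon> V n h l \<oplus> cre \<epsilon> V n k l"
proof (induction l arbitrary: h k)
  case (Cons j l)
  note h = ann_closed[OF Cons.prems(1), of j] and k = ann_closed[OF Cons.prems(2), of j]
  show ?case
    using Cons.prems Cons.IH[OF h k] cre_closed[OF h] cre_closed[OF k]
    by (cases "j = n") (simp_all add: ann_linear(1) scale_add_right M.add.m_ac)
qed simp

lemma cre_if: "cre \<epsilon> V n (\<lambda>l. if b then h l else \<zero>) l = (if b then cre \<epsilon> V n h l else \<zero>)"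
proof -
  have "cre \<epsilon> V n (\<lambda>l. \<zero>) l = \<zero>" by (induction l) (simp_all add: ann_def[abs_def])
  then show ?thesis by simp
qed

lemma ann_cre: "ann j (cre \<epsilon> V n h) = (\<lambda>l. (if j = n then h l else \<zero>) \<oplus> \<epsilon> \<odot> cre \<epsilon> V n (ann j h) l)"
  by (simp add: ann_def[of j "cre \<epsilon> V n h"] fun_eq_iff)

lemma cre_finite_support:
  assumes "h \<in> finite_support V"
  shows "cre \<epsilon> V n h \<in> finite_support V"
proof -
  let ?B = "\<Union>k\<in>{k. h k \<noteq> \<zero>}. {l. set l \<subseteq> insert n (set k) \<and> length l = Suc (length k)}"
  have "finite ?B"
    by (intro finite_UN_I finite_supportD(2)[OF assms] finite_lists_length_eq) simp
  moreover have "{l. cre \<epsilon> V n h l \<noteq> \<zero>} \<subseteq> ?B"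
  proof
    fix l assume "l \<in> {l. cre \<epsilon> V n h l \<noteq> \<zero>}"
    then have "cre \<epsilon> V n h l \<noteq> \<zero>" by simp
    from cre_nonzero[OF qspace_axioms this] show "l \<in> ?B" by auto
  qed
  ultimately show ?thesis
    by (intro finite_supportI[of _ _ ?B] cre_closed) (use finite_supportD(1)[OF assms] in auto)
qed

lemma cre_twisted:
  assumes h: "\<forall>l. h l \<in> carrier V" and tw: "twisted \<epsilon> V h"
  shows "twisted \<epsilon> V (cre \<epsilon> V n h)"
proof -
  have "cre \<epsilon> V n h (p @ i # j # q) = \<epsilon> \<odot> cre \<epsilon> V n h (p @ j # i # q)" for p i j q
    using h tw
  proof (induction p arbitrary: h)
    case Nil
    have eq: "cre \<epsilon> V n (ann j (ann i h)) q = \<epsilon> \<odot> cre \<epsilon> V n (ann i (ann j h)) q"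
      using ann_ann[OF Nil(2), of j i] cre_smult[OF ann_closed[OF ann_closed[OF Nil(1)]]] by simp
    have c: "cre \<epsilon> V n (ann i (ann j h)) q \<in> carrier V"
      by (rule cre_closed[OF ann_closed[OF ann_closed[OF Nil(1)]]])
    have "(if i = n then h (j # q) else \<zero>) \<in> carrier V" "(if j = n then h (i # q) else \<zero>) \<in> carrier V"
      using Nil(1) by simp_all
    from swap_sign[OF this c] show ?case
      by (simp only: append_Nil cre.simps eq ann_def[of _ h])
  next
    case (Cons k p)
    have c: "cre \<epsilon> V n (ann k h) l \<in> carrier V" for l by (rule cre_closed[OF ann_closed[OF Cons.prems(1)]])
    have "(if k = n then h (p @ i # j # q) else \<zero>) = \<epsilon> \<odot> (if k = n then h (p @ j # i # q) else \<zero>)"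
      using twistedD[OF Cons.prems(2), of p i j q] by simp
    then show ?case
      using Cons.prems(1) c Cons.IH[OF ann_closed[OF Cons.prems(1)] twisted_ann[OF Cons.prems(2)], of k]
      by (simp add: scale_add_right)
  qed
  then show ?thesis unfolding twisted_def by blast
qed

lemma cre_cre:
  "\<forall>l. h l \<in> carrier V \<Longrightarrow> cre \<epsilon> V i (cre \<epsilon> V j h) l = \<epsilon> \<odot> cre \<epsilon> V j (cre \<epsilon> V i h) l"
proof (induction l arbitrary: h)
  case (Cons k l)
  note h = ann_closed[OF Cons.prems, of k]
  have c: "cre \<epsilon> V n h l \<in> carrier V" "cre \<epsilon> V n (cre \<epsilon> V m (ann k h)) l \<in> carrier V" for n m l
    using cre_closed[OF Cons.prems] cre_closed[of "cre \<epsilon> V m (ann k h)" n l] cre_closed[OF h] by simp_all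
  have IH: "cre \<epsilon> V i (cre \<epsilon> V j (ann k h)) l = \<epsilon> \<odot> cre \<epsilon> V j (cre \<epsilon> V i (ann k h)) l"
    by (rule Cons.IH[OF h])
  have expand: "cre \<epsilon> V i (ann k (cre \<epsilon> V j h)) l =
     (if k = j then cre \<epsilon> V i h l else \<zero>) \<oplus> \<epsilon> \<odot> cre \<epsilon> V i (cre \<epsilon> V j (ann k h)) l" for i j
  proof -
    have "cre \<epsilon> V i (ann k (cre \<epsilon> V j h)) l = cre \<epsilon> V i (\<lambda>l. if k = j then h l else \<zero>) l \<oplus>
        cre \<epsilon> V i (\<lambda>l. \<epsilon> \<odot> cre \<epsilon> V j (ann k h) l) l"
      unfolding ann_cre by (rule cre_add) (use Cons.prems cre_closed[OF h] in auto)
    also have "cre \<epsilon> V i (\<lambda>l. \<epsilon> \<odot> cre \<epsilon> V j (ann k h) l) l = \<epsilon> \<odot> cre \<epsilon> V i (cre \<epsilon> V j (ann k h)) l"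
      by (rule cre_smult) (use cre_closed[OF h] in auto)
    finally show ?thesis by (simp only: cre_if)
  qed
  show ?case
    by (simp only: cre.simps expand IH) (rule swap_sign; simp add: c)
qed simp

text \<open>
  Moving the first letter \<open>k\<close> of a word past \<open>c\<^sub>n a\<^sub>n\<close> produces two factors \<open>\<epsilon>\<close>, which cancel, and an extra
  term \<open>h (k # l)\<close> for \<open>n = k\<close>. So each letter contributes one copy of the value.
\<close>

lemma number_operator:
  assumes "\<forall>l. h l \<in> carrier V" "twisted \<epsilon> V h" "\<And>l. h l \<noteq> \<zero> \<Longrightarrow> set l \<subseteq> {..<m}"
  shows "(\<Oplus>n\<in>{..<m}. cre \<epsilon> V n (ann n h) l) = of_nat (length l) \<odot> h l"
  using assms
proof (induction l arbitrary: h)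
  case Nil
  then show ?case by simp
next
  case (Cons k l)
  note hk = ann_closed[OF Cons.prems(1), of k]
  have step: "cre \<epsilon> V n (ann n h) (k # l) = (if k = n then h (k # l) else \<zero>) \<oplus> cre \<epsilon> V n (ann n (ann k h)) l" for n
  proof -
    have "cre \<epsilon> V n (ann k (ann n h)) l = \<epsilon> \<odot> cre \<epsilon> V n (ann n (ann k h)) l"
      using ann_ann[OF Cons.prems(2), of k n] cre_smult[OF ann_closed[OF hk]] by simp
    moreover have "cre \<epsilon> V n (ann n (ann k h)) l \<in> carrier V" by (rule cre_closed[OF ann_closed[OF hk]])
    ultimately show ?thesis by (simp add: \<epsilon> ann_def[of n h])
  qed
  have c: "(\<lambda>n. cre \<epsilon> V n (ann n (ann k h)) l) \<in> {..<m} \<rightarrow> carrier V"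
    using cre_closed[OF ann_closed[OF hk]] by auto
  have "(\<Oplus>n\<in>{..<m}. cre \<epsilon> V n (ann n h) (k # l)) =
     (\<Oplus>n\<in>{..<m}. if k = n then h (k # l) else \<zero>) \<oplus> (\<Oplus>n\<in>{..<m}. cre \<epsilon> V n (ann n (ann k h)) l)"
    unfolding step by (rule M.finsum_addf) (use Cons.prems(1) c in auto)
  also have "(\<Oplus>n\<in>{..<m}. if k = n then h (k # l) else \<zero>) = h (k # l)"
  proof (cases "k < m")
    case True
    then show ?thesis using M.add.finprod_singleton[of k "{..<m}" "\<lambda>_. h (k # l)"] Cons.prems(1) by simp
  next
    case False
    then have "h (k # l) = \<zero>" using Cons.prems(3)[of "k # l"] by auto
    then show ?thesis by (simp only: if_cancel M.finsum_zero)
  qed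
  also have "(\<Oplus>n\<in>{..<m}. cre \<epsilon> V n (ann n (ann k h)) l) = of_nat (length l) \<odot> ann k h l"
    by (rule Cons.IH[OF hk twisted_ann[OF Cons.prems(2)]]) (use Cons.prems(3) in \<open>force simp: ann_def\<close>)
  also have "h (k # l) \<oplus> of_nat (length l) \<odot> ann k h l = of_nat (length (k # l)) \<odot> h (k # l)"
    using Cons.prems(1) scale_add_left[of "h (k # l)" 1 "of_nat (length l)"] by (simp add: ann_def)
  finally show ?case .
qed

lemma twisted_fock: "qspace (fock (twisted \<epsilon>) V)"
proof (rule qspace_fock[OF qspace_axioms])
  fix h k :: "nat list \<Rightarrow> 'a" assume h: "h \<in> finite_support V" "twisted \<epsilon> V h"
  note hc = finite_supportD(1)[OF h(1)]
  have h': "h (p @ i # j # q) = \<epsilon> \<odot> h (p @ j # i # q)" for p i j q by (rule twistedD[OF h(2)])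
  show "twisted \<epsilon> V (\<lambda>l. q \<odot> h l)" for q
    unfolding twisted_def
  proof (intro allI)
    fix p i j r
    show "q \<odot> h (p @ i # j # r) = \<epsilon> \<odot> (q \<odot> h (p @ j # i # r))"
      unfolding h'[of p i j r] using hc by (simp add: mult.commute)
  qed
  assume k: "k \<in> finite_support V" "twisted \<epsilon> V k"
  have k': "k (p @ i # j # q) = \<epsilon> \<odot> k (p @ j # i # q)" for p i j q by (rule twistedD[OF k(2)])
  show "twisted \<epsilon> V (\<lambda>l. h l \<oplus> k l)"
    unfolding twisted_def
  proof (intro allI)
    fix p i j r
    show "h (p @ i # j # r) \<oplus> k (p @ i # j # r) = \<epsilon> \<odot> (h (p @ j # i # r) \<oplus> k (p @ j # i # r))"
      unfolding h'[of p i j r] k'[of p i j r] using hc finite_supportD(1)[OF k(1)] by (simp add: scale_add_right)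
  qed
qed (simp add: twisted_def)

end

lemma (in statistics) qlinear_fock:
  "qlinear (fock (twisted \<epsilon>) V) (fock (twisted \<epsilon>) V) (ann n)"
  "qlinear (fock (twisted \<epsilon>) V) (fock (twisted \<epsilon>) V) (cre \<epsilon> V n)"
proof -
  have closed: "\<forall>l. h l \<in> carrier V" if "h \<in> finite_support V" for h :: "nat list \<Rightarrow> 'a"
    using finite_supportD(1)[OF that] by blast
  show "qlinear (fock (twisted \<epsilon>) V) (fock (twisted \<epsilon>) V) (ann n)"
  proof (rule qlinearI)
    fix h assume "h \<in> carrier (fock (twisted \<epsilon>) V)"
    then have h: "h \<in> finite_support V" "twisted \<epsilon> V h" by simp_all
    then show "ann n h \<in> carrier (fock (twisted \<epsilon>) V)"
      using ann_finite_support[OF h(1)] twisted_ann[OF h(2)] by simp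
  qed (simp_all add: ann_def fun_eq_iff)
  show "qlinear (fock (twisted \<epsilon>) V) (fock (twisted \<epsilon>) V) (cre \<epsilon> V n)"
  proof (rule qlinearI)
    fix h assume "h \<in> carrier (fock (twisted \<epsilon>) V)"
    then have h: "h \<in> finite_support V" "twisted \<epsilon> V h" by simp_all
    then show "cre \<epsilon> V n h \<in> carrier (fock (twisted \<epsilon>) V)"
      using cre_finite_support[OF h(1)] cre_twisted[OF closed[OF h(1)] h(2)] by simp
    show "cre \<epsilon> V n (q \<odot>\<^bsub>fock (twisted \<epsilon>) V\<^esub> h) = q \<odot>\<^bsub>fock (twisted \<epsilon>) V\<^esub> cre \<epsilon> V n h" for q
      using cre_smult[OF closed[OF h(1)]] by (simp add: fun_eq_iff)
    fix k assume "k \<in> carrier (fock (twisted \<epsilon>) V)"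
    then have k: "k \<in> finite_support V" by simp
    show "cre \<epsilon> V n (h \<oplus>\<^bsub>fock (twisted \<epsilon>) V\<^esub> k) = cre \<epsilon> V n h \<oplus>\<^bsub>fock (twisted \<epsilon>) V\<^esub> cre \<epsilon> V n k"
      using cre_add[OF closed[OF h(1)] closed[OF k]] by (simp add: fun_eq_iff)
  qed
qed

lemma twisted_vac: "qspace V \<Longrightarrow> twisted \<epsilon> V (\<lambda>l. if l = [] then v else \<zero>\<^bsub>V\<^esub>)"
proof -
  assume "qspace V"
  then interpret qspace V .
  show ?thesis by (simp add: twisted_def)
qed

lemma twisted_trunc:
  "qspace V \<Longrightarrow> twisted \<epsilon> V h \<Longrightarrow> twisted \<epsilon> V (\<lambda>l. if int (length l) = i then h l else \<zero>\<^bsub>V\<^esub>)"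
proof -
  assume "qspace V" and h: "twisted \<epsilon> V h"
  then interpret qspace V by simp
  show ?thesis
    unfolding twisted_def
  proof (intro allI)
    fix p j k q
    show "(if int (length (p @ j # k # q)) = i then h (p @ j # k # q) else \<zero>\<^bsub>V\<^esub>) =
      \<epsilon> \<odot>\<^bsub>V\<^esub> (if int (length (p @ k # j # q)) = i then h (p @ k # j # q) else \<zero>\<^bsub>V\<^esub>)"
      unfolding twistedD[OF h, of p j k q] by simp
  qed
qed

lemma twisted_natural:
  assumes "qlinear V V' f" "h \<in> finite_support V" "twisted \<epsilon> V h"
  shows "twisted \<epsilon> V' (\<lambda>l. f (h l))"
  unfolding twisted_def
proof (intro allI)
  fix p i j q
  show "f (h (p @ i # j # q)) = \<epsilon> \<odot>\<^bsub>V'\<^esub> f (h (p @ j # i # q))"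
    unfolding twistedD[OF assms(3), of p i j q]
    by (rule qlinearD(3)[OF assms(1) finite_supportD(1)[OF assms(2)]])
qed

subsection \<open>Modules with creation and annihilation operators\<close>

text \<open>
  The condition \<open>\<pi>_c\<close> says that created vectors have no vacuum component. Together with the exchange
  relation it determines all coordinates of a created vector.
\<close>

locale ladder = annihilation V a \<pi> + statistics V \<epsilon>
  for V :: "(rat, 'a) module" (structure) and a \<pi> \<epsilon> +
  fixes c :: "nat \<Rightarrow> 'a \<Rightarrow> 'a"
  assumes c: "qlinear V V (c n)"
    and a_a: "x \<in> carrier V \<Longrightarrow> a i (a j x) = \<epsilon> \<odot> a j (a i x)"
    and a_c: "x \<in> carrier V \<Longrightarrow> a i (c j x) = (if i = j then x else \<zero>) \<oplus> \<epsilon> \<odot> c j (a i x)"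
    and \<pi>_c: "x \<in> carrier V \<Longrightarrow> \<pi> (c n x) = \<zero>"
begin

lemma c_closed [simp]: "x \<in> carrier V \<Longrightarrow> c n x \<in> carrier V"
  using c by (rule qlinearD(1))

lemma coord_a: "coord (a n x) = ann n (coord x)"
  by (simp add: ann_def fun_eq_iff coord_Cons)

lemma coord_c: "x \<in> carrier V \<Longrightarrow> coord (c n x) l = cre \<epsilon> V n (coord x) l"
proof (induction l arbitrary: x)
  case Nil
  then show ?case by (simp add: coord_def \<pi>_c)
next
  case (Cons j l)
  have "coord (c n x) (j # l) = coord ((if j = n then x else \<zero>) \<oplus> \<epsilon> \<odot> c n (a j x)) l"
    using Cons.prems by (simp add: coord_Cons a_c)
  also have "\<dots> = coord (if j = n then x else \<zero>) l \<oplus> \<epsilon> \<odot> coord (c n (a j x)) l"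
    using Cons.prems by (simp add: qlinearD(2,3)[OF coord_linear])
  also have "coord (c n (a j x)) l = cre \<epsilon> V n (ann j (coord x)) l"
    using Cons.IH[of "a j x"] Cons.prems by (simp add: coord_a)
  also have "coord (if j = n then x else \<zero>) l = (if j = n then coord x l else \<zero>)"
    using qlinear_zero[OF coord_linear qspace_axioms qspace_axioms] by simp
  finally show ?case by simp
qed

lemma coord_twisted: "x \<in> carrier V \<Longrightarrow> twisted \<epsilon> V (coord x)"
  unfolding twisted_def
proof (intro allI)
  fix p i j q assume x: "x \<in> carrier V"
  let ?y = "ann_word a p x"
  have y: "?y \<in> carrier V" using x by simp
  have "coord x (p @ i # j # q) = coord (a j (a i ?y)) q"
    by (simp add: coord_def ann_word_append)
  also have "\<dots> = \<epsilon> \<odot> coord (a i (a j ?y)) q"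
    unfolding a_a[OF y, of j i] by (rule qlinearD(3)[OF coord_linear]) (use y in simp)
  also have "coord (a i (a j ?y)) q = coord x (p @ j # i # q)"
    by (simp add: coord_def ann_word_append)
  finally show "coord x (p @ i # j # q) = \<epsilon> \<odot> coord x (p @ j # i # q)" .
qed

text \<open>
  Shortening words by one letter gives functions \<open>ann n h\<close>, which are by induction the coordinates of
  vectors \<open>y\<^sub>n\<close>. The coordinates of \<open>\<Sum> c\<^sub>n y\<^sub>n\<close> are obtained by applying the number operator to \<open>h\<close>, that
  is, they are \<open>N + 1\<close> times \<open>h\<close>.
\<close>

lemma coord_surj_homogeneous:
  assumes "h \<in> finite_support V" "\<And>l. h l \<in> vac" "twisted \<epsilon> V h" "\<And>l. h l \<noteq> \<zero> \<Longrightarrow> length l = N"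
  shows "\<exists>x\<in>carrier V. coord x = h"
  using assms
proof (induction N arbitrary: h)
  case 0
  have "coord (h []) l = h l" for l
    using 0(4)[of l] by (cases "h l = \<zero>") (auto simp: coord_of_vac[OF 0(2)])
  then show ?case using vac_carrier[OF 0(2), of "[]"] by (intro bexI[of _ "h []"]) auto
next
  case (Suc N)
  have hc: "\<forall>l. h l \<in> carrier V" using finite_supportD(1)[OF Suc.prems(1)] by blast
  have "ann n h l \<in> vac" for n l using Suc.prems(2) by (simp add: ann_def)
  moreover have "length l = N" if "ann n h l \<noteq> \<zero>" for n l
    using Suc.prems(4)[of "n # l"] that by (simp add: ann_def)
  ultimately have "\<exists>y\<in>carrier V. coord y = ann n h" for n
    by (rule Suc.IH[OF ann_finite_support[OF Suc.prems(1)] _ twisted_ann[OF Suc.prems(3)]])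
  then obtain y where y: "\<And>n. y n \<in> carrier V" "\<And>n. coord (y n) = ann n h" by metis
  have "finite (\<Union>(set ` {l. h l \<noteq> \<zero>}))" using finite_supportD(2)[OF Suc.prems(1)] by simp
  then obtain m where m: "\<Union>(set ` {l. h l \<noteq> \<zero>}) \<subseteq> {..<m}" using finite_subset_lessThan by blast
  let ?s = "\<Oplus>n\<in>{..<m}. c n (y n)"
  have s: "?s \<in> carrier V" by (rule M.finsum_closed) (use y in auto)
  let ?x = "(1 / of_nat (Suc N)) \<odot> ?s"
  have "coord ?x l = h l" for l
  proof -
    have "coord ?s l = (\<Oplus>n\<in>{..<m}. coord (c n (y n)) l)"
      by (rule qlinear_finsum[OF coord_linear qspace_axioms qspace_axioms]) (use y in simp)
    also have "\<dots> = (\<Oplus>n\<in>{..<m}. cre \<epsilon> V n (ann n h) l)"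
      using coord_c[OF y(1)] y(2) by simp
    also have "\<dots> = of_nat (length l) \<odot> h l"
      by (rule number_operator[OF hc Suc.prems(3)]) (use m in blast)
    finally have "coord ?x l = (1 / of_nat (Suc N) * of_nat (length l)) \<odot> h l"
      using s hc by (simp add: qlinearD(3)[OF coord_linear])
    then show ?thesis using Suc.prems(4)[of l] hc by (cases "h l = \<zero>") simp_all
  qed
  then show ?case using s by (intro bexI[of _ ?x]) auto
qed

text \<open>
  The parts of \<open>h\<close> on words of a fixed length are realized separately and added.
\<close>

lemma coord_surj:
  assumes "h \<in> finite_support V" "\<And>l. h l \<in> vac" "twisted \<epsilon> V h"
  shows "\<exists>x\<in>carrier V. coord x = h"
proof -
  have z: "\<zero> \<in> vac" using coord_vac[of "\<zero>" "[]"] qlinear_zero[OF coord_linear qspace_axioms qspace_axioms] by simp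
  have "\<exists>x\<in>carrier V. coord x = h"
    if "h \<in> finite_support V" "\<And>l. h l \<in> vac" "twisted \<epsilon> V h" "\<And>l. h l \<noteq> \<zero> \<Longrightarrow> length l < N" for h N
    using that
  proof (induction N arbitrary: h)
    case 0
    then have "h = (\<lambda>_. \<zero>)" by auto
    then show ?case
      using qlinear_zero[OF coord_linear qspace_axioms qspace_axioms] by (intro bexI[of _ "\<zero>"]) auto
  next
    case (Suc N)
    let ?t = "\<lambda>l. if int (length l) = int N then h l else \<zero>"
    have fs: "(\<lambda>l. if P l then h l else \<zero>) \<in> finite_support V" for P
      by (rule finite_supportI[OF _ _ finite_supportD(2)[OF Suc.prems(1)]])
        (use finite_supportD(1)[OF Suc.prems(1)] in auto)
    have "\<exists>x\<in>carrier V. coord x = ?t"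
      by (rule coord_surj_homogeneous[where N = N, OF fs _ twisted_trunc[OF qspace_axioms Suc.prems(3)]])
        (use Suc.prems(2) z in \<open>auto split: if_splits\<close>)
    then obtain x where x: "x \<in> carrier V" "coord x = ?t" by blast
    let ?r = "\<lambda>l. if length l < N then h l else \<zero>"
    have "\<exists>y\<in>carrier V. coord y = ?r"
    proof (rule Suc.IH[OF fs])
      show "twisted \<epsilon> V ?r"
        unfolding twisted_def
      proof (intro allI)
        fix p j k q
        show "?r (p @ j # k # q) = \<epsilon> \<odot> ?r (p @ k # j # q)"
          unfolding twistedD[OF Suc.prems(3), of p j k q] by simp
      qed
    qed (use Suc.prems(2) z in \<open>auto split: if_splits\<close>)
    then obtain y where y: "y \<in> carrier V" "coord y = ?r" by blast
    have "coord (x \<oplus> y) l = h l" for l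
      using x y Suc.prems(4)[of l] finite_supportD(1)[OF Suc.prems(1), of l]
      by (cases "h l = \<zero>") (auto simp: qlinearD(2)[OF coord_linear] not_less less_Suc_eq)
    then show ?case using x y by (intro bexI[of _ "x \<oplus> y"]) auto
  qed
  moreover have "finite (length ` {l. h l \<noteq> \<zero>})" using finite_supportD(2)[OF assms(1)] by simp
  then obtain N where "length ` {l. h l \<noteq> \<zero>} \<subseteq> {..<N}" using finite_subset_lessThan by blast
  then have "h l \<noteq> \<zero> \<Longrightarrow> length l < N" for l by blast
  ultimately show ?thesis using assms by blast
qed

end

lemma finite_support_subspace:
  assumes "h \<in> finite_support (rational_subspace P M U)" "U \<subseteq> carrier M"
  shows "h \<in> finite_support (underlying P M)" "h l \<in> U"
  using assms by (auto simp: finite_support_def)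

lemma cre_subspace: "cre \<epsilon> (rational_subspace P M U) n h l = cre \<epsilon> (underlying P M) n h l"
  by (induction l arbitrary: h) simp_all

lemma twisted_subspace: "twisted \<epsilon> (rational_subspace P M U) h = twisted \<epsilon> (underlying P M) h"
  by (simp add: twisted_def)

section \<open>Graded modules in Fock coordinates\<close>

text \<open>
  Here the projection to the vacuum vectors is the projection to the component of degree \<open>0\<close>.
\<close>

locale graded_annihilation = grading V W for V :: "(rat, 'a) module" (structure) and W +
  fixes a :: "nat \<Rightarrow> 'a \<Rightarrow> 'a"
  assumes a: "qlinear V V (a n)" and a_W: "x \<in> W i \<Longrightarrow> a n x \<in> W (i - 1)"
    and negative: "i < 0 \<Longrightarrow> W i = {\<zero>}"
    and vacuum: "\<lbrakk>x \<in> carrier V; \<And>n. a n x = \<zero>\<rbrakk> \<Longrightarrow> x \<in> W 0"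
    and loc_finite: "x \<in> W i \<Longrightarrow> finite {l. ann_word a l x \<noteq> \<zero>}"
begin

lemma word_linear': "qlinear V V (ann_word a l)"
proof (induction l)
  case (Cons n l)
  then show ?case using qlinear_comp[OF a] by simp
qed (simp add: qlinear_def)

lemma word_W: "x \<in> W i \<Longrightarrow> ann_word a l x \<in> W (i - int (length l))"
proof (induction l arbitrary: x i)
  case (Cons n l)
  then show ?case using Cons.IH[OF a_W[OF Cons.prems, of n]] by (simp add: algebra_simps)
qed simp

lemma component_word:
  assumes "x \<in> carrier V"
  shows "ann_word a l (component i x) = component (i - int (length l)) (ann_word a l x)"
proof -
  have "component (i + (- int (length l))) (ann_word a l x) = ann_word a l (component i x)"
    by (rule component_morphism[OF grading_axioms word_linear' _ assms]) (use word_W in simp)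
  then show ?thesis by simp
qed

lemma a_W0: "x \<in> W 0 \<Longrightarrow> a n x = \<zero>"
  using a_W[of x 0 n] negative[of "- 1"] by simp

sublocale annihilation V a "component 0"
proof
  show "component 0 x = x" if "x \<in> carrier V" "\<And>n. a n x = \<zero>" for x
    using component_homogeneous[OF vacuum[OF that], of 0] by simp
  show "finite {l. ann_word a l x \<noteq> \<zero>}" if x: "x \<in> carrier V" for x
  proof (rule finite_subset)
    let ?B = "{i. component i x \<noteq> \<zero>}"
    show "finite (\<Union>i\<in>?B. {l. ann_word a l (component i x) \<noteq> \<zero>})"
      using component(2)[OF x] loc_finite[OF component(1)[OF x]] by blast
    show "{l. ann_word a l x \<noteq> \<zero>} \<subseteq> (\<Union>i\<in>?B. {l. ann_word a l (component i x) \<noteq> \<zero>})"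
    proof
      fix l assume l: "l \<in> {l. ann_word a l x \<noteq> \<zero>}"
      show "l \<in> (\<Union>i\<in>?B. {l. ann_word a l (component i x) \<noteq> \<zero>})"
      proof (rule ccontr)
        assume *: "l \<notin> (\<Union>i\<in>?B. {l. ann_word a l (component i x) \<noteq> \<zero>})"
        have "ann_word a l x = ann_word a l (finsum V (\<lambda>i. component i x) ?B)" using component(3)[OF x] by simp
        also have "\<dots> = finsum V (\<lambda>i. ann_word a l (component i x)) ?B"
          by (rule qlinear_finsum[OF word_linear' qspace_axioms qspace_axioms]) (use x in simp)
        also have "\<dots> = \<zero>" by (rule M.add.finprod_one_eqI) (use * in auto)
        finally show False using l by simp
      qed
    qed
  qed
qed (use a qlinear_comp_i a_W0 component(1) in auto)

lemma vac_eq: "vac = W 0"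
  unfolding vac_def using vacuum a_W0 W_closed(1) by blast

lemma coord_comp:
  assumes "x \<in> carrier V"
  shows "coord (component j x) l = (if j = int (length l) then coord x l else \<zero>)"
  using assms by (simp add: coord_def component_word component_homogeneous[OF component(1)])

text \<open>
  A word of length \<open>k\<close> lowers the degree by \<open>k\<close>, and \<open>\<pi>\<close> picks out degree \<open>0\<close>: the coordinates at words of
  length \<open>k\<close> are those of the component of degree \<open>k\<close>.
\<close>

lemma homogeneous_iff:
  assumes x: "x \<in> carrier V"
  shows "x \<in> W i \<longleftrightarrow> (\<forall>l. coord x l \<noteq> \<zero> \<longrightarrow> int (length l) = i)"
proof
  assume "x \<in> W i"
  then have c: "component i x = x" by (simp add: component_homogeneous)
  show "\<forall>l. coord x l \<noteq> \<zero> \<longrightarrow> int (length l) = i"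
  proof (intro allI impI)
    fix l assume "coord x l \<noteq> \<zero>"
    then show "int (length l) = i" using coord_comp[OF x, of i l] unfolding c by (auto split: if_splits)
  qed
next
  assume *: "\<forall>l. coord x l \<noteq> \<zero> \<longrightarrow> int (length l) = i"
  show "x \<in> W i"
  proof (rule homogeneousI[OF x])
    fix j assume "j \<noteq> i"
    then have "coord (component j x) l = \<zero>" for l using * by (auto simp: coord_comp[OF x])
    then show "component j x = \<zero>" by (rule coord_eq_zero[rotated]) (use x in simp)
  qed
qed

end

lemma graded_category_simps [simp]:
  "Obj (graded_module_category P deg adm) = {(M, W). graded_module P deg M W \<and> adm M W}"
  "Hom (graded_module_category P deg adm) (M, W) (N, U) =
     {f \<in> linear_maps (presented_algebra P) M N. \<forall>i. f ` W i \<subseteq> U i}"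
  "Id (graded_module_category P deg adm) (M, W) = (\<lambda>x\<in>carrier M. x)"
  "Comp (graded_module_category P deg adm) (M, W) Y Z g f = compose (carrier M) g f"
  by (simp_all add: graded_module_category_def)

lemma graded_moduleD:
  assumes "graded_module P deg M W" "presentation P"
  shows "presented_module P M" "grading (underlying P M) W" "W i \<subseteq> carrier M"
    "\<lbrakk>s \<in> fst P; x \<in> W i\<rbrakk> \<Longrightarrow> act P M s x \<in> W (i + deg s)" "i < 0 \<Longrightarrow> W i = {\<zero>\<^bsub>M\<^esub>}"
proof -
  have "left_module (presented_algebra P) M" using assms(1) by (simp add: graded_module_iff)
  then show M: "presented_module P M" using assms(2) by (simp add: presented_module_def)
  show g: "grading (underlying P M) W"
    using assms(1) presented_module.qspace_underlying[OF M]
    by (simp add: grading_def grading_axioms_def graded_module_iff)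
  show "W i \<subseteq> carrier M" using grading.W_closed(1)[OF g] by auto
qed (use assms(1) in \<open>simp_all add: graded_module_iff\<close>)

lemma is_category_graded:
  fixes P :: "'g presentation" and adm :: "('g ncpoly set, 'a) module \<Rightarrow> (int \<Rightarrow> 'a set) \<Rightarrow> bool"
  assumes "presentation P"
  shows "is_category (graded_module_category P deg adm)"
proof -
  have sub: "W i \<subseteq> carrier M" if "graded_module P deg M W" for M :: "(_, 'a) module" and W i
    by (rule graded_moduleD(3)[OF that assms])
  have lm: "left_module (presented_algebra P) M" if "graded_module P deg M W" for M :: "(_, 'a) module" and W
    using that by (simp add: graded_module_iff)
  show ?thesis
    unfolding is_category_def
  proof (intro conjI ballI)
    let ?C = "graded_module_category P deg adm"
    fix X :: "('g ncpoly set, 'a) module \<times> (int \<Rightarrow> 'a set)" assume "X \<in> Obj ?C"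
    then obtain M W where X: "X = (M, W)" and m: "graded_module P deg M W" by auto
    have "(\<lambda>x\<in>carrier M. x) ` W i \<subseteq> W i" for i using sub[OF m] by auto
    then show "Id ?C X \<in> Hom ?C X X" using linear_maps_id[OF lm[OF m]] by (simp add: X)
    fix Y :: "('g ncpoly set, 'a) module \<times> (int \<Rightarrow> 'a set)" and f assume "Y \<in> Obj ?C" "f \<in> Hom ?C X Y"
    then obtain N U where Y: "Y = (N, U)" and f: "f \<in> linear_maps (presented_algebra P) M N" "\<forall>i. f ` W i \<subseteq> U i"
      by (cases Y) (simp add: X)
    show "Comp ?C X X Y f (Id ?C X) = f" "Comp ?C X Y Y (Id ?C Y) f = f"
      unfolding X Y graded_category_simps using f(1) by (rule compose_id)+
    fix Z :: "('g ncpoly set, 'a) module \<times> (int \<Rightarrow> 'a set)" and g assume "Z \<in> Obj ?C" "g \<in> Hom ?C Y Z"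
    then obtain L T where Z: "Z = (L, T)" and g: "g \<in> linear_maps (presented_algebra P) N L" "\<forall>i. g ` U i \<subseteq> T i"
      by (cases Z) (simp add: Y)
    have "compose (carrier M) g f x = g (f x)" if "x \<in> W i" for x i
      using sub[OF m] that by (auto simp: compose_def)
    then have "compose (carrier M) g f ` W i \<subseteq> T i" for i using f(2) g(2) by (fastforce simp: image_subset_iff)
    then show "Comp ?C X Y Z g f \<in> Hom ?C X Z"
      using linear_maps_compose[OF lm[OF m] f(1) g(1)] by (simp add: X Y Z)
    fix Z' :: "('g ncpoly set, 'a) module \<times> (int \<Rightarrow> 'a set)" and h
    show "Comp ?C X Z Z' h (Comp ?C X Y Z g f) = Comp ?C X Y Z' (Comp ?C Y Z Z' h g) f"
      unfolding X Y Z graded_category_simps by (rule compose_assoc_linear[OF f(1), symmetric])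
  qed
qed

text \<open>
  The common part of the graded cases: a Fock model whose functions describe all admissible modules
  makes the component of degree \<open>0\<close> an equivalence.
\<close>

locale graded_model = fock_model P ok G
  for P :: "'g presentation" and ok :: "(rat, 'a) module \<Rightarrow> (nat list \<Rightarrow> 'a) \<Rightarrow> bool" and G +
  fixes deg :: "'g \<Rightarrow> int" and adm :: "('g ncpoly set, 'a) module \<Rightarrow> (int \<Rightarrow> 'a set) \<Rightarrow> bool"
    and a :: "('g ncpoly set, 'a) module \<Rightarrow> nat \<Rightarrow> 'a \<Rightarrow> 'a"
  assumes graded_ann: "\<lbrakk>graded_module P deg M W; adm M W\<rbrakk> \<Longrightarrow> graded_annihilation (underlying P M) W (a M)"
    and fock_mod: "\<lbrakk>graded_module P deg M W; adm M W\<rbrakk> \<Longrightarrow> fock_module P ok G M (a M) (grading.component (underlying P M) W 0)"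
    and a_natural: "\<lbrakk>presented_module P M; presented_module P N; f \<in> linear_maps (presented_algebra P) M N;
       x \<in> carrier M\<rbrakk> \<Longrightarrow> f (a M n x) = a N n (f x)"
    and G_shift: "\<And>V s h i l. \<lbrakk>qspace V; s \<in> fst P; h \<in> finite_support V; ok V h;
       \<And>l. h l \<noteq> \<zero>\<^bsub>V\<^esub> \<Longrightarrow> int (length l) = i; G V s h l \<noteq> \<zero>\<^bsub>V\<^esub>\<rbrakk> \<Longrightarrow> int (length l) = i + deg s"
    and adm_level: "fock_realization P ok G V M \<phi> \<Longrightarrow> adm M (fock_realization.level ok V \<phi>)"
begin

abbreviation "C \<equiv> graded_module_category P deg adm"

lemma degree_zero_simps:
  "FObj (degree_zero P) (M, W) = rational_subspace P M (W 0)"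
  "FMor (degree_zero P) (M, W) Y f = restrict f (W 0)"
  by (simp_all add: degree_zero_def)

lemma qspace_degree_zero: "graded_module P deg M W \<Longrightarrow> qspace (rational_subspace P M (W 0))"
proof -
  assume m: "graded_module P deg M W"
  interpret g: grading "underlying P M" W by (rule graded_moduleD(2)[OF m presentation_axioms])
  show ?thesis
    by (rule rational_subspace_qspace[OF graded_moduleD(1)[OF m presentation_axioms]])
      (use g.W_closed[where i = 0] in auto)
qed

lemma restrict_degree_zero:
  assumes m: "graded_module P deg M W" and n: "graded_module P deg N U"
    and f: "f \<in> linear_maps (presented_algebra P) M N" "\<forall>i. f ` W i \<subseteq> U i"
  shows "restrict f (W 0) \<in> linear_maps rat_ring (rational_subspace P M (W 0)) (rational_subspace P N (U 0))"
proof -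
  have "qlinear (underlying P M) (underlying P N) f"
    using f(1) linear_maps_presented_iff graded_moduleD(1)[OF m presentation_axioms]
      graded_moduleD(1)[OF n presentation_axioms] by blast
  then have "qlinear (rational_subspace P M (W 0)) (rational_subspace P N (U 0)) f"
    using f(2) graded_moduleD(3)[OF m presentation_axioms, of 0] by (auto simp: qlinear_def subset_iff)
  from qlinear_restrict[OF this qspace_degree_zero[OF m]] show ?thesis by simp
qed

lemma is_functor_degree_zero: "is_functor C (vector_spaces TYPE('a)) (degree_zero P)"
  unfolding is_functor_def
proof (intro conjI ballI)
  fix X assume "X \<in> Obj C"
  then obtain M W where X: "X = (M, W)" and m: "graded_module P deg M W" by auto
  have W0: "W 0 \<subseteq> carrier M" by (rule graded_moduleD(3)[OF m presentation_axioms])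
  show "FObj (degree_zero P) X \<in> Obj (vector_spaces TYPE('a))"
    using qspace_degree_zero[OF m] by (simp add: X degree_zero_simps)
  show "FMor (degree_zero P) X X (Id C X) = Id (vector_spaces TYPE('a)) (FObj (degree_zero P) X)"
    using W0 by (auto simp: X degree_zero_simps fun_eq_iff)
  fix Y f assume "Y \<in> Obj C" "f \<in> Hom C X Y"
  then obtain N U where Y: "Y = (N, U)" and n: "graded_module P deg N U"
    and f: "f \<in> linear_maps (presented_algebra P) M N" "\<forall>i. f ` W i \<subseteq> U i"
    by (cases Y) (simp add: X)
  show "FMor (degree_zero P) X Y f \<in> Hom (vector_spaces TYPE('a)) (FObj (degree_zero P) X) (FObj (degree_zero P) Y)"
    using restrict_degree_zero[OF m n f] by (simp add: X Y degree_zero_simps)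
  fix Z g
  show "FMor (degree_zero P) X Z (Comp C X Y Z g f) =
        Comp (vector_spaces TYPE('a)) (FObj (degree_zero P) X) (FObj (degree_zero P) Y) (FObj (degree_zero P) Z)
          (FMor (degree_zero P) Y Z g) (FMor (degree_zero P) X Y f)"
    using W0 f(2) by (cases Z) (auto simp: X Y degree_zero_simps fun_eq_iff compose_def)
qed

lemma fully_faithful_degree_zero: "fully_faithful C (vector_spaces TYPE('a)) (degree_zero P)"
  unfolding fully_faithful_def
proof (intro ballI)
  fix X Y assume "X \<in> Obj C" "Y \<in> Obj C"
  then obtain M W N U where X: "X = (M, W)" and m: "graded_module P deg M W" "adm M W"
    and Y: "Y = (N, U)" and n: "graded_module P deg N U" "adm N U" by auto
  note pm = graded_moduleD(1)[OF m(1) presentation_axioms] and pn = graded_moduleD(1)[OF n(1) presentation_axioms]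
  interpret M: graded_annihilation "underlying P M" W "a M" by (rule graded_ann[OF m])
  interpret N: graded_annihilation "underlying P N" U "a N" by (rule graded_ann[OF n])
  let ?H = "{f \<in> linear_maps (presented_algebra P) M N. \<forall>i. f ` W i \<subseteq> U i}"
  let ?V = "rational_subspace P M (W 0)" and ?V' = "rational_subspace P N (U 0)"
  note fm = fock_mod[OF m] fock_mod[OF n]
  have "bij_betw (\<lambda>f. restrict f (W 0)) ?H (linear_maps rat_ring ?V ?V')"
    unfolding bij_betw_def
  proof (intro conjI inj_onI subset_antisym image_subsetI subsetI)
    fix f g assume f: "f \<in> ?H" and g: "g \<in> ?H" and eq: "restrict f (W 0) = restrict g (W 0)"
    have nat: "k (M.component 0 x) = N.component 0 (k x)" if k: "k \<in> ?H" and x: "x \<in> carrier M" for k x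
    proof -
      have lin: "qlinear (underlying P M) (underlying P N) k" using k linear_maps_presented_iff[OF pm pn] by blast
      have kU: "k x \<in> U (i + 0)" if "x \<in> W i" for x i using k that by auto
      have "N.component (0 + 0) (k x) = k (M.component 0 x)"
        by (rule M.component_morphism[OF N.grading_axioms lin kU]) (use x in simp_all)
      then show ?thesis by simp
    qed
    have "f x = g x" if x: "x \<in> carrier M" for x
    proof (rule fock_faithful[OF fm, of f g])
      show "f (M.component 0 x) = N.component 0 (f x)" "g (M.component 0 x) = N.component 0 (g x)" if "x \<in> carrier M" for x
        using nat[OF f that] nat[OF g that] by simp_all
      show "f (a M n x) = a N n (f x)" "g (a M n x) = a N n (g x)" if "x \<in> carrier M" for x n
        using f g that by (auto intro!: a_natural[OF pm pn])
      show "f x \<in> carrier N" "g x \<in> carrier N" if "x \<in> carrier M" for x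
        using f g that by (auto intro: linear_maps_arr(1))
      show "f v = g v" if "v \<in> annihilation.vac (underlying P M) (a M)" for v
        using fun_cong[OF eq, of v] that by (simp add: M.vac_eq)
    qed (fact x)
    then show "f = g" using f g by (intro linear_maps_eqI) auto
  next
    fix f assume "f \<in> ?H"
    then show "restrict f (W 0) \<in> linear_maps rat_ring ?V ?V'" using restrict_degree_zero[OF m(1) n(1)] by blast
  next
    fix f assume f: "f \<in> linear_maps rat_ring ?V ?V'"
    then have fl: "qlinear ?V ?V' f" by (simp add: linear_maps_rat_iff)
    obtain F where F: "F \<in> linear_maps (presented_algebra P) M N"
      "\<And>x. x \<in> carrier M \<Longrightarrow> N.coord (F x) = (\<lambda>l. f (M.coord x l))" "\<And>v. v \<in> M.vac \<Longrightarrow> F v = f v"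
      by (rule fock_full[OF fm, of f]) (use fl in \<open>simp_all add: M.vac_eq N.vac_eq\<close>)
    have "F x \<in> U i" if x: "x \<in> W i" for x i
    proof -
      have xM: "x \<in> carrier M" using M.W_closed(1)[OF x] by simp
      have Fx: "F x \<in> carrier N" using linear_maps_arr(1)[OF F(1) xM] .
      have z: "f \<zero>\<^bsub>M\<^esub> = \<zero>\<^bsub>N\<^esub>"
        using qlinear_zero[OF fl qspace_degree_zero[OF m(1)] qspace_degree_zero[OF n(1)]] by simp
      have "\<forall>l. M.coord x l \<noteq> \<zero>\<^bsub>M\<^esub> \<longrightarrow> int (length l) = i"
        using M.homogeneous_iff[of x i] x xM by simp
      then have "\<forall>l. N.coord (F x) l \<noteq> \<zero>\<^bsub>N\<^esub> \<longrightarrow> int (length l) = i"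
        unfolding F(2)[OF xM] using z by metis
      then show ?thesis using N.homogeneous_iff[of "F x" i] Fx by simp
    qed
    then have "F \<in> ?H" using F(1) by auto
    moreover have "restrict F (W 0) = f"
    proof (rule extensionalityI[of _ "W 0"])
      show "f \<in> extensional (W 0)" using linear_maps_arr(2)[OF f] by simp
    qed (use F(3) M.vac_eq in auto)
    ultimately show "f \<in> (\<lambda>f. restrict f (W 0)) ` ?H" by blast
  qed
  moreover have "FMor (degree_zero P) X Y = (\<lambda>f. restrict f (W 0))"
    by (simp add: X fun_eq_iff degree_zero_simps)
  ultimately show "bij_betw (FMor (degree_zero P) X Y) (Hom C X Y)
      (Hom (vector_spaces TYPE('a)) (FObj (degree_zero P) X) (FObj (degree_zero P) Y))"
    by (simp add: X Y degree_zero_simps)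
qed

lemma essentially_surjective_degree_zero:
  "essentially_surjective C (vector_spaces TYPE('a)) (degree_zero P)"
  unfolding essentially_surjective_def
proof
  fix V :: "(rat, 'a) module" assume "V \<in> Obj (vector_spaces TYPE('a))"
  then have V: "qspace V" by simp
  obtain M \<phi> where "fock_realization P ok G V M \<phi>" by (rule realization_exists[OF V])
  then interpret R: fock_realization P ok G V M \<phi> .
  have "graded_module P deg M R.level" by (rule R.graded_module_level) (rule G_shift[OF V])
  moreover have "adm M R.level" by (rule adm_level[OF R.fock_realization_axioms])
  ultimately have "(M, R.level) \<in> Obj C" by simp
  then show "\<exists>X\<in>Obj C. \<exists>i. is_iso (vector_spaces TYPE('a)) (FObj (degree_zero P) X) V i"
    using R.vacuum_iso by (intro bexI[of _ "(M, R.level)"]) (simp_all add: degree_zero_simps)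
qed

lemma weak_equivalence_degree_zero: "weak_equivalence C (vector_spaces TYPE('a)) (degree_zero P)"
  by (intro weak_equivalence.intro func.intro cat.intro func_axioms.intro weak_equivalence_axioms.intro
      is_category_graded presentation_axioms is_category_vector_spaces is_functor_degree_zero
      fully_faithful_degree_zero essentially_surjective_degree_zero)

end

section \<open>The Clifford algebra\<close>

lemma clifford_presentation: "presentation clifford"
  unfolding presentation_def
  by (unfold clifford_def fst_conv snd_conv, safe,
      (intro free_algebra_closed gen_in_free_algebra scalar_in_free_algebra; simp)+)

text \<open>
  Letters are numbered from \<open>0\<close>, generators from \<open>1\<close>.
\<close>

definition clifford_op :: "(rat, 'a) module \<Rightarrow> cliff_gen \<Rightarrow> (nat list \<Rightarrow> 'a) \<Rightarrow> (nat list \<Rightarrow> 'a)" where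
  "clifford_op V s = (case s of Pgen i \<Rightarrow> cre (- 1) V (i - 1) | Qgen i \<Rightarrow> ann (i - 1))"

definition clifford_ann :: "(cliff_gen ncpoly set, 'a) module \<Rightarrow> nat \<Rightarrow> 'a \<Rightarrow> 'a" where
  "clifford_ann M n = act clifford M (Qgen (Suc n))"

definition clifford_cre :: "(cliff_gen ncpoly set, 'a) module \<Rightarrow> nat \<Rightarrow> 'a \<Rightarrow> 'a" where
  "clifford_cre M n = act clifford M (Pgen (Suc n))"

lemma clifford_gens: "Pgen i \<in> fst clifford \<longleftrightarrow> i > 0" "Qgen i \<in> fst clifford \<longleftrightarrow> i > 0"
  by (auto simp: clifford_def)

lemma clifford_relators:
  assumes "r \<in> snd clifford"
  obtains i j where "i > 0" "j > 0" "r = gen (Pgen i) * gen (Pgen j) + gen (Pgen j) * gen (Pgen i)"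
  | i j where "i > 0" "j > 0" "r = gen (Qgen i) * gen (Qgen j) + gen (Qgen j) * gen (Qgen i)"
  | i j where "i > 0" "j > 0"
      "r = gen (Pgen i) * gen (Qgen j) + gen (Qgen j) * gen (Pgen i) - scalar (if i = j then 1 else 0)"
  using assms by (auto simp: clifford_def)

lemma fock_model_clifford: "fock_model clifford (twisted (- 1)) clifford_op"
proof (intro fock_model.intro fock_model_axioms.intro clifford_presentation twisted_vac twisted_trunc)
  fix V V' :: "(rat, 'a) module" and f and h :: "nat list \<Rightarrow> 'a"
  assume V: "qspace V" and V': "qspace V'" and f: "qlinear V V' f" and h: "h \<in> finite_support V" "twisted (- 1) V h"
  show "twisted (- 1) V' (\<lambda>l. f (h l))" by (rule twisted_natural[OF f h])
  have "\<forall>l. h l \<in> carrier V" using finite_supportD(1)[OF h(1)] by blast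
  from cre_natural(1)[OF V V' f this] show "clifford_op V' s (\<lambda>l. f (h l)) = (\<lambda>l. f (clifford_op V s h l))" for s
    by (cases s) (simp_all add: clifford_op_def fun_eq_iff ann_def)
next
  fix V :: "(rat, 'a) module" assume V: "qspace V"
  interpret V: statistics V "- 1" by (intro statistics.intro V statistics_axioms.intro) simp
  interpret operators clifford "fock (twisted (- 1)) V" "clifford_op V"
  proof (intro operators.intro clifford_presentation V.twisted_fock operators_axioms.intro)
    show "qlinear (fock (twisted (- 1)) V) (fock (twisted (- 1)) V) (clifford_op V s)" for s
      by (cases s) (simp_all add: clifford_op_def V.qlinear_fock)
  qed
  show "representation clifford (fock (twisted (- 1)) V) (clifford_op V)"
  proof (intro representation.intro operators_axioms representation_axioms.intro)
    fix r h assume r: "r \<in> snd clifford" and "h \<in> carrier (fock (twisted (- 1)) V)"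
    then have h: "h \<in> carrier (fock (twisted (- 1)) V)" "h \<in> finite_support V" "twisted (- 1) V h" by simp_all
    have hc: "\<forall>l. h l \<in> carrier V" using finite_supportD(1)[OF h(2)] by blast
    have c: "cre (- 1) V i (cre (- 1) V j h) l \<in> carrier V" "cre (- 1) V i (ann j h) l \<in> carrier V"
      "ann i (ann j h) l \<in> carrier V" for i j l
      using V.cre_closed[of "cre (- 1) V j h" i l] V.cre_closed[OF hc] V.cre_closed[OF ann_closed[OF hc]]
        ann_closed[OF ann_closed[OF hc]] by auto
    note ev = ev_add ev_diff ev_gen_gen ev_scalar free_algebra_closed gen_in_free_algebra scalar_in_free_algebra
    from r show "ev r h = \<zero>\<^bsub>fock (twisted (- 1)) V\<^esub>"
    proof (cases rule: clifford_relators)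
      case (1 i j)
      have "ev r h = (\<lambda>l. cre (- 1) V (i - 1) (cre (- 1) V (j - 1) h) l \<oplus>\<^bsub>V\<^esub> cre (- 1) V (j - 1) (cre (- 1) V (i - 1) h) l)"
        unfolding 1(3) using 1(1,2) h(1)
        by (subst ev_add) (simp_all add: clifford_gens ev_gen_gen free_algebra_closed gen_in_free_algebra clifford_op_def
            del: fock_simps(1))
      then show ?thesis
        using c V.cre_cre[OF hc, of "i - 1" "j - 1"] by (simp add: V.M.a_comm)
    next
      case (2 i j)
      have "ev r h = (\<lambda>l. ann (i - 1) (ann (j - 1) h) l \<oplus>\<^bsub>V\<^esub> ann (j - 1) (ann (i - 1) h) l)"
        unfolding 2(3) using 2(1,2) h(1)
        by (subst ev_add) (simp_all add: clifford_gens ev_gen_gen free_algebra_closed gen_in_free_algebra clifford_op_def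
            del: fock_simps(1))
      moreover have "ann (i - 1) (ann (j - 1) h) = (\<lambda>l. (- 1) \<odot>\<^bsub>V\<^esub> ann (j - 1) (ann (i - 1) h) l)"
        by (rule ann_ann[OF h(3)])
      ultimately show ?thesis
        using c by (simp only: fock_simps) (simp add: V.M.a_comm)
    next
      case (3 i j)
      have "ev r h = (\<lambda>l. (cre (- 1) V (i - 1) (ann (j - 1) h) l \<oplus>\<^bsub>V\<^esub> ann (j - 1) (cre (- 1) V (i - 1) h) l)
            \<oplus>\<^bsub>V\<^esub> (- 1) \<odot>\<^bsub>V\<^esub> ((if i = j then 1 else 0) \<odot>\<^bsub>V\<^esub> h l))"
        unfolding 3(3) using 3(1,2) h(1)
        by (subst ev_diff) (simp_all add: clifford_gens ev_add ev_gen_gen ev_scalar free_algebra_closed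
            gen_in_free_algebra scalar_in_free_algebra clifford_op_def del: fock_simps(1))
      moreover have "j - 1 = i - 1 \<longleftrightarrow> i = j" using 3(1,2) by auto
      ultimately show ?thesis
        using c hc by (simp add: V.ann_cre V.M.add.m_ac)
    qed
  qed
qed

locale clifford_module = presented_module clifford M for M :: "(cliff_gen ncpoly set, 'a) module"
begin

sublocale U: qspace "underlying clifford M" by (rule qspace_underlying)

lemma ops_closed: "x \<in> carrier M \<Longrightarrow> clifford_ann M n x \<in> carrier M"
    "x \<in> carrier M \<Longrightarrow> clifford_cre M n x \<in> carrier M"
  by (simp_all add: clifford_ann_def clifford_cre_def act_closed clifford_gens)

lemma ann_ann_relation:
  assumes x: "x \<in> carrier M"
  shows "clifford_ann M i (clifford_ann M j x) = (- 1) \<odot>\<^bsub>underlying clifford M\<^esub> clifford_ann M j (clifford_ann M i x)"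
proof (rule U.eq_scale_if_sum_zero)
  let ?r = "gen (Qgen (Suc i)) * gen (Qgen (Suc j)) + gen (Qgen (Suc j)) * gen (Qgen (Suc i))"
  have "?r \<in> snd clifford" unfolding clifford_def snd_conv by blast
  from relator_action[OF this x]
  show "clifford_ann M i (clifford_ann M j x) \<oplus>\<^bsub>underlying clifford M\<^esub> clifford_ann M j (clifford_ann M i x)
      = \<zero>\<^bsub>underlying clifford M\<^esub>"
    using x by (simp add: rc_action(2) gen_gen_action clifford_gens free_algebra_closed gen_in_free_algebra clifford_ann_def)
qed (use x ops_closed in auto)

lemma ann_cre_relation:
  assumes x: "x \<in> carrier M"
  shows "clifford_ann M i (clifford_cre M j x) =
    (if i = j then x else \<zero>\<^bsub>M\<^esub>) \<oplus>\<^bsub>M\<^esub> (- 1) \<odot>\<^bsub>underlying clifford M\<^esub> clifford_cre M j (clifford_ann M i x)"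
proof -
  let ?r = "gen (Pgen (Suc j)) * gen (Qgen (Suc i)) + gen (Qgen (Suc i)) * gen (Pgen (Suc j))
     - scalar (if Suc j = Suc i then 1 else 0)"
  have "?r \<in> snd clifford" unfolding clifford_def snd_conv by blast
  from relator_action[OF this x]
  have "(clifford_cre M j (clifford_ann M i x) \<oplus>\<^bsub>underlying clifford M\<^esub> clifford_ann M i (clifford_cre M j x))
      \<oplus>\<^bsub>underlying clifford M\<^esub> (- 1) \<odot>\<^bsub>underlying clifford M\<^esub> ((if j = i then 1 else 0) \<odot>\<^bsub>underlying clifford M\<^esub> x)
      = \<zero>\<^bsub>underlying clifford M\<^esub>"
    using x by (simp add: diff_action rc_action(2) gen_gen_action clifford_gens free_algebra_closed gen_in_free_algebra
        scalar_in_free_algebra clifford_ann_def clifford_cre_def del: U.scale_scale)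
  from U.sum_eq_if_diff_zero[OF this] have "clifford_ann M i (clifford_cre M j x) =
     (if j = i then 1 else 0) \<odot>\<^bsub>underlying clifford M\<^esub> x \<oplus>\<^bsub>underlying clifford M\<^esub>
     (- 1) \<odot>\<^bsub>underlying clifford M\<^esub> clifford_cre M j (clifford_ann M i x)"
    using x ops_closed U.scale_closed by simp
  moreover have "(if j = i then 1 else 0) \<odot>\<^bsub>underlying clifford M\<^esub> x = (if i = j then x else \<zero>\<^bsub>underlying clifford M\<^esub>)"
    using x U.scale_one U.scale_zero_left by (simp del: rational_subspace_simps(4))
  ultimately show ?thesis by simp
qed

text \<open>
  As the annihilation operators anticommute, the letter \<open>n\<close> can be made to act first.
\<close>

lemma ann_word_zero:
  "\<lbrakk>clifford_ann M n x = \<zero>\<^bsub>M\<^esub>; n \<in> set l; x \<in> carrier M\<rbrakk> \<Longrightarrow> ann_word (clifford_ann M) l x = \<zero>\<^bsub>M\<^esub>"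
proof (induction l arbitrary: x)
  case (Cons j l)
  have lin: "qlinear (underlying clifford M) (underlying clifford M) (clifford_ann M i)" for i
    unfolding clifford_ann_def by (rule qlinear_act) (simp add: clifford_gens)
  have z: "clifford_ann M i \<zero>\<^bsub>M\<^esub> = \<zero>\<^bsub>M\<^esub>" for i
    using qlinear_zero[OF lin U.qspace_axioms U.qspace_axioms] by simp
  show ?case
  proof (cases "j = n")
    case True
    have "ann_word (clifford_ann M) l \<zero>\<^bsub>M\<^esub> = \<zero>\<^bsub>M\<^esub>" by (induction l) (simp_all add: z)
    then show ?thesis using Cons.prems True by simp
  next
    case False
    have "clifford_ann M n (clifford_ann M j x) = \<zero>\<^bsub>M\<^esub>"
      using ann_ann_relation[OF Cons.prems(3), of n j] Cons.prems(1) z U.scale_zero_right by simp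
    then show ?thesis using Cons False ops_closed by simp
  qed
qed simp

end

lemma admissible_cliffordD:
  assumes "admissible_clifford M W"
  shows "x \<in> carrier M \<Longrightarrow> \<exists>m. \<forall>n\<ge>m. clifford_ann M n x = \<zero>\<^bsub>M\<^esub>"
    "W 0 = {x \<in> carrier M. \<forall>n. clifford_ann M n x = \<zero>\<^bsub>M\<^esub>}"
proof -
  show "\<exists>m. \<forall>n\<ge>m. clifford_ann M n x = \<zero>\<^bsub>M\<^esub>" if x: "x \<in> carrier M"
  proof -
    have "\<exists>m0. \<forall>m>m0. act clifford M (Qgen m) x = \<zero>\<^bsub>M\<^esub>"
      using assms x by (simp add: admissible_clifford_def)
    then obtain m0 where m0: "\<forall>m>m0. act clifford M (Qgen m) x = \<zero>\<^bsub>M\<^esub>" ..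
    then show ?thesis by (intro exI[of _ m0]) (simp add: clifford_ann_def)
  qed
  have "(\<forall>i>0. act clifford M (Qgen i) x = \<zero>\<^bsub>M\<^esub>) \<longleftrightarrow> (\<forall>n. clifford_ann M n x = \<zero>\<^bsub>M\<^esub>)" for x
    unfolding clifford_ann_def by (auto simp: gr0_conv_Suc)
  then show "W 0 = {x \<in> carrier M. \<forall>n. clifford_ann M n x = \<zero>\<^bsub>M\<^esub>}"
    using assms by (simp add: admissible_clifford_def)
qed

text \<open>
  Only finitely many words do not kill a vector of degree \<open>i\<close>: their letters are bounded by the first
  condition of admissibility and their length is at most \<open>i\<close>.
\<close>

lemma graded_annihilation_clifford:
  assumes g: "graded_module clifford clifford_degree M W" and adm: "admissible_clifford M W"
  shows "graded_annihilation (underlying clifford M) W (clifford_ann M)"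
proof -
  note gm = graded_moduleD[OF g clifford_presentation]
  interpret clifford_module M using gm(1) by (simp add: clifford_module_def)
  interpret grading "underlying clifford M" W by (rule gm(2))
  have lin: "qlinear (underlying clifford M) (underlying clifford M) (clifford_ann M i)" for i
    unfolding clifford_ann_def by (rule qlinear_act) (simp add: clifford_gens)
  have aW: "clifford_ann M n x \<in> W (i - 1)" if "x \<in> W i" for x i n
    using gm(4)[of "Qgen (Suc n)" x i] that by (simp add: clifford_gens clifford_ann_def)
  have wordW: "ann_word (clifford_ann M) l x \<in> W (i - int (length l))" if "x \<in> W i" for l x i
    using that
  proof (induction l arbitrary: x i)
    case (Cons n l)
    then show ?case using Cons.IH[OF aW[OF Cons.prems, of n]] by (simp add: algebra_simps)
  qed simp
  show ?thesis
  proof (intro graded_annihilation.intro grading_axioms graded_annihilation_axioms.intro lin aW)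
    show "x \<in> W 0" if "x \<in> carrier (underlying clifford M)" "\<And>n. clifford_ann M n x = \<zero>\<^bsub>underlying clifford M\<^esub>" for x
      using that by (simp add: admissible_cliffordD(2)[OF adm])
    show "finite {l. ann_word (clifford_ann M) l x \<noteq> \<zero>\<^bsub>underlying clifford M\<^esub>}" if x: "x \<in> W i" for x i
    proof -
      have xM: "x \<in> carrier M" using W_closed(1)[OF x] by simp
      obtain m where m: "\<And>n. n \<ge> m \<Longrightarrow> clifford_ann M n x = \<zero>\<^bsub>M\<^esub>"
        using admissible_cliffordD(1)[OF adm xM] by blast
      have "{l. ann_word (clifford_ann M) l x \<noteq> \<zero>\<^bsub>M\<^esub>} \<subseteq> {l. set l \<subseteq> {..<m} \<and> length l \<le> nat i}"
      proof (intro subsetI CollectI conjI)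
        fix l assume l: "l \<in> {l. ann_word (clifford_ann M) l x \<noteq> \<zero>\<^bsub>M\<^esub>}"
        show "n \<in> {..<m}" if "n \<in> set l" for n
          using ann_word_zero[OF m that xM] l by (cases "m \<le> n") auto
        have "\<not> i - int (length l) < 0"
          using wordW[OF x, of l] gm(5)[of "i - int (length l)"] l by auto
        then show "length l \<le> nat i" by simp
      qed
      then show ?thesis by (simp add: finite_subset finite_lists_length_le)
    qed
    show "W i = {\<zero>\<^bsub>underlying clifford M\<^esub>}" if "i < 0" for i
      using gm(5)[OF that] by simp
  qed
qed

text \<open>
  A created vector has no component of degree \<open>0\<close>, since that would be created from degree \<open>-1\<close>.
\<close>

lemma fock_module_clifford:
  assumes g: "graded_module clifford clifford_degree M W" and adm: "admissible_clifford M W"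
  shows "fock_module clifford (twisted (- 1)) clifford_op M (clifford_ann M) (grading.component (underlying clifford M) W 0)"
proof -
  note gm = graded_moduleD[OF g clifford_presentation]
  interpret clifford_module M using gm(1) by (simp add: clifford_module_def)
  interpret A: graded_annihilation "underlying clifford M" W "clifford_ann M"
    by (rule graded_annihilation_clifford[OF g adm])
  have lin: "qlinear (underlying clifford M) (underlying clifford M) (clifford_cre M i)" for i
    unfolding clifford_cre_def by (rule qlinear_act) (simp add: clifford_gens)
  interpret L: ladder "underlying clifford M" "clifford_ann M" "A.component 0" "- 1" "clifford_cre M"
  proof (intro ladder.intro A.annihilation_axioms statistics.intro statistics_axioms.intro ladder_axioms.intro
      U.qspace_axioms lin)
    fix x i j n assume "x \<in> carrier (underlying clifford M)"
    then have x: "x \<in> carrier M" by simp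
    show "clifford_ann M i (clifford_ann M j x) = (- 1) \<odot>\<^bsub>underlying clifford M\<^esub> clifford_ann M j (clifford_ann M i x)"
      by (rule ann_ann_relation[OF x])
    show "clifford_ann M i (clifford_cre M j x) = (if i = j then x else \<zero>\<^bsub>underlying clifford M\<^esub>)
      \<oplus>\<^bsub>underlying clifford M\<^esub> (- 1) \<odot>\<^bsub>underlying clifford M\<^esub> clifford_cre M j (clifford_ann M i x)"
      using ann_cre_relation[OF x, of i j] by simp
    have cW: "clifford_cre M n y \<in> W (k + 1)" if "y \<in> W k" for y k
      using gm(4)[of "Pgen (Suc n)" y k] that by (simp add: clifford_gens clifford_cre_def)
    have "A.component (- 1 + 1) (clifford_cre M n x) = clifford_cre M n (A.component (- 1) x)"
      by (rule A.component_morphism[OF A.grading_axioms lin cW]) (use x in simp_all)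
    moreover have "A.component (- 1) x = \<zero>\<^bsub>underlying clifford M\<^esub>"
      using A.component(1)[of x "- 1"] gm(5)[of "- 1"] x by simp
    ultimately show "A.component 0 (clifford_cre M n x) = \<zero>\<^bsub>underlying clifford M\<^esub>"
      using qlinear_zero[OF lin U.qspace_axioms U.qspace_axioms] by simp
  qed simp
  have vac: "A.vac \<subseteq> carrier M" using A.vac_carrier by auto
  show ?thesis
  proof (rule fock_module.intro[OF fock_model_clifford presented_module_axioms A.annihilation_axioms fock_module_axioms.intro])
    show "twisted (- 1) (rational_subspace clifford M A.vac) (A.coord x)" if "x \<in> carrier M" for x
      unfolding twisted_subspace[where U = A.vac] using L.coord_twisted[of x] that by simp
    show "\<exists>x\<in>carrier M. A.coord x = h" if "h \<in> finite_support (rational_subspace clifford M A.vac)"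
      "twisted (- 1) (rational_subspace clifford M A.vac) h" for h
      using L.coord_surj[OF finite_support_subspace[OF that(1) vac] that(2)[unfolded twisted_subspace[where U = A.vac]]] by simp
    show "A.coord (act clifford M s x) = clifford_op (rational_subspace clifford M A.vac) s (A.coord x)"
      if "s \<in> fst clifford" "x \<in> carrier M" for s x
    proof (cases s)
      case (Pgen i)
      then have "i > 0" using that(1) by (simp add: clifford_gens)
      then show ?thesis using L.coord_c[of x "i - 1"] that(2) Pgen
        by (simp add: clifford_op_def fun_eq_iff cre_subspace[where U = A.vac] clifford_cre_def)
    next
      case (Qgen i)
      then have "i > 0" using that(1) by (simp add: clifford_gens)
      then show ?thesis using L.coord_a[of "i - 1" x] Qgen by (simp add: clifford_op_def clifford_ann_def)
    qed
  qed
qed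

lemma admissible_clifford_level:
  assumes "fock_realization clifford (twisted (- 1)) clifford_op V M \<phi>"
  shows "admissible_clifford M (fock_realization.level (twisted (- 1)) V \<phi>)"
proof -
  interpret R: fock_realization clifford "twisted (- 1)" clifford_op V M \<phi> by fact
  have Q: "act clifford M (Qgen i) (\<phi> h) = \<zero>\<^bsub>M\<^esub> \<longleftrightarrow> (\<forall>l. h ((i - 1) # l) = \<zero>\<^bsub>V\<^esub>)"
    if "i > 0" "h \<in> finite_support V" "twisted (- 1) V h" for i h
    using that R.act_M[of "Qgen i" h] R.phi_zero_iff[OF ann_finite_support[OF that(2)] twisted_ann[OF that(3)], of "i - 1"]
    by (simp add: clifford_gens clifford_op_def ann_def)
  show ?thesis
    unfolding admissible_clifford_def
  proof (intro conjI ballI)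
    fix x assume "x \<in> carrier M"
    then obtain h where h: "h \<in> finite_support V" "twisted (- 1) V h" "x = \<phi> h" by (auto simp: R.carrier_M)
    have "finite (\<Union>(set ` {l. h l \<noteq> \<zero>\<^bsub>V\<^esub>}))" using finite_supportD(2)[OF h(1)] by simp
    then obtain m where m: "\<Union>(set ` {l. h l \<noteq> \<zero>\<^bsub>V\<^esub>}) \<subseteq> {..<m}" using finite_subset_lessThan by blast
    have "h (n # l) = \<zero>\<^bsub>V\<^esub>" if "n \<ge> m" for n l
    proof (rule ccontr)
      assume "h (n # l) \<noteq> \<zero>\<^bsub>V\<^esub>"
      then have "n \<in> {..<m}" using m by force
      then show False using that by simp
    qed
    then show "\<exists>m0. \<forall>m>m0. act clifford M (Qgen m) x = \<zero>\<^bsub>M\<^esub>"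
      using Q h by (intro exI[of _ m]) auto
  next
    show "R.level 0 = {x \<in> carrier M. \<forall>i>0. act clifford M (Qgen i) x = \<zero>\<^bsub>M\<^esub>}"
    proof (rule Set.set_eqI)
    fix x
    show "x \<in> R.level 0 \<longleftrightarrow> x \<in> {x \<in> carrier M. \<forall>i>0. act clifford M (Qgen i) x = \<zero>\<^bsub>M\<^esub>}"
    proof (cases "x \<in> carrier M")
      case True
      then obtain h where h: "h \<in> finite_support V" "twisted (- 1) V h" "x = \<phi> h" by (auto simp: R.carrier_M)
      have "(\<forall>i>0. act clifford M (Qgen i) x = \<zero>\<^bsub>M\<^esub>) \<longleftrightarrow> (\<forall>i>0. \<forall>l. h ((i - 1) # l) = \<zero>\<^bsub>V\<^esub>)"
        using Q h by simp
      also have "\<dots> \<longleftrightarrow> (\<forall>n l. h (n # l) = \<zero>\<^bsub>V\<^esub>)"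
      proof (intro iffI allI impI)
        fix n l assume "\<forall>i>0. \<forall>l. h ((i - 1) # l) = \<zero>\<^bsub>V\<^esub>"
        from this[rule_format, of "Suc n" l] show "h (n # l) = \<zero>\<^bsub>V\<^esub>" by simp
      qed blast
      finally show ?thesis using True h R.level_zero_iff[OF h(1,2)] by simp
    next
      case False
      then show ?thesis by (auto simp: R.level_def R.carrier_M)
    qed
    qed
  qed
qed

lemma graded_model_clifford:
  "graded_model clifford (twisted (- 1)) clifford_op clifford_degree admissible_clifford clifford_ann"
proof (intro graded_model.intro fock_model_clifford graded_model_axioms.intro graded_annihilation_clifford
    fock_module_clifford admissible_clifford_level)
  fix M N :: "(cliff_gen ncpoly set, 'a) module" and f x n
  assume "presented_module clifford M" "presented_module clifford N"
    "f \<in> linear_maps (presented_algebra clifford) M N" "x \<in> carrier M"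
  then show "f (clifford_ann M n x) = clifford_ann N n (f x)"
    using linear_maps_presented_iff[of clifford M N f] by (auto simp: clifford_ann_def clifford_gens)
next
  fix V :: "(rat, 'a) module" and s h and i :: int and l
  assume V: "qspace V" and h: "\<And>l. h l \<noteq> \<zero>\<^bsub>V\<^esub> \<Longrightarrow> int (length l) = i" and nz: "clifford_op V s h l \<noteq> \<zero>\<^bsub>V\<^esub>"
  show "int (length l) = i + clifford_degree s"
  proof (cases s)
    case (Pgen j)
    then obtain k where "h k \<noteq> \<zero>\<^bsub>V\<^esub>" "length l = Suc (length k)"
      using cre_nonzero[OF V, of "- 1" "j - 1" h l] nz by (auto simp: clifford_op_def)
    then show ?thesis using h[of k] Pgen by simp
  next
    case (Qgen j)
    then show ?thesis using h[of "(j - 1) # l"] nz by (simp add: clifford_op_def ann_def)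
  qed
qed

lemma weak_equivalence_clifford:
  "weak_equivalence (clifford_modules TYPE('a)) (vector_spaces TYPE('a)) (degree_zero clifford)"
  unfolding clifford_modules_def by (rule graded_model.weak_equivalence_degree_zero[OF graded_model_clifford])

section \<open>The algebra generated by \<open>K\<^sub>1\<close>, \<open>K\<^bsub>-1\<^esub>\<close>, \<open>E\<close>, \<open>F\<close>\<close>

text \<open>
  On coordinates each generator moves values from words to words: the value of the result at \<open>l\<close> is read
  at \<open>e_source s l\<close>, and it is zero if there is no such word. The letter \<open>n\<close> stands for the
  annihilation operator \<open>F K\<^bsub>-1\<^esub>\<^bsup>n\<^esup>\<close>, so that \<open>K\<^bsub>-1\<^esub>\<close> raises the first letter and \<open>F\<close> prepends the
  letter \<open>0\<close>; at the empty word \<open>K\<^sub>1\<close> and \<open>K\<^bsub>-1\<^esub>\<close> act as the identity.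
\<close>

fun e_source :: "e_gen \<Rightarrow> nat list \<Rightarrow> nat list option" where
  "e_source Kneg [] = Some []"
| "e_source Kneg (n # l) = Some (Suc n # l)"
| "e_source Kpos [] = Some []"
| "e_source Kpos (0 # l) = None"
| "e_source Kpos (Suc n # l) = Some (n # l)"
| "e_source Egen [] = None"
| "e_source Egen (0 # l) = Some l"
| "e_source Egen (Suc n # l) = None"
| "e_source Fgen l = Some (0 # l)"

definition e_op :: "(rat, 'a) module \<Rightarrow> e_gen \<Rightarrow> (nat list \<Rightarrow> 'a) \<Rightarrow> (nat list \<Rightarrow> 'a)" where
  "e_op V s h l = (case e_source s l of None \<Rightarrow> \<zero>\<^bsub>V\<^esub> | Some k \<Rightarrow> h k)"

text \<open>
  With the creation operators \<open>K\<^sub>1\<^bsup>n\<^esup> E\<close> these satisfy \<open>a\<^sub>m c\<^sub>n = \<delta>\<^sub>m\<^sub>n\<close>: the exchange relation with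
  \<open>\<epsilon> = 0\<close>, for which words cannot be reordered and no symmetry is imposed on functions.
\<close>

definition e_ann :: "(e_gen ncpoly set, 'a) module \<Rightarrow> nat \<Rightarrow> 'a \<Rightarrow> 'a" where
  "e_ann M n x = act e_algebra M Fgen ((act e_algebra M Kneg ^^ n) x)"

abbreviation "no_condition \<equiv> (\<lambda>_ _. True)"

lemma e_presentation: "presentation e_algebra"
  unfolding presentation_def
  by (unfold e_algebra_def fst_conv snd_conv, safe,
      (intro free_algebra_closed gen_in_free_algebra one_in_free_algebra UNIV_I)+)

lemma e_gens [simp]: "s \<in> fst e_algebra"
  by (simp add: e_algebra_def)

lemma word_cases: 
  obtains "l = []" | k where "l = 0 # k" | n k where "l = Suc n # k"
  by (metis list.exhaust not0_implies_Suc)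

lemma e_source_inj: "\<lbrakk>e_source s l = Some k; e_source s l' = Some k\<rbrakk> \<Longrightarrow> l = l'"
  by (cases s; cases l rule: word_cases; cases l' rule: word_cases) auto

lemma e_source_length: "e_source s l = Some k \<Longrightarrow> int (length l) = int (length k) + e_degree s"
  by (cases s; cases l rule: word_cases) auto

lemma e_op_finite_support:
  assumes "qspace V" "h \<in> finite_support V"
  shows "e_op V s h \<in> finite_support V"
proof -
  interpret qspace V by fact
  let ?B = "\<Union>k\<in>{k. h k \<noteq> \<zero>\<^bsub>V\<^esub>}. {l. e_source s l = Some k}"
  have "finite {l. e_source s l = Some k}" for k
  proof (cases "\<exists>l0. e_source s l0 = Some k")
    case True
    then obtain l0 where "e_source s l0 = Some k" ..
    then have "{l. e_source s l = Some k} \<subseteq> {l0}" using e_source_inj by blast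
    then show ?thesis by (rule finite_subset) simp
  qed simp
  then have "finite ?B" using finite_supportD(2)[OF assms(2)] by simp
  then show ?thesis
    by (rule finite_supportI[rotated 2])
      (use finite_supportD(1)[OF assms(2)] in \<open>auto simp: e_op_def split: option.splits\<close>)
qed

lemma e_relators:
  assumes "r \<in> snd e_algebra"
  obtains "r = gen Kneg * gen Kpos - 1" | "r = gen Fgen * gen Egen - 1" | "r = gen Kneg * gen Egen"
    | "r = gen Fgen * gen Kpos" | "r = gen Kpos * gen Kneg + gen Egen * gen Fgen - 1"
  using assms by (auto simp: e_algebra_def)

lemma e_op_relations:
  shows "e_op V Kneg (e_op V Kpos h) l = h l" "e_op V Fgen (e_op V Egen h) l = h l"
    "e_op V Kneg (e_op V Egen h) l = \<zero>\<^bsub>V\<^esub>" "e_op V Fgen (e_op V Kpos h) l = \<zero>\<^bsub>V\<^esub>"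
    "qspace V \<Longrightarrow> h \<in> finite_support V \<Longrightarrow>
      e_op V Kpos (e_op V Kneg h) l \<oplus>\<^bsub>V\<^esub> e_op V Egen (e_op V Fgen h) l = h l"
proof -
  show "e_op V Kpos (e_op V Kneg h) l \<oplus>\<^bsub>V\<^esub> e_op V Egen (e_op V Fgen h) l = h l"
    if V: "qspace V" and h: "h \<in> finite_support V"
  proof -
    interpret qspace V by fact
    show ?thesis using finite_supportD(1)[OF h, of l] by (cases l rule: word_cases) (simp_all add: e_op_def)
  qed
qed (cases l rule: word_cases; simp add: e_op_def)+

lemma fock_model_e: "fock_model e_algebra no_condition e_op"
proof (intro fock_model.intro fock_model_axioms.intro e_presentation)
  fix V V' :: "(rat, 'a) module" and f and h :: "nat list \<Rightarrow> 'a" and s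
  assume V: "qspace V" and V': "qspace V'" and f: "qlinear V V' f"
  show "e_op V' s (\<lambda>l. f (h l)) = (\<lambda>l. f (e_op V s h l))"
    by (auto simp: e_op_def fun_eq_iff qlinear_zero[OF f V V'] split: option.splits)
next
  fix V :: "(rat, 'a) module" assume V: "qspace V"
  interpret V: qspace V by fact
  interpret operators e_algebra "fock no_condition V" "e_op V"
  proof (intro operators.intro e_presentation qspace_fock[OF V] operators_axioms.intro qlinearI)
    fix s and h k :: "nat list \<Rightarrow> 'a" and q
    assume h: "h \<in> carrier (fock no_condition V)"
    show "e_op V s h \<in> carrier (fock no_condition V)" using h e_op_finite_support[OF V] by simp
    show "e_op V s (q \<odot>\<^bsub>fock no_condition V\<^esub> h) = q \<odot>\<^bsub>fock no_condition V\<^esub> e_op V s h"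
      by (auto simp: e_op_def fun_eq_iff split: option.splits)
    show "e_op V s (h \<oplus>\<^bsub>fock no_condition V\<^esub> k) = e_op V s h \<oplus>\<^bsub>fock no_condition V\<^esub> e_op V s k"
      by (auto simp: e_op_def fun_eq_iff split: option.splits)
  qed simp_all
  show "representation e_algebra (fock no_condition V) (e_op V)"
  proof (intro representation.intro operators_axioms representation_axioms.intro)
    fix r h assume r: "r \<in> snd e_algebra" and h: "h \<in> carrier (fock no_condition V)"
    have hc: "h l \<in> carrier V" for l using h finite_supportD(1) by auto
    have hf: "h \<in> finite_support V" using h by simp
    have gg: "ev (gen s * gen t) h = e_op V s (e_op V t h)" for s t
      by (rule ev_gen_gen) (use h in simp_all)
    have F: "gen s * gen t \<in> carrier F" for s t by (intro free_algebra_closed gen_in_free_algebra) simp_all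
    note F1 = one_in_free_algebra[of "fst e_algebra"]
    from r show "ev r h = \<zero>\<^bsub>fock no_condition V\<^esub>"
    proof (cases rule: e_relators)
      case 1
      then show ?thesis
        unfolding 1 ev_diff[OF F F1 h] gg ev_one[OF h] using hc by (simp add: fun_eq_iff e_op_relations)
    next
      case 2
      then show ?thesis
        unfolding 2 ev_diff[OF F F1 h] gg ev_one[OF h] using hc by (simp add: fun_eq_iff e_op_relations)
    next
      case 3
      then show ?thesis unfolding 3 gg by (simp add: fun_eq_iff e_op_relations)
    next
      case 4
      then show ?thesis unfolding 4 gg by (simp add: fun_eq_iff e_op_relations)
    next
      case 5
      have F2: "gen Kpos * gen Kneg + gen Egen * gen Fgen \<in> carrier F" by (intro free_algebra_closed(1) F)
      show ?thesis
        unfolding 5 ev_diff[OF F2 F1 h] ev_add[OF F F h] gg ev_one[OF h]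
        using hc by (simp add: fun_eq_iff e_op_relations(5)[OF V hf])
    qed
  qed
qed auto

locale e_module = presented_module e_algebra M for M :: "(e_gen ncpoly set, 'a) module"
begin

sublocale U: qspace "underlying e_algebra M" by (rule qspace_underlying)

abbreviation "ac \<equiv> act e_algebra M"

lemma ac_linear: "qlinear (underlying e_algebra M) (underlying e_algebra M) (ac s)"
  by (rule qlinear_act) simp

lemma ac_closed [simp]: "x \<in> carrier M \<Longrightarrow> ac s x \<in> carrier M"
  by (simp add: act_closed)

lemma ac_zero [simp]: "ac s \<zero>\<^bsub>M\<^esub> = \<zero>\<^bsub>M\<^esub>"
  using qlinear_zero[OF ac_linear U.qspace_axioms U.qspace_axioms] by simp

lemma relations:
  assumes x: "x \<in> carrier M"
  shows "ac Kneg (ac Kpos x) = x" "ac Fgen (ac Egen x) = x" "ac Kneg (ac Egen x) = \<zero>\<^bsub>M\<^esub>"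
    "ac Fgen (ac Kpos x) = \<zero>\<^bsub>M\<^esub>" "ac Kpos (ac Kneg x) \<oplus>\<^bsub>M\<^esub> ac Egen (ac Fgen x) = x"
proof -
  have F: "gen s * gen t \<in> carrier F" for s t by (intro free_algebra_closed gen_in_free_algebra) simp_all
  note F1 = one_in_free_algebra[of "fst e_algebra"]
  have gg: "rc (gen s * gen t) \<odot>\<^bsub>M\<^esub> x = ac s (ac t x)" for s t by (rule gen_gen_action) (use x in simp_all)
  have diff: "y = x" if "y \<oplus>\<^bsub>underlying e_algebra M\<^esub> (- 1) \<odot>\<^bsub>underlying e_algebra M\<^esub> x = \<zero>\<^bsub>underlying e_algebra M\<^esub>" "y \<in> carrier M" for y
    using that x U.diff_eq_zero_iff[of y x] by simp
  have one: "y = x" if "rc (p - 1) \<odot>\<^bsub>M\<^esub> x = \<zero>\<^bsub>M\<^esub>" "rc p \<odot>\<^bsub>M\<^esub> x = y" "p \<in> carrier F" for p y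
    by (rule diff) (use that x diff_action[OF x that(3) F1] rc_action(1)[OF x that(3)] in \<open>simp_all add: rc_action(4)\<close>)
  have r: "gen Kneg * gen Kpos - 1 \<in> snd e_algebra" "gen Fgen * gen Egen - 1 \<in> snd e_algebra"
    "gen Kneg * gen Egen \<in> snd e_algebra" "gen Fgen * gen Kpos \<in> snd e_algebra"
    "gen Kpos * gen Kneg + gen Egen * gen Fgen - 1 \<in> snd e_algebra"
    by (simp_all add: e_algebra_def)
  note z = relator_action[OF _ x]
  show "ac Kneg (ac Kpos x) = x" by (rule one[OF z[OF r(1)] gg F])
  show "ac Fgen (ac Egen x) = x" by (rule one[OF z[OF r(2)] gg F])
  show "ac Kneg (ac Egen x) = \<zero>\<^bsub>M\<^esub>" using z[OF r(3)] gg by simp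
  show "ac Fgen (ac Kpos x) = \<zero>\<^bsub>M\<^esub>" using z[OF r(4)] gg by simp
  have "rc (gen Kpos * gen Kneg + gen Egen * gen Fgen) \<odot>\<^bsub>M\<^esub> x = ac Kpos (ac Kneg x) \<oplus>\<^bsub>M\<^esub> ac Egen (ac Fgen x)"
    by (simp add: rc_action(2)[OF x F F] gg)
  then show "ac Kpos (ac Kneg x) \<oplus>\<^bsub>M\<^esub> ac Egen (ac Fgen x) = x"
    by (rule one[OF z[OF r(5)]]) (intro free_algebra_closed(1) F)
qed

lemma Kneg_power_closed [simp]: "x \<in> carrier M \<Longrightarrow> (ac Kneg ^^ n) x \<in> carrier M"
  by (induction n) simp_all

lemma Kneg_power_zero: "(ac Kneg ^^ n) \<zero>\<^bsub>M\<^esub> = \<zero>\<^bsub>M\<^esub>"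
  by (induction n) simp_all

lemma e_ann_linear: "qlinear (underlying e_algebra M) (underlying e_algebra M) (e_ann M n)"
proof -
  have "qlinear (underlying e_algebra M) (underlying e_algebra M) (ac Kneg ^^ n)"
  proof (induction n)
    case (Suc n)
    then show ?case using qlinear_comp[OF Suc ac_linear] by simp
  qed (simp add: qlinear_def)
  from qlinear_comp[OF this ac_linear] show ?thesis by (simp add: e_ann_def[abs_def])
qed

lemma e_ann_relations:
  assumes x: "x \<in> carrier M"
  shows "e_ann M n (ac Kneg x) = e_ann M (Suc n) x" "e_ann M 0 (ac Kpos x) = \<zero>\<^bsub>M\<^esub>"
    "e_ann M (Suc n) (ac Kpos x) = e_ann M n x" "e_ann M 0 (ac Egen x) = x"
    "e_ann M (Suc n) (ac Egen x) = \<zero>\<^bsub>M\<^esub>" "e_ann M 0 x = ac Fgen x"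
  by (simp_all add: e_ann_def relations[OF x] funpow_Suc_right Kneg_power_zero del: funpow.simps)

text \<open>
  By \<open>K\<^sub>1 K\<^bsub>-1\<^esub> + E F = 1\<close> a vector killed by \<open>K\<^bsub>-1\<^esub>\<close> and \<open>F\<close> is zero; the general case is an induction on
  the order of nilpotency of \<open>K\<^bsub>-1\<^esub>\<close>.
\<close>

lemma zero_if_annihilated:
  "\<lbrakk>(ac Kneg ^^ N) x = \<zero>\<^bsub>M\<^esub>; \<And>n. e_ann M n x = \<zero>\<^bsub>M\<^esub>; x \<in> carrier M\<rbrakk> \<Longrightarrow> x = \<zero>\<^bsub>M\<^esub>"
proof (induction N arbitrary: x)
  case (Suc N)
  have "ac Kneg x = \<zero>\<^bsub>M\<^esub>"
    by (rule Suc.IH) (use Suc.prems in \<open>simp_all add: funpow_Suc_right e_ann_relations del: funpow.simps\<close>)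
  moreover have "ac Fgen x = \<zero>\<^bsub>M\<^esub>" using Suc.prems(2)[of 0] by (simp add: e_ann_def)
  ultimately show ?case using relations(5)[OF Suc.prems(3)] U.M.zero_closed by simp
qed simp

end

text \<open>
  In degree \<open>k\<close> the first letter of a word that does not kill \<open>x\<close> is bounded because \<open>K\<^bsub>-1\<^esub>\<close> is nilpotent
  on \<open>x\<close>, and the remaining letters by induction, as the degree has dropped by one. A vector killed by
  all annihilation operators has degree \<open>0\<close>, because its components of positive degree vanish by
  \<open>zero_if_annihilated\<close>.
\<close>

lemma graded_annihilation_e:
  assumes g: "graded_module e_algebra e_degree M W" and adm: "admissible_e M W"
  shows "graded_annihilation (underlying e_algebra M) W (e_ann M)"
proof -
  note gm = graded_moduleD[OF g e_presentation]
  interpret e_module M using gm(1) by (simp add: e_module_def)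
  interpret grading "underlying e_algebra M" W by (rule gm(2))
  have KW: "(ac Kneg ^^ n) x \<in> W i" if "x \<in> W i" for n x i
  proof (induction n)
    case (Suc n)
    then show ?case using gm(4)[of Kneg "(ac Kneg ^^ n) x" i] by simp
  qed (use that in simp)
  have aW: "e_ann M n x \<in> W (i - 1)" if "x \<in> W i" for x i n
    using gm(4)[of Fgen "(ac Kneg ^^ n) x" i] KW[OF that] by (simp add: e_ann_def)
  have WM: "x \<in> carrier M" if "x \<in> W i" for x i using W_closed(1)[OF that] by simp
  have word_zero: "ann_word (e_ann M) l \<zero>\<^bsub>M\<^esub> = \<zero>\<^bsub>M\<^esub>" for l
    by (induction l) (simp_all add: e_ann_def Kneg_power_zero)
  show ?thesis
  proof (intro graded_annihilation.intro grading_axioms graded_annihilation_axioms.intro e_ann_linear aW)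
    show "W i = {\<zero>\<^bsub>underlying e_algebra M\<^esub>}" if "i < 0" for i using gm(5)[OF that] by simp
    show "x \<in> W 0" if x: "x \<in> carrier (underlying e_algebra M)"
      and z: "\<And>n. e_ann M n x = \<zero>\<^bsub>underlying e_algebra M\<^esub>" for x
    proof (rule homogeneousI[OF x])
      fix j :: int assume "j \<noteq> 0"
      then consider "j < 0" | "j > 0" by linarith
      then show "component j x = \<zero>\<^bsub>underlying e_algebra M\<^esub>"
      proof cases
        case 1
        then show ?thesis using component(1)[OF x, of j] gm(5) by simp
      next
        case 2
        have cj: "component j x \<in> W j" by (rule component(1)[OF x])
        obtain N where N: "(ac Kneg ^^ N) (component j x) = \<zero>\<^bsub>M\<^esub>"
          using adm 2 cj unfolding admissible_e_def by blast
        have "e_ann M n (component j x) = \<zero>\<^bsub>M\<^esub>" for n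
        proof -
          have "component (j + (- 1)) (e_ann M n x) = e_ann M n (component j x)"
            by (rule component_morphism[OF grading_axioms e_ann_linear _ x]) (use aW in simp)
          then show ?thesis using z component_homogeneous[OF W_closed(2), of "j - 1" 0] by simp
        qed
        from zero_if_annihilated[OF N this WM[OF cj]] show ?thesis by simp
      qed
    qed
    have fin: "finite {l. ann_word (e_ann M) l x \<noteq> \<zero>\<^bsub>M\<^esub>}" if "x \<in> W (int k)" for x k
      using that
    proof (induction k arbitrary: x)
      case 0
      have "e_ann M n x = \<zero>\<^bsub>M\<^esub>" for n using aW[OF 0, of n] gm(5)[of "- 1"] by simp
      then have "ann_word (e_ann M) l x \<noteq> \<zero>\<^bsub>M\<^esub> \<Longrightarrow> l = []" for l by (cases l) (simp_all add: word_zero)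
      then have "{l. ann_word (e_ann M) l x \<noteq> \<zero>\<^bsub>M\<^esub>} \<subseteq> {[]}" by auto
      then show ?case by (rule finite_subset) simp
    next
      case (Suc k)
      obtain N where N: "(ac Kneg ^^ N) x = \<zero>\<^bsub>M\<^esub>"
        using adm Suc.prems unfolding admissible_e_def by (metis of_nat_0_less_iff zero_less_Suc)
      have big: "e_ann M n x = \<zero>\<^bsub>M\<^esub>" if "n \<ge> N" for n
      proof -
        have "(ac Kneg ^^ (n - N + N)) x = (ac Kneg ^^ (n - N)) ((ac Kneg ^^ N) x)" by (simp only: funpow_add o_apply)
        then show ?thesis using that N by (simp add: e_ann_def Kneg_power_zero)
      qed
      let ?B = "insert [] (\<Union>n\<in>{..<N}. (\<lambda>l. n # l) ` {l. ann_word (e_ann M) l (e_ann M n x) \<noteq> \<zero>\<^bsub>M\<^esub>})"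
      have "finite {l. ann_word (e_ann M) l (e_ann M n x) \<noteq> \<zero>\<^bsub>M\<^esub>}" for n
        by (rule Suc.IH) (use aW[OF Suc.prems, of n] in simp)
      then have "finite ?B" by simp
      moreover have "{l. ann_word (e_ann M) l x \<noteq> \<zero>\<^bsub>M\<^esub>} \<subseteq> ?B"
      proof
        fix l assume l: "l \<in> {l. ann_word (e_ann M) l x \<noteq> \<zero>\<^bsub>M\<^esub>}"
        show "l \<in> ?B"
        proof (cases l)
          case (Cons n k)
          then have "n < N" using l big[of n] by (cases "n \<ge> N") (auto simp: word_zero)
          then show ?thesis using Cons l by auto
        qed simp
      qed
      ultimately show ?case by (rule finite_subset[rotated])
    qed
    show "finite {l. ann_word (e_ann M) l x \<noteq> \<zero>\<^bsub>underlying e_algebra M\<^esub>}" if x: "x \<in> W i" for x i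
    proof (cases "i < 0")
      case True
      then have "x = \<zero>\<^bsub>M\<^esub>" using x gm(5) by simp
      then show ?thesis by (simp add: word_zero)
    next
      case False
      then show ?thesis using fin[of x "nat i"] x by simp
    qed
  qed
qed

lemma fock_module_e:
  assumes g: "graded_module e_algebra e_degree M W" and adm: "admissible_e M W"
  shows "fock_module e_algebra no_condition e_op M (e_ann M) (grading.component (underlying e_algebra M) W 0)"
proof -
  note gm = graded_moduleD[OF g e_presentation]
  interpret e_module M using gm(1) by (simp add: e_module_def)
  interpret A: graded_annihilation "underlying e_algebra M" W "e_ann M"
    by (rule graded_annihilation_e[OF g adm])
  let ?V = "rational_subspace e_algebra M A.vac"
  have K0: "ac Kneg y = y" "ac Kpos y = y" if y: "y \<in> W 0" for y
  proof -
    have yM: "y \<in> carrier M" using A.W_closed(1)[OF y] by simp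
    show Kn: "ac Kneg y = y" using adm y by (simp add: admissible_e_def)
    have "ac Fgen y \<in> W (- 1)" using gm(4)[of Fgen y 0] y by simp
    then have "ac Fgen y = \<zero>\<^bsub>M\<^esub>" using gm(5)[of "- 1"] by simp
    then show "ac Kpos y = y" using relations(5)[OF yM] Kn U.M.r_zero[of "ac Kpos y"] yM by simp
  qed
  have component_ac: "A.component 0 (ac s x) = ac s (A.component (- e_degree s) x)" if x: "x \<in> carrier M" for s x
  proof -
    have "A.component (- e_degree s + e_degree s) (ac s x) = ac s (A.component (- e_degree s) x)"
      by (rule A.component_morphism[OF A.grading_axioms ac_linear]) (use gm(4) x in simp_all)
    then show ?thesis by simp
  qed
  have coord_nil: "A.coord y [] = A.component 0 y" for y by (simp add: A.coord_def)
  have z: "A.coord \<zero>\<^bsub>M\<^esub> l = \<zero>\<^bsub>M\<^esub>" for l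
    using qlinear_zero[OF A.coord_linear U.qspace_axioms U.qspace_axioms] by simp
  have coord_ac: "A.coord (ac s x) l = e_op ?V s (A.coord x) l" if x: "x \<in> carrier M" for s x l
  proof -
    have c0: "A.component 0 x \<in> W 0" using A.component(1)[of x 0] x by simp
    have cm: "A.component (- 1) x = \<zero>\<^bsub>M\<^esub>" using A.component(1)[of x "- 1"] gm(5)[of "- 1"] x by simp
    show ?thesis
    proof (cases s)
      case Kpos
      then show ?thesis by (cases l rule: word_cases)
        (simp_all add: e_op_def coord_nil component_ac[OF x] K0[OF c0] A.coord_Cons e_ann_relations[OF x] z)
    next
      case Kneg
      then show ?thesis by (cases l)
        (simp_all add: e_op_def coord_nil component_ac[OF x] K0[OF c0] A.coord_Cons e_ann_relations[OF x])
    next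
      case Egen
      then show ?thesis by (cases l rule: word_cases)
        (simp_all add: e_op_def coord_nil component_ac[OF x] cm A.coord_Cons e_ann_relations[OF x] z)
    next
      case Fgen
      then show ?thesis by (simp add: e_op_def A.coord_Cons e_ann_relations[OF x])
    qed
  qed
  define sg where "sg l v = (\<lambda>k :: nat list. if k = l then v else \<zero>\<^bsub>M\<^esub>)" for l v
  \<comment> \<open>The word \<open>[n\<^sub>1, \<dots>, n\<^sub>k]\<close> is reached from a vacuum vector by \<open>K\<^sub>1\<^bsup>n\<^sub>1\<^esup> E \<dots> K\<^sub>1\<^bsup>n\<^sub>k\<^esup> E\<close>.\<close>
  have single: "\<exists>x\<in>carrier M. A.coord x = sg l v" if v: "v \<in> A.vac" for l v
  proof (induction l)
    case Nil
    show ?case using A.coord_of_vac[OF v] A.vac_carrier[OF v] by (intro bexI[of _ v]) (auto simp: sg_def fun_eq_iff)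
  next
    case (Cons n l)
    then obtain y where y: "y \<in> carrier M" "A.coord y = sg l v" by blast
    show ?case
    proof (induction n)
      case 0
      have "A.coord (ac Egen y) k = sg (0 # l) v k" for k
        unfolding coord_ac[OF y(1)] y(2) by (cases k rule: word_cases) (simp_all add: e_op_def sg_def)
      then show ?case using y(1) by (intro bexI[of _ "ac Egen y"]) auto
    next
      case (Suc n)
      then obtain x where x: "x \<in> carrier M" "A.coord x = sg (n # l) v" by blast
      have "A.coord (ac Kpos x) k = sg (Suc n # l) v k" for k
        unfolding coord_ac[OF x(1)] x(2) by (cases k rule: word_cases) (simp_all add: e_op_def sg_def)
      then show ?case using x(1) by (intro bexI[of _ "ac Kpos x"]) auto
    qed
  qed
  have zero_vac: "\<zero>\<^bsub>M\<^esub> \<in> A.vac" using A.coord_vac[of "\<zero>\<^bsub>M\<^esub>" "[]"] z[of "[]"] U.M.zero_closed by simp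
  have surj: "\<exists>x\<in>carrier M. A.coord x = h"
    if "finite B" "{l. h l \<noteq> \<zero>\<^bsub>M\<^esub>} \<subseteq> B" "\<And>l. h l \<in> A.vac" for B h
    using that
  proof (induction B arbitrary: h)
    case empty
    then have "h = (\<lambda>_. \<zero>\<^bsub>M\<^esub>)" by auto
    then show ?case using z U.M.zero_closed by (intro bexI[of _ "\<zero>\<^bsub>M\<^esub>"]) auto
  next
    case (insert l B)
    obtain x where x: "x \<in> carrier M" "A.coord x = sg l (h l)" using single[OF insert.prems(2)] by blast
    have "\<exists>y\<in>carrier M. A.coord y = h(l := \<zero>\<^bsub>M\<^esub>)"
      by (rule insert.IH) (use insert.prems zero_vac in \<open>auto split: if_splits\<close>)
    then obtain y where y: "y \<in> carrier M" "A.coord y = h(l := \<zero>\<^bsub>M\<^esub>)" by blast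
    have "A.coord (x \<oplus>\<^bsub>M\<^esub> y) k = h k" for k
    proof -
      have "A.coord (x \<oplus>\<^bsub>underlying e_algebra M\<^esub> y) k = A.coord x k \<oplus>\<^bsub>underlying e_algebra M\<^esub> A.coord y k"
        by (rule qlinearD(2)[OF A.coord_linear]) (use x y in simp_all)
      then show ?thesis using x y A.vac_carrier[OF insert.prems(2), of k] U.M.l_zero U.M.r_zero by (auto simp: sg_def)
    qed
    then show ?case using x y U.M.add.m_closed by (intro bexI[of _ "x \<oplus>\<^bsub>M\<^esub> y"]) auto
  qed
  have vac: "A.vac \<subseteq> carrier M" using A.vac_carrier by auto
  show ?thesis
  proof (rule fock_module.intro[OF fock_model_e presented_module_axioms A.annihilation_axioms fock_module_axioms.intro])
    show "\<exists>x\<in>carrier M. A.coord x = h" if "h \<in> finite_support ?V" for h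
      using surj[OF finite_supportD(2)[OF that], of h] finite_support_subspace(2)[OF that vac] by simp
    show "A.coord (act e_algebra M s x) = e_op ?V s (A.coord x)" if "x \<in> carrier M" for s x
      using coord_ac[OF that] by (simp add: fun_eq_iff)
  qed simp
qed

lemma admissible_e_level:
  assumes "fock_realization e_algebra no_condition e_op V M \<phi>"
  shows "admissible_e M (fock_realization.level no_condition V \<phi>)"
proof -
  interpret R: fock_realization e_algebra no_condition e_op V M \<phi> by fact
  have act: "act e_algebra M s (\<phi> h) = \<phi> (e_op V s h)" if "h \<in> finite_support V" for s h
    by (rule R.act_M) (use that in simp_all)
  show ?thesis
    unfolding admissible_e_def
  proof (intro conjI ballI allI impI)
    fix x assume "x \<in> R.level 0"
    then obtain h where h: "h \<in> finite_support V" "no_condition V h" "\<forall>l. h l \<noteq> \<zero>\<^bsub>V\<^esub> \<longrightarrow> int (length l) = 0" "x = \<phi> h"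
      by (rule R.levelE)
    have "h (n # l) = \<zero>\<^bsub>V\<^esub>" for n l
      by (rule ccontr) (use h(3)[rule_format, of "n # l"] in simp)
    then have "e_op V Kneg h l = h l" for l by (cases l) (simp_all add: e_op_def)
    then have "e_op V Kneg h = h" by (simp add: fun_eq_iff)
    then show "act e_algebra M Kneg x = x" using act[OF h(1)] h(4) by simp
  next
    fix i :: int and x assume i: "i > 0" and xi: "x \<in> R.level i"
    from xi obtain h where h: "h \<in> finite_support V" "no_condition V h" "\<forall>l. h l \<noteq> \<zero>\<^bsub>V\<^esub> \<longrightarrow> int (length l) = i" "x = \<phi> h"
      by (rule R.levelE)
    have nil: "h [] = \<zero>\<^bsub>V\<^esub>" by (rule ccontr) (use h(3)[rule_format, of "[]"] i in simp)
    have pow: "(act e_algebra M Kneg ^^ n) x = \<phi> ((e_op V Kneg ^^ n) h) \<and> (e_op V Kneg ^^ n) h \<in> finite_support V" for n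
    proof (induction n)
      case (Suc n)
      then show ?case using act e_op_finite_support[OF R.V.qspace_axioms] by simp
    qed (use h in simp)
    have val: "(e_op V Kneg ^^ n) h l = (case l of [] \<Rightarrow> h [] | m # k \<Rightarrow> h ((m + n) # k))" for n l
      by (induction n arbitrary: l) (auto simp: e_op_def split: list.splits)
    have "finite (\<Union>(set ` {l. h l \<noteq> \<zero>\<^bsub>V\<^esub>}))" using finite_supportD(2)[OF h(1)] by simp
    then obtain N where N: "\<Union>(set ` {l. h l \<noteq> \<zero>\<^bsub>V\<^esub>}) \<subseteq> {..<N}" using finite_subset_lessThan by blast
    have "h ((m + N) # k) = \<zero>\<^bsub>V\<^esub>" for m k
    proof (rule ccontr)
      assume "h ((m + N) # k) \<noteq> \<zero>\<^bsub>V\<^esub>"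
      then have "m + N \<in> {..<N}" using N by force
      then show False by simp
    qed
    then have "(e_op V Kneg ^^ N) h l = \<zero>\<^bsub>V\<^esub>" for l unfolding val by (cases l) (simp_all add: nil)
    then have "(act e_algebra M Kneg ^^ N) x = \<zero>\<^bsub>M\<^esub>" using pow[of N] R.phi_zero_iff by simp
    then show "\<exists>n. (act e_algebra M Kneg ^^ n) x = \<zero>\<^bsub>M\<^esub>" ..
  qed
qed

lemma graded_model_e: "graded_model e_algebra no_condition e_op e_degree admissible_e e_ann"
proof (intro graded_model.intro fock_model_e graded_model_axioms.intro graded_annihilation_e
    fock_module_e admissible_e_level)
  fix M N :: "(e_gen ncpoly set, 'a) module" and f x n
  assume M: "presented_module e_algebra M" and N: "presented_module e_algebra N"
    and f: "f \<in> linear_maps (presented_algebra e_algebra) M N" and x: "x \<in> carrier M"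
  interpret e_module M using M by (simp add: e_module_def)
  have fa: "f (act e_algebra M s y) = act e_algebra N s (f y)" if "y \<in> carrier M" for s y
    using linear_maps_presented_iff[OF M N, of f] f that by auto
  have "f ((ac Kneg ^^ n) x) = (act e_algebra N Kneg ^^ n) (f x)"
    using x by (induction n) (simp_all add: fa)
  then show "f (e_ann M n x) = e_ann N n (f x)" using x by (simp add: e_ann_def fa)
next
  fix V :: "(rat, 'a) module" and s h and i :: int and l
  assume h: "\<And>l. h l \<noteq> \<zero>\<^bsub>V\<^esub> \<Longrightarrow> int (length l) = i" and nz: "e_op V s h l \<noteq> \<zero>\<^bsub>V\<^esub>"
  then obtain k where k: "e_source s l = Some k" "h k \<noteq> \<zero>\<^bsub>V\<^esub>" by (auto simp: e_op_def split: option.splits)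
  then show "int (length l) = i + e_degree s" using e_source_length[OF k(1)] h[OF k(2)] by simp
qed

lemma weak_equivalence_e:
  "weak_equivalence (e_modules TYPE('a)) (vector_spaces TYPE('a)) (degree_zero e_algebra)"
  unfolding e_modules_def by (rule graded_model.weak_equivalence_degree_zero[OF graded_model_e])

section \<open>The vacuum projection of a bosonic module\<close>

text \<open>
  A module over the Heisenberg algebra is not graded a priori. Its number operator \<open>D\<close> would be the degree,
  and the projection to degree \<open>0\<close> can be written as a polynomial in \<open>D\<close> on each vector.
\<close>

locale oscillator = qspace V for V :: "(rat, 'a) module" (structure) +
  fixes a c :: "nat \<Rightarrow> 'a \<Rightarrow> 'a"
  assumes a: "qlinear V V (a n)" and c: "qlinear V V (c n)"
    and a_a: "x \<in> carrier V \<Longrightarrow> a i (a j x) = a j (a i x)"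
    and c_c: "x \<in> carrier V \<Longrightarrow> c i (c j x) = c j (c i x)"
    and a_c: "x \<in> carrier V \<Longrightarrow> a i (c j x) = (if i = j then x else \<zero>) \<oplus> c j (a i x)"
    and nilpotent: "x \<in> carrier V \<Longrightarrow> finite {l. ann_word a l x \<noteq> \<zero>}"
begin

lemma closed [simp]: "x \<in> carrier V \<Longrightarrow> a n x \<in> carrier V" "x \<in> carrier V \<Longrightarrow> c n x \<in> carrier V"
  using qlinearD(1)[OF a] qlinearD(1)[OF c] by auto

lemma zero_image [simp]: "a n \<zero> = \<zero>" "c n \<zero> = \<zero>"
  using qlinear_zero[OF a qspace_axioms qspace_axioms] qlinear_zero[OF c qspace_axioms qspace_axioms] by auto

lemma word_linear: "qlinear V V (ann_word a l)"
proof (induction l)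
  case (Cons n l)
  then show ?case using qlinear_comp[OF a] by simp
qed (simp add: qlinear_def)

lemma word_zero [simp]: "ann_word a l \<zero> = \<zero>"
  using qlinear_zero[OF word_linear qspace_axioms qspace_axioms] .

lemma word_closed [simp]: "x \<in> carrier V \<Longrightarrow> ann_word a l x \<in> carrier V"
  using word_linear by (rule qlinearD(1))

definition number :: "'a \<Rightarrow> 'a" where
  "number x = (\<Oplus>m\<in>{m. a m x \<noteq> \<zero>}. c m (a m x))"

lemma finite_ann: "x \<in> carrier V \<Longrightarrow> finite {m. a m x \<noteq> \<zero>}"
proof -
  assume "x \<in> carrier V"
  then have "finite ((\<lambda>m. [m]) -` {l. ann_word a l x \<noteq> \<zero>})"
    by (intro finite_vimageI nilpotent) (auto simp: inj_on_def)
  then show ?thesis by (simp add: vimage_def)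
qed

lemma number_superset:
  assumes "x \<in> carrier V" "finite B" "{m. a m x \<noteq> \<zero>} \<subseteq> B"
  shows "number x = (\<Oplus>m\<in>B. c m (a m x))"
  unfolding number_def
  by (rule M.add.finprod_mono_neutral_cong_left) (use assms in auto)

lemma number_closed [simp]: "x \<in> carrier V \<Longrightarrow> number x \<in> carrier V"
  unfolding number_def by (rule M.finsum_closed) auto

lemma number_linear: "qlinear V V number"
proof (rule qlinearI)
  fix x y assume xy: "x \<in> carrier V" "y \<in> carrier V"
  let ?B = "{m. a m x \<noteq> \<zero>} \<union> {m. a m y \<noteq> \<zero>}"
  have B: "finite ?B" using finite_ann xy by simp
  have sub: "{m. a m (x \<oplus> y) \<noteq> \<zero>} \<subseteq> ?B" using xy by (auto simp: qlinearD(2)[OF a])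
  have "number (x \<oplus> y) = (\<Oplus>m\<in>?B. c m (a m (x \<oplus> y)))"
    by (rule number_superset[OF _ B sub]) (use xy in simp)
  also have "\<dots> = (\<Oplus>m\<in>?B. c m (a m x) \<oplus> c m (a m y))"
    using xy by (simp add: qlinearD(2)[OF a] qlinearD(2)[OF c])
  also have "\<dots> = (\<Oplus>m\<in>?B. c m (a m x)) \<oplus> (\<Oplus>m\<in>?B. c m (a m y))"
    by (rule M.finsum_addf) (use xy in auto)
  also have "\<dots> = number x \<oplus> number y"
    using number_superset[OF xy(1) B] number_superset[OF xy(2) B] by simp
  finally show "number (x \<oplus> y) = number x \<oplus> number y" .
next
  fix q x assume x: "x \<in> carrier V"
  have sub: "{m. a m (q \<odot> x) \<noteq> \<zero>} \<subseteq> {m. a m x \<noteq> \<zero>}" using x by (auto simp: qlinearD(3)[OF a])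
  have "number (q \<odot> x) = (\<Oplus>m\<in>{m. a m x \<noteq> \<zero>}. c m (a m (q \<odot> x)))"
    by (rule number_superset[OF _ finite_ann[OF x] sub]) (use x in simp)
  also have "\<dots> = (\<Oplus>m\<in>{m. a m x \<noteq> \<zero>}. q \<odot> c m (a m x))"
    using x by (simp add: qlinearD(3)[OF a] qlinearD(3)[OF c])
  also have "\<dots> = q \<odot> number x"
    unfolding number_def
    by (rule qlinear_finsum[OF qlinear_scale[OF qspace_axioms] qspace_axioms qspace_axioms, symmetric]) (use x in simp)
  finally show "number (q \<odot> x) = q \<odot> number x" .
qed simp

text \<open>
  The relations \<open>a\<^sub>n D = (D + 1) a\<^sub>n\<close> and \<open>D c\<^sub>n = c\<^sub>n (D + 1)\<close> say that annihilation lowers and creation raises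
  the eigenvalues of \<open>D\<close> by one.
\<close>

lemma a_number:
  assumes x: "x \<in> carrier V"
  shows "a n (number x) = number (a n x) \<oplus> a n x"
proof -
  let ?B = "insert n {m. a m x \<noteq> \<zero>}"
  have B: "finite ?B" using finite_ann[OF x] by simp
  have sub: "{m. a m (a n x) \<noteq> \<zero>} \<subseteq> ?B"
  proof
    fix m assume "m \<in> {m. a m (a n x) \<noteq> \<zero>}"
    then have "a m x \<noteq> \<zero>" using a_a[OF x, of m n] by auto
    then show "m \<in> ?B" by simp
  qed
  have "a n (number x) = a n (\<Oplus>m\<in>?B. c m (a m x))" using number_superset[OF x B subset_insertI] by (rule arg_cong)
  also have "\<dots> = (\<Oplus>m\<in>?B. a n (c m (a m x)))"
    by (rule qlinear_finsum[OF a qspace_axioms qspace_axioms]) (use x in simp)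
  also have "\<dots> = (\<Oplus>m\<in>?B. (if n = m then a m x else \<zero>) \<oplus> c m (a m (a n x)))"
  proof (rule arg_cong[where f = "\<lambda>f. finsum V f ?B"], rule ext)
    fix m
    have "a n (c m (a m x)) = (if n = m then a m x else \<zero>) \<oplus> c m (a n (a m x))" using x by (simp add: a_c)
    then show "a n (c m (a m x)) = (if n = m then a m x else \<zero>) \<oplus> c m (a m (a n x))"
      by (simp only: a_a[OF x, of n m])
  qed
  also have "\<dots> = (\<Oplus>m\<in>?B. if n = m then a m x else \<zero>) \<oplus> (\<Oplus>m\<in>?B. c m (a m (a n x)))"
    by (rule M.finsum_addf) (use x in auto)
  also have "(\<Oplus>m\<in>?B. if n = m then a m x else \<zero>) = a n x"
    by (rule M.add.finprod_singleton) (use x B in auto)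
  also have "(\<Oplus>m\<in>?B. c m (a m (a n x))) = number (a n x)"
    using number_superset[OF _ B sub] x by simp
  finally show ?thesis using x by (simp add: M.a_comm)
qed

lemma number_c:
  assumes x: "x \<in> carrier V"
  shows "number (c n x) = c n (number x) \<oplus> c n x"
proof -
  let ?B = "insert n {m. a m x \<noteq> \<zero>}"
  have B: "finite ?B" using finite_ann[OF x] by simp
  have sub: "{m. a m (c n x) \<noteq> \<zero>} \<subseteq> ?B"
    using x by (auto simp: a_c split: if_splits)
  have "number (c n x) = (\<Oplus>m\<in>?B. c m (a m (c n x)))"
    by (rule number_superset[OF _ B sub]) (use x in simp)
  also have "\<dots> = (\<Oplus>m\<in>?B. (if n = m then c m x else \<zero>) \<oplus> c n (c m (a m x)))"
  proof (rule arg_cong[where f = "\<lambda>f. finsum V f ?B"], rule ext)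
    fix m
    have "c m (a m (c n x)) = c m (if m = n then x else \<zero>) \<oplus> c m (c n (a m x))"
      using x by (simp add: a_c qlinearD(2)[OF c])
    then show "c m (a m (c n x)) = (if n = m then c m x else \<zero>) \<oplus> c n (c m (a m x))"
      using x c_c[of "a m x" m n] by (cases "m = n") simp_all
  qed
  also have "\<dots> = (\<Oplus>m\<in>?B. if n = m then c m x else \<zero>) \<oplus> (\<Oplus>m\<in>?B. c n (c m (a m x)))"
    by (rule M.finsum_addf) (use x in auto)
  also have "(\<Oplus>m\<in>?B. if n = m then c m x else \<zero>) = c n x"
    by (rule M.add.finprod_singleton) (use x B in auto)
  also have "(\<Oplus>m\<in>?B. c n (c m (a m x))) = c n (\<Oplus>m\<in>?B. c m (a m x))"
    by (rule qlinear_finsum[OF c qspace_axioms qspace_axioms, symmetric]) (use x in simp)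
  also have "(\<Oplus>m\<in>?B. c m (a m x)) = number x" using number_superset[OF x B subset_insertI] by (rule sym)
  finally show ?thesis using x by (simp add: M.a_comm)
qed

lemma word_number:
  "x \<in> carrier V \<Longrightarrow> ann_word a l (number x) = number (ann_word a l x) \<oplus> of_nat (length l) \<odot> ann_word a l x"
proof (induction l arbitrary: x)
  case (Cons n l)
  have w: "ann_word a l (a n x) \<in> carrier V" using Cons.prems by simp
  have "ann_word a (n # l) (number x) = ann_word a l (number (a n x)) \<oplus> ann_word a l (a n x)"
    using Cons.prems by (simp add: a_number qlinearD(2)[OF word_linear])
  also have "ann_word a l (number (a n x)) = number (ann_word a l (a n x)) \<oplus> of_nat (length l) \<odot> ann_word a l (a n x)"
    by (rule Cons.IH) (use Cons.prems in simp)
  finally show ?case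
    using w scale_add_left[OF w, of "of_nat (length l)" 1] by (simp add: M.a_assoc add.commute)
qed simp

text \<open>
  The vectors of degree at most \<open>N\<close>.
\<close>

definition level :: "nat \<Rightarrow> 'a set" where
  "level N = {x \<in> carrier V. \<forall>l. length l > N \<longrightarrow> ann_word a l x = \<zero>}"

lemma level_closed:
  "x \<in> level N \<Longrightarrow> x \<in> carrier V" "\<lbrakk>x \<in> level N; y \<in> level N\<rbrakk> \<Longrightarrow> x \<oplus> y \<in> level N"
  "x \<in> level N \<Longrightarrow> q \<odot> x \<in> level N" "\<lbrakk>x \<in> level N; N \<le> N'\<rbrakk> \<Longrightarrow> x \<in> level N'"
  by (auto simp: level_def qlinearD(2,3)[OF word_linear])

lemma level_number: "x \<in> level N \<Longrightarrow> number x \<in> level N"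
proof -
  assume x: "x \<in> level N"
  have "number \<zero> = \<zero>" by (rule qlinear_zero[OF number_linear qspace_axioms qspace_axioms])
  then show ?thesis using x by (auto simp: level_def word_number)
qed

lemma level_zero: "x \<in> level 0 \<longleftrightarrow> x \<in> carrier V \<and> (\<forall>n. a n x = \<zero>)"
proof
  assume x: "x \<in> level 0"
  have "ann_word a [n] x = \<zero>" for n 
  proof -
    have "\<forall>l. length l > 0 \<longrightarrow> ann_word a l x = \<zero>" using x unfolding level_def by blast
    from this[rule_format, of "[n]"] show ?thesis by simp
  qed
  then have "a n x = \<zero>" for n by simp
  then show "x \<in> carrier V \<and> (\<forall>n. a n x = \<zero>)" using x by (simp add: level_def)
next
  assume x: "x \<in> carrier V \<and> (\<forall>n. a n x = \<zero>)"
  have "ann_word a l x = \<zero>" if "length l > 0" for l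
    using that x by (cases l) simp_all
  then show "x \<in> level 0" using x by (simp add: level_def)
qed

lemma level_exists: "x \<in> carrier V \<Longrightarrow> \<exists>N. x \<in> level N"
proof -
  assume x: "x \<in> carrier V"
  have "finite (length ` {l. ann_word a l x \<noteq> \<zero>})" using nilpotent[OF x] by simp
  then obtain m where m: "length ` {l. ann_word a l x \<noteq> \<zero>} \<subseteq> {..<m}" using finite_subset_lessThan by blast
  have "ann_word a l x = \<zero>" if "length l > m" for l
  proof (rule ccontr)
    assume "ann_word a l x \<noteq> \<zero>"
    then have "length l < m" using m by blast
    then show False using that by simp
  qed
  then show ?thesis using x by (auto simp: level_def)
qed

lemma number_level_zero: "x \<in> level 0 \<Longrightarrow> number x = \<zero>"
  by (simp add: level_zero number_def)

text \<open>
  The factor \<open>1 - D / k\<close>, which is zero on degree \<open>k\<close> and the identity on degree \<open>0\<close>.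
\<close>

definition cut :: "nat \<Rightarrow> 'a \<Rightarrow> 'a" where
  "cut k x = x \<oplus> (- 1 / of_nat k) \<odot> number x"

lemma cut_linear: "qlinear V V (cut k)"
  by (rule qlinearI) (simp_all add: cut_def qlinearD(2,3)[OF number_linear] scale_add_right M.add.m_ac mult.commute)

lemma cut_closed [simp]: "x \<in> carrier V \<Longrightarrow> cut k x \<in> carrier V"
  using cut_linear by (rule qlinearD(1))

lemma cut_level: "x \<in> level N \<Longrightarrow> cut k x \<in> level N"
  unfolding cut_def using level_closed(2)[OF _ level_closed(3)[OF level_number]] by simp

text \<open>
  A word of length \<open>N + 1\<close> takes \<open>x\<close> to a vacuum vector and \<open>D x\<close> to \<open>N + 1\<close> times that vector, so it
  kills \<open>x - D x / (N + 1)\<close>.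
\<close>

lemma cut_lowers: "x \<in> level (Suc N) \<Longrightarrow> cut (Suc N) x \<in> level N"
proof -
  assume x: "x \<in> level (Suc N)"
  have xc: "x \<in> carrier V" using x level_closed(1) by blast
  have "ann_word a l (cut (Suc N) x) = \<zero>" if l: "length l > N" for l
  proof (cases "length l > Suc N")
    case True
    then show ?thesis using cut_level[OF x] by (simp add: level_def)
  next
    case False
    then have len: "length l = Suc N" using l by simp
    let ?y = "ann_word a l x"
    have y: "?y \<in> carrier V" using xc by simp
    have "a n ?y = \<zero>" for n
    proof -
      have "ann_word a (l @ [n]) x = \<zero>" using x len unfolding level_def by simp
      then show ?thesis by (simp add: ann_word_append)
    qed
    then have "number ?y = \<zero>" by (simp add: number_def)
    then have "ann_word a l (cut (Suc N) x) = ?y \<oplus> (- 1 / of_nat (Suc N)) \<odot> (of_nat (Suc N) \<odot> ?y)"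
      using xc y unfolding cut_def
      by (simp add: qlinearD(2,3)[OF word_linear] word_number len del: scale_scale of_nat_Suc)
    also have "\<dots> = ?y \<oplus> (- 1) \<odot> ?y" using y by (simp del: of_nat_Suc add_minus_one)
    finally show ?thesis using y by simp
  qed
  then show ?thesis using xc by (simp add: level_def)
qed

text \<open>
  The product of the factors \<open>1 - D / j\<close> for \<open>1 \<le> j \<le> k\<close>.
\<close>

primrec vacuum_part :: "nat \<Rightarrow> 'a \<Rightarrow> 'a" where
  "vacuum_part 0 x = x"
| "vacuum_part (Suc k) x = vacuum_part k (cut (Suc k) x)"

lemma vacuum_part_linear: "qlinear V V (vacuum_part k)"
proof (induction k)
  case (Suc k)
  then show ?case using qlinear_comp[OF cut_linear Suc] by simp
qed (simp add: qlinear_def)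

lemma vacuum_part_level: "x \<in> level k \<Longrightarrow> vacuum_part k x \<in> level 0"
  by (induction k arbitrary: x) (simp_all add: cut_lowers)

lemma vacuum_part_number: "x \<in> carrier V \<Longrightarrow> vacuum_part k (number x) = number (vacuum_part k x)"
proof (induction k arbitrary: x)
  case (Suc k)
  have "cut (Suc k) (number x) = number (cut (Suc k) x)"
    using Suc.prems unfolding cut_def by (simp add: qlinearD(2,3)[OF number_linear])
  then show ?case using Suc by simp
qed simp

text \<open>
  The first \<open>N\<close> factors already reach the vacuum vectors, on which the other factors are the identity.
\<close>

lemma vacuum_part_stable: "\<lbrakk>x \<in> level N; N \<le> k\<rbrakk> \<Longrightarrow> vacuum_part k x = vacuum_part N x"
proof (induction "k - N" arbitrary: k)
  case (Suc d)
  then obtain k' where k: "k = Suc k'" "N \<le> k'" by (cases k) auto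
  have xc: "x \<in> carrier V" using Suc.prems(1) level_closed(1) by blast
  let ?y = "vacuum_part k' x"
  have xk: "x \<in> level k'" using level_closed(4)[OF Suc.prems(1) k(2)] .
  have y: "?y \<in> level 0" by (rule vacuum_part_level[OF xk])
  have "vacuum_part k x = ?y \<oplus> (- 1 / of_nat (Suc k')) \<odot> number ?y"
    using xc unfolding k(1) vacuum_part.simps cut_def
    by (simp add: qlinearD(2,3)[OF vacuum_part_linear] vacuum_part_number del: of_nat_Suc)
  then have "vacuum_part k x = ?y" using y level_closed(1)[OF y] by (simp add: number_level_zero)
  moreover have "d = k' - N" using Suc.hyps(2) k by simp
  ultimately show ?case using Suc.hyps(1)[of k'] Suc.prems(1) k(2) by simp
qed simp

definition proj :: "'a \<Rightarrow> 'a" where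
  "proj x = vacuum_part (LEAST N. x \<in> level N) x"

lemma proj_eq: "x \<in> level N \<Longrightarrow> proj x = vacuum_part N x"
  unfolding proj_def by (rule vacuum_part_stable[symmetric]) (auto intro: LeastI Least_le)

lemma proj_vac: "x \<in> level 0 \<Longrightarrow> proj x = x"
  using proj_eq[of x 0] by simp

lemma proj_level: "x \<in> carrier V \<Longrightarrow> proj x \<in> level 0"
  using level_exists[of x] proj_eq vacuum_part_level by metis

lemma proj_linear: "qlinear V V proj"
proof (rule qlinearI)
  fix x y assume xy: "x \<in> carrier V" "y \<in> carrier V"
  obtain N where N: "x \<in> level N" using level_exists xy by blast
  obtain N' where N': "y \<in> level N'" using level_exists xy by blast
  let ?m = "max N N'"
  have m: "x \<in> level ?m" "y \<in> level ?m" using level_closed(4)[OF N] level_closed(4)[OF N'] by simp_all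
  show "proj (x \<oplus> y) = proj x \<oplus> proj y"
    using proj_eq[OF m(1)] proj_eq[OF m(2)] proj_eq[OF level_closed(2)[OF m]] xy
    by (simp add: qlinearD(2)[OF vacuum_part_linear])
next
  fix q x assume x: "x \<in> carrier V"
  obtain N where N: "x \<in> level N" using level_exists x by blast
  show "proj (q \<odot> x) = q \<odot> proj x"
    using proj_eq[OF N] proj_eq[OF level_closed(3)[OF N]] x by (simp add: qlinearD(3)[OF vacuum_part_linear])
qed (use proj_level level_closed(1) in blast)

lemma c_level: "x \<in> level k \<Longrightarrow> c n x \<in> level (Suc k)"
proof -
  assume x: "x \<in> level k"
  have "ann_word a l (c n y) = \<zero>"
    if "y \<in> carrier V" "length l > Suc k" "\<And>p. length p > k \<Longrightarrow> ann_word a p y = \<zero>" for l y k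
    using that
  proof (induction l arbitrary: y k)
    case (Cons j l)
    have split: "ann_word a (j # l) (c n y) = ann_word a l (if j = n then y else \<zero>) \<oplus> ann_word a l (c n (a j y))"
      using Cons.prems(1) by (simp add: a_c qlinearD(2)[OF word_linear])
    have "ann_word a l (if j = n then y else \<zero>) = \<zero>" using Cons.prems(2,3) by simp
    moreover have "ann_word a l (c n (a j y)) = \<zero>"
    proof (cases k)
      case 0
      have "a j y = \<zero>" using Cons.prems(3)[of "[j]"] 0 by simp
      then show ?thesis by simp
    next
      case (Suc k')
      show ?thesis
      proof (rule Cons.IH[where k = k'])
        show "ann_word a p (a j y) = \<zero>" if "length p > k'" for p
          using Cons.prems(3)[of "j # p"] that Suc by simp
      qed (use Cons.prems Suc in simp_all)
    qed
    ultimately show ?case unfolding split by simp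
  qed simp
  then show ?thesis using x by (simp add: level_def)
qed

text \<open>
  From \<open>D c\<^sub>n = c\<^sub>n (D + 1)\<close> follows \<open>(1 - D / (k + 1)) c\<^sub>n = k / (k + 1) c\<^sub>n (1 - D / k)\<close>. Thus moving \<open>c\<^sub>n\<close> to
  the left lowers the index of each factor by one, and the factor with index \<open>1\<close> becomes zero once it
  meets a vacuum vector.
\<close>

lemma proj_c: "x \<in> carrier V \<Longrightarrow> proj (c n x) = \<zero>"
proof -
  have step: "cut (Suc k) (c n x) = (of_nat k / of_nat (Suc k)) \<odot> c n (cut k x)"
    if x: "x \<in> carrier V" "k > 0" for k x
  proof -
    let ?q = "- 1 / of_nat (Suc k) :: rat"
    have "cut (Suc k) (c n x) = (c n x \<oplus> ?q \<odot> c n x) \<oplus> ?q \<odot> c n (number x)"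
      using x(1) unfolding cut_def by (simp add: number_c scale_add_right M.add.m_ac del: of_nat_Suc)
    also have "c n x \<oplus> ?q \<odot> c n x = (1 + ?q) \<odot> c n x"
      using x(1) scale_add_left[of "c n x" 1 ?q] by simp
    also have "1 + ?q = of_nat k / of_nat (Suc k)" by (simp add: field_simps)
    also have "?q \<odot> c n (number x) = (of_nat k / of_nat (Suc k)) \<odot> ((- 1 / of_nat k) \<odot> c n (number x))"
      using x by (simp del: of_nat_Suc)
    also have "(of_nat k / of_nat (Suc k)) \<odot> c n x \<oplus> (of_nat k / of_nat (Suc k)) \<odot> ((- 1 / of_nat k) \<odot> c n (number x))
       = (of_nat k / of_nat (Suc k)) \<odot> c n (cut k x)"
      using x(1) unfolding cut_def by (simp add: qlinearD(2,3)[OF c] scale_add_right del: of_nat_Suc)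
    finally show ?thesis .
  qed
  have main: "vacuum_part (Suc k) (c n x) = \<zero>" if "x \<in> level k" for k x
    using that
  proof (induction k arbitrary: x)
    case 0
    have xc: "x \<in> carrier V" using 0 level_closed(1) by blast
    have "cut (Suc 0) (c n x) = \<zero>"
      using xc by (simp add: cut_def number_c number_level_zero[OF 0])
    then show ?case by simp
  next
    case (Suc k)
    have xc: "x \<in> carrier V" using Suc.prems level_closed(1) by blast
    have "vacuum_part (Suc (Suc k)) (c n x) = (of_nat (Suc k) / of_nat (Suc (Suc k))) \<odot> vacuum_part (Suc k) (c n (cut (Suc k) x))"
      using xc step[OF xc, of "Suc k"] qlinearD(3)[OF vacuum_part_linear, of "c n (cut (Suc k) x)"]
      by (simp del: of_nat_Suc vacuum_part.simps add: vacuum_part.simps(2)[of "Suc k"])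
    then show ?case using Suc.IH[OF cut_lowers[OF Suc.prems]] by simp
  qed
  assume "x \<in> carrier V"
  then obtain N where N: "x \<in> level N" using level_exists by blast
  show ?thesis using proj_eq[OF c_level[OF N]] main[OF N] by simp
qed

lemma ladder_proj: "ladder V a proj 1 c"
proof (intro ladder.intro annihilation.intro annihilation_axioms.intro statistics.intro statistics_axioms.intro
    ladder_axioms.intro qspace_axioms a c proj_linear nilpotent proj_c)
  show "a n (proj x) = \<zero>" if "x \<in> carrier V" for n x
    using proj_level[OF that] by (simp add: level_zero)
  show "proj x = x" if "x \<in> carrier V" "\<And>n. a n x = \<zero>" for x
    by (rule proj_vac) (use that in \<open>simp add: level_zero\<close>)
qed (simp_all add: a_a[symmetric] a_c)

end

text \<open>
  The projection is built from the annihilation and creation operators, so it commutes with every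
  linear map that commutes with these.
\<close>

lemma proj_natural:
  assumes "oscillator V a c" "oscillator V' a' c'" and f: "qlinear V V' f"
    and fa: "\<And>x n. x \<in> carrier V \<Longrightarrow> f (a n x) = a' n (f x)" and fc: "\<And>x n. x \<in> carrier V \<Longrightarrow> f (c n x) = c' n (f x)"
    and x: "x \<in> carrier V"
  shows "f (oscillator.proj V a c x) = oscillator.proj V' a' c' (f x)"
proof -
  interpret V: oscillator V a c by fact
  interpret V': oscillator V' a' c' by fact
  note fin = qlinearD(1)[OF f] and f0 = qlinear_zero[OF f V.qspace_axioms V'.qspace_axioms]
  have num: "f (V.number x) = V'.number (f x)" if x: "x \<in> carrier V" for x
  proof -
    let ?B = "{m. a m x \<noteq> \<zero>\<^bsub>V\<^esub>}"
    have "a' m (f x) = \<zero>\<^bsub>V'\<^esub>" if "a m x = \<zero>\<^bsub>V\<^esub>" for m using fa[OF x, of m] f0 that by simp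
    then have sub: "{m. a' m (f x) \<noteq> \<zero>\<^bsub>V'\<^esub>} \<subseteq> ?B" by blast
    have "f (V.number x) = (\<Oplus>\<^bsub>V'\<^esub>m\<in>?B. f (c m (a m x)))"
      unfolding V.number_def by (rule qlinear_finsum[OF f V.qspace_axioms V'.qspace_axioms]) (use x in simp)
    also have "\<dots> = (\<Oplus>\<^bsub>V'\<^esub>m\<in>?B. c' m (a' m (f x)))" using x by (simp add: fa fc)
    also have "\<dots> = V'.number (f x)"
      by (rule V'.number_superset[OF fin[OF x] V.finite_ann[OF x] sub, symmetric])
    finally show ?thesis .
  qed
  have cut: "f (V.cut k x) = V'.cut k (f x)" if x: "x \<in> carrier V" for x k
    using x by (simp add: V.cut_def V'.cut_def qlinearD(2,3)[OF f] num)
  have part: "f (V.vacuum_part k x) = V'.vacuum_part k (f x)" if x: "x \<in> carrier V" for x k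
    using x by (induction k arbitrary: x) (simp_all add: cut)
  obtain N where N: "x \<in> V.level N" using V.level_exists[OF x] by blast
  have word: "f (ann_word a l x) = ann_word a' l (f x)" if "x \<in> carrier V" for l x
    using that by (induction l arbitrary: x) (simp_all add: fa)
  have "f x \<in> V'.level N"
    unfolding V'.level_def
  proof (intro CollectI conjI allI impI)
    fix l :: "nat list" assume "length l > N"
    then have "ann_word a l x = \<zero>\<^bsub>V\<^esub>" using N by (simp add: V.level_def)
    then show "ann_word a' l (f x) = \<zero>\<^bsub>V'\<^esub>" using word[OF x, of l] f0 by simp
  qed (use fin x in simp)
  then show ?thesis using V.proj_eq[OF N] V'.proj_eq part[OF x] by simp
qed

section \<open>The Heisenberg algebra\<close>

lemma heisenberg_presentation: "presentation heisenberg"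
  unfolding presentation_def
  by (unfold heisenberg_def fst_conv snd_conv, safe,
      (intro free_algebra_closed gen_in_free_algebra scalar_in_free_algebra; simp)+)

text \<open>
  In the conventional normalization \<open>[H\<^bsub>-k\<^esub>, H\<^sub>k] = - k\<close>, so the operator with commutator \<open>1\<close> is
  \<open>- H\<^sub>k / k\<close>. Letters are numbered from \<open>0\<close>.
\<close>

definition heisenberg_op :: "(rat, 'a) module \<Rightarrow> heis_gen \<Rightarrow> (nat list \<Rightarrow> 'a) \<Rightarrow> (nat list \<Rightarrow> 'a)" where
  "heisenberg_op V s = (case s of Hgen k \<Rightarrow>
     if k < 0 then ann (nat (- k) - 1) else (\<lambda>h l. (- of_int k) \<odot>\<^bsub>V\<^esub> cre 1 V (nat k - 1) h l))"

definition heisenberg_ann :: "(heis_gen ncpoly set, 'a) module \<Rightarrow> nat \<Rightarrow> 'a \<Rightarrow> 'a" where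
  "heisenberg_ann M n = act heisenberg M (Hgen (- int (Suc n)))"

definition heisenberg_cre :: "(heis_gen ncpoly set, 'a) module \<Rightarrow> nat \<Rightarrow> 'a \<Rightarrow> 'a" where
  "heisenberg_cre M n x =
     (- 1 / of_nat (Suc n)) \<odot>\<^bsub>underlying heisenberg M\<^esub> act heisenberg M (Hgen (int (Suc n))) x"

lemma heisenberg_gens: "Hgen i \<in> fst heisenberg \<longleftrightarrow> i \<noteq> 0"
  by (auto simp: heisenberg_def)

lemma heisenberg_op_simps:
  "heisenberg_op V (Hgen (- int (Suc n))) h = ann n h"
  "heisenberg_op V (Hgen (int (Suc n))) h = (\<lambda>l. (- of_nat (Suc n)) \<odot>\<^bsub>V\<^esub> cre 1 V n h l)"
  by (simp_all add: heisenberg_op_def del: of_nat_Suc)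

lemma nonzero_int_cases:
  fixes i :: int
  assumes "i \<noteq> 0"
  obtains n where "i = - int (Suc n)" | n where "i = int (Suc n)"
  using assms by (metis int_cases nat.exhaust neg_eq_iff_add_eq_0 of_nat_0 int_cases2)

lemma (in qspace) cancel_pairs:
  assumes "y \<in> carrier V" "z \<in> carrier V"
  shows "((q \<odot> y \<oplus> q \<odot> z) \<oplus> (- q) \<odot> z) \<oplus> (- q) \<odot> y = \<zero>"
    "(q \<odot> z \<oplus> (- q) \<odot> z) = \<zero>"
    "(q \<odot> z \<oplus> ((- q) \<odot> y \<oplus> (- q) \<odot> z)) \<oplus> q \<odot> y = \<zero>"
proof -
  have z: "q \<odot> x \<oplus> (- q) \<odot> x = \<zero>" if "x \<in> carrier V" for x q
    using scale_add_left[OF that, of q "- q"] that by simp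
  then show "(q \<odot> z \<oplus> (- q) \<odot> z) = \<zero>" using assms(2) .
  have "((q \<odot> y \<oplus> q \<odot> z) \<oplus> (- q) \<odot> z) \<oplus> (- q) \<odot> y = (q \<odot> y \<oplus> (q \<odot> z \<oplus> (- q) \<odot> z)) \<oplus> (- q) \<odot> y"
    using assms by (simp only: M.a_assoc scale_closed M.add.m_closed)
  then show "((q \<odot> y \<oplus> q \<odot> z) \<oplus> (- q) \<odot> z) \<oplus> (- q) \<odot> y = \<zero>" using assms z by simp
  have "(q \<odot> z \<oplus> ((- q) \<odot> y \<oplus> (- q) \<odot> z)) \<oplus> q \<odot> y = (q \<odot> z \<oplus> (- q) \<odot> z) \<oplus> (q \<odot> y \<oplus> (- q) \<odot> y)"
    using assms by (simp only: M.add.m_ac scale_closed M.add.m_closed)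
  then show "(q \<odot> z \<oplus> ((- q) \<odot> y \<oplus> (- q) \<odot> z)) \<oplus> q \<odot> y = \<zero>" using assms z by simp
qed

lemma fock_model_heisenberg: "fock_model heisenberg (twisted 1) heisenberg_op"
proof (intro fock_model.intro fock_model_axioms.intro heisenberg_presentation twisted_vac twisted_trunc)
  fix V V' :: "(rat, 'a) module" and f and h :: "nat list \<Rightarrow> 'a"
  assume V: "qspace V" and V': "qspace V'" and f: "qlinear V V' f" and h: "h \<in> finite_support V" "twisted 1 V h"
  show "twisted 1 V' (\<lambda>l. f (h l))" by (rule twisted_natural[OF f h])
  have hc: "\<forall>l. h l \<in> carrier V" using finite_supportD(1)[OF h(1)] by blast
  show "heisenberg_op V' s (\<lambda>l. f (h l)) = (\<lambda>l. f (heisenberg_op V s h l))" for s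
    using cre_natural[OF V V' f hc]
    by (cases s) (simp add: heisenberg_op_def fun_eq_iff ann_def qlinearD(3)[OF f])
next
  fix V :: "(rat, 'a) module" assume V: "qspace V"
  interpret V: statistics V 1 by (intro statistics.intro V statistics_axioms.intro) simp
  interpret operators heisenberg "fock (twisted 1) V" "heisenberg_op V"
  proof (intro operators.intro heisenberg_presentation V.twisted_fock operators_axioms.intro)
    fix s
    have "qlinear (fock (twisted 1) V) (fock (twisted 1) V) (\<lambda>h. q \<odot>\<^bsub>fock (twisted 1) V\<^esub> cre 1 V n h)" for q n
      by (rule qlinear_comp[OF V.qlinear_fock(2) qlinear_scale[OF V.twisted_fock]])
    then show "qlinear (fock (twisted 1) V) (fock (twisted 1) V) (heisenberg_op V s)"
      by (cases s) (simp add: heisenberg_op_def V.qlinear_fock(1))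
  qed
  show "representation heisenberg (fock (twisted 1) V) (heisenberg_op V)"
  proof (intro representation.intro operators_axioms representation_axioms.intro)
    fix r h assume r: "r \<in> snd heisenberg" and h: "h \<in> carrier (fock (twisted 1) V)"
    then have hs: "h \<in> finite_support V" and tw: "twisted 1 V h" by simp_all
    have hc: "\<forall>l. h l \<in> carrier V" using finite_supportD(1)[OF hs] by blast
    note hn = ann_closed[OF hc]
    have c1: "\<forall>l. cre 1 V n h l \<in> carrier V" for n using V.cre_closed[OF hc] by blast
    have c: "cre 1 V i (cre 1 V j h) l \<in> carrier V" "cre 1 V i (ann j h) l \<in> carrier V"
      "ann i (ann j h) l \<in> carrier V" "h l \<in> carrier V" for i j l
      using V.cre_closed[OF c1] V.cre_closed[OF hn] ann_closed[OF hn] hc by auto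
    obtain i j where ij: "i \<noteq> 0" "j \<noteq> 0" and r': "r = gen (Hgen i) * gen (Hgen j) - gen (Hgen j) * gen (Hgen i)
        - scalar (if i = - j then of_int i else 0)"
      using r by (auto simp: heisenberg_def)
    have F: "gen (Hgen i) * gen (Hgen j) \<in> carrier F" if "i \<noteq> 0" "j \<noteq> 0" for i j
      using that by (intro free_algebra_closed gen_in_free_algebra) (simp_all add: heisenberg_gens)
    have gg: "ev (gen (Hgen i) * gen (Hgen j)) h = heisenberg_op V (Hgen i) (heisenberg_op V (Hgen j) h)" if "i \<noteq> 0" "j \<noteq> 0" for i j
      by (rule ev_gen_gen) (use h that in \<open>simp_all add: heisenberg_gens\<close>)
    have ev: "ev r h = (\<lambda>l. (heisenberg_op V (Hgen i) (heisenberg_op V (Hgen j) h) l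
        \<oplus>\<^bsub>V\<^esub> (- 1) \<odot>\<^bsub>V\<^esub> heisenberg_op V (Hgen j) (heisenberg_op V (Hgen i) h) l)
        \<oplus>\<^bsub>V\<^esub> (- 1) \<odot>\<^bsub>V\<^esub> ((if i = - j then of_int i else 0) \<odot>\<^bsub>V\<^esub> h l))"
      unfolding r' ev_diff[OF free_algebra_closed(2)[OF F[OF ij] F[OF ij(2,1)]] scalar_in_free_algebra h]
        ev_diff[OF F[OF ij] F[OF ij(2,1)] h] gg[OF ij] gg[OF ij(2,1)] ev_scalar[OF h] by simp
    have "ev r h l = \<zero>\<^bsub>V\<^esub>" for l
    proof (rule nonzero_int_cases[OF ij(1)]; rule nonzero_int_cases[OF ij(2)])
      fix n m assume i: "i = - int (Suc n)" and j: "j = - int (Suc m)"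
      have "ann n (ann m h) l = ann m (ann n h) l"
        using fun_cong[OF ann_ann[OF tw, of n m], of l] c by simp
      then show ?thesis using c hc by (simp add: ev i j heisenberg_op_simps del: of_nat_Suc)
    next
      fix n m assume i: "i = int (Suc n)" and j: "j = int (Suc m)"
      have "cre 1 V n (cre 1 V m h) l = cre 1 V m (cre 1 V n h) l"
        using V.cre_cre[OF hc, of n m l] c by simp
      then show ?thesis
        using c hc V.cancel_pairs(2)[of "cre 1 V m (cre 1 V n h) l"]
        by (simp add: ev i j heisenberg_op_simps V.cre_smult[OF c1] mult.commute del: of_nat_Suc)
    next
      fix n m assume i: "i = - int (Suc n)" and j: "j = int (Suc m)"
      have 1: "ann n (\<lambda>l. (- of_nat (Suc m)) \<odot>\<^bsub>V\<^esub> cre 1 V m h l) l =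
          (- of_nat (Suc m)) \<odot>\<^bsub>V\<^esub> ((if n = m then h l else \<zero>\<^bsub>V\<^esub>) \<oplus>\<^bsub>V\<^esub> cre 1 V m (ann n h) l)"
        using fun_cong[OF V.ann_cre[of n m h], of l] c by (simp add: ann_linear(2) del: of_nat_Suc)
      show ?thesis
        using c hc V.cancel_pairs(1)[of "h l" "cre 1 V m (ann n h) l" "- of_nat (Suc m)"]
          V.cancel_pairs(2)[of "h l" "cre 1 V m (ann n h) l" "- of_nat (Suc m)"] 1
        by (cases "n = m") (simp_all add: ev i j heisenberg_op_simps V.scale_add_right del: of_nat_Suc)
    next
      fix n m assume i: "i = int (Suc n)" and j: "j = - int (Suc m)"
      have 1: "ann m (\<lambda>l. (- of_nat (Suc n)) \<odot>\<^bsub>V\<^esub> cre 1 V n h l) l =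
          (- of_nat (Suc n)) \<odot>\<^bsub>V\<^esub> ((if m = n then h l else \<zero>\<^bsub>V\<^esub>) \<oplus>\<^bsub>V\<^esub> cre 1 V n (ann m h) l)"
        using fun_cong[OF V.ann_cre[of m n h], of l] c by (simp add: ann_linear(2) del: of_nat_Suc)
      show ?thesis
        using c hc V.cancel_pairs(3)[of "h l" "cre 1 V n (ann m h) l" "- of_nat (Suc n)"]
          V.cancel_pairs(2)[of "h l" "cre 1 V n (ann m h) l" "- of_nat (Suc n)"] 1
        by (cases "m = n") (simp_all add: ev i j heisenberg_op_simps V.scale_add_right del: of_nat_Suc)
    qed
    then show "ev r h = \<zero>\<^bsub>fock (twisted 1) V\<^esub>" by (simp add: fun_eq_iff)
  qed
qed

locale heisenberg_module = presented_module heisenberg M for M :: "(heis_gen ncpoly set, 'a) module"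
begin

sublocale U: qspace "underlying heisenberg M" by (rule qspace_underlying)

abbreviation "H \<equiv> \<lambda>i. act heisenberg M (Hgen i)"

lemma H_closed [simp]: "\<lbrakk>i \<noteq> 0; x \<in> carrier M\<rbrakk> \<Longrightarrow> H i x \<in> carrier M"
  by (simp add: act_closed heisenberg_gens)

lemma H_linear: "i \<noteq> 0 \<Longrightarrow> qlinear (underlying heisenberg M) (underlying heisenberg M) (H i)"
  by (rule qlinear_act) (simp add: heisenberg_gens)

lemma commutator:
  assumes x: "x \<in> carrier M" and ij: "i \<noteq> 0" "j \<noteq> 0"
  shows "H i (H j x) = H j (H i x) \<oplus>\<^bsub>M\<^esub> (if i = - j then of_int i else 0) \<odot>\<^bsub>underlying heisenberg M\<^esub> x"
proof -
  let ?p = "gen (Hgen i) * gen (Hgen j)" and ?q = "gen (Hgen j) * gen (Hgen i)"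
  let ?d = "if i = - j then of_int i else 0 :: rat"
  have F: "?p \<in> carrier F" "?q \<in> carrier F"
    using ij by (auto intro!: free_algebra_closed gen_in_free_algebra simp: heisenberg_gens)
  have r: "?p - ?q - scalar ?d \<in> snd heisenberg" using ij unfolding heisenberg_def snd_conv by blast
  have gg: "rc ?p \<odot>\<^bsub>M\<^esub> x = H i (H j x)" "rc ?q \<odot>\<^bsub>M\<^esub> x = H j (H i x)"
    using ij x by (auto intro!: gen_gen_action simp: heisenberg_gens)
  let ?U = "underlying heisenberg M"
  have "rc (?p - ?q) \<odot>\<^bsub>M\<^esub> x \<oplus>\<^bsub>?U\<^esub> (- 1) \<odot>\<^bsub>?U\<^esub> (?d \<odot>\<^bsub>?U\<^esub> x) = \<zero>\<^bsub>?U\<^esub>"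
    using relator_action[OF r x] diff_action[OF x free_algebra_closed(2)[OF F] scalar_in_free_algebra, of ?d] by simp
  then have "rc (?p - ?q) \<odot>\<^bsub>M\<^esub> x = ?d \<odot>\<^bsub>?U\<^esub> x"
    using U.diff_eq_zero_iff[of "rc (?p - ?q) \<odot>\<^bsub>M\<^esub> x" "?d \<odot>\<^bsub>?U\<^esub> x"] U.scale_closed[of x ?d] x
      rc_action(1)[OF x free_algebra_closed(2)[OF F]] by simp
  then have eq: "H i (H j x) \<oplus>\<^bsub>?U\<^esub> (- 1) \<odot>\<^bsub>?U\<^esub> H j (H i x) = ?d \<odot>\<^bsub>?U\<^esub> x"
    using diff_action[OF x F] gg by simp
  have c: "H i (H j x) \<in> carrier ?U" "H j (H i x) \<in> carrier ?U" using ij x by simp_all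
  have "H j (H i x) \<oplus>\<^bsub>?U\<^esub> ?d \<odot>\<^bsub>?U\<^esub> x = (H j (H i x) \<oplus>\<^bsub>?U\<^esub> (- 1) \<odot>\<^bsub>?U\<^esub> H j (H i x)) \<oplus>\<^bsub>?U\<^esub> H i (H j x)"
    unfolding eq[symmetric] using c by (simp only: U.M.add.m_ac U.scale_closed U.M.add.m_closed)
  also have "\<dots> = H i (H j x)" using c by (simp only: U.add_minus_one U.M.l_zero)
  finally show ?thesis by simp
qed

lemma ann_commute: "x \<in> carrier M \<Longrightarrow> heisenberg_ann M i (heisenberg_ann M j x) = heisenberg_ann M j (heisenberg_ann M i x)"
  using commutator[of x "- int (Suc i)" "- int (Suc j)"] U.scale_zero_left[of x] U.M.r_zero
    H_closed[of "- int (Suc j)" "H (- int (Suc i)) x"] H_closed[of "- int (Suc i)" x]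
  by (simp add: heisenberg_ann_def del: of_nat_Suc)

lemma ann_closed_M [simp]: "x \<in> carrier M \<Longrightarrow> heisenberg_ann M n x \<in> carrier M"
  by (simp add: heisenberg_ann_def del: of_nat_Suc)

lemma word_closed_M [simp]: "x \<in> carrier M \<Longrightarrow> ann_word (heisenberg_ann M) l x \<in> carrier M"
  by (induction l arbitrary: x) simp_all

lemma word_commute:
  "x \<in> carrier M \<Longrightarrow> heisenberg_ann M n (ann_word (heisenberg_ann M) l x) = ann_word (heisenberg_ann M) l (heisenberg_ann M n x)"
  by (induction l arbitrary: x) (simp_all add: ann_commute[of _ n])

lemma word_permute:
  "\<lbrakk>mset l = mset l'; x \<in> carrier M\<rbrakk> \<Longrightarrow> ann_word (heisenberg_ann M) l x = ann_word (heisenberg_ann M) l' x"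
proof (induction l arbitrary: l' x)
  case (Cons n k)
  have "n \<in> set l'" using Cons.prems(1) by (metis list.set_intros(1) set_mset_mset)
  then obtain p q where l': "l' = p @ n # q" by (meson split_list)
  then have "mset k = mset (p @ q)" using Cons.prems(1) by simp
  then have "ann_word (heisenberg_ann M) k (heisenberg_ann M n x) = ann_word (heisenberg_ann M) (p @ q) (heisenberg_ann M n x)"
    using Cons.IH Cons.prems(2) by simp
  then show ?case using Cons.prems(2) by (simp add: l' ann_word_append word_commute)
qed simp

end

text \<open>
  The letters of the monomial \<open>H_minus n\<close> in the order in which they act: the product is taken in
  increasing order of the index, and its last factor acts first.
\<close>

definition partition_word :: "(nat \<Rightarrow> nat) \<Rightarrow> nat list" where
  "partition_word n = rev (concat (map (\<lambda>i. replicate (n i) (i - 1)) (sorted_list_of_set {i. n i \<noteq> 0})))"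

lemma sum_partition_word:
  assumes "n \<in> finite_sequences"
  shows "sum_list (map Suc (partition_word n)) = weight n"
proof -
  have fin: "finite {i. n i \<noteq> 0}" and n0: "n 0 = 0" using assms by (auto simp: finite_sequences_def)
  have "sum_list (map Suc (concat (map (\<lambda>i. replicate (n i) (i - 1)) is))) = sum_list (map (\<lambda>i. i * n i) is)"
    if "0 \<notin> set is" for "is"
    using that by (induction "is") (auto simp: map_replicate_const sum_list_replicate)
  moreover have "0 \<notin> set (sorted_list_of_set {i. n i \<noteq> 0})" using fin n0 by simp
  ultimately have "sum_list (map Suc (partition_word n)) = sum_list (map (\<lambda>i. i * n i) (sorted_list_of_set {i. n i \<noteq> 0}))"
    by (simp add: partition_word_def rev_map[symmetric] sum_list_rev)
  then show ?thesis using fin by (simp add: weight_def sum_list_distinct_conv_sum_set)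
qed

text \<open>
  Admissibility speaks of ordered monomials only; up to a permutation of letters they are all words.
\<close>

lemma partition_word_exists: "\<exists>n\<in>finite_sequences. mset (partition_word n) = mset l"
proof -
  define n where "n i = (if i = 0 then 0 else count (mset l) (i - 1))" for i
  have "{i. n i \<noteq> 0} \<subseteq> Suc ` set l"
    by (auto simp: n_def split: if_splits) (metis Suc_pred count_eq_zero_iff imageI set_mset_mset)
  then have fin: "finite {i. n i \<noteq> 0}" by (rule finite_subset) simp
  then have nf: "n \<in> finite_sequences" by (simp add: finite_sequences_def n_def)
  have "count (mset (concat (map (\<lambda>i. replicate (n i) (i - 1)) is))) k = (if Suc k \<in> set is then n (Suc k) else 0)"
    if "0 \<notin> set is" "distinct is" for "is" k
    using that
  proof (induction "is")
    case (Cons i "is")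
    then obtain i' where "i = Suc i'" by (cases i) auto
    then show ?case using Cons by (auto simp: n_def)
  qed simp
  moreover have "0 \<notin> set (sorted_list_of_set {i. n i \<noteq> 0})" using fin by (simp add: n_def)
  ultimately have "count (mset (partition_word n)) k = count (mset l) k" for k
    using fin by (simp add: partition_word_def) (auto simp: n_def)
  then show ?thesis using nf by (intro bexI[of _ n] multiset_eqI) auto
qed

context heisenberg_module
begin

lemma H_minus_action:
  assumes "n \<in> finite_sequences" "x \<in> carrier M"
  shows "H_minus n \<odot>\<^bsub>M\<^esub> x = ann_word (heisenberg_ann M) (partition_word n) x"
proof -
  have pow: "(rc (gen (Hgen (- int (Suc m)))) [^]\<^bsub>A\<^esub> k) \<odot>\<^bsub>M\<^esub> y = ann_word (heisenberg_ann M) (replicate k m) y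
      \<and> rc (gen (Hgen (- int (Suc m)))) [^]\<^bsub>A\<^esub> k \<in> carrier A"
    if "y \<in> carrier M" for m k y
    using that
  proof (induction k arbitrary: y)
    case 0
    then show ?case by (simp add: smult_one)
  next
    case (Suc k)
    have g: "rc (gen (Hgen (- int (Suc m)))) \<in> carrier A"
      by (intro rc_closed gen_in_free_algebra) (simp add: heisenberg_gens del: of_nat_Suc)
    have "rc (gen (Hgen (- int (Suc m)))) \<odot>\<^bsub>M\<^esub> y = heisenberg_ann M m y"
      by (simp add: heisenberg_ann_def act_def)
    then show ?case using Suc.IH[of "heisenberg_ann M m y"] Suc.prems g by (simp add: smult_assoc1 del: of_nat_Suc)
  qed
  have "foldr (\<lambda>i a. rc (gen (Hgen (- int i))) [^]\<^bsub>A\<^esub> n i \<otimes>\<^bsub>A\<^esub> a) is \<one>\<^bsub>A\<^esub> \<odot>\<^bsub>M\<^esub> x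
      = ann_word (heisenberg_ann M) (rev (concat (map (\<lambda>i. replicate (n i) (i - 1)) is))) x
      \<and> foldr (\<lambda>i a. rc (gen (Hgen (- int i))) [^]\<^bsub>A\<^esub> n i \<otimes>\<^bsub>A\<^esub> a) is \<one>\<^bsub>A\<^esub> \<in> carrier A"
    if "0 \<notin> set is" for "is"
    using that
  proof (induction "is")
    case Nil
    then show ?case using assms(2) by (simp add: smult_one)
  next
    case (Cons i "is")
    then obtain m where i: "i = Suc m" by (cases i) auto
    let ?a = "foldr (\<lambda>i a. rc (gen (Hgen (- int i))) [^]\<^bsub>A\<^esub> n i \<otimes>\<^bsub>A\<^esub> a) is \<one>\<^bsub>A\<^esub>"
    let ?w = "rev (concat (map (\<lambda>i. replicate (n i) (i - 1)) is))"
    have IH: "?a \<odot>\<^bsub>M\<^esub> x = ann_word (heisenberg_ann M) ?w x" "?a \<in> carrier A" using Cons by simp_all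
    have p: "rc (gen (Hgen (- int (Suc m)))) [^]\<^bsub>A\<^esub> n i \<in> carrier A" using pow[OF assms(2)] by blast
    have "(rc (gen (Hgen (- int i))) [^]\<^bsub>A\<^esub> n i \<otimes>\<^bsub>A\<^esub> ?a) \<odot>\<^bsub>M\<^esub> x
        = rc (gen (Hgen (- int (Suc m)))) [^]\<^bsub>A\<^esub> n i \<odot>\<^bsub>M\<^esub> ann_word (heisenberg_ann M) ?w x"
      using smult_assoc1[OF p IH(2) assms(2)] IH(1) by (simp add: i del: of_nat_Suc)
    also have "\<dots> = ann_word (heisenberg_ann M) (replicate (n i) m) (ann_word (heisenberg_ann M) ?w x)"
      using pow[OF word_closed_M[OF assms(2)]] by blast
    also have "\<dots> = ann_word (heisenberg_ann M) (?w @ replicate (n i) m) x" by (simp add: ann_word_append)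
    finally show ?case using monoid.m_closed[OF ring.is_monoid[OF ring_A] p IH(2)] by (simp add: i del: of_nat_Suc)
  qed
  from this[of "sorted_list_of_set {i. n i \<noteq> 0}"] assms(1) show ?thesis
    by (simp add: H_minus_def partition_word_def finite_sequences_def)
qed

text \<open>
  Since the letters commute, a word acts as an ordered monomial whose weight is the sum of its letters,
  numbered from \<open>1\<close>. A bound on the weight bounds the letters and the length.
\<close>

lemma admissible_nilpotent:
  assumes adm: "admissible_heisenberg M" and x: "x \<in> carrier M"
  shows "finite {l. ann_word (heisenberg_ann M) l x \<noteq> \<zero>\<^bsub>M\<^esub>}"
proof -
  obtain N where N: "\<forall>n\<in>finite_sequences. weight n > N \<longrightarrow> H_minus n \<odot>\<^bsub>M\<^esub> x = \<zero>\<^bsub>M\<^esub>"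
    using adm x unfolding admissible_heisenberg_def by blast
  have "{l. ann_word (heisenberg_ann M) l x \<noteq> \<zero>\<^bsub>M\<^esub>} \<subseteq> {l. set l \<subseteq> {..<N} \<and> length l \<le> N}"
  proof
    fix l assume l: "l \<in> {l. ann_word (heisenberg_ann M) l x \<noteq> \<zero>\<^bsub>M\<^esub>}"
    obtain n where n: "n \<in> finite_sequences" "mset (partition_word n) = mset l" using partition_word_exists by blast
    have "H_minus n \<odot>\<^bsub>M\<^esub> x = ann_word (heisenberg_ann M) l x"
      using H_minus_action[OF n(1) x] word_permute[OF n(2) x] by simp
    then have "weight n \<le> N" using N n(1) l by (metis (mono_tags, lifting) mem_Collect_eq not_le)
    moreover have "weight n = sum_list (map Suc l)"
    proof -
      have "sum_mset (image_mset Suc (mset (partition_word n))) = sum_mset (image_mset Suc (mset l))" using n(2) by simp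
      then show ?thesis using sum_partition_word[OF n(1)] by (simp add: sum_mset_sum_list flip: mset_map)
    qed
    ultimately have s: "sum_list (map Suc l) \<le> N" by simp
    have "length l \<le> sum_list (map Suc l)" by (induction l) auto
    moreover have "k < N" if "k \<in> set l" for k
      using member_le_sum_list[of "Suc k" "map Suc l"] that s by simp
    ultimately show "l \<in> {l. set l \<subseteq> {..<N} \<and> length l \<le> N}" using s by auto
  qed
  then show ?thesis by (rule finite_subset) (simp add: finite_lists_length_le)
qed

lemma oscillator:
  assumes adm: "admissible_heisenberg M"
  shows "oscillator (underlying heisenberg M) (heisenberg_ann M) (heisenberg_cre M)"
proof -
  let ?U = "underlying heisenberg M"
  have c_lin: "qlinear ?U ?U (heisenberg_cre M n)" for n
    using qlinear_comp[OF H_linear qlinear_scale[OF U.qspace_axioms], of "int (Suc n)" "- 1 / of_nat (Suc n)"]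
    by (simp only: heisenberg_cre_def[abs_def])
  have a_lin: "qlinear ?U ?U (heisenberg_ann M n)" for n
    unfolding heisenberg_ann_def by (rule H_linear) simp
  show ?thesis
  proof (intro oscillator.intro U.qspace_axioms oscillator_axioms.intro c_lin a_lin)
    fix x i j assume "x \<in> carrier ?U"
    then have x: "x \<in> carrier M" "x \<in> carrier ?U" by simp_all
    show "heisenberg_ann M i (heisenberg_ann M j x) = heisenberg_ann M j (heisenberg_ann M i x)"
      by (rule ann_commute[OF x(1)])
    let ?qi = "- 1 / of_nat (Suc i) :: rat" and ?qj = "- 1 / of_nat (Suc j) :: rat"
    have Hc: "H (int (Suc k)) y \<in> carrier ?U" if "y \<in> carrier M" for k y using that by simp
    have sc: "H (int (Suc k)) (q \<odot>\<^bsub>?U\<^esub> y) = q \<odot>\<^bsub>?U\<^esub> H (int (Suc k)) y" if "y \<in> carrier M" for k q y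
      by (rule qlinearD(3)[OF H_linear]) (use that in simp_all)
    have sc': "H (- int (Suc k)) (q \<odot>\<^bsub>?U\<^esub> y) = q \<odot>\<^bsub>?U\<^esub> H (- int (Suc k)) y" if "y \<in> carrier M" for k q y
      by (rule qlinearD(3)[OF H_linear]) (use that in simp_all)
    have "H (int (Suc i)) (H (int (Suc j)) x) = H (int (Suc j)) (H (int (Suc i)) x)"
      using commutator[OF x(1), of "int (Suc i)" "int (Suc j)"] U.scale_zero_left[OF x(2)]
        U.M.r_zero[of "H (int (Suc j)) (H (int (Suc i)) x)"] Hc x(1) by simp
    then show "heisenberg_cre M i (heisenberg_cre M j x) = heisenberg_cre M j (heisenberg_cre M i x)"
      unfolding heisenberg_cre_def
      by (simp only: sc[OF H_closed[OF _ x(1)]] of_nat_eq_0_iff nat.simps not_False_eq_True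
          U.scale_scale[OF Hc[OF H_closed[OF _ x(1)]]] mult.commute)
    let ?d = "if i = j then - of_nat (Suc i) else 0 :: rat"
    have cm: "H (- int (Suc i)) (H (int (Suc j)) x) = H (int (Suc j)) (H (- int (Suc i)) x) \<oplus>\<^bsub>?U\<^esub> ?d \<odot>\<^bsub>?U\<^esub> x"
      using commutator[OF x(1), of "- int (Suc i)" "int (Suc j)"] by (auto simp del: of_nat_Suc)
    have "heisenberg_ann M i (heisenberg_cre M j x) = ?qj \<odot>\<^bsub>?U\<^esub> (H (int (Suc j)) (H (- int (Suc i)) x) \<oplus>\<^bsub>?U\<^esub> ?d \<odot>\<^bsub>?U\<^esub> x)"
      unfolding heisenberg_cre_def heisenberg_ann_def cm[symmetric] by (rule sc') (use x in simp)
    also have "\<dots> = heisenberg_cre M j (heisenberg_ann M i x) \<oplus>\<^bsub>?U\<^esub> (?qj * ?d) \<odot>\<^bsub>?U\<^esub> x"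
      unfolding heisenberg_cre_def heisenberg_ann_def
      using U.scale_add_right[of "H (int (Suc j)) (H (- int (Suc i)) x)" "?d \<odot>\<^bsub>?U\<^esub> x" ?qj] U.scale_closed[OF x(2), of ?d]
        U.scale_scale[OF x(2), of ?qj ?d] Hc[of "H (- int (Suc i)) x" j] x(1) by simp
    also have "(?qj * ?d) \<odot>\<^bsub>?U\<^esub> x = (if i = j then x else \<zero>\<^bsub>?U\<^esub>)"
      using U.scale_one[OF x(2)] U.scale_zero_left[OF x(2)] by (cases "i = j") (simp_all del: rational_subspace_simps of_nat_Suc)
    also have "heisenberg_cre M j (heisenberg_ann M i x) \<oplus>\<^bsub>?U\<^esub> (if i = j then x else \<zero>\<^bsub>?U\<^esub>)
        = (if i = j then x else \<zero>\<^bsub>?U\<^esub>) \<oplus>\<^bsub>?U\<^esub> heisenberg_cre M j (heisenberg_ann M i x)"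
      by (rule U.M.a_comm) (use x qlinearD(1)[OF c_lin] in simp_all)
    finally show "heisenberg_ann M i (heisenberg_cre M j x) =
      (if i = j then x else \<zero>\<^bsub>?U\<^esub>) \<oplus>\<^bsub>?U\<^esub> heisenberg_cre M j (heisenberg_ann M i x)" .
  qed (use admissible_nilpotent[OF adm] in simp)
qed

lemma act_cre:
  assumes "x \<in> carrier M"
  shows "H (int (Suc n)) x = (- of_nat (Suc n)) \<odot>\<^bsub>underlying heisenberg M\<^esub> heisenberg_cre M n x"
  unfolding heisenberg_cre_def
  using assms U.scale_scale[of "H (int (Suc n)) x" "- of_nat (Suc n)" "- 1 / of_nat (Suc n)"]
    U.scale_one[of "H (int (Suc n)) x"] by (simp del: rational_subspace_simps(4) of_nat_Suc)

end

abbreviation "heisenberg_proj M \<equiv> oscillator.proj (underlying heisenberg M) (heisenberg_ann M) (heisenberg_cre M)"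

lemma fock_module_heisenberg:
  assumes pm: "presented_module heisenberg M" and adm: "admissible_heisenberg M"
  shows "fock_module heisenberg (twisted 1) heisenberg_op M (heisenberg_ann M) (heisenberg_proj M)"
proof -
  interpret heisenberg_module M using pm by (simp add: heisenberg_module_def)
  interpret L: ladder "underlying heisenberg M" "heisenberg_ann M" "heisenberg_proj M" 1 "heisenberg_cre M"
    by (rule oscillator.ladder_proj[OF oscillator[OF adm]])
  have vac: "L.vac \<subseteq> carrier M" using L.vac_carrier by auto
  show ?thesis
  proof (rule fock_module.intro[OF fock_model_heisenberg pm L.annihilation_axioms fock_module_axioms.intro])
    show "twisted 1 (rational_subspace heisenberg M L.vac) (L.coord x)" if "x \<in> carrier M" for x
      unfolding twisted_subspace[where U = L.vac] using L.coord_twisted[of x] that by simp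
    show "\<exists>x\<in>carrier M. L.coord x = h" if "h \<in> finite_support (rational_subspace heisenberg M L.vac)"
      "twisted 1 (rational_subspace heisenberg M L.vac) h" for h
      using L.coord_surj[OF finite_support_subspace[OF that(1) vac] that(2)[unfolded twisted_subspace[where U = L.vac]]] by simp
    show "L.coord (act heisenberg M s x) = heisenberg_op (rational_subspace heisenberg M L.vac) s (L.coord x)"
      if "s \<in> fst heisenberg" and x: "x \<in> carrier M" for s x
    proof (cases s)
      case (Hgen i)
      then have i: "i \<noteq> 0" using that(1) by (simp add: heisenberg_gens)
      show ?thesis
      proof (rule nonzero_int_cases[OF i])
        fix n assume "i = - int (Suc n)"
        then show ?thesis using L.coord_a[of n x] Hgen by (simp only: heisenberg_op_simps heisenberg_ann_def)
      next
        fix n assume n: "i = int (Suc n)"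
        have "L.coord (H i x) l = (- of_nat (Suc n)) \<odot>\<^bsub>underlying heisenberg M\<^esub> cre 1 (underlying heisenberg M) n (L.coord x) l" for l
          unfolding n act_cre[OF x] using qlinearD(3)[OF L.coord_linear, of "heisenberg_cre M n x"] L.coord_c[of x n l] x L.c_closed[of x n]
          by simp
        then show ?thesis
          unfolding Hgen n heisenberg_op_simps cre_subspace[where U = L.vac] by (simp add: fun_eq_iff)
      qed
    qed
  qed
qed

lemma vacuum_space_eq: "vacuum_space M = annihilation.vac (underlying heisenberg M) (heisenberg_ann M)"
  if "annihilation (underlying heisenberg M) (heisenberg_ann M) \<pi>"
proof -
  have "(\<forall>i>0. act heisenberg M (Hgen (- i)) x = \<zero>\<^bsub>M\<^esub>) \<longleftrightarrow> (\<forall>n. heisenberg_ann M n x = \<zero>\<^bsub>M\<^esub>)" for x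
  proof (intro iffI allI impI)
    fix n assume "\<forall>i>0. act heisenberg M (Hgen (- i)) x = \<zero>\<^bsub>M\<^esub>"
    from this[rule_format, of "int (Suc n)"] show "heisenberg_ann M n x = \<zero>\<^bsub>M\<^esub>" by (simp add: heisenberg_ann_def)
  next
    fix i :: int assume *: "\<forall>n. heisenberg_ann M n x = \<zero>\<^bsub>M\<^esub>" and "i > 0"
    then obtain n where "i = int (Suc n)" by (metis zero_less_imp_eq_int gr0_conv_Suc of_nat_0_less_iff)
    then show "act heisenberg M (Hgen (- i)) x = \<zero>\<^bsub>M\<^esub>" using *[rule_format, of n] by (simp only: heisenberg_ann_def)
  qed
  then show ?thesis by (simp add: vacuum_space_def annihilation.vac_def[OF that])
qed

text \<open>
  A monomial acts by shifting a function by a word; if its weight exceeds the weights in the support,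
  nothing is left.
\<close>

lemma realization_heisenberg:
  assumes "fock_realization heisenberg (twisted 1) heisenberg_op V M \<phi>"
  shows "admissible_heisenberg M" "vacuum_space M = fock_realization.level (twisted 1) V \<phi> 0"
proof -
  interpret R: fock_realization heisenberg "twisted 1" heisenberg_op V M \<phi> by fact
  interpret heisenberg_module M using R.presented_module_axioms by (simp add: heisenberg_module_def)
  have a: "heisenberg_ann M n (\<phi> h) = \<phi> (ann n h)" if "h \<in> finite_support V" "twisted 1 V h" for n h
    using R.act_M[OF _ that, of "Hgen (- int (Suc n))"] by (simp only: heisenberg_op_simps heisenberg_ann_def) (simp add: heisenberg_gens)
  have word: "ann_word (heisenberg_ann M) w (\<phi> h) = \<phi> (\<lambda>l. h (w @ l)) \<and> (\<lambda>l. h (w @ l)) \<in> finite_support V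
      \<and> twisted 1 V (\<lambda>l. h (w @ l))"
    if "h \<in> finite_support V" "twisted 1 V h" for w h
    using that
  proof (induction w arbitrary: h)
    case (Cons n w)
    have "ann n h = (\<lambda>l. h (n # l))" by (simp add: fun_eq_iff ann_def)
    then show ?case
      using Cons.IH[OF ann_finite_support[OF Cons.prems(1)] twisted_ann[OF Cons.prems(2)], of n] a[OF Cons.prems, of n]
      by simp
  qed simp
  show "admissible_heisenberg M"
    unfolding admissible_heisenberg_def
  proof
    fix x assume x: "x \<in> carrier M"
    then obtain h where h: "h \<in> finite_support V" "twisted 1 V h" "x = \<phi> h" by (auto simp: R.carrier_M)
    have "finite ((\<lambda>l. sum_list (map Suc l)) ` {l. h l \<noteq> \<zero>\<^bsub>V\<^esub>})" using finite_supportD(2)[OF h(1)] by simp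
    then obtain N where N: "(\<lambda>l. sum_list (map Suc l)) ` {l. h l \<noteq> \<zero>\<^bsub>V\<^esub>} \<subseteq> {..<N}" using finite_subset_lessThan by blast
    have "H_minus n \<odot>\<^bsub>M\<^esub> x = \<zero>\<^bsub>M\<^esub>" if n: "n \<in> finite_sequences" "weight n > Suc N" for n
    proof -
      have "h (partition_word n @ l) = \<zero>\<^bsub>V\<^esub>" for l
      proof (rule ccontr)
        assume "h (partition_word n @ l) \<noteq> \<zero>\<^bsub>V\<^esub>"
        then have "sum_list (map Suc (partition_word n @ l)) < N" using N by blast
        then show False using sum_partition_word[OF n(1)] n(2) by simp
      qed
      then show ?thesis
        using H_minus_action[OF n(1) x] word[OF h(1,2), of "partition_word n"] h(3) by (simp add: R.phi_zero_iff)
    qed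
    then show "\<exists>N>0. \<forall>n\<in>finite_sequences. weight n > N \<longrightarrow> H_minus n \<odot>\<^bsub>M\<^esub> x = \<zero>\<^bsub>M\<^esub>"
      by (intro exI[of _ "Suc N"]) simp
  qed
  then have ann: "annihilation (underlying heisenberg M) (heisenberg_ann M) (heisenberg_proj M)"
    using fock_module_heisenberg[OF R.presented_module_axioms] by (simp add: fock_module_def)
  show "vacuum_space M = R.level 0"
  proof (rule Set.set_eqI)
    fix x
    show "x \<in> vacuum_space M \<longleftrightarrow> x \<in> R.level 0"
    proof (cases "x \<in> carrier M")
      case True
      then obtain h where h: "h \<in> finite_support V" "twisted 1 V h" "x = \<phi> h" by (auto simp: R.carrier_M)
      have "heisenberg_ann M n x = \<zero>\<^bsub>M\<^esub> \<longleftrightarrow> (\<forall>l. h (n # l) = \<zero>\<^bsub>V\<^esub>)" for n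
        using a[OF h(1,2), of n] R.phi_zero_iff[OF ann_finite_support[OF h(1)] twisted_ann[OF h(2)], of n] h(3)
        by (simp add: ann_def)
      then show ?thesis
        using True h R.level_zero_iff[OF h(1,2)] by (simp add: vacuum_space_eq[OF ann] annihilation.vac_def[OF ann])
    next
      case False
      then show ?thesis by (auto simp: R.level_def R.carrier_M vacuum_space_def)
    qed
  qed
qed

lemma heisenberg_modules_simps [simp]:
  "Obj (heisenberg_modules T) = {M. presented_module heisenberg M \<and> admissible_heisenberg M}"
  "Hom (heisenberg_modules T) = linear_maps (presented_algebra heisenberg)"
  "Id (heisenberg_modules T) M = (\<lambda>x\<in>carrier M. x)"
  "Comp (heisenberg_modules T) M N L g f = compose (carrier M) g f"
  by (simp_all add: heisenberg_modules_def presented_module_def heisenberg_presentation)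

lemma vacuum_simps [simp]:
  "FObj vacuum M = rational_subspace heisenberg M (vacuum_space M)"
  "FMor vacuum M N f = restrict f (vacuum_space M)"
  by (simp_all add: vacuum_def)

text \<open>
  Morphisms are not required to preserve a grading here; that they respect coordinates rests on the
  naturality of the projection.
\<close>

lemma weak_equivalence_heisenberg:
  "weak_equivalence (heisenberg_modules TYPE('a)) (vector_spaces TYPE('a)) vacuum"
proof -
  let ?C = "heisenberg_modules TYPE('a)" and ?D = "vector_spaces TYPE('a)"
  have ann: "annihilation (underlying heisenberg M) (heisenberg_ann M) (heisenberg_proj M)"
    if "M \<in> Obj ?C" for M :: "(heis_gen ncpoly set, 'a) module"
    using that fock_module_heisenberg[of M] by (simp add: fock_module_def)
  have q: "qspace (rational_subspace heisenberg M (vacuum_space M))"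
    if "M \<in> Obj ?C" for M :: "(heis_gen ncpoly set, 'a) module"
    using fock_module.qspace_Vac[OF fock_module_heisenberg[of M]] that by (simp add: vacuum_space_eq[OF ann[OF that]])
  have vac: "vacuum_space M \<subseteq> carrier M" for M :: "(heis_gen ncpoly set, 'a) module" by (auto simp: vacuum_space_def)
  have facts: "qlinear (underlying heisenberg M) (underlying heisenberg N) f"
      "\<And>x n. x \<in> carrier M \<Longrightarrow> f (heisenberg_ann M n x) = heisenberg_ann N n (f x)"
      "\<And>x n. x \<in> carrier M \<Longrightarrow> f (heisenberg_cre M n x) = heisenberg_cre N n (f x)"
    if M: "M \<in> Obj ?C" and N: "N \<in> Obj ?C" and f: "f \<in> Hom ?C M N"
    for M N :: "(heis_gen ncpoly set, 'a) module" and f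
  proof -
    have pm: "presented_module heisenberg M" "presented_module heisenberg N" using M N by simp_all
    interpret heisenberg_module M using pm by (simp add: heisenberg_module_def)
    have f': "qlinear (underlying heisenberg M) (underlying heisenberg N) f"
      and fa: "\<And>s x. \<lbrakk>s \<in> fst heisenberg; x \<in> carrier M\<rbrakk> \<Longrightarrow> f (act heisenberg M s x) = act heisenberg N s (f x)"
      using f linear_maps_presented_iff[OF pm, of f] by auto
    show "qlinear (underlying heisenberg M) (underlying heisenberg N) f" by (rule f')
    show "f (heisenberg_ann M n x) = heisenberg_ann N n (f x)" if "x \<in> carrier M" for x n
      using fa[OF _ that, of "Hgen (- int (Suc n))"] by (simp add: heisenberg_gens heisenberg_ann_def del: of_nat_Suc)
    show "f (heisenberg_cre M n x) = heisenberg_cre N n (f x)" if "x \<in> carrier M" for x n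
      unfolding heisenberg_cre_def
      using fa[OF _ that, of "Hgen (int (Suc n))"] qlinearD(3)[OF f', of "H (int (Suc n)) x"] that
      by (simp add: heisenberg_gens del: of_nat_Suc rational_subspace_simps(4))
  qed
  have f_vac: "f x \<in> vacuum_space N"
    if M: "M \<in> Obj ?C" and N: "N \<in> Obj ?C" and f: "f \<in> Hom ?C M N" and x: "x \<in> vacuum_space M"
    for M N :: "(heis_gen ncpoly set, 'a) module" and f x
  proof -
    have mv: "x \<in> carrier M" "heisenberg_ann M n x = \<zero>\<^bsub>M\<^esub>" for n
      using x unfolding vacuum_space_eq[OF ann[OF M]] annihilation.vac_def[OF ann[OF M]] by simp_all
    have "presented_module heisenberg M" "presented_module heisenberg N" using M N by simp_all
    then have "f \<zero>\<^bsub>M\<^esub> = \<zero>\<^bsub>N\<^esub>"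
      using qlinear_zero[OF facts(1)[OF M N f]] by (simp add: presented_module.qspace_underlying)
    then have "heisenberg_ann N n (f x) = \<zero>\<^bsub>N\<^esub>" for n using facts(2)[OF M N f mv(1), of n] mv(2) by simp
    then show ?thesis
      using qlinearD(1)[OF facts(1)[OF M N f], of x] mv(1)
      unfolding vacuum_space_eq[OF ann[OF N]] annihilation.vac_def[OF ann[OF N]] by simp
  qed
  have restr: "restrict f (vacuum_space M) \<in> linear_maps rat_ring (rational_subspace heisenberg M (vacuum_space M))
      (rational_subspace heisenberg N (vacuum_space N))"
    if M: "M \<in> Obj ?C" and N: "N \<in> Obj ?C" and f: "f \<in> Hom ?C M N" for M N :: "(heis_gen ncpoly set, 'a) module" and f
  proof -
    have "qlinear (rational_subspace heisenberg M (vacuum_space M)) (rational_subspace heisenberg N (vacuum_space N)) f"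
      using facts(1)[OF M N f] f_vac[OF M N f] vac[of M] unfolding qlinear_def rational_subspace_simps by blast
    from qlinear_restrict[OF this q[OF M]] show ?thesis by simp
  qed
  have func: "is_functor ?C ?D vacuum"
    unfolding is_functor_def
  proof (intro conjI ballI)
    fix M assume M: "M \<in> Obj ?C"
    show "FObj vacuum M \<in> Obj ?D" using q[OF M] by simp
    show "FMor vacuum M M (Id ?C M) = Id ?D (FObj vacuum M)" using vac[of M] by (auto simp: fun_eq_iff)
    fix N f assume N: "N \<in> Obj ?C" and f: "f \<in> Hom ?C M N"
    show "FMor vacuum M N f \<in> Hom ?D (FObj vacuum M) (FObj vacuum N)" using restr[OF M N f] by simp
    fix L g
    show "FMor vacuum M L (Comp ?C M N L g f) =
       Comp ?D (FObj vacuum M) (FObj vacuum N) (FObj vacuum L) (FMor vacuum N L g) (FMor vacuum M N f)"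
      using f_vac[OF M N f] vac[of M] by (auto simp: fun_eq_iff compose_def)
  qed
  have ff: "fully_faithful ?C ?D vacuum"
    unfolding fully_faithful_def bij_betw_def
  proof (intro ballI conjI inj_onI subset_antisym image_subsetI subsetI)
    fix M N f g assume M: "M \<in> Obj ?C" and N: "N \<in> Obj ?C" and f: "f \<in> Hom ?C M N" and g: "g \<in> Hom ?C M N"
      and eq: "FMor vacuum M N f = FMor vacuum M N g"
    have fm: "fock_module heisenberg (twisted 1) heisenberg_op M (heisenberg_ann M) (heisenberg_proj M)"
      "fock_module heisenberg (twisted 1) heisenberg_op N (heisenberg_ann N) (heisenberg_proj N)"
      using M N by (simp_all add: fock_module_heisenberg)
    have osc: "oscillator (underlying heisenberg M) (heisenberg_ann M) (heisenberg_cre M)"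
      "oscillator (underlying heisenberg N) (heisenberg_ann N) (heisenberg_cre N)"
      using M N by (auto intro!: heisenberg_module.oscillator simp: heisenberg_module_def)
    have pn: "k (heisenberg_proj M x) = heisenberg_proj N (k x)" if k: "k \<in> Hom ?C M N" and x: "x \<in> carrier M" for k x
      by (rule proj_natural[OF osc facts(1)[OF M N k]]) (use facts(2,3)[OF M N k] x in simp_all)
    have kc: "k x \<in> carrier N" if k: "k \<in> Hom ?C M N" and x: "x \<in> carrier M" for k x
      using qlinearD(1)[OF facts(1)[OF M N k], of x] x by simp
    have "f x = g x" if x: "x \<in> carrier M" for x
    proof (rule fock_faithful[OF fm, of f g])
      fix v assume "v \<in> annihilation.vac (underlying heisenberg M) (heisenberg_ann M)"
      then have "v \<in> vacuum_space M" by (simp add: vacuum_space_eq[OF ann[OF M]])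
      then show "f v = g v" using fun_cong[OF eq, of v] by simp
    qed (use facts(2)[OF M N f] facts(2)[OF M N g] pn[OF f] pn[OF g] kc[OF f] kc[OF g] x in auto)
    then show "f = g" using f g by (intro linear_maps_eqI) auto
  next
    fix M N f assume "M \<in> Obj ?C" "N \<in> Obj ?C" "f \<in> Hom ?C M N"
    then show "FMor vacuum M N f \<in> Hom ?D (FObj vacuum M) (FObj vacuum N)" using restr by simp
  next
    fix M N f assume M: "M \<in> Obj ?C" and N: "N \<in> Obj ?C" and f: "f \<in> Hom ?D (FObj vacuum M) (FObj vacuum N)"
    have fm: "fock_module heisenberg (twisted 1) heisenberg_op M (heisenberg_ann M) (heisenberg_proj M)"
      "fock_module heisenberg (twisted 1) heisenberg_op N (heisenberg_ann N) (heisenberg_proj N)"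
      using M N by (simp_all add: fock_module_heisenberg)
    have fl: "qlinear (rational_subspace heisenberg M (vacuum_space M)) (rational_subspace heisenberg N (vacuum_space N)) f"
      "f \<in> extensional (vacuum_space M)"
      using f by (simp_all add: linear_maps_rat_iff)
    obtain F where F: "F \<in> linear_maps (presented_algebra heisenberg) M N" "\<And>v. v \<in> vacuum_space M \<Longrightarrow> F v = f v"
      using fock_full[OF fm, of f] fl(1) unfolding vacuum_space_eq[OF ann[OF M]] vacuum_space_eq[OF ann[OF N]] by metis
    have "FMor vacuum M N F = f"
      by (rule extensionalityI[of _ "vacuum_space M"]) (use F(2) fl(2) in auto)
    then show "f \<in> FMor vacuum M N ` Hom ?C M N" using F(1) by auto
  qed
  have es: "essentially_surjective ?C ?D vacuum"
    unfolding essentially_surjective_def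
  proof
    fix V :: "(rat, 'a) module" assume "V \<in> Obj ?D"
    then have V: "qspace V" by simp
    obtain M \<phi> where R: "fock_realization heisenberg (twisted 1) heisenberg_op V M \<phi>"
      by (rule fock_model.realization_exists[OF fock_model_heisenberg V])
    have "presented_module heisenberg M" using R by (simp add: fock_realization_def)
    then have "M \<in> Obj ?C" using realization_heisenberg(1)[OF R] by simp
    then show "\<exists>M\<in>Obj ?C. \<exists>i. is_iso ?D (FObj vacuum M) V i"
      using fock_realization.vacuum_iso[OF R, folded realization_heisenberg(2)[OF R]]
      by (intro bexI[OF _ \<open>M \<in> Obj ?C\<close>]) simp
  qed
  have cat: "is_category ?C" unfolding heisenberg_modules_def by (rule is_category_module_category)
  show ?thesis
    by (intro weak_equivalence.intro func.intro cat.intro func_axioms.intro weak_equivalence_axioms.intro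
        cat is_category_vector_spaces func ff es)
qed

theorem theorem1p5:
  shows
    "abelian_category (heisenberg_modules TYPE('a)) \<and>
     abelian_category (clifford_modules TYPE('a)) \<and>
     abelian_category (e_modules TYPE('a)) \<and>
     abelian_category (vector_spaces TYPE('a)) \<and>
     is_equivalence (heisenberg_modules TYPE('a)) (vector_spaces TYPE('a)) vacuum \<and>
     is_equivalence (clifford_modules TYPE('a)) (vector_spaces TYPE('a)) (degree_zero clifford) \<and>
     is_equivalence (e_modules TYPE('a)) (vector_spaces TYPE('a)) (degree_zero e_algebra) \<and>
     equivalent_over (vector_spaces TYPE('a))
       (heisenberg_modules TYPE('a)) vacuum
       (clifford_modules TYPE('a)) (degree_zero clifford) \<and>
     equivalent_over (vector_spaces TYPE('a))
       (heisenberg_modules TYPE('a)) vacuum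
       (e_modules TYPE('a)) (degree_zero e_algebra) \<and>
     equivalent_over (vector_spaces TYPE('a))
       (clifford_modules TYPE('a)) (degree_zero clifford)
       (e_modules TYPE('a)) (degree_zero e_algebra)"
proof (intro conjI)
  note h = weak_equivalence_heisenberg[where 'a = 'a]
    and c = weak_equivalence_clifford[where 'a = 'a]
    and e = weak_equivalence_e[where 'a = 'a]
    and v = abelian_vector_spaces[where 'a = 'a]
  show "abelian_category (heisenberg_modules TYPE('a))" by (rule weak_equivalence.abelian_transfer[OF h v])
  show "abelian_category (clifford_modules TYPE('a))" by (rule weak_equivalence.abelian_transfer[OF c v])
  show "abelian_category (e_modules TYPE('a))" by (rule weak_equivalence.abelian_transfer[OF e v])
  show "abelian_category (vector_spaces TYPE('a))" by (rule v)
  show "is_equivalence (heisenberg_modules TYPE('a)) (vector_spaces TYPE('a)) vacuum"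
    by (rule weak_equivalence.is_equivalence[OF h])
  show "is_equivalence (clifford_modules TYPE('a)) (vector_spaces TYPE('a)) (degree_zero clifford)"
    by (rule weak_equivalence.is_equivalence[OF c])
  show "is_equivalence (e_modules TYPE('a)) (vector_spaces TYPE('a)) (degree_zero e_algebra)"
    by (rule weak_equivalence.is_equivalence[OF e])
qed (rule equivalent_overI weak_equivalence_heisenberg weak_equivalence_clifford weak_equivalence_e)+

end
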